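(* Let $K$ be a field, $q,Q\in K^{\times}$, and $n,d\ge 1$ integers. If $$f^{\mathrm B}_d(Q,q)=\prod_{i=1-d}^{d-1}\bigl(Q^{-2}+q^{2i}\bigr)$$ is invertible in $K$, then there is an isomorphism of $K$-algebras $$\Phi:\ S^{\mathrm B}_{Q,q}(n,d)\ \longrightarrow\ \bigoplus_{i=0}^{d}S^{\mathrm A}_q(\lceil n/2\rceil,i)\otimes S^{\mathrm A}_q(\lfloor n/2\rfloor,d-i).$$
   Context: Put $I(n)=[-r,r]\cap\mathbb Z$ if $n=2r+1$ and $I(n)=([-r,r]\cap\mathbb Z)\setminus\{0\}$ if $n=2r$. Hecke algebra of type B: $\mathcal H^{\mathrm B}_{Q,q}(d)$ is the $K$-algebra generated by $T_0,\dots,T_{d-1}$ with relations $T_iT_{i+1}T_i=T_{i+1}T_iT_{i+1}$ $(1\le i\le d-2)$, $(T_0T_1)^2=(T_1T_0)^2$, $T_iT_j=T_jT_i$ $(|i-j|>1)$, $T_0^2=(Q^{-1}-Q)T_0+1$, $T_i^2=(q^{-1}-q)T_i+1$ $(1\le i\le d-1)$. The subalgebra generated by $T_1,\dots,T_{d-1}$ is the Hecke algebra $\mathcal H_q(\Sigma_d)$ of the symmetric group. Tensor space: $V=V(n)$ has basis $\{v_i\mid i\in I(n)\}$; for $\mu\in I(n)^d$ put $v_\mu=v_{\mu_1}\otimes\cdots\otimes v_{\mu_d}$. For $1\le t\le d-1$ let $\mu\cdot s_t$ be $\mu$ with entries $\mu_t,\mu_{t+1}$ exchanged, and $\mu\cdot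 s_0=(-\mu_1,\mu_2,\dots,\mu_d)$. $V^{\otimes d}$ is a right $\mathcal H^{\mathrm B}_{Q,q}(d)$-module via: $v_\mu T_t=v_{\mu\cdot s_t}$ if $\mu_t<\mu_{t+1}$, $q^{-1}v_{\mu\cdot s_t}$ if $\mu_t=\mu_{t+1}$, $v_{\mu\cdot s_t}+(q^{-1}-q)v_\mu$ if $\mu_t>\mu_{t+1}$; and $v_\mu T_0=v_{\mu\cdot s_0}$ if $\mu_1>0$, $Q^{-1}v_{\mu\cdot s_0}$ if $\mu_1=0$, $v_{\mu\cdot s_0}+(Q^{-1}-Q)v_\mu$ if $\mu_1<0$. Schur algebras: $S^{\mathrm B}_{Q,q}(n,d)=\operatorname{End}_{\mathcal H^{\mathrm B}_{Q,q}(d)}(V(n)^{\otimes d})$ and $S^{\mathrm A}_q(m,i)=\operatorname{End}_{\mathcal H_q(\Sigma_i)}(V(m)^{\otimes i})$, where $\dim V(m)=m$; by convention $S^{\mathrm A}_q(m,0)=K$ for $m\ge0$ and $S^{\mathrm A}_q(0,i)=0$ for $i\ge1$. *)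

theory Defs
  imports "HOL-Algebra.QuotRing" "HOL-Algebra.Module"
begin

text \<open>
  The ground field is a type \<open>'k\<close> of class \<open>field\<close>. A (not necessarily commutative)
  \<open>K\<close>-algebra is a record \<open>('k, 'a) module\<close>: ring operations together with a scalar
  multiplication. (The library locale \<^locale>\<open>algebra\<close> is for commutative algebras only.)
\<close>

definition kalg_iso :: "('k, 'a) module \<Rightarrow> ('k, 'b) module \<Rightarrow> ('a \<Rightarrow> 'b) set" where
  "kalg_iso A B =
    {\<phi> \<in> ring_iso A B. \<forall>c. \<forall>x \<in> carrier A. \<phi> (c \<odot>\<^bsub>A\<^esub> x) = c \<odot>\<^bsub>B\<^esub> \<phi> x}"

inductive_set subalgebra_generated :: "('k, 'a) module \<Rightarrow> 'a set \<Rightarrow> 'a set"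
  for A :: "('k, 'a) module" and G :: "'a set" where
  gen: "x \<in> G \<Longrightarrow> x \<in> subalgebra_generated A G"
| one: "\<one>\<^bsub>A\<^esub> \<in> subalgebra_generated A G"
| add: "x \<in> subalgebra_generated A G \<Longrightarrow> y \<in> subalgebra_generated A G
    \<Longrightarrow> x \<oplus>\<^bsub>A\<^esub> y \<in> subalgebra_generated A G"
| mult: "x \<in> subalgebra_generated A G \<Longrightarrow> y \<in> subalgebra_generated A G
    \<Longrightarrow> x \<otimes>\<^bsub>A\<^esub> y \<in> subalgebra_generated A G"
| smult: "x \<in> subalgebra_generated A G \<Longrightarrow> c \<odot>\<^bsub>A\<^esub> x \<in> subalgebra_generated A G"

text \<open>For a two-sided ideal \<open>I\<close>, the union defining the scalar multiplication of \<open>A / I\<close> is the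
  single coset \<open>I + c x\<close>, for any representative \<open>x\<close> of \<open>X\<close>.\<close>

definition quotient_algebra :: "('k, 'a) module \<Rightarrow> 'a set \<Rightarrow> ('k, 'a set) module" where
  "quotient_algebra A I =
    ring.extend (A Quot I) (module.fields (\<lambda>c X. \<Union>x\<in>X. I +>\<^bsub>A\<^esub> (c \<odot>\<^bsub>A\<^esub> x)))"

text \<open>The two-sided ideal imposing the relations \<open>l = r\<close> for \<open>(l, r) \<in> R\<close>.\<close>

definition relation_ideal :: "('k, 'a) module \<Rightarrow> ('a \<times> 'a) set \<Rightarrow> 'a set" where
  "relation_ideal A R = Idl\<^bsub>A\<^esub> {l \<ominus>\<^bsub>A\<^esub> r | l r. (l, r) \<in> R}"

definition direct_sum_algebra :: "'i set \<Rightarrow> ('i \<Rightarrow> ('k, 'a) module) \<Rightarrow> ('k, 'i \<Rightarrow> 'a) module" where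
  \<comment> \<open>intended for a finite index set, where direct sum and direct product agree\<close>
  "direct_sum_algebra I A =
    \<lparr>carrier = (\<Pi>\<^sub>E i\<in>I. carrier (A i)),
     monoid.mult = (\<lambda>x y. \<lambda>i\<in>I. x i \<otimes>\<^bsub>A i\<^esub> y i),
     one = (\<lambda>i\<in>I. \<one>\<^bsub>A i\<^esub>),
     zero = (\<lambda>i\<in>I. \<zero>\<^bsub>A i\<^esub>),
     add = (\<lambda>x y. \<lambda>i\<in>I. x i \<oplus>\<^bsub>A i\<^esub> y i),
     smult = (\<lambda>c x. \<lambda>i\<in>I. c \<odot>\<^bsub>A i\<^esub> x i)\<rparr>"

definition basis_vec :: "'b \<Rightarrow> 'b \<Rightarrow> 'k::field" where
  "basis_vec b = (\<lambda>x. if x = b then 1 else 0)"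

text \<open>The monoid algebra \<open>K[M]\<close>: finitely supported functions on \<open>M\<close> under convolution. The
  element \<open>m\<close> of \<open>M\<close> is \<open>basis_vec m\<close>.\<close>

definition monoid_algebra :: "('m, 'z) monoid_scheme \<Rightarrow> ('k::field, 'm \<Rightarrow> 'k) module" where
  "monoid_algebra M =
    \<lparr>carrier = {x. finite {m. x m \<noteq> 0} \<and> {m. x m \<noteq> 0} \<subseteq> carrier M},
     monoid.mult = (\<lambda>x y m. \<Sum>a | x a \<noteq> 0. \<Sum>b | y b \<noteq> 0. if a \<otimes>\<^bsub>M\<^esub> b = m then x a * y b else 0),
     one = basis_vec \<one>\<^bsub>M\<^esub>,
     zero = (\<lambda>m. 0),
     add = (\<lambda>x y m. x m + y m),
     smult = (\<lambda>c x m. c * x m)\<rparr>"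

text \<open>
  The tensor product over \<open>K\<close> is the free vector space on the set \<open>A \<times> B\<close> modulo the bilinearity
  relations, with \<open>(a \<otimes> b) (a' \<otimes> b') = a a' \<otimes> b b'\<close>. The free vector space with this product is
  the monoid algebra of the multiplicative monoid \<open>A \<times> B\<close>. The span of the bilinearity relations
  is stable under multiplication by pairs, so it is the two-sided ideal that they generate.
\<close>

definition bilinear_relations ::
  "('k::field, 'a) module \<Rightarrow> ('k, 'b) module \<Rightarrow> (('a \<times> 'b \<Rightarrow> 'k) \<times> ('a \<times> 'b \<Rightarrow> 'k)) set" where
  "bilinear_relations A B =
    (let F = monoid_algebra (A \<times>\<times> B) in
      {(basis_vec (a \<oplus>\<^bsub>A\<^esub> a', b), basis_vec (a, b) \<oplus>\<^bsub>F\<^esub> basis_vec (a', b)) | a a' b.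
         a \<in> carrier A \<and> a' \<in> carrier A \<and> b \<in> carrier B} \<union>
      {(basis_vec (a, b \<oplus>\<^bsub>B\<^esub> b'), basis_vec (a, b) \<oplus>\<^bsub>F\<^esub> basis_vec (a, b')) | a b b'.
         a \<in> carrier A \<and> b \<in> carrier B \<and> b' \<in> carrier B} \<union>
      {(basis_vec (c \<odot>\<^bsub>A\<^esub> a, b), c \<odot>\<^bsub>F\<^esub> basis_vec (a, b)) | c a b.
         a \<in> carrier A \<and> b \<in> carrier B} \<union>
      {(basis_vec (a, c \<odot>\<^bsub>B\<^esub> b), c \<odot>\<^bsub>F\<^esub> basis_vec (a, b)) | c a b.
         a \<in> carrier A \<and> b \<in> carrier B})"

definition tensor_algebra ::
  "('k::field, 'a) module \<Rightarrow> ('k, 'b) module \<Rightarrow> ('k, ('a \<times> 'b \<Rightarrow> 'k) set) module" where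
  "tensor_algebra A B =
    (let F = monoid_algebra (A \<times>\<times> B)
     in quotient_algebra F (relation_ideal F (bilinear_relations A B)))"


text \<open>The word \<open>[i, j, \<dots>]\<close> stands for the product \<open>T\<^sub>i T\<^sub>j \<dots>\<close> of free generators.\<close>

definition free_algebra :: "nat \<Rightarrow> ('k::field, nat list \<Rightarrow> 'k) module" where
  "free_algebra d = monoid_algebra \<lparr>carrier = lists {..<d}, monoid.mult = (@), one = []\<rparr>"

definition hecke_relations ::
  "'k::field \<Rightarrow> 'k \<Rightarrow> nat \<Rightarrow> ((nat list \<Rightarrow> 'k) \<times> (nat list \<Rightarrow> 'k)) set" where
  "hecke_relations Q q d =
    (let F = free_algebra d; T = basis_vec in
      {(T [i, i+1, i], T [i+1, i, i+1]) | i. 1 \<le> i \<and> i + 2 \<le> d} \<union>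
      (if 2 \<le> d then {(T [0, 1, 0, 1], T [1, 0, 1, 0])} else {}) \<union>
      {(T [i, j], T [j, i]) | i j. i < d \<and> j < d \<and> \<bar>int i - int j\<bar> > 1} \<union>
      (if 1 \<le> d then {(T [0, 0], ((inverse Q - Q) \<odot>\<^bsub>F\<^esub> T [0]) \<oplus>\<^bsub>F\<^esub> \<one>\<^bsub>F\<^esub>)} else {}) \<union>
      {(T [i, i], ((inverse q - q) \<odot>\<^bsub>F\<^esub> T [i]) \<oplus>\<^bsub>F\<^esub> \<one>\<^bsub>F\<^esub>) | i. 1 \<le> i \<and> i < d})"

definition hecke_ideal :: "'k::field \<Rightarrow> 'k \<Rightarrow> nat \<Rightarrow> (nat list \<Rightarrow> 'k) set" where
  "hecke_ideal Q q d = relation_ideal (free_algebra d) (hecke_relations Q q d)"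

definition hecke_B :: "'k::field \<Rightarrow> 'k \<Rightarrow> nat \<Rightarrow> ('k, (nat list \<Rightarrow> 'k) set) module" where
  "hecke_B Q q d = quotient_algebra (free_algebra d) (hecke_ideal Q q d)"

definition hecke_gen :: "'k::field \<Rightarrow> 'k \<Rightarrow> nat \<Rightarrow> nat \<Rightarrow> (nat list \<Rightarrow> 'k) set" where
  "hecke_gen Q q d i = hecke_ideal Q q d +>\<^bsub>free_algebra d\<^esub> basis_vec [i]"

text \<open>The Hecke algebra of the symmetric group on \<open>d\<close> letters, as a subset of \<open>hecke_B Q q d\<close>. The
  parameter \<open>Q\<close> occurs only through the ambient algebra.\<close>

definition hecke_A :: "'k::field \<Rightarrow> 'k \<Rightarrow> nat \<Rightarrow> (nat list \<Rightarrow> 'k) set set" where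
  "hecke_A Q q d = subalgebra_generated (hecke_B Q q d) (hecke_gen Q q d ` {1..<d})"


definition index_set :: "nat \<Rightarrow> int set" where
  "index_set n =
    (let r = int (n div 2) in if odd n then {-r..r} else {-r..r} - {0})"

definition multi_index :: "nat \<Rightarrow> nat \<Rightarrow> int list set" where
  "multi_index n d = {\<mu>. length \<mu> = d \<and> set \<mu> \<subseteq> index_set n}"

text \<open>The \<open>d\<close>-th tensor power of \<open>V(n)\<close>, in coordinates with respect to the basis \<open>v\<^sub>\<mu>\<close>: the vector
  \<open>v\<^sub>\<mu>\<close> is \<open>basis_vec \<mu>\<close>. For \<open>d = 0\<close> the only index is \<open>[]\<close> and the space is \<open>K\<close>; for \<open>n = 0\<close> and
  \<open>d \<ge> 1\<close> there is no index and the space is zero.\<close>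

definition tensor_space :: "nat \<Rightarrow> nat \<Rightarrow> (int list \<Rightarrow> 'k::field) set" where
  "tensor_space n d = {v. \<forall>\<mu>. \<mu> \<notin> multi_index n d \<longrightarrow> v \<mu> = 0}"

text \<open>List positions start at \<open>0\<close>, so the entry \<open>\<mu>\<^sub>t\<close> is \<open>\<mu> ! (t - 1)\<close>.\<close>

definition index_act :: "int list \<Rightarrow> nat \<Rightarrow> int list" where
  "index_act \<mu> t =
    (if t = 0 then \<mu>[0 := - (\<mu> ! 0)] else \<mu>[t - 1 := \<mu> ! t, t := \<mu> ! (t - 1)])"

definition basis_act :: "'k::field \<Rightarrow> 'k \<Rightarrow> int list \<Rightarrow> nat \<Rightarrow> int list \<Rightarrow> 'k" where
  "basis_act Q q \<mu> t =
    (if t = 0 then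
       if \<mu> ! 0 > 0 then basis_vec (index_act \<mu> 0)
       else if \<mu> ! 0 = 0 then (\<lambda>\<nu>. inverse Q * basis_vec (index_act \<mu> 0) \<nu>)
       else (\<lambda>\<nu>. basis_vec (index_act \<mu> 0) \<nu> + (inverse Q - Q) * basis_vec \<mu> \<nu>)
     else
       if \<mu> ! (t - 1) < \<mu> ! t then basis_vec (index_act \<mu> t)
       else if \<mu> ! (t - 1) = \<mu> ! t then (\<lambda>\<nu>. inverse q * basis_vec (index_act \<mu> t) \<nu>)
       else (\<lambda>\<nu>. basis_vec (index_act \<mu> t) \<nu> + (inverse q - q) * basis_vec \<mu> \<nu>))"

definition gen_act ::
  "'k::field \<Rightarrow> 'k \<Rightarrow> nat \<Rightarrow> nat \<Rightarrow> (int list \<Rightarrow> 'k) \<Rightarrow> nat \<Rightarrow> int list \<Rightarrow> 'k" where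
  "gen_act Q q n d v t = (\<lambda>\<nu>. \<Sum>\<mu>\<in>multi_index n d. v \<mu> * basis_act Q q \<mu> t \<nu>)"

text \<open>Right action of the free algebra: \<open>v \<cdot> (T\<^sub>i T\<^sub>j \<dots>) = ((v \<cdot> T\<^sub>i) \<cdot> T\<^sub>j) \<dots>\<close>\<close>

definition free_act ::
  "'k::field \<Rightarrow> 'k \<Rightarrow> nat \<Rightarrow> nat \<Rightarrow> (int list \<Rightarrow> 'k) \<Rightarrow> (nat list \<Rightarrow> 'k) \<Rightarrow> int list \<Rightarrow> 'k" where
  "free_act Q q n d v x =
    (\<lambda>\<nu>. \<Sum>w | x w \<noteq> 0. x w * foldl (gen_act Q q n d) v w \<nu>)"

text \<open>For \<open>Q, q \<noteq> 0\<close> the free action respects the Hecke relations, so all representatives of a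
  coset \<open>h\<close> act in the same way; the action of \<open>h\<close> is this common value.\<close>

definition hecke_act ::
  "'k::field \<Rightarrow> 'k \<Rightarrow> nat \<Rightarrow> nat \<Rightarrow> (int list \<Rightarrow> 'k) \<Rightarrow> (nat list \<Rightarrow> 'k) set \<Rightarrow> int list \<Rightarrow> 'k" where
  "hecke_act Q q n d v h = the_elem (free_act Q q n d v ` h)"


text \<open>Linear endomorphisms of a space \<open>W\<close> of functions that commute with the right action \<open>act\<close> of
  all elements of \<open>H\<close>, with composition as product. They are extensional (\<open>undefined\<close> outside \<open>W\<close>)
  so that equality of functions is equality on \<open>W\<close>.\<close>

definition end_algebra ::
  "('b \<Rightarrow> 'k::field) set \<Rightarrow> 'h set \<Rightarrow> (('b \<Rightarrow> 'k) \<Rightarrow> 'h \<Rightarrow> 'b \<Rightarrow> 'k) \<Rightarrow>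
    ('k, ('b \<Rightarrow> 'k) \<Rightarrow> 'b \<Rightarrow> 'k) module" where
  "end_algebra W H act =
    \<lparr>carrier = {f \<in> W \<rightarrow>\<^sub>E W.
       (\<forall>v\<in>W. \<forall>w\<in>W. f (\<lambda>\<mu>. v \<mu> + w \<mu>) = (\<lambda>\<mu>. f v \<mu> + f w \<mu>)) \<and>
       (\<forall>c. \<forall>v\<in>W. f (\<lambda>\<mu>. c * v \<mu>) = (\<lambda>\<mu>. c * f v \<mu>)) \<and>
       (\<forall>h\<in>H. \<forall>v\<in>W. f (act v h) = act (f v) h)},
     monoid.mult = (\<lambda>f g. compose W f g),
     one = (\<lambda>v\<in>W. v),
     zero = (\<lambda>v\<in>W. \<lambda>\<mu>. 0),
     add = (\<lambda>f g. \<lambda>v\<in>W. \<lambda>\<mu>. f v \<mu> + g v \<mu>),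
     smult = (\<lambda>c f. \<lambda>v\<in>W. \<lambda>\<mu>. c * f v \<mu>)\<rparr>"

type_synonym 'k tensor_end = "(int list \<Rightarrow> 'k) \<Rightarrow> int list \<Rightarrow> 'k"

definition schur_B :: "'k::field \<Rightarrow> 'k \<Rightarrow> nat \<Rightarrow> nat \<Rightarrow> ('k, 'k tensor_end) module" where
  "schur_B Q q n d =
    end_algebra (tensor_space n d) (carrier (hecke_B Q q d)) (hecke_act Q q n d)"

text \<open>The conventions for \<open>d = 0\<close> (the algebra \<open>K\<close>) and for \<open>m = 0\<close>, \<open>d \<ge> 1\<close> (the zero algebra)
  are instances of the general formula.\<close>

definition schur_A :: "'k::field \<Rightarrow> 'k \<Rightarrow> nat \<Rightarrow> nat \<Rightarrow> ('k, 'k tensor_end) module" where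
  "schur_A Q q m d =
    end_algebra (tensor_space m d) (hecke_A Q q d) (hecke_act Q q m d)"

definition f_B :: "nat \<Rightarrow> 'k::field \<Rightarrow> 'k \<Rightarrow> 'k" where
  "f_B d Q q = (\<Prod>i\<in>{1 - int d..int d - 1}. Q powi (-2) + q powi (2 * i))"

end

theory Submission
  imports Defs
begin

text \<open>
  Let \<open>H\<close> be the type B Hecke algebra, acting on tensor space \<open>M\<close> from the right, and put \<open>r = Q\<^sup>-\<^sup>1\<close>,
  \<open>s = -Q\<close>, so that \<open>(T\<^sub>0 - r) (T\<^sub>0 - s) = 0\<close>. For \<open>a + b = d\<close> the proof studies, in the style of
  Dipper and James, the element \<open>h = u\<^sup>- T\<^sub>w u\<^sup>+\<close>. Here \<open>u\<^sup>-\<close> is the product of \<open>X\<^sub>k - r\<close> over the first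
  \<open>b\<close> Jucys-Murphy elements \<open>X\<^sub>k = T\<^sub>k \<dots> T\<^sub>1 T\<^sub>0 T\<^sub>1 \<dots> T\<^sub>k\<close>, \<open>u\<^sup>+\<close> is the product of \<open>X\<^sub>k - s\<close> over the first
  \<open>a\<close> of them, and \<open>w\<close> exchanges a block of \<open>b\<close> strands with a block of \<open>a\<close> strands. Write \<open>H'\<close> for
  the subalgebra generated by all \<open>T\<^sub>i\<close> with \<open>i \<noteq> 0, b\<close>; it is the Hecke algebra of the symmetric
  groups on \<open>b\<close> and on \<open>a\<close> letters. Four facts carry the theorem.

  \<^item> \<open>h H h \<subseteq> H' h\<close>, the elements for different \<open>a\<close> annihilate each other (\<open>h H h\<^sub>1 = 0\<close>), and \<open>T\<^sub>i h = h T\<^sub>j\<close>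
    for each generator \<open>T\<^sub>i\<close> of \<open>H'\<close> and a suitable \<open>j\<close>. These are \<open>h_x_h_same\<close>, \<open>h_x_h_zero\<close>,
    \<open>T_h_low\<close> and \<open>T_h_high\<close>.

  \<^item> The elements \<open>h\<close> together generate the unit ideal of \<open>H\<close> (\<open>one_in_full\<close>). Here \<open>f\<^sup>B\<close>
    enters: modulo the ideal, \<open>X\<^sub>k\<close> has on a smaller \<open>h\<close> eigenvalues of the form \<open>s q\<^sup>2\<^sup>i\<close> and also of
    the form \<open>r q\<^sup>2\<^sup>j\<close>, and a factor of \<open>f\<^sup>B\<close> vanishes exactly when two such numbers agree.

  \<^item> Let \<open>B\<close> be the span of the words with \<open>b\<close> positive letters followed by \<open>a\<close> nonnegative letters.
    Then \<open>v \<mapsto> v h\<close> is a bijection from \<open>B\<close> to \<open>M h\<close>: words with a negative letter can be straightened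
    (\<open>span_h\<close>), and \<open>h\<close> is triangular in the number of negative letters, with
    diagonal part \<open>u\<^sup>+\<close>, which is injective because of \<open>f\<^sup>B\<close> (\<open>h_inj\<close>).

  \<^item> An \<open>H\<close>-endomorphism of \<open>M\<close> preserves each \<open>M h\<close>, so it induces an \<open>H'\<close>-endomorphism of each \<open>B\<close>.
    Writing \<open>1 = \<Sum> x h y\<close> one recovers the endomorphism from this tuple, and every tuple \<open>G\<close> arises, from
    \<open>m \<mapsto> \<Sum> G(m x h) y\<close>. Hence the type B Schur algebra is the product of the algebras of
    \<open>H'\<close>-endomorphisms of the spaces \<open>B\<close> (\<open>Phi_iso\<close>).

  Finally \<open>B\<close> is the tensor product of a tensor power of the span of the positive letters, of which
  there are \<open>\<lfloor>n/2\<rfloor>\<close>, and one of the span of the nonnegative letters, of which there are \<open>\<lceil>n/2\<rceil>\<close>; \<open>H'\<close>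
  acts factor by factor. The commutant of such an action is the tensor product of the commutants
  (\<open>tensor_iso\<close>), and only the order of the letters matters to the action, so the two factors are type
  A Schur algebras.
\<close>

section \<open>Jucys-Murphy elements and braid words\<close>

text \<open>
  The arguments about the Hecke algebra take place inside a ring of operators, so only the relations are
  assumed, for a sequence of generators that does not end: the number of letters then enters as a bound
  on the indices, which permits induction on it. Writing the relation of \<open>T\<^sub>0\<close> with roots \<open>r\<close>, \<open>s\<close>
  makes the two signs symmetric, and exchanging them turns each statement about \<open>u\<^sup>-\<close> into one about \<open>u\<^sup>+\<close>.
\<close>

locale hecke_ring =
  fixes sc :: "'k::field \<Rightarrow> 'a::ring_1" and T :: "nat \<Rightarrow> 'a" and q r s :: 'k
  assumes sc_add: "sc (x + y) = sc x + sc y"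
    and sc_mult: "sc (x * y) = sc x * sc y"
    and sc_1: "sc 1 = 1"
    and sc_comm: "sc x * z = z * sc x"
    and q0: "q \<noteq> 0"
    and braid: "1 \<le> i \<Longrightarrow> T i * T (Suc i) * T i = T (Suc i) * T i * T (Suc i)"
    and braid4: "T 0 * T 1 * T 0 * T 1 = T 1 * T 0 * T 1 * T 0"
    and far: "Suc i < j \<Longrightarrow> T i * T j = T j * T i"
    and quad: "1 \<le> i \<Longrightarrow> T i * T i = sc (inverse q - q) * T i + 1"
    and quad0: "(T 0 - sc r) * (T 0 - sc s) = 0"
begin

lemma sc_0: "sc 0 = 0"
  using sc_add[of 0 0] by simp

lemma sc_minus: "sc (- x) = - sc x"
  using sc_add[of x "- x"] sc_0 by (simp add: eq_neg_iff_add_eq_0 add.commute)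

lemma sc_diff: "sc (x - y) = sc x - sc y"
  using sc_add[of x "- y"] sc_minus by simp

lemma quad0': "(T 0 - sc s) * (T 0 - sc r) = 0"
  using quad0 sc_comm[of r "T 0"] sc_comm[of s "T 0"] sc_comm[of r "sc s"]
  by (simp add: algebra_simps)

lemma swapped: "hecke_ring sc T q s r"
  by (unfold_locales; (rule sc_add sc_mult sc_1 sc_comm q0 quad0' braid4 | erule braid far quad))

inductive_set alg :: "'a set \<Rightarrow> 'a set" for G where
  gen: "x \<in> G \<Longrightarrow> x \<in> alg G"
| sc: "sc c \<in> alg G"
| add: "x \<in> alg G \<Longrightarrow> y \<in> alg G \<Longrightarrow> x + y \<in> alg G"
| mult: "x \<in> alg G \<Longrightarrow> y \<in> alg G \<Longrightarrow> x * y \<in> alg G"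

lemma alg_one: "1 \<in> alg G"
  using alg.sc[of 1 G] by (simp add: sc_1)

lemma alg_uminus: "x \<in> alg G \<Longrightarrow> - x \<in> alg G"
  using alg.mult[OF alg.sc[of "-1" G]] by (simp add: sc_1 sc_minus)

lemma alg_diff: "x \<in> alg G \<Longrightarrow> y \<in> alg G \<Longrightarrow> x - y \<in> alg G"
  using alg.add[OF _ alg_uminus] by fastforce

lemma alg_subset: assumes "G \<subseteq> alg G'" shows "alg G \<subseteq> alg G'"
proof
  fix x assume "x \<in> alg G"
  then show "x \<in> alg G'" by induction (use assms in \<open>auto intro: alg.intros\<close>)
qed

lemma alg_mono: "x \<in> alg G \<Longrightarrow> G \<subseteq> G' \<Longrightarrow> x \<in> alg G'"
  using alg_subset[of G G'] alg.gen by blast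

lemma alg_commute:
  assumes "x \<in> alg G" "\<And>g. g \<in> G \<Longrightarrow> z * g = g * z"
  shows "z * x = x * z"
  using assms(1)
proof induction
  case (mult x y) then show ?case by (metis mult.assoc)
next
  case (sc c) show ?case by (rule sc_comm[symmetric])
qed (use assms(2) in \<open>auto simp: distrib_left distrib_right\<close>)

lemma alg_far:
  assumes "x \<in> alg (T ` I)" "y \<in> alg (T ` J)"
    and "\<And>i j. i \<in> I \<Longrightarrow> j \<in> J \<Longrightarrow> i + 2 \<le> j \<or> j + 2 \<le> i"
  shows "x * y = y * x"
proof (rule alg_commute[OF assms(2)])
  fix g assume "g \<in> T ` J"
  then obtain j where j: "j \<in> J" "g = T j" by auto
  have "g * x = x * g"
  proof (rule alg_commute[OF assms(1)])
    fix h assume "h \<in> T ` I"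
    then obtain i where i: "i \<in> I" "h = T i" by auto
    show "g * h = h * g" using assms(3)[OF i(1) j(1)] far[of i j] far[of j i] i j by auto
  qed
  then show "x * g = g * x" by simp
qed

abbreviation "kap \<equiv> inverse q - q"

definition "Ti i = T i - sc kap"

lemma T_Ti: "1 \<le> i \<Longrightarrow> T i * Ti i = 1" "1 \<le> i \<Longrightarrow> Ti i * T i = 1"
  using quad[of i] sc_comm[of kap "T i"] by (auto simp: Ti_def algebra_simps)

lemma Ti_mem: "i \<in> I \<Longrightarrow> Ti i \<in> alg (T ` I)"
  unfolding Ti_def by (rule alg_diff[OF alg.gen alg.sc]) simp

text \<open>The Jucys-Murphy elements of type B.\<close>

fun XX :: "nat \<Rightarrow> 'a" where
  "XX 0 = T 0"
| "XX (Suc k) = T (Suc k) * XX k * T (Suc k)"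

text \<open>For \<open>c = r\<close> and \<open>c = s\<close> these are the elements \<open>u\<^sup>-\<close> and \<open>u\<^sup>+\<close> of Dipper and James.\<close>

fun U :: "'k \<Rightarrow> nat \<Rightarrow> 'a" where
  "U c 0 = 1"
| "U c (Suc n) = U c n * (XX n - sc c)"

text \<open>The descending braid word \<open>T\<^bsub>j+l-1\<^esub> \<dots> T\<^sub>j\<close>, which carries one strand past \<open>l\<close> others.\<close>

fun D :: "nat \<Rightarrow> nat \<Rightarrow> 'a" where
  "D j 0 = 1"
| "D j (Suc l) = T (j + l) * D j l"

text \<open>The ascending braid word \<open>T\<^sub>j \<dots> T\<^bsub>j+l-1\<^esub>\<close>.\<close>

fun A :: "nat \<Rightarrow> nat \<Rightarrow> 'a" where
  "A j 0 = 1"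
| "A j (Suc l) = A j l * T (j + l)"

text \<open>The multiplicative Jucys-Murphy elements of type A, with \<open>T\<^sub>j, T\<^bsub>j+1\<^esub>, \<dots>\<close> as generators.\<close>

fun J :: "nat \<Rightarrow> nat \<Rightarrow> 'a" where
  "J j 0 = 1"
| "J j (Suc l) = T (j + l) * J j l * T (j + l)"

text \<open>The basis element of the permutation that exchanges a block of \<open>b\<close> strands with a block of \<open>a\<close>
  strands.\<close>

fun P :: "nat \<Rightarrow> nat \<Rightarrow> 'a" where
  "P b 0 = 1"
| "P b (Suc a) = P b a * D (Suc a) b"

lemma D_mem: "D j l \<in> alg (T ` {j..<j+l})"
proof (induction l)
  case (Suc l)
  show ?case using alg.mult[OF alg.gen alg_mono[OF Suc], of "T (j + l)" "T ` {j..<j + Suc l}"] by (simp add: image_mono)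
qed (simp add: alg_one)

lemma A_mem: "A j l \<in> alg (T ` {j..<j+l})"
proof (induction l)
  case (Suc l)
  show ?case using alg.mult[OF alg_mono[OF Suc] alg.gen, of "T ` {j..<j + Suc l}" "T (j + l)"] by (simp add: image_mono)
qed (simp add: alg_one)

lemma XX_mem: "XX k \<in> alg (T ` {..k})"
proof (induction k)
  case (Suc k)
  have "XX k \<in> alg (T ` {..Suc k})" by (rule alg_mono[OF Suc]) auto
  then show ?case by (auto intro!: alg.mult intro: alg.gen)
qed (simp add: alg.gen)

lemma U_mem: "U c n \<in> alg (T ` {..<n})"
proof (induction n)
  case (Suc n)
  have "XX n \<in> alg (T ` {..<Suc n})" by (rule alg_mono[OF XX_mem]) auto
  moreover have "U c n \<in> alg (T ` {..<Suc n})" by (rule alg_mono[OF Suc]) auto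
  ultimately show ?case by (auto intro!: alg.mult alg_diff alg.sc)
qed (simp add: alg_one)

lemma P_mem: "P b a \<in> alg (T ` {1..<a+b})"
proof (induction a)
  case (Suc a)
  have "D (Suc a) b \<in> alg (T ` {1..<Suc a+b})" by (rule alg_mono[OF D_mem]) auto
  moreover have "P b a \<in> alg (T ` {1..<Suc a+b})" by (rule alg_mono[OF Suc]) auto
  ultimately show ?case by (auto intro!: alg.mult)
qed (simp add: alg_one)

subsection \<open>Commutation\<close>

lemma comm_prod:
  fixes x y z :: 'a
  shows "x * z = z * x \<Longrightarrow> y * z = z * y \<Longrightarrow> x * y * z = z * (x * y)"
  by (metis mult.assoc)

lemma XX_T_less:
  assumes "1 \<le> i" "i < k" shows "XX k * T i = T i * XX k"
  using assms
proof (induction k)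
  case (Suc k)
  show ?case
  proof (cases "i < k")
    case True
    have f: "T (Suc k) * T i = T i * T (Suc k)" using far[of i "Suc k"] True by simp
    have ih: "XX k * T i = T i * XX k" using Suc True by simp
    show ?thesis unfolding XX.simps by (intro comm_prod f ih)
  next
    case False
    then obtain m where m: "k = Suc m" "i = Suc m"
      using Suc.prems by (metis One_nat_def Suc_le_D less_SucE)
    have f: "XX m * T (Suc (Suc m)) = T (Suc (Suc m)) * XX m"
      by (rule alg_far[OF XX_mem alg.gen, where J = "{Suc (Suc m)}"]) auto
    have b: "T (Suc m) * T (Suc (Suc m)) * T (Suc m) = T (Suc (Suc m)) * T (Suc m) * T (Suc (Suc m))"
      using braid[of "Suc m"] by simp
    have "T i * XX (Suc k) = (T (Suc m) * T (Suc (Suc m)) * T (Suc m)) * XX m * T (Suc m) * T (Suc (Suc m))"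
      unfolding m by (simp add: mult.assoc)
    also have "\<dots> = T (Suc (Suc m)) * T (Suc m) * (T (Suc (Suc m)) * XX m) * T (Suc m) * T (Suc (Suc m))"
      unfolding b by (simp add: mult.assoc)
    also have "\<dots> = T (Suc (Suc m)) * T (Suc m) * XX m * (T (Suc (Suc m)) * T (Suc m) * T (Suc (Suc m)))"
      unfolding f[symmetric] by (simp add: mult.assoc)
    also have "\<dots> = XX (Suc k) * T i" unfolding b[symmetric] m by (simp add: mult.assoc)
    finally show ?thesis by simp
  qed
qed simp

lemma XX_T0: "1 \<le> k \<Longrightarrow> XX k * T 0 = T 0 * XX k"
proof (induction k)
  case (Suc k)
  show ?case
  proof (cases k)
    case 0 then show ?thesis using braid4 by (simp add: mult.assoc)
  next
    case m: (Suc m)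
    have f: "T (Suc k) * T 0 = T 0 * T (Suc k)" using far[of 0 "Suc k"] m by simp
    have ih: "XX k * T 0 = T 0 * XX k" using Suc.IH m by simp
    show ?thesis unfolding XX.simps by (intro comm_prod f ih)
  qed
qed simp

lemma XX_commute_low: "x \<in> alg (T ` {..<k}) \<Longrightarrow> XX k * x = x * XX k"
proof (rule alg_commute)
  fix g assume "g \<in> T ` {..<k}"
  then obtain i where "i < k" "g = T i" by auto
  then show "XX k * g = g * XX k" using XX_T_less[of i k] XX_T0[of k] by (cases "i = 0") auto
qed

lemma XX_commute: "XX k * XX l = XX l * XX k"
proof (induction k l rule: linorder_wlog)
  case (le a b)
  show ?case
  proof (cases "a = b")
    case False
    have "XX a \<in> alg (T ` {..<b})" by (rule alg_mono[OF XX_mem]) (use le False in auto)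
    then show ?thesis using XX_commute_low by metis
  qed simp
qed simp

lemma XX_T: assumes "1 \<le> i" "i \<noteq> k" "i \<noteq> Suc k" shows "XX k * T i = T i * XX k"
proof (cases "i < k")
  case True then show ?thesis using XX_T_less assms by simp
next
  case False
  then show ?thesis using assms by (intro alg_far[OF XX_mem alg.gen, where J = "{i}"]) auto
qed

lemma T_XX: "T (Suc k) * XX k = XX (Suc k) * Ti (Suc k)"
  using T_Ti(1)[of "Suc k"] by (simp add: mult.assoc)

lemma XX_T_same: "XX k * T (Suc k) = Ti (Suc k) * XX (Suc k)"
  using T_Ti(2)[of "Suc k"] by (simp add: mult.assoc[symmetric])

lemma T_XX_Suc: "T (Suc k) * XX (Suc k) = XX k * T (Suc k) + sc kap * XX (Suc k)"
  unfolding XX_T_same by (simp add: Ti_def algebra_simps)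

lemma XX_Suc_T: "XX (Suc k) * T (Suc k) = T (Suc k) * XX k + sc kap * XX (Suc k)"
  unfolding T_XX using sc_comm[of kap "XX (Suc k)"] by (simp add: Ti_def algebra_simps)

text \<open>The step from symmetric polynomials: \<open>T\<^bsub>k+1\<^esub>\<close> commutes with the sum and with the product of
  \<open>X\<^sub>k\<close> and \<open>X\<^bsub>k+1\<^esub>\<close>. It makes \<open>U c n\<close> commute with the type A generators on its strands.\<close>

lemma T_pair:
  "T (Suc k) * ((XX k - sc c) * (XX (Suc k) - sc c)) = ((XX k - sc c) * (XX (Suc k) - sc c)) * T (Suc k)"
proof -
  let ?t = "T (Suc k)" and ?x = "XX k" and ?y = "XX (Suc k)"
  have e: "(?x - sc c) * (?y - sc c) = ?x * ?y - sc c * (?x + ?y) + sc c * sc c"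
    using sc_comm[of c ?x] by (simp add: algebra_simps)
  have sum: "?t * (?x + ?y) = (?x + ?y) * ?t"
    using T_XX_Suc[of k] XX_Suc_T[of k] by (simp add: algebra_simps del: XX.simps)
  have "?t * (?x * ?y) = ?y * Ti (Suc k) * ?y" by (simp only: mult.assoc[symmetric] T_XX)
  also have "\<dots> = ?y * (?x * ?t)" by (simp only: mult.assoc XX_T_same)
  also have "\<dots> = ?x * ?y * ?t" using XX_commute[of k "Suc k"] by (simp only: mult.assoc[symmetric])
  finally have prod: "?t * (?x * ?y) = ?x * ?y * ?t" .
  have c1: "?t * (sc c * z) = sc c * (?t * z)" for z using sc_comm[of c ?t] by (metis mult.assoc)
  have c2: "?t * (sc c * sc c) = sc c * sc c * ?t"
    using sc_comm[of c ?t] by (metis mult.assoc)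
  have "?t * (?x * ?y - sc c * (?x + ?y) + sc c * sc c)
      = ?t * (?x * ?y) - ?t * (sc c * (?x + ?y)) + ?t * (sc c * sc c)"
    by (simp only: distrib_left right_diff_distrib)
  also have "\<dots> = ?x * ?y * ?t - sc c * ((?x + ?y) * ?t) + sc c * sc c * ?t"
    by (simp only: prod c1 sum) (simp only: c2 c1[symmetric])
  also have "\<dots> = (?x * ?y - sc c * (?x + ?y) + sc c * sc c) * ?t"
    by (simp only: distrib_right left_diff_distrib mult.assoc)
  finally show ?thesis unfolding e .
qed

lemma U_T: "1 \<le> i \<Longrightarrow> i < n \<Longrightarrow> T i * U c n = U c n * T i"
proof (induction n)
  case (Suc n)
  show ?case
  proof (cases "i < n")
    case True
    have "T i * (XX n - sc c) = (XX n - sc c) * T i"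
      using XX_T_less[of i n] sc_comm[of c "T i"] Suc True by (simp add: algebra_simps)
    then show ?thesis using Suc True by simp (metis mult.assoc)
  next
    case False
    then obtain m where m: "n = Suc m" "i = Suc m"
      using Suc.prems by (metis One_nat_def Suc_le_D less_SucE)
    have "T i * U c m = U c m * T i" unfolding m
      by (rule alg_far[OF alg.gen U_mem, where I = "{Suc m}"]) auto
    moreover have "U c (Suc n) = U c m * ((XX m - sc c) * (XX (Suc m) - sc c))"
      unfolding m by (simp add: mult.assoc del: XX.simps)
    ultimately show ?thesis using T_pair[of m c] m by (metis mult.assoc)
  qed
qed simp

lemma U_commute_A: "x \<in> alg (T ` ({1..<n} \<union> {Suc n..})) \<Longrightarrow> U c n * x = x * U c n"
proof (rule alg_commute)
  fix g assume "g \<in> T ` ({1..<n} \<union> {Suc n..})"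
  then obtain i where i: "g = T i" "1 \<le> i \<and> i < n \<or> Suc n \<le> i" by auto
  then show "U c n * g = g * U c n"
  proof (cases "i < n")
    case False
    then show ?thesis using i
      by (intro alg_far[OF U_mem alg.gen, where J = "{i}"]) auto
  qed (use U_T[of i n c] in auto)
qed

lemma U_commute_XX: "U c n * XX k = XX k * U c n"
proof (induction n)
  case (Suc n)
  have "(XX n - sc c) * XX k = XX k * (XX n - sc c)"
    using XX_commute[of n k] sc_comm[of c "XX k"] by (simp add: algebra_simps)
  then show ?case using Suc by simp (metis mult.assoc)
qed simp

lemma U_head:
  assumes "1 \<le> n"
  obtains V where "U c n = (T 0 - sc c) * V" "U c n = V * (T 0 - sc c)"
proof -
  have "\<exists>V. U c (Suc m) = (T 0 - sc c) * V \<and> U c (Suc m) = V * (T 0 - sc c)" for m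
  proof (induction m)
    case 0 show ?case by (rule exI[of _ 1]) simp
  next
    case (Suc m)
    then obtain V where V: "U c (Suc m) = (T 0 - sc c) * V" "U c (Suc m) = V * (T 0 - sc c)" by blast
    have e: "U c (Suc (Suc m)) = U c (Suc m) * (XX (Suc m) - sc c)" by simp
    have com: "(T 0 - sc c) * (XX (Suc m) - sc c) = (XX (Suc m) - sc c) * (T 0 - sc c)"
      using XX_T0[of "Suc m"] sc_comm[of c "T 0"] sc_comm[of c "XX (Suc m)"] by (simp add: algebra_simps)
    show ?case
      by (rule exI[of _ "V * (XX (Suc m) - sc c)"])
        (unfold e, intro conjI, metis V(1) mult.assoc, metis V(2) com mult.assoc)
  qed
  then show ?thesis using that assms by (metis Suc_le_D One_nat_def)
qed

lemma U_r_T0: "1 \<le> n \<Longrightarrow> T 0 * U r n = sc s * U r n" "1 \<le> n \<Longrightarrow> U r n * T 0 = sc s * U r n"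
proof -
  assume "1 \<le> n"
  then obtain V where V: "U r n = (T 0 - sc r) * V" "U r n = V * (T 0 - sc r)" by (rule U_head)
  have "(T 0 - sc s) * U r n = 0" unfolding V(1) using quad0' by (simp add: mult.assoc[symmetric])
  then show "T 0 * U r n = sc s * U r n" by (simp add: algebra_simps)
  have "U r n * (T 0 - sc s) = 0" unfolding V(2) using quad0 by (simp add: mult.assoc)
  then show "U r n * T 0 = sc s * U r n" using sc_comm[of s "U r n"] by (simp add: algebra_simps)
qed

lemma U_s_T0: "1 \<le> n \<Longrightarrow> T 0 * U s n = sc r * U s n" "1 \<le> n \<Longrightarrow> U s n * T 0 = sc r * U s n"
  using hecke_ring.U_r_T0[OF swapped] by auto

text \<open>The mechanism that makes most products vanish: when \<open>x\<close> commutes with \<open>T\<^sub>0\<close>, the factor \<open>T\<^sub>0 - r\<close> at the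
  right end of \<open>U r b\<close> meets the factor \<open>T\<^sub>0 - s\<close> at the left end of \<open>U s a\<close>.\<close>

lemma U_x_U_zero:
  assumes "1 \<le> a" "1 \<le> b" "T 0 * x = x * T 0"
  shows "U r b * x * U s a = 0"
proof -
  obtain V where V: "U r b = V * (T 0 - sc r)" using U_head[OF assms(2)] by metis
  obtain W where W: "U s a = (T 0 - sc s) * W" using U_head[OF assms(1)] by metis
  have "(T 0 - sc r) * x = x * (T 0 - sc r)"
    using assms(3) sc_comm[of r x] by (simp add: algebra_simps)
  then have "U r b * x * U s a = V * x * ((T 0 - sc r) * (T 0 - sc s)) * W"
    unfolding V W by (metis mult.assoc)
  then show ?thesis using quad0 by simp
qed

lemma alg2_T0: "x \<in> alg (T ` {2..}) \<Longrightarrow> T 0 * x = x * T 0"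
  by (rule alg_far[OF alg.gen, where I = "{0}" and J = "{2..}"]) auto

subsection \<open>Braid words\<close>

lemma D_T_shift: "1 \<le> j \<Longrightarrow> j < i \<Longrightarrow> i < j + l \<Longrightarrow> D j l * T i = T (i - 1) * D j l"
proof (induction l)
  case (Suc l)
  show ?case
  proof (cases "i < j + l")
    case True
    have "T (j + l) * T (i - 1) = T (i - 1) * T (j + l)" using far[of "i - 1" "j + l"] True Suc by simp
    then show ?thesis using Suc True by simp (metis mult.assoc)
  next
    case False
    then have i: "i = j + l" using Suc by simp
    then obtain m where m: "l = Suc m" using Suc.prems by (cases l) auto
    have f: "D j m * T i = T i * D j m"
      by (rule alg_far[OF D_mem alg.gen, where J = "{i}"]) (auto simp: i m)
    have b: "T (j + m) * T (Suc (j + m)) * T (j + m) = T (Suc (j + m)) * T (j + m) * T (Suc (j + m))"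
      using braid[of "j + m"] Suc.prems by simp
    have "D j (Suc l) * T i = T (Suc (j+m)) * T (j + m) * (D j m * T i)"
      unfolding m by (simp add: mult.assoc)
    also have "\<dots> = (T (Suc (j+m)) * T (j + m) * T (Suc (j+m))) * D j m"
      unfolding f by (simp add: i m mult.assoc)
    also have "\<dots> = T (i - 1) * D j (Suc l)" unfolding b[symmetric] by (simp add: i m mult.assoc)
    finally show ?thesis .
  qed
qed simp

lemma D_split: "D j (k + l) = D (j + k) l * D j k"
  by (induction l) (auto simp: mult.assoc add.assoc)

lemma A_split: "A j (k + l) = A j k * A (j + k) l"
  by (induction l) (auto simp: mult.assoc add.assoc)

lemma D_first: "D j (Suc l) = D (Suc j) l * T j"
  using D_split[of j 1 l] by simp

lemma A_first: "A j (Suc l) = T j * A (Suc j) l"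
  using A_split[of j 1 l] by simp

lemma J_eq: "J j l = D j l * A j l"
  by (induction l) (auto simp: mult.assoc)

lemma XX_split: "XX (k + l) = D (Suc k) l * XX k * A (Suc k) l"
  by (induction l) (auto simp: mult.assoc)

lemma XX_eq: "XX l = D 1 l * T 0 * A 1 l"
  using XX_split[of 0 l] by simp

lemma A_D_inverse:
  assumes "1 \<le> j"
  obtains E where "E \<in> alg (T ` {j..<j+l})" "E * D j l = 1" "D j l * E = 1"
proof -
  have "\<exists>E. E \<in> alg (T ` {j..<j+l}) \<and> E * D j l = 1 \<and> D j l * E = 1"
  proof (induction l)
    case 0 then show ?case by (auto intro!: exI[of _ 1] alg_one)
  next
    case (Suc l)
    then obtain E where E: "E \<in> alg (T ` {j..<j+l})" "E * D j l = 1" "D j l * E = 1" by auto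
    have t: "T (j+l) * Ti (j+l) = 1" "Ti (j+l) * T (j+l) = 1" using T_Ti[of "j+l"] assms by auto
    have m: "E \<in> alg (T ` {j..<j+Suc l})" by (rule alg_mono[OF E(1)]) auto
    show ?case
    proof (intro exI[of _ "E * Ti (j + l)"] conjI)
      show "E * Ti (j + l) \<in> alg (T ` {j..<j + Suc l})" using m by (auto intro!: alg.mult Ti_mem)
      show "E * Ti (j + l) * D j (Suc l) = 1" using E(2) t(2) by simp (metis mult.assoc mult_1)
      show "D j (Suc l) * (E * Ti (j + l)) = 1" using E(3) t(1) by simp (metis mult.assoc mult_1)
    qed
  qed
  then show ?thesis using that by blast
qed

lemma P_T_right: "1 \<le> i \<Longrightarrow> i < b \<Longrightarrow> T i * P b a = P b a * T (i + a)"
proof (induction a)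
  case (Suc a)
  have "D (Suc a) b * T (Suc (i + a)) = T (i + a) * D (Suc a) b"
    using D_T_shift[of "Suc a" "Suc (i + a)" b] Suc.prems by simp
  then show ?case using Suc by simp (metis mult.assoc)
qed simp

lemma P_T_left: "1 \<le> i \<Longrightarrow> i < a \<Longrightarrow> T (b + i) * P b a = P b a * T i"
proof (induction a)
  case (Suc a)
  show ?case
  proof (cases "i < a")
    case True
    have "D (Suc a) b * T i = T i * D (Suc a) b"
      by (rule alg_far[OF D_mem alg.gen, where J = "{i}"]) (use True in auto)
    then show ?thesis using Suc True by simp (metis mult.assoc)
  next
    case False
    then obtain m where m: "a = Suc m" "i = Suc m"
      using Suc.prems by (metis One_nat_def Suc_le_D less_SucE)
    have f: "T (b + i) * P b m = P b m * T (b + i)"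
      by (rule alg_far[OF alg.gen P_mem, where I = "{b + i}"]) (auto simp: m)
    have shift: "\<And>l. l \<le> b \<Longrightarrow> D i (Suc b) * D (Suc i) l = D i l * D i (Suc b)"
    proof -
      fix l assume "l \<le> b"
      then show "D i (Suc b) * D (Suc i) l = D i l * D i (Suc b)"
      proof (induction l)
        case (Suc l)
        have "D i (Suc b) * T (Suc i + l) = T (i + l) * D i (Suc b)"
          using D_T_shift[of i "Suc i + l" "Suc b"] Suc m by simp
        then show ?case using Suc by (simp del: D.simps(2) add: D.simps(2)[of _ l]) (metis mult.assoc)
      qed simp
    qed
    have "T (b + i) * P b (Suc a) = P b m * (T (i + b) * D i b) * D (Suc i) b"
      using f unfolding m by (simp add: add.commute) (metis mult.assoc)
    also have "\<dots> = P b m * (D i (Suc b) * D (Suc i) b)" by (simp add: mult.assoc)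
    also have "\<dots> = P b m * (D i b * D i (Suc b))" using shift[of b] by simp
    also have "\<dots> = P b (Suc a) * T i" unfolding D_first by (simp add: m mult.assoc)
    finally show ?thesis .
  qed
qed simp

lemma P_Suc_left: "P (Suc b) a = A (Suc b) a * P b a"
proof (induction a)
  case (Suc a)
  have f: "T (Suc (a + b)) * P b a = P b a * T (Suc (a + b))"
    by (rule alg_far[OF alg.gen P_mem, where I = "{Suc (a + b)}"]) auto
  have "P (Suc b) (Suc a) = A (Suc b) a * (P b a * T (Suc (a + b))) * D (Suc a) b"
    using Suc by (simp add: mult.assoc)
  also have "\<dots> = A (Suc b) (Suc a) * P b (Suc a)"
    unfolding f[symmetric] by (simp add: mult.assoc add.commute)
  finally show ?case .
qed simp

lemma P_tail:
  assumes "1 \<le> b"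
  obtains P' where "P' \<in> alg (T ` {2..})" "P b a = P' * A 1 a"
proof -
  have "\<exists>P'. P' \<in> alg (T ` {2..}) \<and> P b a = P' * A 1 a"
  proof (induction a)
    case 0 then show ?case by (auto intro!: exI[of _ 1] alg_one)
  next
    case (Suc a)
    then obtain P' where P': "P' \<in> alg (T ` {2..})" "P b a = P' * A 1 a" by auto
    obtain b' where b': "b = Suc b'" using assms by (cases b) auto
    have f: "A 1 a * D (Suc (Suc a)) b' = D (Suc (Suc a)) b' * A 1 a"
      by (rule alg_far[OF A_mem D_mem]) auto
    have "P b (Suc a) = P' * (A 1 a * D (Suc (Suc a)) b') * T (Suc a)"
      using P'(2) by (simp add: b' D_first mult.assoc del: D.simps)
    also have "\<dots> = P' * D (Suc (Suc a)) b' * A 1 (Suc a)" unfolding f by (simp add: mult.assoc)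
    finally have "P b (Suc a) = P' * D (Suc (Suc a)) b' * A 1 (Suc a)" .
    moreover have "D (Suc (Suc a)) b' \<in> alg (T ` {2..})" by (rule alg_mono[OF D_mem]) auto
    ultimately show ?case using P'(1) alg.mult by blast
  qed
  then show ?thesis using that by blast
qed

lemma P_head:
  assumes "1 \<le> a"
  obtains P' where "P' \<in> alg (T ` {2..})" "P b a = D 1 b * P'"
proof -
  have "\<exists>P'. P' \<in> alg (T ` {2..}) \<and> P b (Suc m) = D 1 b * P'" for m
  proof (induction m)
    case 0 then show ?case by (auto intro!: exI[of _ 1] alg_one)
  next
    case (Suc m)
    then obtain P' where P': "P' \<in> alg (T ` {2..})" "P b (Suc m) = D 1 b * P'" by auto
    have "P b (Suc (Suc m)) = D 1 b * (P' * D (Suc (Suc m)) b)"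
      using P'(2) by (simp add: mult.assoc)
    moreover have "D (Suc (Suc m)) b \<in> alg (T ` {2..})" by (rule alg_mono[OF D_mem]) auto
    ultimately show ?case using P'(1) alg.mult by blast
  qed
  then show ?thesis using that assms by (metis Suc_le_D One_nat_def)
qed

end

section \<open>The elements h\<close>

text \<open>Finite sums as an inductive set, which avoids index sets: ideals and spans are handled by induction.\<close>

inductive_set sums :: "'b::monoid_add set \<Rightarrow> 'b set" for G where
  zero: "0 \<in> sums G"
| add_gen: "x \<in> G \<Longrightarrow> y \<in> sums G \<Longrightarrow> x + y \<in> sums G"

lemma sums_gen: "x \<in> G \<Longrightarrow> x \<in> sums G"
  using sums.add_gen[OF _ sums.zero] by fastforce

lemma sums_add: "x \<in> sums G \<Longrightarrow> y \<in> sums G \<Longrightarrow> x + y \<in> sums G"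
  by (induction rule: sums.induct) (auto simp: add.assoc intro: sums.add_gen)

lemma sums_induct_add:
  assumes "x \<in> sums G" "Q 0" "\<And>x y. Q x \<Longrightarrow> Q y \<Longrightarrow> Q (x + y)" "\<And>x. x \<in> G \<Longrightarrow> Q x"
  shows "Q x"
  using assms(1) by induction (auto intro: assms)

lemma sums_left:
  fixes g :: "'b::ring_1"
  assumes "\<And>x. x \<in> G \<Longrightarrow> g * x \<in> sums G'" "x \<in> sums G"
  shows "g * x \<in> sums G'"
  using assms(2) by (rule sums_induct_add) (auto simp: distrib_left intro: sums.zero sums_add assms(1))

lemma sums_right:
  fixes g :: "'b::ring_1"
  assumes "\<And>x. x \<in> G \<Longrightarrow> x * g \<in> sums G'" "x \<in> sums G"
  shows "x * g \<in> sums G'"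
  using assms(2) by (rule sums_induct_add) (auto simp: distrib_right intro: sums.zero sums_add assms(1))

lemma sums_sum_list: "x \<in> sums G \<Longrightarrow> \<exists>xs. set xs \<subseteq> G \<and> x = sum_list xs"
proof (induction rule: sums.induct)
  case zero show ?case by (rule exI[of _ "[]"]) simp
next
  case (add_gen x y)
  then obtain xs where "set xs \<subseteq> G" "y = sum_list xs" by auto
  then show ?case using add_gen(1) by (intro exI[of _ "x # xs"]) auto
qed

context hecke_ring
begin

lemma sc_out: "x * (sc c * y) = sc c * (x * y)"
  using sc_comm[of c x] by (metis mult.assoc)

lemma pre:
  fixes x y u v z :: 'a
  shows "x * y = u * v \<Longrightarrow> x * (y * z) = u * (v * z)"
  by (simp add: mult.assoc[symmetric])

text \<open>The element \<open>u\<^sup>- T\<^sub>w u\<^sup>+\<close> of Dipper and James.\<close>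

definition "h b a = U r b * P b a * U s a"

lemma T_U: "1 \<le> i \<Longrightarrow> i < n \<or> Suc n \<le> i \<Longrightarrow> T i * U c n = U c n * T i"
  using U_commute_A[OF alg.gen[of "T i"], of n c] by force

lemma T_h_low: assumes "1 \<le> i" "i < b" shows "T i * h b a = h b a * T (i + a)"
proof -
  have "T i * h b a = U r b * (T i * P b a) * U s a"
    using T_U[of i b r] assms by (simp add: h_def) (metis mult.assoc)
  also have "\<dots> = U r b * P b a * (T (i + a) * U s a)"
    using P_T_right[OF assms] by (simp add: mult.assoc)
  also have "\<dots> = h b a * T (i + a)"
    using T_U[of "i + a" a s] assms by (simp add: h_def mult.assoc)
  finally show ?thesis .
qed

lemma T_h_high: assumes "1 \<le> i" "i < a" shows "T (b + i) * h b a = h b a * T i"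
proof -
  have "T (b + i) * h b a = U r b * (T (b + i) * P b a) * U s a"
    using T_U[of "b + i" b r] assms by (simp add: h_def) (metis mult.assoc)
  also have "\<dots> = U r b * P b a * (T i * U s a)"
    using P_T_left[OF assms] by (simp add: mult.assoc)
  also have "\<dots> = h b a * T i"
    using T_U[of i a s] assms by (simp add: h_def mult.assoc)
  finally show ?thesis .
qed

text \<open>The inverses of \<open>D 1 l\<close> and of \<open>A 1 l\<close>.\<close>

fun Ai :: "nat \<Rightarrow> 'a" where
  "Ai 0 = 1"
| "Ai (Suc l) = Ai l * Ti (Suc l)"

fun Di :: "nat \<Rightarrow> 'a" where
  "Di 0 = 1"
| "Di (Suc l) = Ti (Suc l) * Di l"

lemma Ai_D: "Ai l * D 1 l = 1"
proof (induction l)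
  case (Suc l)
  have "Ai (Suc l) * D 1 (Suc l) = Ai l * (Ti (Suc l) * T (Suc l)) * D 1 l"
    by (simp add: mult.assoc)
  then show ?case using T_Ti(2)[of "Suc l"] Suc by simp
qed simp

lemma A_Di: "A 1 l * Di l = 1"
proof (induction l)
  case (Suc l)
  have "A 1 (Suc l) * Di (Suc l) = A 1 l * (T (Suc l) * Ti (Suc l)) * Di l"
    by (simp add: mult.assoc)
  then show ?case using T_Ti(1)[of "Suc l"] Suc by simp
qed simp

lemma Ai_mem: "Ai l \<in> alg (T ` {1..<Suc l})"
proof (induction l)
  case (Suc l)
  have "Ai l \<in> alg (T ` {1..<Suc (Suc l)})" by (rule alg_mono[OF Suc]) auto
  then show ?case by (auto intro!: alg.mult Ti_mem)
qed (simp add: alg_one)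

lemma Di_mem: "Di l \<in> alg (T ` {1..<Suc l})"
proof (induction l)
  case (Suc l)
  have "Di l \<in> alg (T ` {1..<Suc (Suc l)})" by (rule alg_mono[OF Suc]) auto
  then show ?case by (auto intro!: alg.mult Ti_mem)
qed (simp add: alg_one)

text \<open>
  Between \<open>u\<^sup>-\<close> and \<open>u\<^sup>+\<close> the generators \<open>T\<^sub>1, \<dots>, T\<^sub>k\<close> in the last part of \<open>T\<^sub>w\<close> may be replaced by their
  inverses. The two differ by a scalar, and without one of these generators the word splits into a part
  that commutes with \<open>T\<^sub>0\<close> and a part that passes through \<open>u\<^sup>+\<close>, so \<open>U_x_U_zero\<close> applies.
\<close>

lemma A_inverse_between:
  assumes g: "g \<in> alg (T ` {2..})" and b: "1 \<le> b" and k: "k \<le> a"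
  shows "U r b * (g * Ai k * A (Suc k) (a - k)) * U s a = U r b * (g * A 1 a) * U s a"
  using k
proof (induction k)
  case (Suc k)
  let ?B = "A (Suc (Suc k)) (a - Suc k)"
  have m: "Ai k * ?B = ?B * Ai k" by (rule alg_far[OF Ai_mem A_mem]) auto
  have "Ai k \<in> alg (T ` ({1..<a} \<union> {Suc a..}))" by (rule alg_mono[OF Ai_mem]) (use Suc.prems in auto)
  from U_commute_A[OF this] have u: "U s a * Ai k = Ai k * U s a" .
  have B: "?B \<in> alg (T ` {2..})" by (rule alg_mono[OF A_mem]) auto
  have "U r b * (g * ?B) * U s a = 0"
    by (rule U_x_U_zero[OF _ b alg2_T0[OF alg.mult[OF g B]]]) (use Suc.prems in auto)
  moreover have "U r b * (g * Ai k * ?B) * U s a = U r b * (g * ?B) * U s a * Ai k"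
    using m u by (simp add: mult.assoc)
  ultimately have z: "U r b * (g * Ai k * ?B) * U s a = 0" by simp
  have A: "A (Suc k) (a - k) = T (Suc k) * ?B"
    using A_first[of "Suc k" "a - Suc k"] Suc.prems by (simp add: Suc_diff_Suc)
  have c: "U r b * (g * Ai k * (sc kap * ?B)) * U s a = sc kap * (U r b * (g * Ai k * ?B) * U s a)"
    by (simp only: mult.assoc sc_out)
  have "U r b * (g * Ai (Suc k) * ?B) * U s a
      = U r b * (g * Ai k * (T (Suc k) * ?B)) * U s a - U r b * (g * Ai k * (sc kap * ?B)) * U s a"
    by (simp add: Ti_def algebra_simps)
  also have "\<dots> = U r b * (g * Ai k * A (Suc k) (a - k)) * U s a"
    unfolding c z A by simp
  finally show ?case using Suc by simp
qed simp

text \<open>The mirror image of \<open>A_inverse_between\<close>, with the first part of \<open>T\<^sub>w\<close> and with \<open>u\<^sup>-\<close>.\<close>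

lemma D_inverse_between:
  assumes g: "g \<in> alg (T ` {2..})" and a: "1 \<le> a" and k: "k \<le> b"
  shows "U r b * (D (Suc k) (b - k) * Di k * g) * U s a = U r b * (D 1 b * g) * U s a"
  using k
proof (induction k)
  case (Suc k)
  let ?B = "D (Suc (Suc k)) (b - Suc k)"
  have m: "Di k * ?B = ?B * Di k" by (rule alg_far[OF Di_mem D_mem]) auto
  have "Di k \<in> alg (T ` ({1..<b} \<union> {Suc b..}))" by (rule alg_mono[OF Di_mem]) (use Suc.prems in auto)
  from U_commute_A[OF this] have u: "U r b * Di k = Di k * U r b" .
  have B: "?B \<in> alg (T ` {2..})" by (rule alg_mono[OF D_mem]) auto
  have "U r b * (?B * g) * U s a = 0"
    by (rule U_x_U_zero[OF a _ alg2_T0[OF alg.mult[OF B g]]]) (use Suc.prems in auto)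
  moreover have "U r b * (?B * Di k * g) * U s a = Di k * (U r b * (?B * g) * U s a)"
    by (simp only: mult.assoc pre[OF m[symmetric]] pre[OF u])
  ultimately have z: "U r b * (?B * Di k * g) * U s a = 0" by simp
  have D: "D (Suc k) (b - k) = ?B * T (Suc k)"
    using D_first[of "Suc k" "b - Suc k"] Suc.prems by (simp add: Suc_diff_Suc)
  have c: "U r b * (?B * sc kap * Di k * g) * U s a = sc kap * (U r b * (?B * Di k * g) * U s a)"
    by (simp only: mult.assoc sc_out)
  have "U r b * (?B * Di (Suc k) * g) * U s a
      = U r b * (?B * T (Suc k) * Di k * g) * U s a - U r b * (?B * sc kap * Di k * g) * U s a"
    by (simp add: Ti_def algebra_simps)
  also have "\<dots> = U r b * (D (Suc k) (b - k) * Di k * g) * U s a"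
    unfolding c z D by simp
  finally show ?case using Suc by simp
qed simp

text \<open>With the last part of \<open>T\<^sub>w\<close> inverted, \<open>X\<^sub>a\<close> becomes a \<open>T\<^sub>0\<close> that can be moved to the left until it is
  absorbed by \<open>u\<^sup>-\<close> with eigenvalue \<open>s\<close>.\<close>

lemma h_XX: assumes "1 \<le> b" shows "h b a * XX a = sc s * h b a"
proof -
  obtain g where g: "g \<in> alg (T ` {2..})" "P b a = g * A 1 a" by (rule P_tail[OF assms])
  have "h b a = U r b * (g * Ai a) * U s a"
    using A_inverse_between[OF g(1) assms order.refl, of a] g(2) by (simp add: h_def mult.assoc)
  then have "h b a * XX a = U r b * g * (Ai a * XX a) * U s a"
    using U_commute_XX[of s a a] by (simp add: mult.assoc)
  also have "Ai a * XX a = T 0 * A 1 a"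
    unfolding XX_eq using Ai_D[of a] by (simp add: mult.assoc[symmetric])
  also have "U r b * g * (T 0 * A 1 a) * U s a = U r b * T 0 * (g * A 1 a) * U s a"
    by (simp only: mult.assoc pre[OF alg2_T0[OF g(1)]])
  also have "\<dots> = sc s * h b a"
    unfolding U_r_T0(2)[OF assms] h_def g(2) by (simp add: mult.assoc)
  finally show ?thesis .
qed

lemma XX_h: assumes "1 \<le> a" shows "XX b * h b a = sc r * h b a"
proof -
  obtain g where g: "g \<in> alg (T ` {2..})" "P b a = D 1 b * g" by (rule P_head[OF assms])
  have "h b a = U r b * (Di b * g) * U s a"
    using D_inverse_between[OF g(1) assms order.refl, of b] g(2) by (simp add: h_def mult.assoc)
  then have "XX b * h b a = U r b * (XX b * Di b) * g * U s a"
    by (simp only: mult.assoc pre[OF U_commute_XX[symmetric, of b r b]])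
  also have "XX b * Di b = D 1 b * T 0"
    unfolding XX_eq using A_Di[of b] by (simp add: mult.assoc)
  also have "U r b * (D 1 b * T 0) * g * U s a = U r b * (D 1 b * g) * (T 0 * U s a)"
    by (simp only: mult.assoc pre[OF alg2_T0[OF g(1)]])
  also have "\<dots> = sc r * h b a"
    unfolding U_s_T0(1)[OF assms] h_def g(2)
    by (simp only: mult.assoc sc_out)
  finally show ?thesis .
qed

text \<open>The Hecke algebra of the two blocks, of \<open>b\<close> and of \<open>n - b\<close> strands.\<close>

definition "parabolic b n = alg (T ` ({1..<n} - {b}))"

text \<open>The target of the sandwich property: \<open>U r b * x * U s a\<close> is a parabolic multiple of \<open>h\<close> when the two
  products together involve exactly \<open>n\<close> strands, and it vanishes when they involve more.\<close>

definition "Z n b a = (if a + b = n then {y * h b a | y. y \<in> parabolic b n} else {0})"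

lemma Z_0: "0 \<in> Z n b a"
  using alg.sc[of 0 "T ` ({1..<n} - {b})"] by (force simp: Z_def parabolic_def sc_0)

lemma Z_add: "x \<in> Z n b a \<Longrightarrow> y \<in> Z n b a \<Longrightarrow> x + y \<in> Z n b a"
  unfolding Z_def parabolic_def by (auto split: if_splits simp: distrib_right[symmetric] intro: alg.add)

lemma Z_left: "x \<in> parabolic b n \<Longrightarrow> y \<in> Z n b a \<Longrightarrow> x * y \<in> Z n b a"
  unfolding Z_def parabolic_def by (auto split: if_splits simp: mult.assoc[symmetric] intro: alg.mult)

text \<open>The words \<open>D i l\<close> represent the cosets of the symmetric group on the strands after \<open>i\<close> in the one on the
  strands from \<open>i\<close> on. The four cases of the proof are the possible positions of a generator
  relative to such a word.\<close>

lemma alg_shift_decomp: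
  assumes i: "1 \<le> i" and g: "g \<in> alg (T ` {i..<n})"
    and Q_add: "\<And>x y. Q x \<Longrightarrow> Q y \<Longrightarrow> Q (x + y)"
    and Q: "\<And>l x. i + l \<le> n \<or> l = 0 \<Longrightarrow> x \<in> alg (T ` {Suc i..<n}) \<Longrightarrow> Q (D i l * x)"
  shows "Q g"
proof -
  let ?H = "alg (T ` {Suc i..<n})"
  define C where "C = {D i l * x | l x. (i + l \<le> n \<or> l = 0) \<and> x \<in> ?H}"
  have C_I: "i + l \<le> n \<or> l = 0 \<Longrightarrow> x \<in> ?H \<Longrightarrow> D i l * x \<in> C" for l x
    unfolding C_def by blast
  define S where "S = sums C"
  have S_add: "x + y \<in> S" if "x \<in> S" "y \<in> S" for x y
    using that sums_add unfolding S_def by blast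
  have C_S: "C \<subseteq> S" unfolding S_def by (auto intro: sums_gen)
  have S_left: "g * x \<in> S" if "\<And>x. x \<in> C \<Longrightarrow> g * x \<in> S" "x \<in> S" for g x
    using sums_left that unfolding S_def by metis
  have T_C: "T m * x \<in> S" if m: "i \<le> m" "m < n" and x: "x \<in> C" for m x
  proof -
    obtain l y where y: "x = D i l * y" "i + l \<le> n \<or> l = 0" "y \<in> ?H" using x unfolding C_def by blast
    have H: "Suc i \<le> j \<Longrightarrow> j < n \<Longrightarrow> T j * y \<in> ?H" for j
      using alg.mult[OF alg.gen[of "T j"] y(3)] by auto
    consider "m > i + l" | "m = i + l" | "Suc m = i + l" | "Suc m < i + l" by linarith
    then show ?thesis
    proof cases
      case 1
      have "T m * D i l = D i l * T m"
        by (rule alg_far[OF alg.gen D_mem, where I = "{m}"]) (use 1 in auto)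
      then have "T m * x = D i l * (T m * y)" unfolding y by (metis mult.assoc)
      moreover have "\<dots> \<in> C" using C_I y(2) H[of m] 1 m by simp
      ultimately show ?thesis using C_S by auto
    next
      case 2
      then have "T m * x = D i (Suc l) * y" unfolding y by (simp add: mult.assoc)
      moreover have "\<dots> \<in> C" using y(3) 2 m by (intro C_I) auto
      ultimately show ?thesis using C_S by auto
    next
      case 3
      then obtain k where k: "l = Suc k" "m = i + k" using m by (cases l) auto
      have "T m * x = (T m * T m) * D i k * y" unfolding y k by (simp add: mult.assoc)
      also have "\<dots> = sc kap * (T m * D i k) * y + D i k * y"
        unfolding quad[OF order.trans[OF i m(1)]] by (simp add: algebra_simps)
      also have "sc kap * (T m * D i k) * y = D i l * (sc kap * y)"
        unfolding k by (simp add: mult.assoc sc_out)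
      finally have "T m * x = D i l * (sc kap * y) + D i k * y" .
      moreover have "D i l * (sc kap * y) \<in> C" "D i k * y \<in> C"
        using y alg.mult[OF alg.sc y(3)] k by (auto intro!: C_I simp del: D.simps)
      ultimately show ?thesis using C_S S_add by auto
    next
      case 4
      have "T m * D i l = D i l * T (Suc m)" using D_T_shift[of i "Suc m" l] i m 4 by simp
      then have "T m * x = D i l * (T (Suc m) * y)" unfolding y by (metis mult.assoc)
      moreover have "\<dots> \<in> C" using C_I y(2) H[of "Suc m"] 4 m by simp
      ultimately show ?thesis using C_S by auto
    qed
  qed
  have one: "1 \<in> C" using C_I[of 0 1] by (simp add: alg_one)
  have gS: "g * x \<in> S" if "x \<in> S" for x using g that
  proof (induction arbitrary: x)
    case (gen y) then show ?case using T_C S_left by auto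
  next
    case (sc c)
    have "sc c * y \<in> S" if yC: "y \<in> C" for y
    proof -
      obtain l z where z: "y = D i l * z" "i + l \<le> n \<or> l = 0" "z \<in> ?H" using yC unfolding C_def by blast
      have "sc c * y = D i l * (sc c * z)" unfolding z by (simp only: sc_out)
      then show ?thesis using C_S C_I[OF z(2) alg.mult[OF alg.sc z(3)]] by auto
    qed
    then show ?case using S_left sc by blast
  next
    case (add y z) then show ?case using S_add by (simp add: distrib_right)
  next
    case (mult y z) then show ?case by (simp add: mult.assoc)
  qed
  have "g \<in> S" using gS[of 1] one C_S by auto
  have "Q 0" using Q[of 0 0] alg.sc[of 0 "T ` {Suc i..<n}"] by (simp add: sc_0)
  show ?thesis using \<open>g \<in> S\<close>[unfolded S_def] \<open>Q 0\<close> Q_add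
    by (rule sums_induct_add) (auto simp: C_def intro: Q)
qed

lemma P_D_shift: "1 \<le> k \<Longrightarrow> k + l \<le> b \<Longrightarrow> P b i * D (i + k) l = D k l * P b i"
proof (induction l)
  case (Suc l)
  have "P b i * T (i + (k + l)) = T (k + l) * P b i"
    using P_T_right[of "k + l" b i] Suc.prems by (simp add: add.commute)
  then show ?case using Suc by (simp add: add.assoc) (metis mult.assoc)
qed simp

text \<open>
  The type A case of the sandwich property, by building \<open>T\<^sub>w\<close> from left to right. Suppose that \<open>i\<close> of its
  factors \<open>D j b\<close> have been built, and decompose the remaining element along cosets. A representative that
  is too short to be the next factor leaves \<open>T\<^sub>0\<close> free to meet both products, so it contributes \<open>0\<close>. A
  longer one contains the next factor, and its excess moves to the left into the parabolic subalgebra.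
\<close>

lemma sandwich_prefix:
  assumes "i \<le> a" "b + i \<le> n" "a \<le> n" "n \<le> a + b" "g \<in> alg (T ` {Suc i..<n})"
  shows "U r b * (P b i * g) * U s a \<in> Z n b a"
  using assms
proof (induction "a - i" arbitrary: i g)
  case 0
  then have i: "i = a" and n: "n = a + b" by auto
  have "g \<in> alg (T ` ({1..<a} \<union> {Suc a..}))" by (rule alg_mono[OF 0(6)]) (auto simp: i)
  then have e: "U r b * (P b i * g) * U s a = h b a * g"
    using U_commute_A[of g a s] by (simp add: h_def i mult.assoc)
  have "\<exists>y \<in> parabolic b n. h b a * g = y * h b a" using 0(6)
  proof induction
    case (gen x)
    then obtain l where l: "x = T l" "Suc a \<le> l" "l < a + b" unfolding i n by auto
    define j where "j = l - a"
    have j: "x = T (j + a)" "1 \<le> j" "j < b" using l by (auto simp: j_def)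
    have "T j \<in> parabolic b n" unfolding parabolic_def n using j by (intro alg.gen imageI) auto
    then show ?case using T_h_low[OF j(2,3), of a] j(1) by metis
  next
    case (sc c)
    have "sc c \<in> parabolic b n" by (simp add: parabolic_def alg.sc)
    then show ?case using sc_comm[of c "h b a"] by (intro bexI[of _ "sc c"]) auto
  next
    case (add x y)
    then obtain u v where "u \<in> parabolic b n" "h b a * x = u * h b a" "v \<in> parabolic b n" "h b a * y = v * h b a"
      by blast
    then show ?case
      by (intro bexI[of _ "u + v"]) (auto simp: parabolic_def distrib_left distrib_right intro: alg.add)
  next
    case (mult x y)
    then obtain u v where uv: "u \<in> parabolic b n" "h b a * x = u * h b a" "v \<in> parabolic b n" "h b a * y = v * h b a"
      by blast
    have "h b a * (x * y) = u * v * h b a"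
      by (simp only: pre[OF uv(2)] uv(4) mult.assoc)
    then show ?case using uv by (intro bexI[of _ "u * v"]) (auto simp: parabolic_def intro: alg.mult)
  qed
  then show ?case unfolding e Z_def using n by auto
next
  case (Suc m)
  have ia: "i < a" using Suc by simp
  show ?case
  proof (rule alg_shift_decomp[OF _ Suc.prems(5)])
    fix x y assume "U r b * (P b i * x) * U s a \<in> Z n b a" "U r b * (P b i * y) * U s a \<in> Z n b a"
    then show "U r b * (P b i * (x + y)) * U s a \<in> Z n b a"
      using Z_add by (simp add: distrib_left distrib_right)
  next
    fix l x assume l: "Suc i + l \<le> n \<or> l = 0" and x: "x \<in> alg (T ` {Suc (Suc i)..<n})"
    show "U r b * (P b i * (D (Suc i) l * x)) * U s a \<in> Z n b a"
    proof (cases "l < b")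
      case True
      have "D 1 l \<in> alg (T ` ({1..<b} \<union> {Suc b..}))" by (rule alg_mono[OF D_mem]) (use True in auto)
      from U_commute_A[OF this] have u: "U r b * D 1 l = D 1 l * U r b" .
      obtain g' where g': "g' \<in> alg (T ` {2..})" "P b i = g' * A 1 i" using P_tail[of b i] True by auto
      have c: "A 1 i * x = x * A 1 i" by (rule alg_far[OF A_mem x]) auto
      have "A 1 i \<in> alg (T ` ({1..<a} \<union> {Suc a..}))" by (rule alg_mono[OF A_mem]) (use ia in auto)
      from U_commute_A[OF this] have u': "U s a * A 1 i = A 1 i * U s a" .
      have "x \<in> alg (T ` {2..})" by (rule alg_mono[OF x]) auto
      then have z: "U r b * (g' * x) * U s a = 0"
        by (intro U_x_U_zero alg2_T0 alg.mult g'(1)) (use ia True in auto)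
      have "P b i * (D (Suc i) l * x) = D 1 l * (P b i * x)"
        using P_D_shift[of 1 l b i] True by (simp add: mult.assoc[symmetric])
      also have "\<dots> = D 1 l * (g' * x * A 1 i)" unfolding g'(2) using c by (simp add: mult.assoc)
      finally have "U r b * (P b i * (D (Suc i) l * x)) * U s a = D 1 l * (U r b * (g' * x) * U s a) * A 1 i"
        by (simp only: mult.assoc pre[OF u] u'[symmetric])
      then show ?thesis using z Z_0 by simp
    next
      case False
      show ?thesis
      proof (cases "b = 0 \<and> l = 0")
        case True
        have "U r b * (P b (Suc i) * x) * U s a \<in> Z n b a"
          by (rule Suc.hyps(1)) (use Suc.hyps(2) Suc.prems ia x True in auto)
        then show ?thesis using True by simp
      next
        case False2: False
        then have l2: "Suc i + l \<le> n" "b \<le> l" using l False by auto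
        define E where "E = D (Suc i + b) (l - b)"
        have D: "D (Suc i) l = E * D (Suc i) b" unfolding E_def using D_split[of "Suc i" b "l - b"] l2 by simp
        have Em: "E \<in> alg (T ` {Suc i + b..<Suc i + l})" unfolding E_def
          using D_mem[of "Suc i + b" "l - b"] l2 by simp
        have cP: "P b i * E = E * P b i" by (rule alg_far[OF P_mem Em]) auto
        have "E \<in> alg (T ` ({1..<b} \<union> {Suc b..}))" by (rule alg_mono[OF Em]) auto
        from U_commute_A[OF this] have cU: "U r b * E = E * U r b" .
        have parabolic: "E \<in> parabolic b n" unfolding parabolic_def by (rule alg_mono[OF Em]) (use l2 in auto)
        have "U r b * (P b (Suc i) * x) * U s a \<in> Z n b a"
          by (rule Suc.hyps(1)) (use Suc.hyps(2) Suc.prems ia x l2 in auto)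
        moreover have "U r b * (P b i * (D (Suc i) l * x)) * U s a
            = E * (U r b * (P b (Suc i) * x) * U s a)"
          unfolding D P.simps by (simp only: mult.assoc pre[OF cP] pre[OF cU])
        ultimately show ?thesis using Z_left[OF parabolic] by simp
      qed
    qed
  qed simp
qed

text \<open>Between two braid words that preserve \<open>Z\<close>, the element \<open>X\<^sub>k\<close> contains either \<open>T\<^sub>0\<close>, which \<open>u\<^sup>+\<close> absorbs, or
  \<open>X\<^sub>a\<close>, which acts on \<open>h\<close> as a scalar by \<open>h_XX\<close>.\<close>

lemma Z_right:
  assumes z: "z \<in> Z n b a" and k: "k < n" and n: "n \<le> a + b"
  shows "z * XX k \<in> Z n b a"
proof (cases "n = a + b")
  case False then show ?thesis using z by (auto simp: Z_def)
next
  case True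
  define S where "S = {x. \<forall>z \<in> Z n b a. z * x \<in> Z n b a}"
  have S_mult: "x \<in> S \<Longrightarrow> y \<in> S \<Longrightarrow> x * y \<in> S" for x y
    unfolding S_def by (auto simp: mult.assoc[symmetric])
  have S_h: "x \<in> S" if "y \<in> parabolic b n" "h b a * x = y * h b a" for x y
  proof -
    have "w * h b a * x \<in> Z n b a" if "w \<in> parabolic b n" for w
      using alg.mult[of w _ y] that(1) \<open>y \<in> parabolic b n\<close> \<open>h b a * x = y * h b a\<close> True
      unfolding Z_def parabolic_def by (auto simp: mult.assoc intro!: exI[of _ "w * y"])
    then show ?thesis unfolding S_def using True by (auto simp: Z_def)
  qed
  have S_T: "T i \<in> S" if "1 \<le> i" "i < n" "i \<noteq> a" for i
  proof (cases "i < a")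
    case i: True
    have "T (b + i) \<in> parabolic b n" unfolding parabolic_def using that i True by (intro alg.gen imageI) auto
    from S_h[OF this] show ?thesis using T_h_high[of i a b] that i by simp
  next
    case i: False
    define j where "j = i - a"
    have j: "i = j + a" "1 \<le> j" "j < b" using that True i by (auto simp: j_def)
    have "T j \<in> parabolic b n" unfolding parabolic_def using j True by (intro alg.gen imageI) auto
    from S_h[OF this] show ?thesis using T_h_low[of j b a] j by simp
  qed
  have S_one: "1 \<in> S" unfolding S_def by simp
  have S_D: "D j l \<in> S" if "\<And>i. j \<le> i \<Longrightarrow> i < j + l \<Longrightarrow> T i \<in> S" for j l
    using that by (induction l) (auto intro!: S_mult S_one)
  have S_A: "A j l \<in> S" if "\<And>i. j \<le> i \<Longrightarrow> i < j + l \<Longrightarrow> T i \<in> S" for j l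
    using that by (induction l) (auto intro!: S_mult S_one)
  have "XX k \<in> S"
  proof (cases "k < a")
    case ka: True
    have "h b a * T 0 = sc r * h b a"
      unfolding h_def using U_s_T0(2)[of a] ka by (simp add: mult.assoc sc_out)
    then have "T 0 \<in> S" by (rule S_h[rotated]) (simp add: parabolic_def alg.sc)
    then show ?thesis unfolding XX_eq using ka k by (intro S_mult S_D S_A) (auto intro: S_T)
  next
    case ka: False
    then have "XX a \<in> S" using h_XX[of b a] True k by (intro S_h[of "sc s"]) (auto simp: parabolic_def alg.sc)
    moreover have "XX k = D (Suc a) (k - a) * XX a * A (Suc a) (k - a)" using XX_split[of a "k - a"] ka by simp
    moreover have "D (Suc a) (k - a) \<in> S" "A (Suc a) (k - a) \<in> S"
      using ka k by (auto intro!: S_D S_A S_T)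
    ultimately show ?thesis using S_mult by simp
  qed
  then show ?thesis using z by (simp add: S_def)
qed

text \<open>Jucys-Murphy elements can be collected on the right of type A elements, at the price of changing the
  index and of lower terms.\<close>

lemma XX_times_A:
  assumes "t \<in> alg (T ` {1..<n})" "k < n"
  shows "XX k * t \<in> sums {t' * XX j | t' j. t' \<in> alg (T ` {1..<n}) \<and> j < n}"
  using assms
proof (induction arbitrary: k)
  case (gen x)
  let ?G = "{t' * XX j | t' j. t' \<in> alg (T ` {1..<n}) \<and> j < n}"
  have G: "t' * XX j \<in> sums ?G" if "t' \<in> alg (T ` {1..<n})" "j < n" for t' j
    by (rule sums_gen) (use that in blast)
  obtain i where i: "x = T i" "1 \<le> i" "i < n" using gen by auto
  have Tm: "T i \<in> alg (T ` {1..<n})" using i by (intro alg.gen) auto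
  consider "i = Suc k" | m where "k = Suc m" "i = Suc m" | "i \<noteq> k" "i \<noteq> Suc k"
    using i by (metis One_nat_def Suc_le_D)
  then show ?case
  proof cases
    case 1
    have "XX k * x = Ti i * XX i" unfolding i 1 by (rule XX_T_same)
    moreover have "Ti i \<in> alg (T ` {1..<n})" using i by (intro Ti_mem) auto
    ultimately show ?thesis using G i by simp
  next
    case 2
    have "XX k * x = T i * XX m + sc kap * XX i" unfolding i 2 by (rule XX_Suc_T)
    moreover have "T i * XX m \<in> sums ?G" using G[OF Tm] i 2 by simp
    moreover have "sc kap * XX i \<in> sums ?G" using G[OF alg.sc] i by blast
    ultimately show ?thesis by (simp only: sums_add)
  next
    case 3
    have "XX k * x = T i * XX k" unfolding i using XX_T[of i k] i 3 by simp
    then show ?thesis using G[OF Tm, of k] gen by simp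
  qed
next
  case (sc c)
  have "XX k * sc c = sc c * XX k" by (rule sc_comm[symmetric])
  then show ?case using alg.sc[of c] sc by (auto intro!: sums_gen)
next
  case (add x y) then show ?case by (simp add: distrib_left sums_add)
next
  case (mult x y)
  have "(XX k * x) * y \<in> sums {t' * XX j | t' j. t' \<in> alg (T ` {1..<n}) \<and> j < n}"
  proof (rule sums_right[OF _ mult.IH(1)[OF mult.prems]])
    fix z assume "z \<in> {t' * XX j | t' j. t' \<in> alg (T ` {1..<n}) \<and> j < n}"
    then obtain t j where z: "z = t * XX j" "t \<in> alg (T ` {1..<n})" "j < n" by blast
    have "t * (XX j * y) \<in> sums {t' * XX j | t' j. t' \<in> alg (T ` {1..<n}) \<and> j < n}"
    proof (rule sums_left[OF _ mult.IH(2)[OF z(3)]])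
      fix w assume "w \<in> {t' * XX j | t' j. t' \<in> alg (T ` {1..<n}) \<and> j < n}"
      then obtain t' j' where w: "w = t' * XX j'" "t' \<in> alg (T ` {1..<n})" "j' < n" by blast
      have "t * w = (t * t') * XX j'" unfolding w by (simp add: mult.assoc)
      then show "t * w \<in> sums {t' * XX j | t' j. t' \<in> alg (T ` {1..<n}) \<and> j < n}"
        using alg.mult[OF z(2) w(2)] w(3) by (intro sums_gen) blast
    qed
    then show "z * y \<in> sums {t' * XX j | t' j. t' \<in> alg (T ` {1..<n}) \<and> j < n}"
      unfolding z by (simp add: mult.assoc)
  qed
  then show ?case by (simp add: mult.assoc)
qed

text \<open>Reduces the sandwich property to type A: each \<open>T\<^sub>0\<close> is turned into Jucys-Murphy elements, which commute
  with \<open>u\<^sup>+\<close> and are collected on its right.\<close>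

lemma H_U_decomp:
  assumes "x \<in> alg (T ` {..<n})"
  shows "x * U s a \<in> sums {t * U s a * p | t p. t \<in> alg (T ` {1..<n}) \<and> p \<in> alg (XX ` {..<n})}"
proof -
  let ?A = "alg (T ` {1..<n})" and ?X = "alg (XX ` {..<n})"
  let ?G = "{t * U s a * p | t p. t \<in> ?A \<and> p \<in> ?X}"
  have G: "t * U s a * p \<in> sums ?G" if "t \<in> ?A" "p \<in> ?X" for t p
    by (rule sums_gen) (use that in blast)
  have "x * z \<in> sums ?G" if "z \<in> sums ?G" for z using assms that
  proof (induction arbitrary: z)
    case (gen x)
    then obtain i where i: "x = T i" "i < n" by auto
    show ?case
    proof (rule sums_left[OF _ gen(2)])
      fix w assume "w \<in> ?G"
      then obtain t p where w: "w = t * U s a * p" "t \<in> ?A" "p \<in> ?X" by blast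
      show "x * w \<in> sums ?G"
      proof (cases "i = 0")
        case False
        have "T i \<in> ?A" using False i by (intro alg.gen) auto
        then show ?thesis using G[OF alg.mult[OF _ w(2)] w(3), of "T i"] i w by (simp add: mult.assoc)
      next
        case True
        have "(XX 0 * t) * (U s a * p) \<in> sums ?G"
        proof (rule sums_right[OF _ XX_times_A[OF w(2)]])
          show "0 < n" using i by simp
          fix v assume "v \<in> {t' * XX j | t' j. t' \<in> ?A \<and> j < n}"
          then obtain t' j where v: "v = t' * XX j" "t' \<in> ?A" "j < n" by blast
          have "v * (U s a * p) = t' * U s a * (XX j * p)"
            unfolding v by (simp only: mult.assoc pre[OF U_commute_XX])
          moreover have "XX j * p \<in> ?X" using v alg.mult[OF alg.gen w(3), of "XX j"] by auto
          ultimately show "v * (U s a * p) \<in> sums ?G" using G[OF v(2)] by simp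
        qed
        then show ?thesis using i True w by (simp add: mult.assoc)
      qed
    qed
  next
    case (sc c)
    show ?case
    proof (rule sums_left[OF _ sc])
      fix w assume "w \<in> ?G"
      then obtain t p where w: "w = t * U s a * p" "t \<in> ?A" "p \<in> ?X" by blast
      show "sc c * w \<in> sums ?G" using G[OF alg.mult[OF alg.sc w(2)] w(3)] w(1) by (simp add: mult.assoc)
    qed
  next
    case (add y z) then show ?case by (simp add: distrib_right sums_add)
  next
    case (mult y z) then show ?case by (simp add: mult.assoc)
  qed
  from this[of "U s a"] show ?thesis using G[OF alg_one alg_one] by simp
qed

lemma sandwich:
  assumes x: "x \<in> alg (T ` {..<n})" and "a \<le> n" "b \<le> n" "n \<le> a + b"
  shows "U r b * x * U s a \<in> Z n b a"
proof -
  have Zp: "z * p \<in> Z n b a" if "p \<in> alg (XX ` {..<n})" "z \<in> Z n b a" for z p using that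
  proof (induction arbitrary: z)
    case (gen p) then show ?case using Z_right assms(4) by auto
  next
    case (sc c)
    then show ?case using Z_left[of "sc c" b n z a] sc_comm[of c z] by (simp add: parabolic_def alg.sc)
  next
    case (add y w) then show ?case by (simp add: distrib_left Z_add)
  next
    case (mult y w) then show ?case by (simp add: mult.assoc[symmetric])
  qed
  have "U r b * (x * U s a) \<in> Z n b a" using H_U_decomp[OF x, of a]
  proof (rule sums_induct_add)
    fix w assume "w \<in> {t * U s a * p | t p. t \<in> alg (T ` {1..<n}) \<and> p \<in> alg (XX ` {..<n})}"
    then obtain t p where w: "w = t * U s a * p" "t \<in> alg (T ` {1..<n})" "p \<in> alg (XX ` {..<n})" by blast
    have "U r b * (P b 0 * t) * U s a \<in> Z n b a"
      by (rule sandwich_prefix) (use w assms in auto)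
    from Zp[OF w(3) this] show "U r b * w \<in> Z n b a" unfolding w by (simp add: mult.assoc)
  qed (auto simp: Z_0 distrib_left intro: Z_add)
  then show ?thesis by (simp add: mult.assoc)
qed

lemma sandwich_zero:
  assumes "x \<in> alg (T ` {..<n})" "a \<le> n" "b \<le> n" "n < a + b"
  shows "U r b * x * U s a = 0"
  using sandwich[OF assms(1-3)] assms(4) by (auto simp: Z_def)

lemma h_mem: "h b a \<in> alg (T ` {..<a + b})"
proof -
  have "U r b \<in> alg (T ` {..<a + b})" "U s a \<in> alg (T ` {..<a + b})" "P b a \<in> alg (T ` {..<a + b})"
    by (rule alg_mono[OF U_mem], force)+ (rule alg_mono[OF P_mem], force)
  then show ?thesis unfolding h_def by (intro alg.mult)
qed

end

lemma (in hecke_ring) h_x_h_same: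
  assumes x: "x \<in> alg (T ` {..<n})" and n: "a + b = n"
  shows "\<exists>y \<in> parabolic b n. h b a * x * h b a = y * h b a"
proof -
  have m: "P b a \<in> alg (T ` {..<n})" "U s a \<in> alg (T ` {..<n})" "U r b \<in> alg (T ` {..<n})"
    by (rule alg_mono[OF P_mem], use n in force) (rule alg_mono[OF U_mem], use n in force)+
  have "U r b * (P b a * U s a * x * U r b * P b a) * U s a \<in> Z n b a"
    by (rule sandwich) (use m x n in \<open>auto intro: alg.mult\<close>)
  moreover have "U r b * (P b a * U s a * x * U r b * P b a) * U s a = h b a * x * h b a"
    unfolding h_def by (simp add: mult.assoc)
  ultimately show ?thesis unfolding Z_def using n by auto
qed

lemma (in hecke_ring) h_x_h_zero:
  assumes x: "x \<in> alg (T ` {..<n})" and n: "a + b = n" "a' + b' = n" "a \<noteq> a'"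
  shows "h b a * x * h b' a' = 0"
proof (cases "a < a'")
  case True
  have m: "P b a \<in> alg (T ` {..<n})" "U s a \<in> alg (T ` {..<n})" "U r b' \<in> alg (T ` {..<n})" "P b' a' \<in> alg (T ` {..<n})"
    by (rule alg_mono[OF P_mem], use n in force) (rule alg_mono[OF U_mem], use n in force,
        rule alg_mono[OF U_mem], use n in force, rule alg_mono[OF P_mem], use n in force)
  have "U r b * (P b a * U s a * x * U r b' * P b' a') * U s a' = 0"
    by (rule sandwich_zero[where n = n]) (use m x n True in \<open>auto intro: alg.mult\<close>)
  then show ?thesis unfolding h_def by (simp add: mult.assoc)
next
  case False
  have "U s a * x * U r b' = 0"
    by (rule hecke_ring.sandwich_zero[OF swapped x]) (use n False in auto)
  then have "U r b * P b a * (U s a * x * U r b') * (P b' a' * U s a') = 0" by simp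
  then show ?thesis unfolding h_def by (simp only: mult.assoc)
qed

context hecke_ring
begin

section \<open>The ideal generated by the elements h\<close>

text \<open>The value at \<open>x\<close> of the monic polynomial with the listed roots.\<close>

fun pr :: "'k list \<Rightarrow> 'a \<Rightarrow> 'a" where
  "pr [] x = 1"
| "pr (\<alpha> # as) x = (x - sc \<alpha>) * pr as x"

lemma comm_sum:
  fixes x y z :: 'a
  shows "x * z = z * x \<Longrightarrow> y * z = z * y \<Longrightarrow> (x + y) * z = z * (x + y)"
  by (simp add: distrib_left distrib_right)

lemma comm_minus:
  fixes x y z :: 'a
  shows "x * z = z * x \<Longrightarrow> y * z = z * y \<Longrightarrow> (x - y) * z = z * (x - y)"
  by (simp add: left_diff_distrib right_diff_distrib)

lemma pr_append: "pr (as @ bs) x = pr as x * pr bs x"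
  by (induction as) (auto simp: mult.assoc)

lemma pr_commute: "z * x = x * z \<Longrightarrow> z * pr as x = pr as x * z"
proof (induction as)
  case (Cons \<alpha> as)
  have "(x - sc \<alpha>) * z = z * (x - sc \<alpha>)"
    using Cons.prems sc_comm[of \<alpha> z] by (simp add: algebra_simps)
  from comm_prod[OF this Cons.IH[OF Cons.prems, symmetric]] show ?case by simp
qed simp

text \<open>A list of candidate eigenvalues for the \<open>l\<close>-th type A Jucys-Murphy element. Adding one strand
  multiplies an eigenvalue by \<open>q\<^sup>2\<close> or by \<open>q\<^sup>-\<^sup>2\<close>, or leaves it unchanged; multiplicities do not matter.\<close>

fun rts :: "nat \<Rightarrow> 'k list" where
  "rts 0 = [1]"
| "rts (Suc l) = rts l @ concat (map (\<lambda>\<alpha>. [q\<^sup>2 * \<alpha>, inverse q ^ 2 * \<alpha>]) (rts l))"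

lemma rts_powi: "\<alpha> \<in> set (rts l) \<Longrightarrow> \<exists>j. \<bar>j\<bar> \<le> int l \<and> \<alpha> = q powi (2 * j)"
proof (induction l arbitrary: \<alpha>)
  case (Suc l)
  then consider "\<alpha> \<in> set (rts l)" | \<beta> where "\<beta> \<in> set (rts l)" "\<alpha> = q\<^sup>2 * \<beta> \<or> \<alpha> = inverse q ^ 2 * \<beta>" by auto
  then show ?case
  proof cases
    case 1 from Suc.IH[OF this] show ?thesis by force
  next
    case 2
    then obtain j where j: "\<bar>j\<bar> \<le> int l" "\<beta> = q powi (2 * j)" using Suc.IH by blast
    have "q\<^sup>2 * \<beta> = q powi (2 * (j + 1))" "inverse q ^ 2 * \<beta> = q powi (2 * (j - 1))"
      using q0 j by (auto simp: power_int_add power_int_diff distrib_left right_diff_distrib field_simps)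
    moreover have "\<bar>j + 1\<bar> \<le> int (Suc l)" "\<bar>j - 1\<bar> \<le> int (Suc l)" using j by auto
    ultimately show ?thesis using 2(2) by blast
  qed
qed (auto intro: exI[of _ 0])

text \<open>
  In an affine Hecke algebra on two strands, \<open>\<phi> = t (X - Y) + \<kappa> Y\<close> intertwines \<open>X\<close> and \<open>Y\<close>, and
  \<open>\<phi>\<^sup>2 = -(X - q\<^sup>2 Y) (X - q\<^sup>-\<^sup>2 Y)\<close>. Where \<open>X\<close> has eigenvalue \<open>\<alpha>\<close>, either \<open>\<phi>\<close> vanishes, so that \<open>Y\<close> has eigenvalue
  \<open>q\<^sup>2 \<alpha>\<close> or \<open>q\<^sup>-\<^sup>2 \<alpha>\<close>, or \<open>\<phi>\<close> transports an eigenvector, so that \<open>\<alpha>\<close> is an eigenvalue of \<open>Y\<close>. The proof is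
  this argument for polynomials in \<open>X\<close> and \<open>Y\<close> in place of eigenvectors.
\<close>

lemma pr_double:
  assumes tt: "t * t = sc kap * t + 1" and Y: "Y = t * X * t" and XY: "X * Y = Y * X"
    and X0: "pr as X = 0"
  shows "pr (as @ concat (map (\<lambda>\<alpha>. [q\<^sup>2 * \<alpha>, inverse q ^ 2 * \<alpha>]) as)) Y = 0"
proof -
  define k where "k = sc kap"
  have k: "k * z = z * k" for z unfolding k_def by (rule sc_comm)
  have kl: "x * (k * z) = k * (x * z)" for x z unfolding k_def by (rule sc_out)
  have tY: "t * Y = X * t + k * Y"
  proof -
    have "t * Y = (t * t) * (X * t)" unfolding Y by (simp add: mult.assoc)
    then show ?thesis unfolding tt k_def[symmetric] Y by (simp add: algebra_simps)
  qed
  have Yt: "Y * t = t * X + k * Y"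
  proof -
    have "Y * t = t * X * (t * t)" unfolding Y by (simp add: mult.assoc)
    then show ?thesis unfolding tt k_def[symmetric] Y by (simp add: algebra_simps kl)
  qed
  define \<phi> where "\<phi> = t * (X - Y) + k * Y"
  have X\<phi>: "X * \<phi> = \<phi> * Y"
  proof -
    have "X * \<phi> = (X * t) * (X - Y) + k * (X * Y)" unfolding \<phi>_def by (simp add: distrib_left kl mult.assoc)
    also have "X * t = t * Y - k * Y" using tY by simp
    also have "(t * Y - k * Y) * (X - Y) + k * (X * Y) = \<phi> * Y"
      unfolding \<phi>_def using XY by (simp add: algebra_simps)
    finally show ?thesis .
  qed
  have Y\<phi>: "Y * \<phi> = \<phi> * X"
  proof -
    have "Y * \<phi> = (Y * t) * (X - Y) + k * (Y * Y)" unfolding \<phi>_def by (simp add: distrib_left kl mult.assoc)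
    also have "\<dots> = \<phi> * X" unfolding Yt \<phi>_def using XY by (simp add: algebra_simps)
    finally show ?thesis .
  qed
  have t\<phi>: "t * \<phi> = k * (t * X) + X - Y"
  proof -
    have "t * \<phi> = (t * t) * (X - Y) + k * (t * Y)" unfolding \<phi>_def by (simp add: distrib_left kl mult.assoc)
    then show ?thesis unfolding tt k_def[symmetric] by (simp add: algebra_simps)
  qed
  have \<phi>\<phi>: "\<phi> * \<phi> = k * k * (X * Y) - (X - Y) * (X - Y)"
  proof -
    have "\<phi> * \<phi> = t * (X * \<phi> - Y * \<phi>) + k * (Y * \<phi>)"
      by (subst (1) \<phi>_def) (simp add: algebra_simps)
    also have "\<dots> = (t * \<phi>) * (Y - X) + k * (\<phi> * X)"
      unfolding X\<phi> Y\<phi> by (simp add: algebra_simps)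
    also have "\<dots> = (k * (t * X) + X - Y) * (Y - X) + k * ((t * (X - Y) + k * Y) * X)"
      unfolding t\<phi> by (simp add: \<phi>_def)
    also have "\<dots> = k * k * (X * Y) - (X - Y) * (X - Y)"
      using XY by (simp add: algebra_simps)
    finally show ?thesis .
  qed
  define c where "c = q\<^sup>2 + inverse q ^ 2"
  have kk: "k * k = sc c - 1 - 1"
  proof -
    have "kap * kap = c - 1 - 1" unfolding c_def using q0 by (simp add: field_simps power2_eq_square)
    moreover have "sc (c - 1 - 1) = sc c - 1 - 1" by (simp only: sc_diff sc_1)
    ultimately show ?thesis unfolding k_def by (metis sc_mult)
  qed
  define g where "g = X * X - sc c * (X * Y) + Y * Y"
  have \<phi>g: "\<phi> * \<phi> = - g"
    unfolding \<phi>\<phi> kk g_def using XY by (simp add: algebra_simps mult_2)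
  have "pr bs X * \<phi> = \<phi> * pr bs Y" for bs
  proof (induction bs)
    case (Cons \<beta> bs)
    have step: "(X - sc \<beta>) * \<phi> = \<phi> * (Y - sc \<beta>)"
      using X\<phi> sc_comm[of \<beta> \<phi>] by (simp add: algebra_simps)
    show ?case using Cons by (simp add: mult.assoc pre[OF step])
  qed simp
  then have "\<phi> * pr as Y = 0" using X0 by (metis mult_zero_left)
  then have "(\<phi> * \<phi>) * pr as Y = 0" by (simp add: mult.assoc)
  then have g0: "g * pr as Y = 0" unfolding \<phi>g by simp
  have gcom: "g * w = w * g" if "X * w = w * X" "Y * w = w * Y" for w
    unfolding g_def by (intro comm_sum comm_minus comm_prod sc_comm that)
  (* once g annihilates z, every root of X on z splits into the two roots of
     (Y - q^2 alpha) (Y - q^-2 alpha), which differs from g by a multiple of X - alpha *)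
  have elim: "pr (concat (map (\<lambda>\<alpha>. [q\<^sup>2 * \<alpha>, inverse q ^ 2 * \<alpha>]) bs)) Y * z = 0"
    if "X * z = z * X" "Y * z = z * Y" "g * z = 0" "pr bs X * z = 0" for bs z
    using that
  proof (induction bs arbitrary: z)
    case (Cons \<alpha> bs)
    let ?e = "(Y - sc (q\<^sup>2 * \<alpha>)) * (Y - sc (inverse q ^ 2 * \<alpha>))"
    let ?u = "X + sc \<alpha> - sc c * Y"
    have cm: "Y * (sc x * w) = sc x * (Y * w)" "X * (sc x * w) = sc x * (X * w)"
      "Y * sc x = sc x * Y" "X * sc x = sc x * X" for x w
      by (rule sc_out sc_comm[symmetric])+
    have "sc (q\<^sup>2 * \<alpha>) * sc (inverse q ^ 2 * \<alpha>) = sc \<alpha> * sc \<alpha>"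
      unfolding sc_mult[symmetric] using q0 by (simp add: field_simps)
    moreover have "sc (q\<^sup>2 * \<alpha>) + sc (inverse q ^ 2 * \<alpha>) = sc c * sc \<alpha>"
      unfolding sc_mult[symmetric] sc_add[symmetric] c_def by (simp add: algebra_simps)
    moreover have "?e = Y * Y - (sc (q\<^sup>2 * \<alpha>) + sc (inverse q ^ 2 * \<alpha>)) * Y + sc (q\<^sup>2 * \<alpha>) * sc (inverse q ^ 2 * \<alpha>)"
      by (simp add: algebra_simps cm)
    ultimately have e: "?e = Y * Y - sc c * sc \<alpha> * Y + sc \<alpha> * sc \<alpha>" by simp
    have "(X - sc \<alpha>) * ?u = X * X - sc \<alpha> * sc \<alpha> - sc c * (X * Y) + sc \<alpha> * (sc c * Y)"
      by (simp add: algebra_simps cm)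
    moreover have "sc \<alpha> * (sc c * Y) = sc c * sc \<alpha> * Y"
      using sc_comm[of c "sc \<alpha>"] by (simp add: mult.assoc[symmetric])
    ultimately have ge: "?e = g - (X - sc \<alpha>) * ?u" unfolding e g_def by simp
    define z' where "z' = ?e * z"
    have z': "z' = - ((X - sc \<alpha>) * (?u * z))"
      unfolding z'_def ge using Cons.prems(3) by (simp add: left_diff_distrib mult.assoc)
    have Xe: "X * ?e = ?e * X" "Y * ?e = ?e * Y"
      using XY by (intro comm_prod[symmetric]; simp add: algebra_simps cm)+
    note Xe = Xe gcom[OF Xe]
    have uX: "?u * X = X * ?u" using XY by (simp add: algebra_simps cm)
    have prX: "pr bs X * X = X * pr bs X" by (rule pr_commute[symmetric, OF refl])
    have "pr (concat (map (\<lambda>\<alpha>. [q\<^sup>2 * \<alpha>, inverse q ^ 2 * \<alpha>]) bs)) Y * z' = 0"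
    proof (rule Cons.IH)
      show "X * z' = z' * X" "Y * z' = z' * Y" unfolding z'_def
        using comm_prod[of ?e X z] comm_prod[of ?e Y z] Xe Cons.prems by simp_all
      show "g * z' = 0" unfolding z'_def using pre[OF Xe(3)] Cons.prems(3) by simp
      have "pr bs X * (X - sc \<alpha>) = (X - sc \<alpha>) * pr bs X"
        using prX sc_comm[of \<alpha> "pr bs X"] by (simp add: algebra_simps)
      then have "pr bs X * z' = - ((X - sc \<alpha>) * pr bs X * (?u * z))"
        unfolding z' by (simp add: mult.assoc[symmetric])
      also have "\<dots> = - (?u * (((X - sc \<alpha>) * pr bs X) * z))"
      proof -
        have "?u * ((X - sc \<alpha>) * pr bs X) = ((X - sc \<alpha>) * pr bs X) * ?u"
          using pr_commute[of ?u X "\<alpha> # bs"] uX by simp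
        then show ?thesis by (metis mult.assoc)
      qed
      also have "\<dots> = 0" using Cons.prems(4) by simp
      finally show "pr bs X * z' = 0" .
    qed
    moreover have "?e * pr (concat (map (\<lambda>\<alpha>. [q\<^sup>2 * \<alpha>, inverse q ^ 2 * \<alpha>]) bs)) Y
        = pr (concat (map (\<lambda>\<alpha>. [q\<^sup>2 * \<alpha>, inverse q ^ 2 * \<alpha>]) bs)) Y * ?e"
      by (rule pr_commute) (use Xe(2) in simp)
    moreover have "pr (concat (map (\<lambda>\<alpha>. [q\<^sup>2 * \<alpha>, inverse q ^ 2 * \<alpha>]) (\<alpha> # bs))) Y
        = ?e * pr (concat (map (\<lambda>\<alpha>. [q\<^sup>2 * \<alpha>, inverse q ^ 2 * \<alpha>]) bs)) Y"
      by (simp add: mult.assoc)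
    ultimately show ?case unfolding z'_def by (simp add: mult.assoc)
  qed simp
  have "pr (concat (map (\<lambda>\<alpha>. [q\<^sup>2 * \<alpha>, inverse q ^ 2 * \<alpha>]) as)) Y * pr as Y = 0"
    by (rule elim) (use pr_commute[of X Y as] pr_commute[of Y Y as] XY g0 X0 in auto)
  then show ?thesis unfolding pr_append using pr_commute[of "pr as Y" Y] pr_commute[of Y Y as]
    by metis
qed

text \<open>The type A elements are type B Jucys-Murphy elements for the trivial choice \<open>T\<^sub>0 = 1\<close>.\<close>

lemma J_commute: assumes "1 \<le> m" shows "J m k * J m l = J m l * J m k"
proof -
  obtain m' where m: "m = Suc m'" using assms by (cases m) auto
  interpret A: hecke_ring sc "\<lambda>i. if i = 0 then 1 else T (m' + i)" q 1 1
  proof (unfold_locales, goal_cases)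
    case (6 i) then show ?case using braid[of "m' + i"] by simp
  next
    case (8 i j) then show ?case using far[of "m' + i" "m' + j"] by simp
  next
    case (9 i) then show ?case using quad[of "m' + i"] by simp
  qed (rule sc_add sc_mult sc_1 sc_comm q0 | simp add: sc_1)+
  have "A.XX l = J m l" for l by (induction l) (auto simp: m)
  then show ?thesis using A.XX_commute by metis
qed

lemma pr_J: assumes "1 \<le> m" shows "pr (rts l) (J m l) = 0"
proof (induction l)
  case 0 then show ?case by (simp add: sc_1)
next
  case (Suc l)
  show ?case unfolding rts.simps
    by (rule pr_double[OF quad _ J_commute Suc, of "m + l"]) (use assms in auto)
qed

text \<open>The two-sided ideal generated by all elements \<open>h\<close> on \<open>n\<close> strands.\<close>

definition "full n = sums {x * h b a * y | x y a b. a + b = n \<and> x \<in> alg (T ` {..<n}) \<and> y \<in> alg (T ` {..<n})}"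

lemma full_left: assumes "g \<in> alg (T ` {..<n})" "z \<in> full n" shows "g * z \<in> full n"
  unfolding full_def
proof (rule sums_left[OF _ assms(2)[unfolded full_def]])
  fix w assume "w \<in> {x * h b a * y | x y a b. a + b = n \<and> x \<in> alg (T ` {..<n}) \<and> y \<in> alg (T ` {..<n})}"
  then obtain x y a b where w: "w = x * h b a * y" "a + b = n" "x \<in> alg (T ` {..<n})" "y \<in> alg (T ` {..<n})"
    by blast
  have "g * w = (g * x) * h b a * y" unfolding w by (simp add: mult.assoc)
  then show "g * w \<in> sums {x * h b a * y | x y a b. a + b = n \<and> x \<in> alg (T ` {..<n}) \<and> y \<in> alg (T ` {..<n})}"
    using w alg.mult[OF assms(1) w(3)] by (intro sums_gen) blast
qed

lemma full_right: assumes "g \<in> alg (T ` {..<n})" "z \<in> full n" shows "z * g \<in> full n"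
  unfolding full_def
proof (rule sums_right[OF _ assms(2)[unfolded full_def]])
  fix w assume "w \<in> {x * h b a * y | x y a b. a + b = n \<and> x \<in> alg (T ` {..<n}) \<and> y \<in> alg (T ` {..<n})}"
  then obtain x y a b where w: "w = x * h b a * y" "a + b = n" "x \<in> alg (T ` {..<n})" "y \<in> alg (T ` {..<n})"
    by blast
  have "w * g = x * h b a * (y * g)" unfolding w by (simp add: mult.assoc)
  then show "w * g \<in> sums {x * h b a * y | x y a b. a + b = n \<and> x \<in> alg (T ` {..<n}) \<and> y \<in> alg (T ` {..<n})}"
    using w alg.mult[OF w(4) assms(1)] by (intro sums_gen) blast
qed

lemma full_add: "x \<in> full n \<Longrightarrow> y \<in> full n \<Longrightarrow> x + y \<in> full n"
  unfolding full_def by (rule sums_add)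

lemma full_diff: "x \<in> full n \<Longrightarrow> y \<in> full n \<Longrightarrow> x - y \<in> full n"
  using full_add[of x n "- y"] full_left[of "- 1" n y] alg_uminus[OF alg_one] by simp

lemma full_unscale: assumes "sc c * x \<in> full n" "c \<noteq> 0" shows "x \<in> full n"
proof -
  have "sc (inverse c) * (sc c * x) \<in> full n" by (rule full_left[OF alg.sc assms(1)])
  then show ?thesis using assms(2) by (simp add: mult.assoc[symmetric] sc_mult[symmetric] sc_1)
qed

lemma pr_mem: "x \<in> alg G \<Longrightarrow> pr as x \<in> alg G"
  by (induction as) (auto intro: alg_one alg.mult alg_diff alg.sc)

lemma telescope:
  fixes a m u v w :: 'a
  shows "a - m * (u - w) + m * (u - v) = a - m * (v - w)"
  by (simp add: right_diff_distrib)

text \<open>Since \<open>X\<close> commutes with \<open>y\<close>, a factor \<open>X - c \<alpha>\<close> can be moved next to \<open>y\<close>, where modulo the ideal it acts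
  as \<open>c (L - \<alpha>)\<close>. So polynomial relations of \<open>L\<close> become relations of \<open>X\<close> on \<open>y\<close>, with roots scaled by \<open>c\<close>.\<close>

lemma full_eigenvalue_right:
  assumes X: "X * y = y * X" "X \<in> alg (T ` {..<n})" and L: "L \<in> alg (T ` {..<n})"
    and e: "y * X - sc c * (y * L) \<in> full n"
  shows "y * pr (map ((*) c) as) X - sc (c ^ length as) * (y * pr as L) \<in> full n"
proof (induction as)
  case Nil then show ?case using full_left[OF alg.sc[of 0] e] by (simp add: sc_0 sc_1)
next
  case (Cons \<alpha> as)
  let ?p = "pr (map ((*) c) as) X" and ?l = "pr as L" and ?s = "sc (c ^ length as)" and ?t = "sc (c * \<alpha>)"
  have "(X - ?t) * (y * ?p - ?s * (y * ?l)) + ?s * ((y * X - sc c * (y * L)) * ?l) \<in> full n"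
    by (rule full_add[OF full_left[OF alg_diff[OF X(2) alg.sc] Cons] full_left[OF alg.sc full_right[OF pr_mem[OF L] e]]])
  moreover have "(X - ?t) * (y * ?p - ?s * (y * ?l)) + ?s * ((y * X - sc c * (y * L)) * ?l)
      = y * ((X - ?t) * ?p) - ?s * (y * (X * ?l) - ?t * (y * ?l)) + ?s * (y * (X * ?l) - sc c * (y * (L * ?l)))"
  proof -
    have "(X - ?t) * (y * ?p) = y * ((X - ?t) * ?p)"
      unfolding left_diff_distrib right_diff_distrib by (simp only: pre[OF X(1)] sc_out)
    moreover have "(X - ?t) * (y * ?l) = y * (X * ?l) - ?t * (y * ?l)"
      by (simp only: left_diff_distrib pre[OF X(1)])
    then have "(X - ?t) * (?s * (y * ?l)) = ?s * (y * (X * ?l) - ?t * (y * ?l))"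
      by (simp only: sc_out[of "X - ?t" "c ^ length as"])
    moreover have "(y * X - sc c * (y * L)) * ?l = y * (X * ?l) - sc c * (y * (L * ?l))"
      by (simp only: left_diff_distrib mult.assoc)
    ultimately show ?thesis by (simp only: right_diff_distrib[of "X - ?t"])
  qed
  moreover have "sc (c ^ length (\<alpha> # as)) * (y * pr (\<alpha> # as) L) = ?s * (sc c * (y * (L * ?l)) - ?t * (y * ?l))"
    by (simp only: pr.simps left_diff_distrib right_diff_distrib sc_out[of y] list.size power_Suc2 sc_mult
        add_Suc_right add_0_right mult.assoc)
  ultimately show ?case by (simp only: telescope pr.simps list.map)
qed

lemma full_eigenvalue_left:
  assumes X: "X * y = y * X" "X \<in> alg (T ` {..<n})" and L: "L \<in> alg (T ` {..<n})"
    and e: "y * X - sc c * (L * y) \<in> full n"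
  shows "y * pr (map ((*) c) as) X - sc (c ^ length as) * (pr as L * y) \<in> full n"
proof (induction as)
  case Nil then show ?case using full_left[OF alg.sc[of 0] e] by (simp add: sc_0 sc_1)
next
  case (Cons \<alpha> as)
  let ?p = "pr (map ((*) c) as) X" and ?l = "pr as L" and ?s = "sc (c ^ length as)" and ?t = "sc (c * \<alpha>)"
  have "(y * ?p - ?s * (?l * y)) * (X - ?t) + ?s * (?l * (y * X - sc c * (L * y))) \<in> full n"
    by (rule full_add[OF full_right[OF alg_diff[OF X(2) alg.sc] Cons] full_left[OF alg.sc full_left[OF pr_mem[OF L] e]]])
  moreover have "(y * ?p - ?s * (?l * y)) * (X - ?t) + ?s * (?l * (y * X - sc c * (L * y)))
      = y * ((X - ?t) * ?p) - ?s * (?l * (y * X) - ?t * (?l * y)) + ?s * (?l * (y * X) - sc c * (?l * (L * y)))"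
  proof -
    have "y * ?p * (X - ?t) = y * ((X - ?t) * ?p)"
      using pr_commute[of X X "map ((*) c) as"] sc_comm[of "c * \<alpha>" ?p]
      by (simp only: left_diff_distrib right_diff_distrib mult.assoc)
    moreover have "?s * (?l * y) * (X - ?t) = ?s * (?l * (y * X) - ?t * (?l * y))"
      using sc_comm[of "c * \<alpha>" "?l * y"] by (simp only: right_diff_distrib mult.assoc)
    moreover have "?l * (sc c * (L * y)) = sc c * (?l * (L * y))" by (rule sc_out)
    ultimately show ?thesis
      by (simp only: left_diff_distrib[of _ _ "X - ?t"] right_diff_distrib[of ?l])
  qed
  moreover have "?l * (L * z) = L * (?l * z)" for z
    by (rule pre[OF pr_commute[symmetric, OF refl]])
  then have "sc (c ^ length (\<alpha> # as)) * (pr (\<alpha> # as) L * y) = ?s * (sc c * (?l * (L * y)) - ?t * (?l * y))"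
    by (simp only: pr.simps left_diff_distrib right_diff_distrib list.size power_Suc2 sc_mult
        add_Suc_right add_0_right mult.assoc)
  ultimately show ?case by (simp only: telescope pr.simps list.map)
qed

text \<open>Two polynomials without a common root generate the unit ideal. The induction removes one root of one
  polynomial by comparing it with all roots of the other, so no polynomial arithmetic is involved.\<close>

lemma full_coprime:
  assumes "y * pr as X \<in> full n" "y * pr bs X \<in> full n" "X * y = y * X" "X \<in> alg (T ` {..<n})"
    and "\<And>\<alpha> \<beta>. \<alpha> \<in> set as \<Longrightarrow> \<beta> \<in> set bs \<Longrightarrow> \<alpha> \<noteq> \<beta>"
  shows "y \<in> full n"
  using assms
proof (induction as arbitrary: y)
  case (Cons \<alpha> as)
  have com: "X * (y * (X - sc \<alpha>)) = y * (X - sc \<alpha>) * X"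
    using Cons.prems(3) sc_comm[of \<alpha> X] pre[OF Cons.prems(3)] by (simp add: algebra_simps)
  have "(X - sc \<alpha>) * (y * pr bs X) = y * (X - sc \<alpha>) * pr bs X"
    using pre[OF Cons.prems(3)] sc_out[of y \<alpha> "pr bs X"] by (simp add: left_diff_distrib right_diff_distrib mult.assoc)
  then have "y * (X - sc \<alpha>) * pr bs X \<in> full n"
    using full_left[OF alg_diff[OF Cons.prems(4) alg.sc] Cons.prems(2)] by metis
  then have 1: "y * (X - sc \<alpha>) \<in> full n"
    using Cons.IH[OF _ _ com Cons.prems(4)] Cons.prems by (simp add: mult.assoc)
  have "\<alpha> \<notin> set bs" using Cons.prems(5)[of \<alpha> \<alpha>] by auto
  with Cons.prems(2) show "y \<in> full n"
  proof (induction bs)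
    case (Cons \<beta> bs)
    have "y * (X - sc \<alpha>) * pr bs X \<in> full n" by (rule full_right[OF pr_mem[OF assms(4)] 1])
    from full_diff[OF this Cons.prems(1)] have "sc (\<beta> - \<alpha>) * (y * pr bs X) \<in> full n"
      using sc_out[of y \<alpha> "pr bs X"] sc_out[of y \<beta> "pr bs X"] by (simp add: algebra_simps sc_diff)
    then have "y * pr bs X \<in> full n" by (rule full_unscale) (use Cons.prems in auto)
    then show ?case using Cons by auto
  qed simp
qed simp

text \<open>
  Downward induction on \<open>k = a + b\<close> shows that \<open>h b a\<close> lies in the ideal; for \<open>k = n\<close> it is a generator
  and for \<open>k = 0\<close> it is \<open>1\<close>. The elements \<open>h b (a + 1)\<close> and \<open>h (b + 1) a\<close> are in the ideal by the induction hypothesis.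
  The first says that \<open>X\<^sub>k\<close> acts on \<open>y = h b a\<close> like \<open>s\<close> times a type A Jucys-Murphy element, the second
  that it acts like \<open>r\<close> times another one. So \<open>y\<close> is annihilated by a polynomial in \<open>X\<^sub>k\<close> with roots
  \<open>s q\<^sup>2\<^sup>i\<close> and by one with roots \<open>r q\<^sup>2\<^sup>j\<close>, where \<open>\<bar>i\<bar> \<le> b\<close> and \<open>\<bar>j\<bar> \<le> a\<close>.
\<close>

lemma one_in_full:
  assumes sep: "\<And>i j. \<bar>i\<bar> + \<bar>j\<bar> < int n \<Longrightarrow> s * q powi (2 * i) \<noteq> r * q powi (2 * j)"
  shows "1 \<in> full n"
proof -
  have "a + b = k \<Longrightarrow> h b a \<in> full n" if "k \<le> n" for k a b using that
  proof (induction k arbitrary: a b rule: inc_induct)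
    case base
    have "1 * h b a * 1 \<in> full n" unfolding full_def
      by (rule sums_gen) (use base alg_one in blast)
    then show ?case by simp
  next
    case (step k)
    let ?H = "alg (T ` {..<n})" and ?y = "h b a" and ?X = "XX k"
    have X: "?X \<in> ?H" by (rule alg_mono[OF XX_mem]) (use step in auto)
    have A: "A (Suc i) j \<in> ?H" and D: "D (Suc i) j \<in> ?H" if "i + j = k" for i j
      by (rule alg_mono[OF A_mem] alg_mono[OF D_mem], use that step in force)+
    have J: "J (Suc i) j \<in> ?H" if "i + j = k" for i j
      unfolding J_eq using A D that by (intro alg.mult) auto
    have XK: "?X * ?y = ?y * ?X" using h_mem[of b a] step.prems by (intro XX_commute_low) simp
    have "D (Suc a) b \<in> alg (T ` ({1..<a} \<union> {Suc a..}))" by (rule alg_mono[OF D_mem]) auto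
    from U_commute_A[OF this] have uD: "U s a * D (Suc a) b = D (Suc a) b * U s a" .
    have "?y * D (Suc a) b * (XX a - sc s) = h b (Suc a)"
      unfolding h_def P.simps U.simps by (simp only: mult.assoc pre[OF uD])
    then have "?y * D (Suc a) b * (XX a - sc s) * A (Suc a) b \<in> full n"
      using step.prems step.IH[of "Suc a" b] by (simp add: full_right A)
    moreover have "?y * D (Suc a) b * (XX a - sc s) * A (Suc a) b = ?y * ?X - sc s * (?y * J (Suc a) b)"
    proof -
      have "?y * D (Suc a) b * (XX a - sc s) * A (Suc a) b
          = ?y * (D (Suc a) b * XX a * A (Suc a) b) - ?y * (D (Suc a) b * (sc s * A (Suc a) b))"
        by (simp only: left_diff_distrib right_diff_distrib mult.assoc)
      then show ?thesis using XX_split[of a b] step.prems by (simp only: sc_out J_eq)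
    qed
    ultimately have e1: "?y * ?X - sc s * (?y * J (Suc a) b) \<in> full n" by simp
    have "A (Suc b) a \<in> alg (T ` ({1..<b} \<union> {Suc b..}))" by (rule alg_mono[OF A_mem]) auto
    from U_commute_A[OF this] have uA: "U r b * A (Suc b) a = A (Suc b) a * U r b" .
    have uX: "(XX b - sc r) * U r b = U r b * (XX b - sc r)"
      using U_commute_XX[of r b b] sc_comm[of r "U r b"] by (simp add: algebra_simps)
    have "(XX b - sc r) * (A (Suc b) a * ?y) = h (Suc b) a"
      unfolding h_def P_Suc_left U.simps
      by (simp only: mult.assoc pre[OF uA[symmetric]] pre[OF uX])
    then have "D (Suc b) a * ((XX b - sc r) * (A (Suc b) a * ?y)) \<in> full n"
      using step.prems step.IH[of a "Suc b"] by (simp add: full_left D)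
    moreover have "D (Suc b) a * ((XX b - sc r) * (A (Suc b) a * ?y)) = ?y * ?X - sc r * (J (Suc b) a * ?y)"
    proof -
      have "D (Suc b) a * ((XX b - sc r) * (A (Suc b) a * ?y))
          = (D (Suc b) a * XX b * A (Suc b) a) * ?y - D (Suc b) a * (sc r * (A (Suc b) a * ?y))"
        by (simp only: left_diff_distrib right_diff_distrib mult.assoc)
      then show ?thesis using XX_split[of b a] step.prems XK
        by (simp only: sc_out J_eq mult.assoc add.commute[of b a])
    qed
    ultimately have e2: "?y * ?X - sc r * (J (Suc b) a * ?y) \<in> full n" by simp
    have "?y * pr (map ((*) s) (rts b)) ?X \<in> full n"
      using full_eigenvalue_right[OF XK X J e1, of "rts b"] step.prems by (simp add: pr_J)
    moreover have "?y * pr (map ((*) r) (rts a)) ?X \<in> full n"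
      using full_eigenvalue_left[OF XK X J e2, of "rts a"] step.prems by (simp add: pr_J)
    moreover have "\<alpha> \<noteq> \<beta>" if mem: "\<alpha> \<in> set (map ((*) s) (rts b))" "\<beta> \<in> set (map ((*) r) (rts a))" for \<alpha> \<beta>
    proof -
      obtain \<alpha>' \<beta>' where ab: "\<alpha> = s * \<alpha>'" "\<beta> = r * \<beta>'" "\<alpha>' \<in> set (rts b)" "\<beta>' \<in> set (rts a)"
        using mem by auto
      obtain i j where "\<bar>i\<bar> \<le> int b" "\<alpha>' = q powi (2 * i)" "\<bar>j\<bar> \<le> int a" "\<beta>' = q powi (2 * j)"
        using rts_powi[OF ab(3)] rts_powi[OF ab(4)] by auto
      then show ?thesis using sep[of i j] step ab by auto
    qed
    ultimately show ?case by (rule full_coprime[OF _ _ XK X])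
  qed
  from this[of 0 0 0] show ?thesis by (simp add: h_def)
qed

end

section \<open>Linear operators\<close>

text \<open>Operators on functions form a ring in which \<open>x * y\<close> means first \<open>x\<close>, then \<open>y\<close>, so that application is a
  right action and the results on \<open>hecke_ring\<close> can be instantiated.\<close>

typedef (overloaded) ('b, 'k::field) linop =
  "{f :: ('b \<Rightarrow> 'k) \<Rightarrow> 'b \<Rightarrow> 'k.
     (\<forall>u v. f (\<lambda>w. u w + v w) = (\<lambda>w. f u w + f v w)) \<and> (\<forall>c u. f (\<lambda>w. c * u w) = (\<lambda>w. c * f u w))}"
  by (rule exI[of _ "\<lambda>v. v"]) simp

definition app :: "('b \<Rightarrow> 'k::field) \<Rightarrow> ('b, 'k) linop \<Rightarrow> 'b \<Rightarrow> 'k" (infixl "\<lhd>\<^sub>L" 75) where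
  "v \<lhd>\<^sub>L x = Rep_linop x v"

lemma app_add: "(\<lambda>w. u w + v w) \<lhd>\<^sub>L x = (\<lambda>w. (u \<lhd>\<^sub>L x) w + (v \<lhd>\<^sub>L x) w)"
  using Rep_linop[of x] by (simp add: app_def)

lemma app_scale: "(\<lambda>w. c * u w) \<lhd>\<^sub>L x = (\<lambda>w. c * (u \<lhd>\<^sub>L x) w)"
  using Rep_linop[of x] by (simp add: app_def)

lemma app_zero: "(\<lambda>w. 0) \<lhd>\<^sub>L x = (\<lambda>w. 0)"
  using app_scale[of 0 "\<lambda>w. 0" x] by simp

lemma linop_eqI: "(\<And>v w. (v \<lhd>\<^sub>L x) w = (v \<lhd>\<^sub>L y) w) \<Longrightarrow> x = y"
  unfolding app_def by (intro Rep_linop_inject[THEN iffD1] ext)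

instantiation linop :: (type, field) ring_1
begin

definition "0 = Abs_linop (\<lambda>v w. 0)"
definition "1 = Abs_linop (\<lambda>v. v)"
definition "x + y = Abs_linop (\<lambda>v w. (v \<lhd>\<^sub>L x) w + (v \<lhd>\<^sub>L y) w)"
definition "x - y = Abs_linop (\<lambda>v w. (v \<lhd>\<^sub>L x) w - (v \<lhd>\<^sub>L y) w)"
definition "- x = Abs_linop (\<lambda>v w. - (v \<lhd>\<^sub>L x) w)"
definition "x * y = Abs_linop (\<lambda>v. v \<lhd>\<^sub>L x \<lhd>\<^sub>L y)"

lemma app_simps [simp]:
  "v \<lhd>\<^sub>L 0 = (\<lambda>w. 0)"
  "v \<lhd>\<^sub>L 1 = v"
  "v \<lhd>\<^sub>L (x + y) = (\<lambda>w. (v \<lhd>\<^sub>L x) w + (v \<lhd>\<^sub>L y) w)"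
  "v \<lhd>\<^sub>L (x - y) = (\<lambda>w. (v \<lhd>\<^sub>L x) w - (v \<lhd>\<^sub>L y) w)"
  "v \<lhd>\<^sub>L (- x) = (\<lambda>w. - (v \<lhd>\<^sub>L x) w)"
  "v \<lhd>\<^sub>L (x * y) = v \<lhd>\<^sub>L x \<lhd>\<^sub>L y"
proof -
  show "v \<lhd>\<^sub>L 0 = (\<lambda>w. 0)" unfolding zero_linop_def
    by (subst app_def, subst Abs_linop_inverse) auto
  show "v \<lhd>\<^sub>L 1 = v" unfolding one_linop_def
    by (subst app_def, subst Abs_linop_inverse) auto
  show "v \<lhd>\<^sub>L (x + y) = (\<lambda>w. (v \<lhd>\<^sub>L x) w + (v \<lhd>\<^sub>L y) w)" unfolding plus_linop_def
    by (subst app_def, subst Abs_linop_inverse) (auto simp: app_add app_scale algebra_simps)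
  show "v \<lhd>\<^sub>L (x - y) = (\<lambda>w. (v \<lhd>\<^sub>L x) w - (v \<lhd>\<^sub>L y) w)" unfolding minus_linop_def
    by (subst app_def, subst Abs_linop_inverse) (auto simp: app_add app_scale algebra_simps)
  show "v \<lhd>\<^sub>L (- x) = (\<lambda>w. - (v \<lhd>\<^sub>L x) w)" unfolding uminus_linop_def
    by (subst app_def, subst Abs_linop_inverse) (auto simp: app_add app_scale algebra_simps)
  show "v \<lhd>\<^sub>L (x * y) = v \<lhd>\<^sub>L x \<lhd>\<^sub>L y" unfolding times_linop_def
    by (subst app_def, subst Abs_linop_inverse) (auto simp: app_add app_scale)
qed

instance
proof
  show "(0::('a, 'b) linop) \<noteq> 1"
  proof
    assume "(0::('a, 'b) linop) = 1"
    then have "(\<lambda>w. 1) \<lhd>\<^sub>L (0::('a, 'b) linop) = (\<lambda>w. 1) \<lhd>\<^sub>L 1" by simp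
    then show False by (simp add: fun_eq_iff)
  qed
qed (rule linop_eqI; simp add: app_add)+

end

definition scal :: "'k::field \<Rightarrow> ('b, 'k) linop" where
  "scal c = Abs_linop (\<lambda>v w. c * v w)"

lemma app_scal [simp]: "v \<lhd>\<^sub>L scal c = (\<lambda>w. c * v w)"
  unfolding scal_def by (subst app_def, subst Abs_linop_inverse) (auto simp: algebra_simps)

lemma app_sum_list: "v \<lhd>\<^sub>L sum_list xs = (\<lambda>w. \<Sum>x\<leftarrow>xs. (v \<lhd>\<^sub>L x) w)"
  by (induction xs) auto

section \<open>Words\<close>

text \<open>A word is a function on all positions, with the value \<open>0\<close> after the last letter. This way words of
  every length live in one type, and the relations hold for all generators at once.\<close>

definition swap :: "nat \<Rightarrow> (nat \<Rightarrow> int) \<Rightarrow> nat \<Rightarrow> int" where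
  "swap t w = (if t = 0 then w(0 := - w 0) else w(t - 1 := w t, t := w (t - 1)))"

lemma swap_swap [simp]: "swap t (swap t w) = w"
  by (auto simp: swap_def fun_eq_iff)

text \<open>The coefficient at \<open>w\<close> of the transformed vector. The action on basis vectors is read backwards
  here, since swapping is an involution: the coefficient at \<open>w\<close> comes from the words \<open>w\<close> and \<open>swap t w\<close>.\<close>

definition tf :: "'k::field \<Rightarrow> 'k \<Rightarrow> nat \<Rightarrow> ((nat \<Rightarrow> int) \<Rightarrow> 'k) \<Rightarrow> (nat \<Rightarrow> int) \<Rightarrow> 'k" where
  "tf Q q t v w =
    (if t = 0 then
       if w 0 = 0 then inverse Q * v w
       else v (swap 0 w) + (if w 0 < 0 then (inverse Q - Q) * v w else 0)
     else
       if w (t - 1) = w t then inverse q * v w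
       else v (swap t w) + (if w (t - 1) > w t then (inverse q - q) * v w else 0))"

definition TT :: "'k::field \<Rightarrow> 'k \<Rightarrow> nat \<Rightarrow> (nat \<Rightarrow> int, 'k) linop" where
  "TT Q q t = Abs_linop (tf Q q t)"

lemma app_TT: "v \<lhd>\<^sub>L TT Q q t = tf Q q t v"
  unfolding TT_def
  by (subst app_def, subst Abs_linop_inverse) (auto simp: tf_def fun_eq_iff algebra_simps)

lemma tf_scale: "tf Q q t (\<lambda>w. c * v w) w = c * tf Q q t v w"
  by (simp add: tf_def algebra_simps)

lemma tf_0: "tf Q q 0 v w = (if w 0 = 0 then inverse Q * v w
   else v (swap 0 w) + (if w 0 < 0 then (inverse Q - Q) * v w else 0))"
  by (simp add: tf_def)

lemma tf_Suc: "tf Q q (Suc i) v w = (if w i = w (Suc i) then inverse q * v w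
   else v (swap (Suc i) w) + (if w i > w (Suc i) then (inverse q - q) * v w else 0))"
  by (simp add: tf_def)

lemma swap_far: "Suc i < j \<Longrightarrow> swap i (swap j w) = swap j (swap i w)"
  by (auto simp: swap_def fun_eq_iff)

lemma swap_braid: "swap (Suc i) (swap (Suc (Suc i)) (swap (Suc i) w)) = swap (Suc (Suc i)) (swap (Suc i) (swap (Suc (Suc i)) w))"
  by (auto simp: swap_def fun_eq_iff)

lemma swap_braid4: "swap 0 (swap (Suc 0) (swap 0 (swap (Suc 0) w))) = swap (Suc 0) (swap 0 (swap (Suc 0) (swap 0 w)))"
  by (auto simp: swap_def fun_eq_iff)

lemma swap_at:
  "swap 0 w j = (if j = 0 then - w 0 else w j)"
  "swap (Suc i) w j = (if j = i then w (Suc i) else if j = Suc i then w i else w j)"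
  by (auto simp: swap_def)

lemma swap_id: "w i = w (Suc i) \<Longrightarrow> swap (Suc i) w = w" "w 0 = 0 \<Longrightarrow> swap 0 w = w"
  by (auto simp: swap_def fun_eq_iff)

lemma tf_quad0:
  assumes "Q \<noteq> 0"
  shows "tf Q q 0 (tf Q q 0 v) w = (inverse Q - Q) * tf Q q 0 v w + v w"
  using assms by (simp add: tf_0 swap_at field_simps)

lemma tf_quad:
  assumes "q \<noteq> 0"
  shows "tf Q q (Suc i) (tf Q q (Suc i) v) w = (inverse q - q) * tf Q q (Suc i) v w + v w"
  using assms by (simp add: tf_Suc swap_at field_simps)

lemma tf_far:
  assumes "Suc i < j" shows "tf Q q i (tf Q q j v) w = tf Q q j (tf Q q i v) w"
proof -
  obtain j' where j: "j = Suc j'" using assms by (cases j) auto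
  show ?thesis
    using assms swap_far[of i j w] unfolding j
    by (cases i) (simp_all add: tf_0 tf_Suc swap_at algebra_simps)
qed

lemma tf_braid:
  assumes "q \<noteq> 0"
  shows "tf Q q (Suc i) (tf Q q (Suc (Suc i)) (tf Q q (Suc i) v)) w
     = tf Q q (Suc (Suc i)) (tf Q q (Suc i) (tf Q q (Suc (Suc i)) v)) w"
proof -
  define a b c where "a = w i" "b = w (Suc i)" "c = w (Suc (Suc i))"
  show ?thesis
    using swap_braid[of i w] swap_id(1)[of _ i] swap_id(1)[of _ "Suc i"]
    by (cases a b rule: linorder_cases; cases b c rule: linorder_cases; cases a c rule: linorder_cases;
        simp add: tf_Suc swap_at a_b_c_def algebra_simps; (simp add: field_simps assms)?)
qed

lemma tf_braid4:
  assumes "q \<noteq> 0" "Q \<noteq> 0"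
  shows "tf Q q 0 (tf Q q (Suc 0) (tf Q q 0 (tf Q q (Suc 0) v))) w
     = tf Q q (Suc 0) (tf Q q 0 (tf Q q (Suc 0) (tf Q q 0 v))) w"
proof -
  define a b where "a = w 0" "b = w (Suc 0)"
  show ?thesis
    using swap_braid4[of w] swap_id(1)[of _ 0] swap_id(2)
    by (cases a "0::int" rule: linorder_cases; cases b "0::int" rule: linorder_cases; cases a b rule: linorder_cases;
        cases "-a" b rule: linorder_cases;
        simp add: tf_Suc tf_0 swap_at a_b_def algebra_simps; (simp add: field_simps assms)?)
qed

lemma TT_hecke:
  fixes Q q :: "'k::field"
  assumes "Q \<noteq> 0" "q \<noteq> 0"
  shows "hecke_ring scal (TT Q q) q (inverse Q) (- Q)"
proof (unfold_locales, goal_cases)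
  case (6 i)
  then obtain j where "i = Suc j" by (cases i) auto
  then show ?case by (intro linop_eqI) (simp add: app_TT tf_braid assms)
next
  case 7 then show ?case by (intro linop_eqI) (simp add: app_TT tf_braid4 assms)
next
  case (8 i j) then show ?case by (intro linop_eqI) (simp add: app_TT tf_far[OF 8, of _ q])
next
  case (9 i)
  then obtain j where "i = Suc j" by (cases i) auto
  then show ?case using assms by (intro linop_eqI) (simp add: app_TT tf_quad tf_scale)
next
  case 10
  have "tf Q q 0 (\<lambda>w. tf Q q 0 v w - inverse Q * v w) w
     = tf Q q 0 (tf Q q 0 v) w - inverse Q * tf Q q 0 v w" for v w
    by (simp add: tf_0 algebra_simps)
  moreover have "tf Q q 0 (\<lambda>w. v w * inverse Q) w = inverse Q * tf Q q 0 v w" for v w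
    using tf_scale[of Q q 0 "inverse Q" v w] by (simp add: mult.commute)
  ultimately show ?case using assms
    by (intro linop_eqI) (simp add: app_TT tf_quad0 algebra_simps)
qed (use assms in \<open>auto intro!: linop_eqI simp: app_scale algebra_simps\<close>)

section \<open>Supports\<close>

definition space :: "'b set \<Rightarrow> ('b \<Rightarrow> 'k::field) set" where
  "space S = {v. \<forall>x. x \<notin> S \<longrightarrow> v x = 0}"

lemma spaceD: "v \<in> space S \<Longrightarrow> v x \<noteq> 0 \<Longrightarrow> x \<in> S"
  by (auto simp: space_def)

lemma space_add: "u \<in> space S \<Longrightarrow> v \<in> space S \<Longrightarrow> (\<lambda>w. u w + v w) \<in> space S"
  by (auto simp: space_def)

lemma space_scale: "v \<in> space S \<Longrightarrow> (\<lambda>w. c * v w) \<in> space S"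
  by (auto simp: space_def)

lemma space_zero: "(\<lambda>w. 0) \<in> space S"
  by (auto simp: space_def)

lemma space_mono: "v \<in> space S \<Longrightarrow> S \<subseteq> S' \<Longrightarrow> v \<in> space S'"
  by (auto simp: space_def)

lemma basis_vec_space: "w \<in> S \<Longrightarrow> basis_vec w \<in> space S"
  by (auto simp: space_def basis_vec_def)

lemma space_induct:
  assumes S: "finite S" and v: "v \<in> space S"
    and R0: "R (\<lambda>w. 0)" and R_add: "\<And>u v. R u \<Longrightarrow> R v \<Longrightarrow> R (\<lambda>w. u w + v w)"
    and R_scale: "\<And>c v. R v \<Longrightarrow> R (\<lambda>w. c * v w)"
    and R_basis: "\<And>x. x \<in> S \<Longrightarrow> R (basis_vec x)"
  shows "R v"
  using S v R_basis
proof (induction S arbitrary: v rule: finite_induct)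
  case empty
  then have "v = (\<lambda>w. 0)" by (auto simp: space_def)
  then show ?case using R0 by simp
next
  case (insert x S)
  define u where "u = (\<lambda>w. if w = x then 0 else v w)"
  have "u \<in> space S" using insert(4) by (auto simp: space_def u_def)
  then have "R u" using insert by auto
  moreover have "R (\<lambda>w. v x * basis_vec x w)" using insert by (intro R_scale) auto
  ultimately have "R (\<lambda>w. u w + v x * basis_vec x w)" by (rule R_add)
  moreover have "(\<lambda>w. u w + v x * basis_vec x w) = v"
    by (auto simp: u_def basis_vec_def)
  ultimately show ?case by simp
qed

lemma tf_space:
  assumes "v \<in> space S" "\<And>w. w \<in> S \<Longrightarrow> swap t w \<in> S"
  shows "tf Q q t v \<in> space S"
proof -
  have "swap t w \<notin> S" if "w \<notin> S" for w using assms(2)[of "swap t w"] that by auto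
  then show ?thesis using assms(1) by (auto simp: space_def tf_def)
qed

lemma tf_basis_less:
  "w i < w (Suc i) \<Longrightarrow> tf Q q (Suc i) (basis_vec w) = basis_vec (swap (Suc i) w)"
  "w 0 > 0 \<Longrightarrow> tf Q q 0 (basis_vec w) = basis_vec (swap 0 w)"
proof -
  have inv: "swap t w' = w \<longleftrightarrow> w' = swap t w" for t w' by auto
  show "tf Q q (Suc i) (basis_vec w) = basis_vec (swap (Suc i) w)" if "w i < w (Suc i)"
  proof -
    have "w \<noteq> swap (Suc i) w" using that by (metis swap_at(2) less_irrefl)
    then show ?thesis
      using that by (auto simp: fun_eq_iff[where f = "tf _ _ _ _"] tf_Suc basis_vec_def inv swap_at)
  qed
  show "tf Q q 0 (basis_vec w) = basis_vec (swap 0 w)" if "w 0 > 0"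
  proof -
    have "w \<noteq> swap 0 w" using that by (metis swap_at(1) less_irrefl neg_0_less_iff_less less_asym)
    then show ?thesis
      using that by (auto simp: fun_eq_iff[where f = "tf _ _ _ _"] tf_0 basis_vec_def inv swap_at)
  qed
qed

text \<open>Restriction to a set of words that is stable under the relevant swaps commutes with the operators. It
  isolates the part of a vector with negative letters at prescribed places.\<close>

definition cut :: "'b set \<Rightarrow> ('b \<Rightarrow> 'k::field) \<Rightarrow> 'b \<Rightarrow> 'k" where
  "cut S v = (\<lambda>w. if w \<in> S then v w else 0)"

lemma tf_cut:
  assumes "\<And>w. w \<in> S \<Longrightarrow> swap t w \<in> S"
  shows "tf Q q t (cut S v) = cut S (tf Q q t v)"
proof -
  have "swap t w \<in> S \<longleftrightarrow> w \<in> S" for w using assms[of w] assms[of "swap t w"] by auto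
  then show ?thesis by (auto simp: cut_def tf_def fun_eq_iff)
qed

section \<open>Straightening tensor space\<close>

lemma (in hecke_ring) A_h_high: "b + l < b + a \<Longrightarrow> A (Suc b) l * h b a = h b a * A 1 l"
proof (induction l)
  case (Suc l)
  have "T (b + Suc l) * h b a = h b a * T (Suc l)" using T_h_high[of "Suc l" a b] Suc.prems by simp
  then have "A (Suc b) (Suc l) * h b a = (A (Suc b) l * h b a) * T (Suc l)" by (simp add: mult.assoc)
  then show ?case using Suc by (simp add: mult.assoc)
qed simp

lemma (in hecke_ring) A_h_low: "k < b \<Longrightarrow> A 1 k * h b a = U r b * A 1 k * P b a * U s a"
proof -
  assume "k < b"
  then have "A 1 k \<in> alg (T ` ({1..<b} \<union> {Suc b..}))" by (intro alg_mono[OF A_mem]) auto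
  from U_commute_A[OF this] show ?thesis unfolding h_def by (simp add: mult.assoc[symmetric])
qed

text \<open>\<open>T\<^sub>0\<close> creates a negative letter and \<open>A 1 k\<close> moves it to place \<open>k\<close>. Against \<open>h\<close> this can be done by a type
  A element instead, which is what allows one to remove negative letters from words.\<close>

lemma (in hecke_ring) T0_A_h:
  assumes "k < a + b"
  shows "\<exists>g \<in> alg (T ` {1..<a + b}). T 0 * A 1 k * h b a = g * h b a"
proof (cases "k < b")
  case True
  have "T 0 * A 1 k * h b a = (T 0 * U r b) * (A 1 k * P b a * U s a)"
    using A_h_low[OF True] by (simp add: mult.assoc)
  also have "\<dots> = sc s * A 1 k * h b a"
    using A_h_low[OF True, of a] U_r_T0(1)[of b] True by (simp add: mult.assoc)
  finally show ?thesis using True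
    by (intro bexI[of _ "sc s * A 1 k"]) (auto intro!: alg.mult alg.sc alg_mono[OF A_mem])
next
  case False
  have k: "A 1 k = A 1 b * A (Suc b) (k - b)" using A_split[of 1 b "k - b"] False by simp
  have AT: "T 0 * A 1 b * h b a = Ai b * (sc r * h b a)"
  proof -
    have "T 0 * A 1 b * h b a = Ai b * (XX b * h b a)"
      unfolding XX_eq using Ai_D[of b] by (simp add: mult.assoc[symmetric])
    then show ?thesis using XX_h[of a b] assms False by simp
  qed
  have "T 0 * A 1 k * h b a = T 0 * A 1 b * (A (Suc b) (k - b) * h b a)"
    unfolding k by (simp add: mult.assoc)
  also have "\<dots> = Ai b * (sc r * (h b a * A 1 (k - b)))"
    using A_h_high[of b "k - b" a] AT assms False by (simp add: mult.assoc[symmetric])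
  also have "\<dots> = (Ai b * (sc r * A (Suc b) (k - b))) * h b a"
    using A_h_high[of b "k - b" a] assms False by (simp add: mult.assoc)
  finally have e: "T 0 * A 1 k * h b a = (Ai b * (sc r * A (Suc b) (k - b))) * h b a" .
  have "Ai b \<in> alg (T ` {1..<a + b})" "A (Suc b) (k - b) \<in> alg (T ` {1..<a + b})"
    by (rule alg_mono[OF Ai_mem], use assms False in force, rule alg_mono[OF A_mem], use assms False in force)
  then have "Ai b * (sc r * A (Suc b) (k - b)) \<in> alg (T ` {1..<a + b})" by (intro alg.mult alg.sc)
  then show ?thesis using e by blast
qed

text \<open>The inequalities \<open>sep\<close> say that no factor of \<open>f\<^sup>B\<close> vanishes.\<close>

locale words =
  fixes Q q :: "'k::field" and I :: "int set" and d :: nat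
  assumes Q0: "Q \<noteq> 0" and qn0: "q \<noteq> 0" and finI: "finite I" and symI: "x \<in> I \<Longrightarrow> - x \<in> I"
    and d1: "1 \<le> d"
    and sep: "\<bar>i\<bar> + \<bar>j\<bar> < int d \<Longrightarrow> - Q * q powi (2 * i) \<noteq> inverse Q * q powi (2 * j)"

sublocale words \<subseteq> hecke_ring scal "TT Q q" q "inverse Q" "- Q"
  using TT_hecke[OF Q0 qn0] .

context words
begin

abbreviation "TQ \<equiv> TT Q q"

lemma alg_space:
  assumes "x \<in> alg (TQ ` X)" "v \<in> space S" "\<And>t w. t \<in> X \<Longrightarrow> w \<in> S \<Longrightarrow> swap t w \<in> S"
  shows "v \<lhd>\<^sub>L x \<in> space S"
  using assms(1,2)
proof (induction arbitrary: v)
  case (gen x) then show ?case using tf_space[OF gen(2)] assms(3) by (auto simp: app_TT)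
qed (auto intro: space_add space_scale)

lemma alg_cut:
  assumes "x \<in> alg (TQ ` X)" "\<And>t w. t \<in> X \<Longrightarrow> w \<in> S \<Longrightarrow> swap t w \<in> S"
  shows "cut S v \<lhd>\<^sub>L x = cut S (v \<lhd>\<^sub>L x)"
  using assms(1)
proof (induction arbitrary: v)
  case (gen x) then show ?case by (auto simp: app_TT intro!: tf_cut assms(2))
next
  case (mult x y) then show ?case by simp
qed (auto simp: cut_def)

definition "words_with X = {w :: nat \<Rightarrow> int. (\<forall>i<d. w i \<in> X i) \<and> (\<forall>i\<ge>d. w i = 0)}"

definition "M = (space (words_with (\<lambda>_. I)) :: ((nat \<Rightarrow> int) \<Rightarrow> 'k) set)"

definition "L b i = (if i < b then I \<inter> {0<..} else I \<inter> {0..})"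

definition "B b = (space (words_with (L b)) :: ((nat \<Rightarrow> int) \<Rightarrow> 'k) set)"

lemma finite_Wd: "(\<And>i. X i \<subseteq> I) \<Longrightarrow> finite (words_with X)"
proof -
  assume X: "\<And>i. X i \<subseteq> I"
  have "words_with X \<subseteq> {w. \<forall>i. (i \<in> {..<d} \<longrightarrow> w i \<in> I) \<and> (i \<notin> {..<d} \<longrightarrow> w i = 0)}"
    unfolding words_with_def using X by (auto simp: not_less)
  then show ?thesis using finite_set_of_finite_funs[of "{..<d}" I 0] finI finite_subset by blast
qed

lemma finite_W: "finite (words_with (\<lambda>_. I))" by (rule finite_Wd) auto

lemma swap_Wd: "w \<in> words_with (\<lambda>_. I) \<Longrightarrow> t < d \<Longrightarrow> swap t w \<in> words_with (\<lambda>_. I)"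
  using symI unfolding words_with_def by (auto simp: swap_def)

lemma B_M: "v \<in> B b \<Longrightarrow> v \<in> M"
  unfolding B_def M_def L_def words_with_def by (erule space_mono) auto

lemma M_alg: "v \<in> M \<Longrightarrow> x \<in> alg (TQ ` {..<d}) \<Longrightarrow> v \<lhd>\<^sub>L x \<in> M"
  unfolding M_def by (rule alg_space) (auto intro: swap_Wd)

lemma swap_WdL: "w \<in> words_with (L b) \<Longrightarrow> t \<in> {1..<d} - {b} \<Longrightarrow> swap t w \<in> words_with (L b)"
proof -
  assume w: "w \<in> words_with (L b)" and t: "t \<in> {1..<d} - {b}"
  then obtain u where u: "t = Suc u" by (cases t) auto
  have "swap t w i \<in> L b i" if "i < d" for i
  proof -
    have "w j \<in> L b j" if "j < d" for j using w that by (auto simp: words_with_def)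
    moreover have "L b u = L b (Suc u)" using t u by (auto simp: L_def)
    ultimately show ?thesis using that t unfolding u by (auto simp: swap_at)
  qed
  then show ?thesis using w t u unfolding words_with_def by (auto simp: swap_at)
qed

lemma B_alg: "v \<in> B b \<Longrightarrow> x \<in> parabolic b d \<Longrightarrow> v \<lhd>\<^sub>L x \<in> B b"
  unfolding B_def parabolic_def by (rule alg_space) (auto intro: swap_WdL)

subsection \<open>Moving a letter\<close>

text \<open>The word in which the letter at place \<open>k\<close> has been moved to the front.\<close>

fun unrot :: "nat \<Rightarrow> (nat \<Rightarrow> int) \<Rightarrow> nat \<Rightarrow> int" where
  "unrot 0 w = w"
| "unrot (Suc k) w = unrot k (swap (Suc k) w)"

lemma unrot_at: "unrot k w j = (if j = 0 then w k else if j \<le> k then w (j - 1) else w j)"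
  by (induction k arbitrary: w) (auto simp: swap_at)

lemma unrot_Wd: "w \<in> words_with (\<lambda>_. I) \<Longrightarrow> k < d \<Longrightarrow> unrot k w \<in> words_with (\<lambda>_. I)"
  by (induction k arbitrary: w) (auto intro: swap_Wd)

lemma basis_A: "(\<And>j. j < k \<Longrightarrow> w k < w j) \<Longrightarrow> basis_vec (unrot k w) \<lhd>\<^sub>L A 1 k = basis_vec w"
proof (induction k arbitrary: w)
  case (Suc k)
  have "basis_vec (unrot k (swap (Suc k) w)) \<lhd>\<^sub>L A 1 k = basis_vec (swap (Suc k) w)"
    by (rule Suc.IH) (use Suc.prems in \<open>auto simp: swap_at\<close>)
  then show ?case using Suc.prems[of k] by (simp add: app_TT tf_basis_less swap_at)
qed simp

lemma space_A:
  assumes v: "v \<in> space {u. u 0 < 0 \<and> (\<forall>j. 1 \<le> j \<and> j \<le> K \<longrightarrow> u j \<ge> 0)}" and "k \<le> K"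
  shows "(v \<lhd>\<^sub>L A 1 k) w = v (unrot k w)"
  using assms(2)
proof (induction k arbitrary: w)
  case (Suc k)
  have sup: "u 0 < 0" "1 \<le> j \<Longrightarrow> j \<le> K \<Longrightarrow> u j \<ge> 0" if "v u \<noteq> 0" for u j
    using v that by (auto simp: space_def)
  have ih: "(v \<lhd>\<^sub>L A 1 k) w = v (unrot k w)" for w using Suc by simp
  have z: "v (unrot k w) = 0" if "w k \<ge> w (Suc k)"
  proof (rule ccontr)
    assume "v (unrot k w) \<noteq> 0"
    from sup(1)[OF this] sup(2)[OF this, of "Suc k"] show False using that Suc.prems by (auto simp: unrot_at)
  qed
  have z': "v (unrot k (swap (Suc k) w)) = 0" if "w k = w (Suc k)"
    using z that swap_id(1)[OF that] by simp
  show ?case using z z' ih by (auto simp: app_TT tf_Suc)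
qed simp

definition "negs w = card {i. i < d \<and> w i < (0::int)}"

lemma negs_swap: assumes "1 \<le> t" "t < d" shows "negs (swap t w) = negs w"
proof -
  define g where "g j = (if j = t - 1 then t else if j = t then t - 1 else j)" for j :: nat
  have gg: "g (g j) = j" for j using assms by (auto simp: g_def)
  have sw: "swap t w j = w (g j)" for j using assms by (auto simp: swap_def g_def)
  have gd: "g j < d \<longleftrightarrow> j < d" for j using assms by (auto simp: g_def)
  have "{i. i < d \<and> swap t w i < 0} = g ` {i. i < d \<and> w i < 0}"
  proof (intro Set.set_eqI iffI)
    fix x assume "x \<in> {i. i < d \<and> swap t w i < 0}"
    then have "g x \<in> {i. i < d \<and> w i < 0}" using sw gd by auto
    then have "g (g x) \<in> g ` {i. i < d \<and> w i < 0}" by (rule imageI)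
    then show "x \<in> g ` {i. i < d \<and> w i < 0}" by (simp add: gg)
  qed (auto simp: sw gd gg)
  moreover have "inj g" by (metis gg injI)
  ultimately show ?thesis unfolding negs_def by (simp add: card_image inj_on_subset)
qed

lemma negs_unrot: "k < d \<Longrightarrow> negs (unrot k w) = negs w"
  by (induction k arbitrary: w) (auto simp: negs_swap)

lemma negs_swap0: assumes "u 0 < 0" shows "negs (swap 0 u) < negs u"
proof -
  have e: "{i. i < d \<and> swap 0 u i < 0} = {i. i < d \<and> u i < 0} - {0}"
    using assms by (auto simp: swap_at)
  show ?thesis unfolding negs_def e by (rule card_Diff1_less) (use assms d1 in auto)
qed

lemma basis_fixed: "u 0 = 0 \<Longrightarrow> basis_vec u \<lhd>\<^sub>L TQ 0 = (\<lambda>w. inverse Q * basis_vec u w)"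
  by (auto simp: app_TT tf_0 basis_vec_def fun_eq_iff swap_at)

subsection \<open>Spanning\<close>

lemma span_closed:
  assumes "finite S" "u \<in> space S" and S: "\<And>x. x \<in> S \<Longrightarrow> \<exists>v \<in> B b. basis_vec x \<lhd>\<^sub>L z = v \<lhd>\<^sub>L z"
  shows "\<exists>v \<in> B b. u \<lhd>\<^sub>L z = v \<lhd>\<^sub>L z"
  using assms(1,2)
proof (rule space_induct)
  show "\<exists>v\<in>B b. (\<lambda>w. 0) \<lhd>\<^sub>L z = v \<lhd>\<^sub>L z"
    by (rule bexI[of _ "\<lambda>w. 0"]) (auto simp: B_def space_zero)
next
  fix u v assume "\<exists>x\<in>B b. u \<lhd>\<^sub>L z = x \<lhd>\<^sub>L z" "\<exists>x\<in>B b. v \<lhd>\<^sub>L z = x \<lhd>\<^sub>L z"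
  then obtain x y where "x \<in> B b" "u \<lhd>\<^sub>L z = x \<lhd>\<^sub>L z" "y \<in> B b" "v \<lhd>\<^sub>L z = y \<lhd>\<^sub>L z" by blast
  then show "\<exists>x\<in>B b. (\<lambda>w. u w + v w) \<lhd>\<^sub>L z = x \<lhd>\<^sub>L z"
    by (intro bexI[of _ "\<lambda>w. x w + y w"]) (auto simp: B_def app_add space_add)
next
  fix c v assume "\<exists>x\<in>B b. v \<lhd>\<^sub>L z = x \<lhd>\<^sub>L z"
  then obtain x where "x \<in> B b" "v \<lhd>\<^sub>L z = x \<lhd>\<^sub>L z" by blast
  then show "\<exists>x\<in>B b. (\<lambda>w. c * v w) \<lhd>\<^sub>L z = x \<lhd>\<^sub>L z"
    by (intro bexI[of _ "\<lambda>w. c * x w"]) (auto simp: B_def app_scale space_scale)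
qed (rule S)

text \<open>
  Induction on the number of negative letters. Write a word with a negative letter as \<open>w\<^sub>0 T\<^sub>0 A\<close> for the first
  such letter; by \<open>T0_A_h\<close> the factor \<open>T\<^sub>0 A\<close> becomes a type A element in front of \<open>h\<close>, and that preserves the
  number of negative letters, which is smaller for \<open>w\<^sub>0\<close>. A word without negative letters lies in \<open>B b\<close>, or has
  a letter \<open>0\<close> among its first \<open>b\<close> letters; moved to the front, \<open>0\<close> is annihilated by the factor \<open>T\<^sub>0 - r\<close> of \<open>u\<^sup>-\<close>.
\<close>

lemma span_h_basis:
  assumes ab: "a + b = d" and w: "w \<in> words_with (\<lambda>_. I)"
  shows "\<exists>v \<in> B b. basis_vec w \<lhd>\<^sub>L h b a = v \<lhd>\<^sub>L h b a"
  using w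
proof (induction "negs w" arbitrary: w rule: less_induct)
  case less
  show ?case
  proof (cases "\<exists>k<d. w k < 0")
    case True
    define k where "k = (LEAST k. k < d \<and> w k < 0)"
    have k: "k < d" "w k < 0" using LeastI_ex[of "\<lambda>k. k < d \<and> w k < 0"] True by (auto simp: k_def)
    have kl: "w j \<ge> 0" if "j < k" for j
      using not_less_Least[of j "\<lambda>k. k < d \<and> w k < 0"] that k(1) by (fastforce simp: k_def)
    define w0 where "w0 = swap 0 (unrot k w)"
    have w00: "w0 0 > 0" using k by (simp add: w0_def swap_at unrot_at)
    have "basis_vec w0 \<lhd>\<^sub>L TQ 0 = basis_vec (unrot k w)"
      using tf_basis_less(2)[of w0 Q q] w00 by (simp add: app_TT w0_def)
    moreover have "basis_vec (unrot k w) \<lhd>\<^sub>L A 1 k = basis_vec w"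
      by (rule basis_A) (use kl k in force)
    ultimately have bw: "basis_vec w \<lhd>\<^sub>L h b a = basis_vec w0 \<lhd>\<^sub>L (TQ 0 * A 1 k * h b a)" by simp
    obtain g where g: "g \<in> alg (TQ ` {1..<d})" "TQ 0 * A 1 k * h b a = g * h b a"
      using T0_A_h[of k a b] k ab by auto
    have neg: "negs w0 < negs w"
      using negs_swap0[of "unrot k w"] negs_unrot[OF k(1), of w] k by (simp add: w0_def unrot_at)
    define S where "S = {u \<in> words_with (\<lambda>_. I). negs u < negs w}"
    have "basis_vec w0 \<in> space S" using neg unrot_Wd[OF less.prems k(1)] d1
      unfolding w0_def by (intro basis_vec_space) (auto simp: S_def intro: swap_Wd)
    then have sp: "basis_vec w0 \<lhd>\<^sub>L g \<in> space S"
      by (rule alg_space[OF g(1)]) (auto simp: S_def negs_swap intro: swap_Wd)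
    have fin: "finite S" unfolding S_def by (rule finite_subset[OF _ finite_W]) blast
    have "\<exists>v \<in> B b. (basis_vec w0 \<lhd>\<^sub>L g) \<lhd>\<^sub>L h b a = v \<lhd>\<^sub>L h b a"
    proof (rule span_closed[OF fin sp])
      fix x assume "x \<in> S"
      then show "\<exists>v\<in>B b. basis_vec x \<lhd>\<^sub>L h b a = v \<lhd>\<^sub>L h b a"
        using less.hyps[of x] unfolding S_def by blast
    qed
    then show ?thesis unfolding bw g(2) by simp
  next
    case False
    show ?thesis
    proof (cases "\<exists>k<b. w k = 0")
      case True
      define k where "k = (LEAST k. k < b \<and> w k = 0)"
      have k: "k < b" "w k = 0" using LeastI_ex[of "\<lambda>k. k < b \<and> w k = 0"] True by (auto simp: k_def)
      have kl: "w j > 0" if "j < k" for j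
        using not_less_Least[of j "\<lambda>k. k < b \<and> w k = 0"] that k(1) False ab
        by (metis k_def le_add2 linorder_neqE_linordered_idom order.strict_trans order.strict_trans2)
      have "basis_vec w = basis_vec (unrot k w) \<lhd>\<^sub>L A 1 k"
        by (rule basis_A[symmetric]) (use kl k in auto)
      then have e: "basis_vec w \<lhd>\<^sub>L h b a = basis_vec (unrot k w) \<lhd>\<^sub>L (A 1 k * h b a)" by simp
      obtain V where V: "U (inverse Q) b = (TQ 0 - scal (inverse Q)) * V"
        using U_head[of b "inverse Q"] k by (metis One_nat_def Suc_leI gr_implies_not0 neq0_conv)
      have "basis_vec (unrot k w) \<lhd>\<^sub>L (TQ 0 - scal (inverse Q)) = (\<lambda>w. 0)"
        using basis_fixed[of "unrot k w"] k by (simp add: unrot_at)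
      then have "basis_vec w \<lhd>\<^sub>L h b a = (\<lambda>w. 0)"
        unfolding e A_h_low[OF k(1)] V app_simps(6) by (simp only: app_zero)
      then show ?thesis by (intro bexI[of _ "\<lambda>w. 0"]) (auto simp: B_def space_zero app_zero)
    next
      case F: False
      have "w i \<in> L b i" if "i < d" for i
      proof -
        have "w i \<in> I" "\<not> w i < 0" "i < b \<Longrightarrow> w i \<noteq> 0" using less.prems False F that by (auto simp: words_with_def)
        then show ?thesis by (cases "i < b") (auto simp: L_def)
      qed
      then have "w \<in> words_with (L b)" using less.prems by (auto simp: words_with_def)
      then have "basis_vec w \<in> B b" unfolding B_def by (rule basis_vec_space)
      then show ?thesis by blast
    qed
  qed
qed

lemma span_h:
  assumes ab: "a + b = d" and m: "m \<in> M"
  shows "\<exists>v \<in> B b. m \<lhd>\<^sub>L h b a = v \<lhd>\<^sub>L h b a"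
  using span_closed[OF finite_W m[unfolded M_def]] span_h_basis[OF ab] by blast

subsection \<open>Injectivity\<close>

definition rot :: "nat \<Rightarrow> (nat \<Rightarrow> int) \<Rightarrow> nat \<Rightarrow> int" where
  "rot k u = (\<lambda>j. if j < k then u (Suc j) else if j = k then - u 0 else u j)"

lemma unrot_rot: "swap 0 (unrot k (rot k u)) = u"
  by (rule ext) (auto simp: swap_at unrot_at rot_def)

text \<open>Applied to nonnegative words, the Jucys-Murphy element \<open>X\<^sub>k\<close> creates at most one negative letter, and only
  at place \<open>k\<close>; the corresponding coefficients are those of \<open>v D\<close>.\<close>

lemma XX_nonneg:
  assumes v: "v \<in> space {w. \<forall>i\<le>k. w i \<ge> 0}"
  shows "v \<lhd>\<^sub>L XX k \<in> space {w. \<forall>i<k. w i \<ge> 0}"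
    and "\<And>w. w k < 0 \<Longrightarrow> (v \<lhd>\<^sub>L XX k) w = (v \<lhd>\<^sub>L D 1 k) (swap 0 (unrot k w))"
proof -
  have stable: "swap t w \<in> {w. \<forall>i\<le>k. w i \<ge> 0}" if "t \<in> {1..<1 + k}" "w \<in> {w. \<forall>i\<le>k. w i \<ge> 0}" for t w
    using that by (cases t) (auto simp: swap_at)
  define v' where "v' = v \<lhd>\<^sub>L D 1 k"
  have v': "v' \<in> space {w. \<forall>i\<le>k. w i \<ge> 0}"
    unfolding v'_def by (rule alg_space[OF D_mem v stable])
  define n where "n = cut {u. u 0 < 0} (tf Q q 0 v')"
  define p where "p = cut {u. \<not> u 0 < 0} (tf Q q 0 v')"
  have t0: "w i \<ge> 0" if w: "tf Q q 0 v' w \<noteq> 0" and i: "1 \<le> i" "i \<le> k" for w i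
  proof -
    have "v' w \<noteq> 0 \<or> v' (swap 0 w) \<noteq> 0" using w by (auto simp: tf_0 split: if_splits)
    then have "(\<forall>i\<le>k. w i \<ge> 0) \<or> (\<forall>i\<le>k. swap 0 w i \<ge> 0)" using v' unfolding space_def by blast
    then show ?thesis using i by (auto simp: swap_at dest!: spec[of _ i])
  qed
  have n: "n \<in> space {u. u 0 < 0 \<and> (\<forall>j. 1 \<le> j \<and> j \<le> k \<longrightarrow> u j \<ge> 0)}"
    using t0 unfolding n_def space_def cut_def by auto
  have "w i \<ge> 0" if "p w \<noteq> 0" "i \<le> k" for w i
  proof -
    have "\<not> w 0 < 0" "tf Q q 0 v' w \<noteq> 0" using that by (auto simp: p_def cut_def split: if_splits)
    then show ?thesis using t0[of w i] that(2) by (cases "i = 0") auto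
  qed
  then have p: "p \<in> space {w. \<forall>i\<le>k. w i \<ge> 0}" unfolding space_def by blast
  have pA: "p \<lhd>\<^sub>L A 1 k \<in> space {w. \<forall>i\<le>k. w i \<ge> 0}"
    by (rule alg_space[OF A_mem p stable])
  have "tf Q q 0 v' = (\<lambda>w. n w + p w)" by (auto simp: n_def p_def cut_def)
  then have X: "v \<lhd>\<^sub>L XX k = (\<lambda>w. n (unrot k w) + (p \<lhd>\<^sub>L A 1 k) w)"
    unfolding XX_eq using space_A[OF n order.refl] by (simp add: app_TT v'_def app_add)
  show "v \<lhd>\<^sub>L XX k \<in> space {w. \<forall>i<k. w i \<ge> 0}"
    unfolding X
  proof (rule space_add)
    show "(\<lambda>w. n (unrot k w)) \<in> space {w. \<forall>i<k. w i \<ge> 0}"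
    proof -
      have "w i \<ge> 0" if "n (unrot k w) \<noteq> 0" "i < k" for w i
        using spaceD[OF n, OF that(1)] that(2) by (auto simp: unrot_at dest!: spec[of _ "Suc i"])
      then show ?thesis by (auto simp: space_def)
    qed
    show "p \<lhd>\<^sub>L A 1 k \<in> space {w. \<forall>i<k. w i \<ge> 0}" by (rule space_mono[OF pA]) auto
  qed
  fix w :: "nat \<Rightarrow> int" assume w: "w k < 0"
  have "(p \<lhd>\<^sub>L A 1 k) w = 0" using pA w by (force simp: space_def)
  moreover have "v' (unrot k w) = 0" using v' w by (force simp: space_def unrot_at)
  then have "n (unrot k w) = v' (swap 0 (unrot k w))"
    using w by (simp add: n_def cut_def tf_0 unrot_at)
  ultimately show "(v \<lhd>\<^sub>L XX k) w = (v \<lhd>\<^sub>L D 1 k) (swap 0 (unrot k w))"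
    unfolding X by (simp add: v'_def)
qed

lemma J_eigenvalue:
  assumes e: "v \<lhd>\<^sub>L J 1 l = (\<lambda>w. c * v w)" and c: "c \<notin> set (rts l)"
  shows "v = (\<lambda>w. 0)"
proof -
  have "v \<lhd>\<^sub>L pr as (J 1 l) = (\<lambda>w. (\<Prod>\<alpha>\<leftarrow>as. c - \<alpha>) * v w)" for as
  proof (induction as)
    case (Cons \<alpha> as)
    have "v \<lhd>\<^sub>L (J 1 l - scal \<alpha>) = (\<lambda>w. (c - \<alpha>) * v w)"
      unfolding app_simps e app_scal by (simp add: algebra_simps)
    then have "v \<lhd>\<^sub>L pr (\<alpha> # as) (J 1 l) = (\<lambda>w. (c - \<alpha>) * (v \<lhd>\<^sub>L pr as (J 1 l)) w)"
      by (simp only: pr.simps app_simps(6) app_scale)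
    then show ?case unfolding Cons by (simp add: mult.assoc)
  qed simp
  from this[of "rts l"] have "(\<Prod>\<alpha>\<leftarrow>rts l. c - \<alpha>) * v w = 0" for w
    using pr_J[of 1 l] by (auto simp: fun_eq_iff)
  moreover have "(\<Prod>\<alpha>\<leftarrow>rts l. c - \<alpha>) \<noteq> 0" using c by (auto simp: prod_list_zero_iff)
  ultimately show ?thesis by auto
qed

text \<open>
  Induction on the number of factors of \<open>u\<^sup>+\<close>. By \<open>XX_nonneg\<close> the vector \<open>y = v (X\<^sub>a + Q)\<close> is again nonnegative on the
  first \<open>a\<close> places, so the smaller product is injective on it; hence \<open>y = 0\<close> and \<open>v X\<^sub>a = -Q v\<close>. Since \<open>v\<close> has
  no coefficients at words with a negative letter at place \<open>a\<close>, only words starting with \<open>0\<close> occur in \<open>v D\<close>; on these \<open>T\<^sub>0\<close> acts as \<open>Q\<^sup>-\<^sup>1\<close>. It follows that \<open>v\<close>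
  is an eigenvector of a type A Jucys-Murphy element with eigenvalue \<open>-Q\<^sup>2\<close>, which \<open>f\<^sup>B\<close> excludes.
\<close>

lemma U_plus_inj:
  assumes "a \<le> d" "v \<in> space {w. \<forall>i<a. w i \<ge> 0}" "v \<lhd>\<^sub>L U (- Q) a = (\<lambda>w. 0)"
  shows "v = (\<lambda>w. 0)"
  using assms
proof (induction a arbitrary: v)
  case (Suc a)
  have v: "v \<in> space {w. \<forall>i\<le>a. w i \<ge> 0}" using Suc.prems(2) by (simp add: less_Suc_eq_le)
  define y where "y = v \<lhd>\<^sub>L (XX a - scal (- Q))"
  have "U (- Q) (Suc a) = (XX a - scal (- Q)) * U (- Q) a"
    using U_commute_XX[of "- Q" a a] sc_comm[of "- Q" "U (- Q) a"] by (simp add: algebra_simps)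
  then have yU: "y \<lhd>\<^sub>L U (- Q) a = (\<lambda>w. 0)" using Suc.prems(3) unfolding y_def by (metis app_simps(6))
  have "y \<in> space {w. \<forall>i<a. w i \<ge> 0}"
  proof -
    have "v \<in> space {w. \<forall>i<a. w i \<ge> 0}" by (rule space_mono[OF v]) auto
    then show ?thesis unfolding y_def using XX_nonneg(1)[OF v] unfolding space_def by simp
  qed
  from Suc.IH[OF _ this yU] have "y = (\<lambda>w. 0)" using Suc.prems by simp
  then have e: "v \<lhd>\<^sub>L XX a = (\<lambda>w. - Q * v w)"
    unfolding y_def app_simps app_scal by (auto simp: fun_eq_iff add_eq_0_iff)
  define v' where "v' = v \<lhd>\<^sub>L D 1 a"
  have v': "v' \<in> space {w. \<forall>i\<le>a. w i \<ge> 0}"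
    unfolding v'_def
  proof (rule alg_space[OF D_mem v])
    fix t and w :: "nat \<Rightarrow> int" assume "t \<in> {1..<1 + a}" "w \<in> {w. \<forall>i\<le>a. w i \<ge> 0}"
    then show "swap t w \<in> {w. \<forall>i\<le>a. w i \<ge> 0}" by (cases t) (auto simp: swap_at)
  qed
  have z: "v' u = 0" if "u 0 \<noteq> 0" for u
  proof (cases "u 0 > 0")
    case True
    let ?w = "rot a u"
    have n: "?w a < 0" using True by (simp add: rot_def)
    then have "v ?w = 0" using v by (force simp: space_def)
    then show ?thesis using XX_nonneg(2)[OF v, of ?w] n e by (simp add: unrot_rot v'_def)
  next
    case False then show ?thesis using that v' by (force simp: space_def)
  qed
  have t: "tf Q q 0 v' = (\<lambda>w. inverse Q * v' w)"
    using z by (auto simp: tf_0 swap_at fun_eq_iff)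
  have "v \<lhd>\<^sub>L XX a = (\<lambda>w. inverse Q * (v \<lhd>\<^sub>L J 1 a) w)"
    unfolding XX_eq J_eq app_simps(6) app_TT v'_def[symmetric] t app_scale by (rule refl)
  then have Jv: "v \<lhd>\<^sub>L J 1 a = (\<lambda>w. (- Q * Q) * v w)"
    using e Q0 by (auto simp: fun_eq_iff field_simps)
  have "- Q * Q \<notin> set (rts a)"
  proof
    assume "- Q * Q \<in> set (rts a)"
    from rts_powi[OF this] obtain j where j: "\<bar>j\<bar> \<le> int a" "- Q * Q = q powi (2 * j)" by auto
    then have "- Q = inverse Q * q powi (2 * j)" using Q0 by (metis left_inverse mult.assoc mult.commute mult_1)
    then show False using sep[of 0 j] j(1) Suc.prems(1) by simp
  qed
  then show ?case by (rule J_eigenvalue[OF Jv])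
qed simp

text \<open>A vector of positive words is determined by the part of its image under \<open>u\<^sup>-\<close> on words with all letters
  negative: a factor \<open>X\<^sub>k - r\<close> makes at most the letter at place \<open>k\<close> negative, and where it does, it acts
  by \<open>XX_nonneg\<close> like the invertible braid word \<open>D\<close>.\<close>

lemma U_minus_top:
  assumes "v \<in> space {w. \<forall>i<b. w i > 0}"
    and "\<And>w. (\<And>i. i < b \<Longrightarrow> w i < 0) \<Longrightarrow> (v \<lhd>\<^sub>L U (inverse Q) b) w = 0"
  shows "v = (\<lambda>w. 0)"
  using assms
proof (induction b arbitrary: v)
  case 0 then show ?case by auto
next
  case (Suc b)
  have vp: "v \<in> space {w. \<forall>i\<le>b. w i > 0}" using Suc.prems(1) by (simp add: less_Suc_eq_le)
  then have v: "v \<in> space {w. \<forall>i\<le>b. w i \<ge> 0}" by (rule space_mono) force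
  define y where "y = v \<lhd>\<^sub>L (XX b - scal (inverse Q))"
  have "U (inverse Q) (Suc b) = (XX b - scal (inverse Q)) * U (inverse Q) b"
    using U_commute_XX[of "inverse Q" b b] sc_comm[of "inverse Q" "U (inverse Q) b"] by (simp add: algebra_simps)
  then have yU: "y \<lhd>\<^sub>L U (inverse Q) b = v \<lhd>\<^sub>L U (inverse Q) (Suc b)" unfolding y_def by simp
  define v' where "v' = v \<lhd>\<^sub>L D 1 b"
  have v': "v' \<in> space {w. \<forall>i\<le>b. w i > 0}"
    unfolding v'_def
  proof (rule alg_space[OF D_mem vp])
    fix t and w :: "nat \<Rightarrow> int" assume "t \<in> {1..<1 + b}" "w \<in> {w. \<forall>i\<le>b. w i > 0}"
    then show "swap t w \<in> {w. \<forall>i\<le>b. w i > 0}" by (cases t) (auto simp: swap_at)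
  qed
  have yw: "y w = v' (swap 0 (unrot b w))" if "w b < 0" for w
  proof -
    have "v w = 0" using v that by (force simp: space_def)
    then show ?thesis using XX_nonneg(2)[OF v, of w] that by (simp add: y_def v'_def)
  qed
  define n where "n = cut {w. w b < 0} y"
  have "w i > 0" if "n w \<noteq> 0" "i < b" for w i
  proof -
    have "v' (swap 0 (unrot b w)) \<noteq> 0" using that(1) yw by (auto simp: n_def cut_def split: if_splits)
    then have "\<forall>i\<le>b. swap 0 (unrot b w) i > 0" using v' unfolding space_def by blast
    then show ?thesis using that(2) by (auto simp: swap_at unrot_at dest!: spec[of _ "Suc i"])
  qed
  then have nS: "n \<in> space {w. \<forall>i<b. w i > 0}" by (auto simp: space_def)
  have "n = (\<lambda>w. 0)"
  proof (rule Suc.IH[OF nS])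
    fix w :: "nat \<Rightarrow> int" assume w: "\<And>i. i < b \<Longrightarrow> w i < 0"
    have "n \<lhd>\<^sub>L U (inverse Q) b = cut {w. w b < 0} (y \<lhd>\<^sub>L U (inverse Q) b)"
      unfolding n_def
    proof (rule alg_cut[OF U_mem])
      fix t and w :: "nat \<Rightarrow> int" assume "t \<in> {..<b}" "w \<in> {w. w b < 0}"
      then show "swap t w \<in> {w. w b < 0}" by (cases t) (auto simp: swap_at)
    qed
    then show "(n \<lhd>\<^sub>L U (inverse Q) b) w = 0"
      using Suc.prems(2)[of w] w unfolding yU cut_def by (auto simp: less_Suc_eq)
  qed
  then have yz: "y w = 0" if "w b < 0" for w using that by (auto simp: n_def cut_def fun_eq_iff split: if_splits)
  have "v' u = 0" for u
  proof (rule ccontr)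
    assume "v' u \<noteq> 0"
    then have "u 0 > 0" using v' unfolding space_def by blast
    then have "rot b u b < 0" by (simp add: rot_def)
    from yw[of "rot b u"] yz[of "rot b u"] this \<open>v' u \<noteq> 0\<close> show False by (simp add: unrot_rot)
  qed
  then have v'0: "v \<lhd>\<^sub>L D 1 b = (\<lambda>w. 0)" by (auto simp: v'_def)
  obtain E where "D 1 b * E = 1" using A_D_inverse[of 1 b] by auto
  then have "v \<lhd>\<^sub>L D 1 b \<lhd>\<^sub>L E = v" by (metis app_simps(2,6))
  then show ?case unfolding v'0 by (simp add: app_zero)
qed

definition "negative_exactly X = {w :: nat \<Rightarrow> int. \<forall>i<d. w i < 0 \<longleftrightarrow> i \<in> X}"

text \<open>A generator moves a negative letter to the right of a nonnegative one without a correction term, because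
  the letters are increasing in the order before the swap.\<close>

lemma tf_negative_exactly:
  assumes v: "v \<in> space (negative_exactly X)" and "i \<in> X" "Suc i \<notin> X" "Suc i < d"
  shows "tf Q q (Suc i) v \<in> space (negative_exactly (insert (Suc i) (X - {i})))"
proof -
  have "w \<in> negative_exactly (insert (Suc i) (X - {i}))" if "tf Q q (Suc i) v w \<noteq> 0" for w
  proof -
    have n: "v w = 0" if "w i \<ge> w (Suc i)"
    proof (rule ccontr)
      assume "v w \<noteq> 0"
      then have "w \<in> negative_exactly X" by (rule spaceD[OF v])
      then have "w i < 0" "\<not> w (Suc i) < 0" using assms(2-4) by (auto simp: negative_exactly_def)
      then show False using that by simp
    qed
    then have "v (swap (Suc i) w) \<noteq> 0" using that by (auto simp: tf_Suc split: if_splits)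
    then have s: "swap (Suc i) w \<in> negative_exactly X" by (rule spaceD[OF v])
    show ?thesis unfolding negative_exactly_def
    proof (clarify)
      fix j assume "j < d"
      then have "swap (Suc i) w j < 0 \<longleftrightarrow> j \<in> X" "swap (Suc i) w i < 0 \<longleftrightarrow> i \<in> X" "swap (Suc i) w (Suc i) < 0 \<longleftrightarrow> Suc i \<in> X"
        using s assms(4) by (auto simp: negative_exactly_def)
      then show "w j < 0 \<longleftrightarrow> j \<in> insert (Suc i) (X - {i})" using assms(2-3)
        by (auto simp: swap_at split: if_splits)
    qed
  qed
  then show ?thesis unfolding space_def by blast
qed

lemma D_Sg:
  assumes "v \<in> space (negative_exactly X)" "{i..<i + l} \<subseteq> X" "i + l \<notin> X" "i + l < d"
  shows "v \<lhd>\<^sub>L D (Suc i) l \<in> space (negative_exactly (insert (i + l) X - {i}))"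
  using assms
proof (induction l arbitrary: v X)
  case 0 then show ?case by (auto simp: insert_Diff_if)
next
  case (Suc l)
  have il: "i + l \<in> X" using Suc.prems by auto
  have "tf Q q (Suc (i + l)) v \<in> space (negative_exactly (insert (Suc (i + l)) (X - {i + l})))"
    by (rule tf_negative_exactly) (use Suc.prems il in auto)
  then have "tf Q q (Suc (i + l)) v \<lhd>\<^sub>L D (Suc i) l
      \<in> space (negative_exactly (insert (i + l) (insert (Suc (i + l)) (X - {i + l})) - {i}))"
    by (rule Suc.IH) (use Suc.prems in auto)
  moreover have "insert (i + l) (insert (Suc (i + l)) (X - {i + l})) - {i} = insert (i + Suc l) X - {i}"
    using Suc.prems il by auto
  ultimately show ?case by (simp add: app_TT)
qed

lemma P_Sg:
  assumes "v \<in> space (negative_exactly {..<b})" "a + b \<le> d"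
  shows "v \<lhd>\<^sub>L P b a \<in> space (negative_exactly {a..<a + b})"
  using assms
proof (induction a)
  case 0 then show ?case by (simp add: atLeast0LessThan)
next
  case (Suc a)
  then have "v \<lhd>\<^sub>L P b a \<in> space (negative_exactly {a..<a + b})" by simp
  then have "v \<lhd>\<^sub>L P b a \<lhd>\<^sub>L D (Suc a) b \<in> space (negative_exactly (insert (a + b) {a..<a + b} - {a}))"
    by (rule D_Sg) (use Suc.prems in auto)
  moreover have "insert (a + b) {a..<a + b} - {a} = {Suc a..<Suc a + b}" by auto
  ultimately show ?case by simp
qed

lemma P_inverse: "\<exists>E. P b a * E = 1"
proof (induction a)
  case 0 then show ?case by (auto intro: exI[of _ 1])
next
  case (Suc a)
  then obtain E where E: "P b a * E = 1" by auto
  obtain F where F: "D (Suc a) b * F = 1" using A_D_inverse[of "Suc a" b] by auto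
  have "P b (Suc a) * (F * E) = P b a * (D (Suc a) b * F) * E" by (simp add: mult.assoc)
  then show ?case using E F by auto
qed

text \<open>
  Only the part \<open>xt\<close> of \<open>v u\<^sup>-\<close> that is negative on all of the first \<open>b\<close> places contributes to words that
  are negative on all of the last \<open>b\<close> places, since \<open>T\<^sub>w\<close> preserves the number of negative letters. On that
  part \<open>T\<^sub>w\<close> is invertible and arrives at words with nonnegative first \<open>a\<close> letters, where \<open>u\<^sup>+\<close> is injective. Hence
  \<open>xt = 0\<close>, and \<open>v = 0\<close> by \<open>U_minus_top\<close>.
\<close>

lemma h_inj:
  assumes v: "v \<in> B b" and ab: "a + b = d" and z: "v \<lhd>\<^sub>L h b a = (\<lambda>w. 0)"
  shows "v = (\<lambda>w. 0)"
proof (rule U_minus_top)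
  show "v \<in> space {w. \<forall>i<b. w i > 0}"
    by (rule space_mono[OF v[unfolded B_def]]) (use ab in \<open>auto simp: words_with_def L_def\<close>)
  define x where "x = v \<lhd>\<^sub>L U (inverse Q) b"
  have "v \<in> space {w. \<forall>i. b \<le> i \<and> i < d \<longrightarrow> w i \<ge> 0}"
    by (rule space_mono[OF v[unfolded B_def]]) (use ab in \<open>auto simp: words_with_def L_def\<close>)
  then have x: "x \<in> space {w. \<forall>i. b \<le> i \<and> i < d \<longrightarrow> w i \<ge> 0}"
    unfolding x_def
  proof (rule alg_space[OF U_mem])
    fix t and w :: "nat \<Rightarrow> int" assume "t \<in> {..<b}" "w \<in> {w. \<forall>i. b \<le> i \<and> i < d \<longrightarrow> w i \<ge> 0}"
    then show "swap t w \<in> {w. \<forall>i. b \<le> i \<and> i < d \<longrightarrow> w i \<ge> 0}" by (cases t) (auto simp: swap_at)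
  qed
  define xt where "xt = cut {w. \<forall>i<b. w i < 0} x"
  define xr where "xr = cut {w. \<not> (\<forall>i<b. w i < 0)} x"
  have xt: "xt \<in> space (negative_exactly {..<b})"
  proof -
    have "w \<in> negative_exactly {..<b}" if w: "xt w \<noteq> 0" for w
    proof -
      have n: "\<forall>i<b. w i < 0" and "x w \<noteq> 0" using w by (auto simp: xt_def cut_def split: if_splits)
      then have p: "\<forall>i. b \<le> i \<and> i < d \<longrightarrow> w i \<ge> 0" using x unfolding space_def by blast
      show ?thesis unfolding negative_exactly_def
      proof (clarify)
        fix i assume "i < d"
        then show "w i < 0 \<longleftrightarrow> i \<in> {..<b}" using n p by (cases "i < b") (auto simp: not_less)
      qed
    qed
    then show ?thesis unfolding space_def by blast
  qed
  have "negs w < b" if "xr w \<noteq> 0" for w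
  proof -
    have "x w \<noteq> 0" and n: "\<not> (\<forall>i<b. w i < 0)" using that by (auto simp: xr_def cut_def split: if_splits)
    then have "{i. i < d \<and> w i < 0} \<subset> {..<b}" using spaceD[OF x] by (force simp: not_less)
    then have "card {i. i < d \<and> w i < 0} < card {..<b}" by (intro psubset_card_mono) auto
    then show ?thesis by (simp add: negs_def)
  qed
  then have "xr \<in> space {w. negs w < b}" by (auto simp: space_def)
  then have xr: "xr \<lhd>\<^sub>L P b a \<in> space {w. negs w < b}"
    by (rule alg_space[OF P_mem]) (use ab in \<open>auto simp: negs_swap\<close>)
  have xt': "xt \<lhd>\<^sub>L P b a \<in> space (negative_exactly {a..<a + b})" by (rule P_Sg[OF xt]) (use ab in simp)
  let ?R = "{w :: nat \<Rightarrow> int. \<forall>i. a \<le> i \<and> i < d \<longrightarrow> w i < 0}"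
  have "x = (\<lambda>w. xt w + xr w)"
  proof (rule ext)
    fix w show "x w = xt w + xr w"
      by (cases "\<forall>i<b. w i < 0") (auto simp: xt_def xr_def cut_def)
  qed
  then have xP: "x \<lhd>\<^sub>L P b a = (\<lambda>w. (xt \<lhd>\<^sub>L P b a) w + (xr \<lhd>\<^sub>L P b a) w)" by (simp add: app_add)
  have "negs w \<ge> b" if "w \<in> ?R" for w
  proof -
    have "card {a..<d} \<le> card {i. i < d \<and> w i < 0}" by (rule card_mono) (use that in auto)
    then show ?thesis using ab by (simp add: negs_def)
  qed
  then have r1: "(xr \<lhd>\<^sub>L P b a) w = 0" if "w \<in> ?R" for w using xr that by (force simp: space_def)
  have r2: "(xt \<lhd>\<^sub>L P b a) w = 0" if "w \<notin> ?R" for w using xt' that ab by (auto simp: space_def negative_exactly_def)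
  have cut: "cut ?R (x \<lhd>\<^sub>L P b a) = xt \<lhd>\<^sub>L P b a"
    unfolding xP cut_def using r1 r2 by auto
  have "cut ?R (x \<lhd>\<^sub>L P b a) \<lhd>\<^sub>L U (- Q) a = cut ?R (x \<lhd>\<^sub>L P b a \<lhd>\<^sub>L U (- Q) a)"
  proof (rule alg_cut[OF U_mem])
    fix t and w :: "nat \<Rightarrow> int" assume "t \<in> {..<a}" "w \<in> ?R"
    then show "swap t w \<in> ?R" by (cases t) (auto simp: swap_at)
  qed
  also have "x \<lhd>\<^sub>L P b a \<lhd>\<^sub>L U (- Q) a = (\<lambda>w. 0)" using z by (simp add: x_def h_def)
  finally have "xt \<lhd>\<^sub>L P b a \<lhd>\<^sub>L U (- Q) a = (\<lambda>w. 0)" unfolding cut by (simp add: cut_def)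
  moreover have "xt \<lhd>\<^sub>L P b a \<in> space {w. \<forall>i<a. w i \<ge> 0}"
  proof (rule space_mono[OF xt'], clarify)
    fix w i assume "w \<in> negative_exactly {a..<a + b}" "i < a"
    then have "w i < 0 \<longleftrightarrow> i \<in> {a..<a + b}" using ab by (simp add: negative_exactly_def)
    then show "0 \<le> w i" using \<open>i < a\<close> by simp
  qed
  ultimately have xt0: "xt \<lhd>\<^sub>L P b a = (\<lambda>w. 0)" using U_plus_inj[of a] ab by simp
  obtain E where E: "P b a * E = 1" using P_inverse by blast
  then have "xt \<lhd>\<^sub>L P b a \<lhd>\<^sub>L E = xt" by (metis app_simps(2,6))
  then have "xt = (\<lambda>w. 0)" unfolding xt0 by (simp add: app_zero)
  then show "(v \<lhd>\<^sub>L U (inverse Q) b) w = 0" if "\<And>i. i < b \<Longrightarrow> w i < 0" for w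
    using that by (auto simp: xt_def cut_def x_def[symmetric] fun_eq_iff split: if_splits)
qed

end

section \<open>Endomorphisms of tensor space\<close>

text \<open>Extensional linear maps, as they occur in \<open>end_algebra\<close>.\<close>

definition lin_on :: "('b \<Rightarrow> 'k::field) set \<Rightarrow> (('b \<Rightarrow> 'k) \<Rightarrow> 'b \<Rightarrow> 'k) \<Rightarrow> bool" where
  "lin_on W f \<longleftrightarrow> f \<in> W \<rightarrow>\<^sub>E W \<and>
     (\<forall>v\<in>W. \<forall>w\<in>W. f (\<lambda>\<mu>. v \<mu> + w \<mu>) = (\<lambda>\<mu>. f v \<mu> + f w \<mu>)) \<and>
     (\<forall>c. \<forall>v\<in>W. f (\<lambda>\<mu>. c * v \<mu>) = (\<lambda>\<mu>. c * f v \<mu>))"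

lemma end_algebra_carrier:
  "f \<in> carrier (end_algebra W H act) \<longleftrightarrow> lin_on W f \<and> (\<forall>h\<in>H. \<forall>v\<in>W. f (act v h) = act (f v) h)"
  unfolding end_algebra_def lin_on_def by auto

lemma end_algebra_ops:
  "f \<otimes>\<^bsub>end_algebra W H act\<^esub> g = compose W f g"
  "\<one>\<^bsub>end_algebra W H act\<^esub> = (\<lambda>v\<in>W. v)"
  "\<zero>\<^bsub>end_algebra W H act\<^esub> = (\<lambda>v\<in>W. \<lambda>\<mu>. 0)"
  "f \<oplus>\<^bsub>end_algebra W H act\<^esub> g = (\<lambda>v\<in>W. \<lambda>\<mu>. f v \<mu> + g v \<mu>)"
  "c \<odot>\<^bsub>end_algebra W H act\<^esub> f = (\<lambda>v\<in>W. \<lambda>\<mu>. c * f v \<mu>)"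
  by (simp_all add: end_algebra_def)

lemma lin_on_mem: "lin_on W f \<Longrightarrow> v \<in> W \<Longrightarrow> f v \<in> W"
  by (auto simp: lin_on_def)

lemma lin_on_add: "lin_on W f \<Longrightarrow> v \<in> W \<Longrightarrow> w \<in> W \<Longrightarrow> f (\<lambda>\<mu>. v \<mu> + w \<mu>) = (\<lambda>\<mu>. f v \<mu> + f w \<mu>)"
  by (auto simp: lin_on_def)

lemma lin_on_scale: "lin_on W f \<Longrightarrow> v \<in> W \<Longrightarrow> f (\<lambda>\<mu>. c * v \<mu>) = (\<lambda>\<mu>. c * f v \<mu>)"
  by (auto simp: lin_on_def)

lemma lin_on_zero: "lin_on (space S) f \<Longrightarrow> f (\<lambda>\<mu>. 0) = (\<lambda>\<mu>. 0)"
  using lin_on_scale[OF _ space_zero, of S f 0] by simp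

lemma lin_on_sum_list:
  assumes "lin_on (space S) f" "\<And>t. t \<in> set ts \<Longrightarrow> F t \<in> space S"
  shows "(\<lambda>w. \<Sum>t\<leftarrow>ts. F t w) \<in> space S \<and> f (\<lambda>w. \<Sum>t\<leftarrow>ts. F t w) = (\<lambda>w. \<Sum>t\<leftarrow>ts. f (F t) w)"
  using assms(2)
  by (induction ts) (auto simp: lin_on_zero[OF assms(1)] lin_on_add[OF assms(1)] space_zero space_add)

definition endW :: "((nat \<Rightarrow> int) \<Rightarrow> 'k::field) set \<Rightarrow> nat set \<Rightarrow> 'k \<Rightarrow> 'k
    \<Rightarrow> ('k, ((nat \<Rightarrow> int) \<Rightarrow> 'k) \<Rightarrow> (nat \<Rightarrow> int) \<Rightarrow> 'k) module" where
  "endW W X Q q = end_algebra W X (\<lambda>v t. v \<lhd>\<^sub>L TT Q q t)"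

context words
begin

abbreviation "HH a \<equiv> h (d - a) a"

lemma HH_mem: "a \<le> d \<Longrightarrow> HH a \<in> alg (TQ ` {..<d})"
  using h_mem[of "d - a" a] by simp

text \<open>The inverse of \<open>v \<mapsto> v h\<close> on its image.\<close>

definition "divide_h a u = (THE v. v \<in> B (d - a) \<and> v \<lhd>\<^sub>L HH a = u)"

lemma HH_inj: assumes "a \<le> d" "v \<in> B (d - a)" "v' \<in> B (d - a)" "v \<lhd>\<^sub>L HH a = v' \<lhd>\<^sub>L HH a"
  shows "v = v'"
proof -
  let ?u = "\<lambda>w. v w + (- 1) * v' w"
  have uB: "?u \<in> B (d - a)" using assms unfolding B_def by (intro space_add space_scale)
  have uz: "?u \<lhd>\<^sub>L HH a = (\<lambda>w. 0)"
    using assms(4) by (simp only: app_add app_scale) simp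
  have "?u = (\<lambda>w. 0)" by (rule h_inj[OF uB _ uz]) (use assms(1) in simp)
  then show ?thesis by (simp add: fun_eq_iff)
qed

lemma divide_h: assumes "a \<le> d" "m \<in> M"
  shows "divide_h a (m \<lhd>\<^sub>L HH a) \<in> B (d - a)" "divide_h a (m \<lhd>\<^sub>L HH a) \<lhd>\<^sub>L HH a = m \<lhd>\<^sub>L HH a"
proof -
  obtain v where "v \<in> B (d - a)" "m \<lhd>\<^sub>L HH a = v \<lhd>\<^sub>L HH a"
    using span_h[of a "d - a" m] assms by auto
  then have "\<exists>!v. v \<in> B (d - a) \<and> v \<lhd>\<^sub>L HH a = m \<lhd>\<^sub>L HH a" using HH_inj[OF assms(1)] by metis
  from theI'[OF this] show "divide_h a (m \<lhd>\<^sub>L HH a) \<in> B (d - a)" "divide_h a (m \<lhd>\<^sub>L HH a) \<lhd>\<^sub>L HH a = m \<lhd>\<^sub>L HH a"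
    unfolding divide_h_def by auto
qed

lemma divide_h_eq: "a \<le> d \<Longrightarrow> v \<in> B (d - a) \<Longrightarrow> divide_h a (v \<lhd>\<^sub>L HH a) = v"
  using divide_h[of a v] HH_inj[of a "divide_h a (v \<lhd>\<^sub>L HH a)" v] B_M by blast

lemma T_HH: assumes "a \<le> d" "i \<in> {1..<d} - {d - a}"
  shows "\<exists>j<d. TQ i * HH a = HH a * TQ j"
proof (cases "i < d - a")
  case True then show ?thesis using T_h_low[of i "d - a" a] assms by (intro exI[of _ "i + a"]) auto
next
  case False
  then show ?thesis using T_h_high[of "i - (d - a)" a "d - a"] assms
    by (intro exI[of _ "i - (d - a)"]) auto
qed

lemma end_commute:
  assumes f: "f \<in> carrier (endW M {..<d} Q q)" and x: "x \<in> alg (TQ ` {..<d})" and v: "v \<in> M"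
  shows "f (v \<lhd>\<^sub>L x) = f v \<lhd>\<^sub>L x"
  using x v
proof (induction arbitrary: v)
  case (gen x) then show ?case using f by (auto simp: endW_def end_algebra_carrier)
next
  case (sc c) then show ?case using f by (auto simp: endW_def end_algebra_carrier lin_on_scale)
next
  case (add x y)
  then show ?case using f M_alg[OF add.prems add.hyps(1)] M_alg[OF add.prems add.hyps(2)]
    by (auto simp: endW_def end_algebra_carrier lin_on_add)
next
  case (mult x y)
  then show ?case using M_alg[OF mult.prems mult.hyps(1)] by simp
qed

lemma parabolic_commute:
  assumes f: "f \<in> carrier (endW (B b) ({1..<d} - {b}) Q q)" and x: "x \<in> parabolic b d" and v: "v \<in> B b"
  shows "f (v \<lhd>\<^sub>L x) = f v \<lhd>\<^sub>L x"
  using x[unfolded parabolic_def] v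
proof (induction arbitrary: v)
  case (gen x) then show ?case using f by (auto simp: endW_def end_algebra_carrier)
next
  case (sc c) then show ?case using f by (auto simp: endW_def end_algebra_carrier lin_on_scale)
next
  case (add x y)
  then show ?case using f B_alg[OF add.prems, of x] B_alg[OF add.prems, of y]
    by (auto simp: endW_def end_algebra_carrier lin_on_add parabolic_def)
next
  case (mult x y)
  then show ?case using B_alg[OF mult.prems, of x] by (simp add: parabolic_def)
qed

text \<open>The tuple of maps that an endomorphism induces on the spaces \<open>B\<close>, by transport along \<open>v \<mapsto> v h\<close>.\<close>

definition "Phi f = (\<lambda>a\<in>{0..d}. \<lambda>v\<in>B (d - a). divide_h a (f (v \<lhd>\<^sub>L HH a)))"

lemma Phi:
  assumes f: "f \<in> carrier (endW M {..<d} Q q)" and a: "a \<le> d" and v: "v \<in> B (d - a)"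
  shows "Phi f a v \<in> B (d - a)" "Phi f a v \<lhd>\<^sub>L HH a = f (v \<lhd>\<^sub>L HH a)"
proof -
  have vM: "v \<in> M" by (rule B_M[OF v])
  have fv: "f v \<in> M" using f vM by (auto simp: endW_def end_algebra_carrier lin_on_mem)
  have "f (v \<lhd>\<^sub>L HH a) = f v \<lhd>\<^sub>L HH a" by (rule end_commute[OF f HH_mem[OF a] vM])
  moreover have "Phi f a v = divide_h a (f (v \<lhd>\<^sub>L HH a))" using a v by (simp add: Phi_def)
  ultimately show "Phi f a v \<in> B (d - a)" "Phi f a v \<lhd>\<^sub>L HH a = f (v \<lhd>\<^sub>L HH a)"
    using divide_h[OF a fv] by simp_all
qed

lemma Phi_eqI:
  assumes "f \<in> carrier (endW M {..<d} Q q)" "a \<le> d" "v \<in> B (d - a)" "u \<in> B (d - a)"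
    and "u \<lhd>\<^sub>L HH a = f (v \<lhd>\<^sub>L HH a)"
  shows "Phi f a v = u"
  by (rule HH_inj[OF assms(2) Phi(1)[OF assms(1-3)] assms(4)]) (simp add: Phi(2)[OF assms(1-3)] assms(5))

lemma Phi_carrier:
  assumes f: "f \<in> carrier (endW M {..<d} Q q)" and a: "a \<le> d"
  shows "Phi f a \<in> carrier (endW (B (d - a)) ({1..<d} - {d - a}) Q q)"
  unfolding endW_def end_algebra_carrier lin_on_def
proof (intro conjI ballI allI)
  have lf: "lin_on M f" using f by (auto simp: endW_def end_algebra_carrier)
  have HM: "v \<lhd>\<^sub>L HH a \<in> M" if "v \<in> B (d - a)" for v using M_alg[OF B_M HH_mem[OF a]] that .
  show "Phi f a \<in> B (d - a) \<rightarrow>\<^sub>E B (d - a)"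
    using Phi(1)[OF f a] a by (auto simp: PiE_def extensional_def Phi_def)
  fix v assume v: "v \<in> B (d - a)"
  { fix w assume w: "w \<in> B (d - a)"
    show "Phi f a (\<lambda>\<mu>. v \<mu> + w \<mu>) = (\<lambda>\<mu>. Phi f a v \<mu> + Phi f a w \<mu>)"
      by (rule Phi_eqI[OF f a]) (use v w Phi[OF f a] lf HM in
          \<open>auto simp: app_add lin_on_add B_def intro!: space_add\<close>) }
  { fix c
    show "Phi f a (\<lambda>\<mu>. c * v \<mu>) = (\<lambda>\<mu>. c * Phi f a v \<mu>)"
      by (rule Phi_eqI[OF f a]) (use v Phi[OF f a] lf HM in
          \<open>auto simp: app_scale lin_on_scale B_def intro!: space_scale\<close>) }
  fix i assume i: "i \<in> {1..<d} - {d - a}"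
  obtain j where j: "j < d" "TQ i * HH a = HH a * TQ j" using T_HH[OF a i] by auto
  have parabolic: "TQ i \<in> parabolic (d - a) d" unfolding parabolic_def using i by (intro alg.gen imageI)
  have "Phi f a v \<lhd>\<^sub>L TQ i \<lhd>\<^sub>L HH a = Phi f a v \<lhd>\<^sub>L HH a \<lhd>\<^sub>L TQ j"
    using j(2) by (metis app_simps(6))
  also have "\<dots> = f (v \<lhd>\<^sub>L HH a \<lhd>\<^sub>L TQ j)"
    unfolding Phi(2)[OF f a v] using j(1) by (intro end_commute[OF f _ HM[OF v], symmetric] alg.gen) auto
  also have "v \<lhd>\<^sub>L HH a \<lhd>\<^sub>L TQ j = v \<lhd>\<^sub>L TQ i \<lhd>\<^sub>L HH a"
    using j(2) by (metis app_simps(6))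
  finally show "Phi f a (v \<lhd>\<^sub>L TQ i) = Phi f a v \<lhd>\<^sub>L TQ i"
    by (intro Phi_eqI[OF f a] B_alg[OF v parabolic] B_alg[OF Phi(1)[OF f a v] parabolic])
qed

lemma one_full: "1 \<in> full d"
  using one_in_full[of d] sep by blast

text \<open>Endomorphisms that agree on all \<open>M h\<close> agree on \<open>M h y\<close> for all \<open>y\<close>, hence on \<open>M\<close>, since the elements
  \<open>x h y\<close> sum to \<open>1\<close>.\<close>

lemma Phi_inj:
  assumes f: "f \<in> carrier (endW M {..<d} Q q)" and g: "g \<in> carrier (endW M {..<d} Q q)" and e: "Phi f = Phi g"
  shows "f = g"
proof -
  have lf: "lin_on M f" and lg: "lin_on M g" using f g by (auto simp: endW_def end_algebra_carrier)
  have H: "f (m \<lhd>\<^sub>L HH a) = g (m \<lhd>\<^sub>L HH a)" if a: "a \<le> d" and m: "m \<in> M" for a m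
  proof -
    obtain v where v: "v \<in> B (d - a)" "m \<lhd>\<^sub>L HH a = v \<lhd>\<^sub>L HH a"
      using span_h[of a "d - a" m] a m by auto
    show ?thesis using Phi(2)[OF f a v(1)] Phi(2)[OF g a v(1)] e v(2) by simp
  qed
  define R where "R z = (\<forall>m \<in> M. m \<lhd>\<^sub>L z \<in> M \<and> f (m \<lhd>\<^sub>L z) = g (m \<lhd>\<^sub>L z))" for z
  have "R 1" using one_full[unfolded full_def]
  proof (rule sums_induct_add)
    show "R 0" using lin_on_zero lf lg space_zero unfolding R_def M_def by auto
    show "R (x + y)" if "R x" "R y" for x y
      using that lf lg unfolding R_def by (auto simp: lin_on_add) (auto simp: M_def space_add)
    fix z assume "z \<in> {x * h b a * y | x y a b. a + b = d \<and> x \<in> alg (TQ ` {..<d}) \<and> y \<in> alg (TQ ` {..<d})}"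
    then obtain x y a b where z: "z = x * h b a * y" "a + b = d" "x \<in> alg (TQ ` {..<d})" "y \<in> alg (TQ ` {..<d})"
      by blast
    have b: "b = d - a" "a \<le> d" using z(2) by auto
    show "R z" unfolding R_def
    proof
      fix m assume m: "m \<in> M"
      have 1: "m \<lhd>\<^sub>L x \<in> M" by (rule M_alg[OF m z(3)])
      have 2: "m \<lhd>\<^sub>L x \<lhd>\<^sub>L HH a \<in> M" by (rule M_alg[OF 1 HH_mem[OF b(2)]])
      show "m \<lhd>\<^sub>L z \<in> M \<and> f (m \<lhd>\<^sub>L z) = g (m \<lhd>\<^sub>L z)"
        unfolding z(1) b(1) app_simps end_commute[OF f z(4) 2] end_commute[OF g z(4) 2] H[OF b(2) 1]
        using M_alg[OF 2 z(4)] by simp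
    qed
  qed
  then have "f m = g m" if "m \<in> M" for m using that by (auto simp: R_def)
  then show ?thesis using lf lg unfolding lin_on_def by (intro PiE_ext[of f M "\<lambda>_. M" g]) auto
qed

text \<open>With \<open>1 = \<Sum> x h y\<close>, put \<open>f m = \<Sum> G(m x h) y\<close>, where \<open>G\<close> is transported to \<open>M h\<close>. The sandwich property says
  precisely that \<open>G\<close> is compatible with \<open>h x h'\<close>; so \<open>f\<close> restricts to \<open>G\<close> on each \<open>M h\<close> and commutes with \<open>H\<close>.\<close>

lemma Phi_surj:
  assumes G: "\<And>a. a \<le> d \<Longrightarrow> G a \<in> carrier (endW (B (d - a)) ({1..<d} - {d - a}) Q q)"
  shows "\<exists>f \<in> carrier (endW M {..<d} Q q). \<forall>a\<le>d. Phi f a = G a"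
proof -
  have lG: "lin_on (B (d - a)) (G a)" if "a \<le> d" for a using G[OF that] by (auto simp: endW_def end_algebra_carrier)
  define GG where "GG a u = G a (divide_h a u) \<lhd>\<^sub>L HH a" for a u
  have GG: "GG a (v \<lhd>\<^sub>L HH a) = G a v \<lhd>\<^sub>L HH a" if "a \<le> d" "v \<in> B (d - a)" for a v
    using divide_h_eq[OF that] by (simp add: GG_def)
  obtain zs where zs: "set zs \<subseteq> {x * h b a * y | x y a b. a + b = d \<and> x \<in> alg (TQ ` {..<d}) \<and> y \<in> alg (TQ ` {..<d})}"
      "1 = sum_list zs"
    using sums_sum_list[OF one_full[unfolded full_def]] by auto
  define ok where "ok t = (case t of (x, a, y) \<Rightarrow> a \<le> d \<and> x \<in> alg (TQ ` {..<d}) \<and> y \<in> alg (TQ ` {..<d}))" for t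
  define el where "el t = (case t of (x, a, y) \<Rightarrow> x * HH a * y)" for t
  have "\<exists>ts. (\<forall>t \<in> set ts. ok t) \<and> zs = map el ts" using zs(1)
  proof (induction zs)
    case (Cons z zs)
    then obtain ts where ts: "\<forall>t \<in> set ts. ok t" "zs = map el ts" by auto
    obtain x y a b where z: "z = x * h b a * y" "a + b = d" "x \<in> alg (TQ ` {..<d})" "y \<in> alg (TQ ` {..<d})"
      using Cons.prems by auto
    have "b = d - a" "a \<le> d" using z(2) by auto
    then have "el (x, a, y) = z" "ok (x, a, y)" using z by (auto simp: el_def ok_def)
    then show ?case using ts by (intro exI[of _ "(x, a, y) # ts"]) auto
  qed auto
  then obtain ts where ts: "\<And>t. t \<in> set ts \<Longrightarrow> ok t" "zs = map el ts" by auto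
  have one: "(\<lambda>w. \<Sum>t\<leftarrow>ts. (v \<lhd>\<^sub>L el t) w) = v" for v
    using app_sum_list[of v zs] zs(2) unfolding ts(2) by (simp add: o_def)
  define fm where "fm m t = (case t of (x, a, y) \<Rightarrow> GG a (m \<lhd>\<^sub>L x \<lhd>\<^sub>L HH a) \<lhd>\<^sub>L y)" for m t
  define f where "f = (\<lambda>m\<in>M. \<lambda>w. \<Sum>t\<leftarrow>ts. fm m t w)"
  have uform: "\<exists>v \<in> B (d - a). m \<lhd>\<^sub>L HH a = v \<lhd>\<^sub>L HH a" if "a \<le> d" "m \<in> M" for a m
    using span_h[of a "d - a" m] that by auto
  have GG_M: "GG a (m \<lhd>\<^sub>L HH a) \<in> M" if a: "a \<le> d" and m: "m \<in> M" for a m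
  proof -
    obtain v where v: "v \<in> B (d - a)" "m \<lhd>\<^sub>L HH a = v \<lhd>\<^sub>L HH a" using uform[OF a m] by blast
    show ?thesis unfolding v(2) GG[OF a v(1)]
      by (rule M_alg[OF B_M[OF lin_on_mem[OF lG[OF a] v(1)]] HH_mem[OF a]])
  qed
  have GG_lin: "GG a ((\<lambda>w. m w + c * m' w) \<lhd>\<^sub>L HH a) = (\<lambda>w. GG a (m \<lhd>\<^sub>L HH a) w + c * GG a (m' \<lhd>\<^sub>L HH a) w)"
    if a: "a \<le> d" and m: "m \<in> M" "m' \<in> M" for a m m' c
  proof -
    obtain v where v: "v \<in> B (d - a)" "m \<lhd>\<^sub>L HH a = v \<lhd>\<^sub>L HH a" using uform[OF a m(1)] by blast
    obtain v' where v': "v' \<in> B (d - a)" "m' \<lhd>\<^sub>L HH a = v' \<lhd>\<^sub>L HH a" using uform[OF a m(2)] by blast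
    have cv: "(\<lambda>w. c * v' w) \<in> B (d - a)" using v'(1) unfolding B_def by (rule space_scale)
    have s: "(\<lambda>w. v w + c * v' w) \<in> B (d - a)" using v(1) cv unfolding B_def by (rule space_add)
    have "(\<lambda>w. m w + c * m' w) \<lhd>\<^sub>L HH a = (\<lambda>w. v w + c * v' w) \<lhd>\<^sub>L HH a"
      by (simp only: app_add app_scale v(2) v'(2))
    then show ?thesis
      unfolding v(2) v'(2) using GG[OF a s] GG[OF a v(1)] GG[OF a v'(1)]
        lin_on_add[OF lG[OF a] v(1) cv] lin_on_scale[OF lG[OF a] v'(1)]
      by (simp only: app_add app_scale)
  qed
  have fm_M: "fm m t \<in> M" if "m \<in> M" "t \<in> set ts" for m t
    using that(1) ts(1)[OF that(2)] by (auto simp: fm_def ok_def split: prod.splits intro!: M_alg GG_M)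
  have fm_lin: "fm (\<lambda>w. m w + c * m' w) t = (\<lambda>w. fm m t w + c * fm m' t w)" if m: "m \<in> M" "m' \<in> M" and tt: "t \<in> set ts" for m m' c t
  proof -
    obtain x a y where t: "t = (x, a, y)" "a \<le> d" "x \<in> alg (TQ ` {..<d})"
      using ts(1)[OF tt] by (cases t) (auto simp: ok_def)
    have e: "(\<lambda>w. m w + c * m' w) \<lhd>\<^sub>L x = (\<lambda>w. (m \<lhd>\<^sub>L x) w + c * (m' \<lhd>\<^sub>L x) w)" by (simp only: app_add app_scale)
    show ?thesis unfolding fm_def t(1) prod.case e
      unfolding GG_lin[OF t(2) M_alg[OF m(1) t(3)] M_alg[OF m(2) t(3)]]
      unfolding app_add app_scale ..
  qed
  have sum_M: "(\<lambda>w. \<Sum>t\<leftarrow>us. F t w) \<in> M" if "\<And>t. t \<in> set us \<Longrightarrow> F t \<in> M" for F and us :: "((nat \<Rightarrow> int, 'k) linop \<times> nat \<times> (nat \<Rightarrow> int, 'k) linop) list"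
    using that unfolding M_def by (induction us) (auto simp: space_zero space_add)
  have f_lin: "f (\<lambda>w. m w + c * m' w) = (\<lambda>w. f m w + c * f m' w)" if m: "m \<in> M" "m' \<in> M" for m m' c
  proof -
    have cm: "(\<lambda>w. m w + c * m' w) \<in> M" using m unfolding M_def by (intro space_add space_scale)
    have "(\<Sum>t\<leftarrow>us. fm (\<lambda>w. m w + c * m' w) t w) = (\<Sum>t\<leftarrow>us. fm m t w) + c * (\<Sum>t\<leftarrow>us. fm m' t w)"
      if "set us \<subseteq> set ts" for us w
      using that by (induction us) (auto simp: fm_lin[OF m] algebra_simps)
    then show ?thesis using m cm by (simp add: f_def)
  qed
  have zM: "(\<lambda>w. 0) \<in> M" unfolding M_def by (rule space_zero)
  have f0: "f (\<lambda>w. 0) = (\<lambda>w. 0)" using f_lin[OF zM zM, of "- 1"] by (simp add: fun_eq_iff)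
  have lf: "lin_on M f"
    unfolding lin_on_def
  proof (intro conjI ballI allI)
    show "f \<in> M \<rightarrow>\<^sub>E M" unfolding f_def using sum_M[of ts] fm_M by auto
    show "f (\<lambda>\<mu>. v \<mu> + w \<mu>) = (\<lambda>\<mu>. f v \<mu> + f w \<mu>)" if "v \<in> M" "w \<in> M" for v w
      using f_lin[OF that, of 1] by simp
    show "f (\<lambda>\<mu>. c * v \<mu>) = (\<lambda>\<mu>. c * f v \<mu>)" if "v \<in> M" for c v
      using f_lin[OF zM that, of c] f0 by simp
  qed
  have compat: "GG a (m \<lhd>\<^sub>L HH a) \<lhd>\<^sub>L x \<lhd>\<^sub>L HH a' = GG a' (m \<lhd>\<^sub>L HH a \<lhd>\<^sub>L x \<lhd>\<^sub>L HH a')"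
    if a: "a \<le> d" "a' \<le> d" and m: "m \<in> M" and x: "x \<in> alg (TQ ` {..<d})" for a a' m x
  proof -
    obtain v where v: "v \<in> B (d - a)" "m \<lhd>\<^sub>L HH a = v \<lhd>\<^sub>L HH a" using uform[OF a(1) m] by blast
    have Gv: "G a v \<in> B (d - a)" by (rule lin_on_mem[OF lG[OF a(1)] v(1)])
    show ?thesis
    proof (cases "a = a'")
      case True
      obtain y where y: "y \<in> parabolic (d - a) d" "HH a * x * HH a = y * HH a"
        using h_x_h_same[OF x, of a "d - a"] a by auto
      have "u \<lhd>\<^sub>L HH a \<lhd>\<^sub>L x \<lhd>\<^sub>L HH a = u \<lhd>\<^sub>L y \<lhd>\<^sub>L HH a" for u using y(2) by (metis app_simps(6))
      then show ?thesis unfolding True[symmetric] v(2) GG[OF a(1) v(1)]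
        using GG[OF a(1) B_alg[OF v(1) y(1)]] parabolic_commute[OF G[OF a(1)] y(1) v(1)] by simp
    next
      case False
      have z: "HH a * x * HH a' = 0" using h_x_h_zero[OF x, of a "d - a" a' "d - a'"] a False by auto
      have u0: "u \<lhd>\<^sub>L HH a \<lhd>\<^sub>L x \<lhd>\<^sub>L HH a' = (\<lambda>w. 0)" for u using z by (metis app_simps(1,6))
      have zB: "(\<lambda>w. 0) \<in> B (d - a')" unfolding B_def by (rule space_zero)
      have "GG a' (\<lambda>w. 0) = (\<lambda>w. 0)"
        using GG[OF a(2) zB] lin_on_zero[OF lG[OF a(2), unfolded B_def]] by (simp add: app_zero)
      then show ?thesis unfolding v(2) GG[OF a(1) v(1)] u0 by simp
    qed
  qed
  (* applied to an element of M h z, the defining sum of f collapses,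
     because compat moves G past x h, and the elements x h y add up to 1 *)
  have key: "f (m \<lhd>\<^sub>L HH a \<lhd>\<^sub>L z) = GG a (m \<lhd>\<^sub>L HH a) \<lhd>\<^sub>L z"
    if a: "a \<le> d" and m: "m \<in> M" and z: "z \<in> alg (TQ ` {..<d})" for a m z
  proof -
    have zM: "m \<lhd>\<^sub>L HH a \<lhd>\<^sub>L z \<in> M" by (rule M_alg[OF M_alg[OF m HH_mem[OF a]] z])
    have "fm (m \<lhd>\<^sub>L HH a \<lhd>\<^sub>L z) t = GG a (m \<lhd>\<^sub>L HH a) \<lhd>\<^sub>L z \<lhd>\<^sub>L el t" if t: "t \<in> set ts" for t
    proof -
      obtain x a' y where t: "t = (x, a', y)" "a' \<le> d" "x \<in> alg (TQ ` {..<d})"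
        using ts(1)[OF t] by (cases t) (auto simp: ok_def)
      have "GG a' (m \<lhd>\<^sub>L HH a \<lhd>\<^sub>L z \<lhd>\<^sub>L x \<lhd>\<^sub>L HH a') = GG a (m \<lhd>\<^sub>L HH a) \<lhd>\<^sub>L z \<lhd>\<^sub>L x \<lhd>\<^sub>L HH a'"
        using compat[OF a t(2) m alg.mult[OF z t(3)]] by simp
      then show ?thesis by (simp add: fm_def el_def t(1))
    qed
    then have "(\<Sum>t\<leftarrow>ts. fm (m \<lhd>\<^sub>L HH a \<lhd>\<^sub>L z) t w) = (\<Sum>t\<leftarrow>ts. (GG a (m \<lhd>\<^sub>L HH a) \<lhd>\<^sub>L z \<lhd>\<^sub>L el t) w)" for w
      by (intro arg_cong[where f = sum_list] map_cong) auto
    then show ?thesis using zM one[of "GG a (m \<lhd>\<^sub>L HH a) \<lhd>\<^sub>L z"] by (simp add: f_def)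
  qed
  have fc: "f \<in> carrier (endW M {..<d} Q q)"
    unfolding endW_def end_algebra_carrier
  proof (intro conjI ballI lf)
    fix i v assume i: "i \<in> {..<d}" and v: "v \<in> M"
    have Ti: "TQ i \<in> alg (TQ ` {..<d})" using i by (intro alg.gen imageI)
    have el: "f (v \<lhd>\<^sub>L el t \<lhd>\<^sub>L TQ i) = fm v t \<lhd>\<^sub>L TQ i" "v \<lhd>\<^sub>L el t \<lhd>\<^sub>L TQ i \<in> M" if t: "t \<in> set ts" for t
    proof -
      obtain x a y where t: "t = (x, a, y)" "a \<le> d" "x \<in> alg (TQ ` {..<d})" "y \<in> alg (TQ ` {..<d})"
        using ts(1)[OF t] by (cases t) (auto simp: ok_def)
      show "f (v \<lhd>\<^sub>L el t \<lhd>\<^sub>L TQ i) = fm v t \<lhd>\<^sub>L TQ i"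
        using key[OF t(2) M_alg[OF v t(3)] alg.mult[OF t(4) Ti]] by (simp add: el_def fm_def t(1))
      show "v \<lhd>\<^sub>L el t \<lhd>\<^sub>L TQ i \<in> M"
        using M_alg[OF M_alg[OF M_alg[OF M_alg[OF v t(3)] HH_mem[OF t(2)]] t(4)] Ti] by (simp add: el_def t(1))
    qed
    have app_sum: "(\<lambda>w. \<Sum>t\<leftarrow>us. F t w) \<lhd>\<^sub>L x = (\<lambda>w. \<Sum>t\<leftarrow>us. (F t \<lhd>\<^sub>L x) w)"
      for F x and us :: "((nat \<Rightarrow> int, 'k) linop \<times> nat \<times> (nat \<Rightarrow> int, 'k) linop) list"
      by (induction us) (simp_all add: app_zero app_add)
    have "v \<lhd>\<^sub>L TQ i = (\<lambda>w. \<Sum>t\<leftarrow>ts. (v \<lhd>\<^sub>L el t \<lhd>\<^sub>L TQ i) w)"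
      using app_sum[of "\<lambda>t. v \<lhd>\<^sub>L el t" ts "TQ i"] one[of v] by simp
    then have "f (v \<lhd>\<^sub>L TQ i) = (\<lambda>w. \<Sum>t\<leftarrow>ts. f (v \<lhd>\<^sub>L el t \<lhd>\<^sub>L TQ i) w)"
      using lin_on_sum_list[OF lf[unfolded M_def], of ts "\<lambda>t. v \<lhd>\<^sub>L el t \<lhd>\<^sub>L TQ i"] el(2) unfolding M_def by simp
    also have "\<dots> = (\<lambda>w. \<Sum>t\<leftarrow>ts. (fm v t \<lhd>\<^sub>L TQ i) w)"
      using el(1) by (intro ext arg_cong[where f = sum_list] map_cong) auto
    also have "\<dots> = f v \<lhd>\<^sub>L TQ i" using app_sum[of "fm v" ts "TQ i"] v by (simp add: f_def)
    finally show "f (v \<lhd>\<^sub>L TQ i) = f v \<lhd>\<^sub>L TQ i" .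
  qed
  moreover have "Phi f a = G a" if a: "a \<le> d" for a
  proof (rule PiE_ext)
    show "Phi f a \<in> B (d - a) \<rightarrow>\<^sub>E B (d - a)"
      using Phi_carrier[OF fc a] by (auto simp: endW_def end_algebra_carrier lin_on_def)
    show "G a \<in> B (d - a) \<rightarrow>\<^sub>E B (d - a)" using lG[OF a] by (auto simp: lin_on_def)
    fix v assume v: "v \<in> B (d - a)"
    show "Phi f a v = G a v"
      by (rule Phi_eqI[OF fc a v lin_on_mem[OF lG[OF a] v]])
        (use key[OF a B_M[OF v] alg_one] GG[OF a v] in simp)
  qed
  ultimately show ?thesis by blast
qed

lemma Phi_restrict:
  assumes "\<And>a v. a \<le> d \<Longrightarrow> v \<in> B (d - a) \<Longrightarrow> G a v \<in> B (d - a) \<and> F (v \<lhd>\<^sub>L HH a) = G a v \<lhd>\<^sub>L HH a"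
  shows "Phi F = (\<lambda>a\<in>{0..d}. \<lambda>v\<in>B (d - a). G a v)"
  unfolding Phi_def using assms by (intro restrict_ext) (auto simp: divide_h_eq)

lemma Phi_iso:
  "Phi \<in> kalg_iso (endW M {..<d} Q q)
     (direct_sum_algebra {0..d} (\<lambda>a. endW (B (d - a)) ({1..<d} - {d - a}) Q q))"
proof -
  let ?E = "endW M {..<d} Q q" and ?C = "\<lambda>a. endW (B (d - a)) ({1..<d} - {d - a}) Q q"
  let ?D = "direct_sum_algebra {0..d} ?C"
  have HM: "v \<lhd>\<^sub>L HH a \<in> M" if "a \<le> d" "v \<in> B (d - a)" for a v
    using M_alg[OF B_M[OF that(2)] HH_mem[OF that(1)]] .
  have car: "Phi f \<in> carrier ?D" if "f \<in> carrier ?E" for f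
    using Phi_carrier[OF that] unfolding direct_sum_algebra_def by (auto simp: Phi_def)
  have mult: "Phi (f \<otimes>\<^bsub>?E\<^esub> g) = Phi f \<otimes>\<^bsub>?D\<^esub> Phi g" if f: "f \<in> carrier ?E" and g: "g \<in> carrier ?E" for f g
  proof -
    have "Phi (compose M f g) = (\<lambda>a\<in>{0..d}. \<lambda>v\<in>B (d - a). Phi f a (Phi g a v))"
      using Phi[OF f] Phi[OF g] HM by (intro Phi_restrict) (simp add: compose_def)
    then show ?thesis
      by (simp add: direct_sum_algebra_def endW_def end_algebra_ops compose_def cong: restrict_cong)
  qed
  have add: "Phi (f \<oplus>\<^bsub>?E\<^esub> g) = Phi f \<oplus>\<^bsub>?D\<^esub> Phi g" if f: "f \<in> carrier ?E" and g: "g \<in> carrier ?E" for f g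
  proof -
    have "Phi (\<lambda>v\<in>M. \<lambda>\<mu>. f v \<mu> + g v \<mu>) = (\<lambda>a\<in>{0..d}. \<lambda>v\<in>B (d - a). \<lambda>\<mu>. Phi f a v \<mu> + Phi g a v \<mu>)"
      using Phi[OF f] Phi[OF g] HM by (intro Phi_restrict) (simp add: app_add B_def space_add)
    then show ?thesis
      by (simp add: direct_sum_algebra_def endW_def end_algebra_ops cong: restrict_cong)
  qed
  have smult: "Phi (c \<odot>\<^bsub>?E\<^esub> f) = c \<odot>\<^bsub>?D\<^esub> Phi f" if f: "f \<in> carrier ?E" for c f
  proof -
    have "Phi (\<lambda>v\<in>M. \<lambda>\<mu>. c * f v \<mu>) = (\<lambda>a\<in>{0..d}. \<lambda>v\<in>B (d - a). \<lambda>\<mu>. c * Phi f a v \<mu>)"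
      using Phi[OF f] HM by (intro Phi_restrict) (simp add: app_scale B_def space_scale)
    then show ?thesis
      by (simp add: direct_sum_algebra_def endW_def end_algebra_ops cong: restrict_cong)
  qed
  have one: "Phi \<one>\<^bsub>?E\<^esub> = \<one>\<^bsub>?D\<^esub>"
  proof -
    have "Phi (\<lambda>v\<in>M. v) = (\<lambda>a\<in>{0..d}. \<lambda>v\<in>B (d - a). v)"
      using HM by (intro Phi_restrict) simp
    then show ?thesis
      by (simp add: direct_sum_algebra_def endW_def end_algebra_ops cong: restrict_cong)
  qed
  have surj: "G \<in> Phi ` carrier ?E" if G: "G \<in> carrier ?D" for G
  proof -
    have "G a \<in> carrier (?C a)" if "a \<le> d" for a using G that by (auto simp: direct_sum_algebra_def)
    then obtain f where f: "f \<in> carrier ?E" "\<forall>a\<le>d. Phi f a = G a" using Phi_surj by blast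
    have "Phi f = G"
    proof
      fix a show "Phi f a = G a"
        using f(2) G by (cases "a \<le> d") (auto simp: direct_sum_algebra_def Phi_def PiE_def extensional_def)
    qed
    then show ?thesis using f(1) by blast
  qed
  have "bij_betw Phi (carrier ?E) (carrier ?D)"
    unfolding bij_betw_def using car surj Phi_inj by (auto intro!: inj_onI)
  then show ?thesis unfolding kalg_iso_def ring_iso_def ring_hom_def
    using car mult add one smult by auto
qed

end

section \<open>Monoid algebras\<close>

lemma monoid_algebra_simps:
  "x \<in> carrier (monoid_algebra M) \<longleftrightarrow> finite {m. x m \<noteq> 0} \<and> {m. x m \<noteq> 0} \<subseteq> carrier M"
  "(x \<otimes>\<^bsub>monoid_algebra M\<^esub> y) m = (\<Sum>a | x a \<noteq> 0. \<Sum>b | y b \<noteq> 0. if a \<otimes>\<^bsub>M\<^esub> b = m then x a * y b else 0)"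
  "\<one>\<^bsub>monoid_algebra M\<^esub> = basis_vec \<one>\<^bsub>M\<^esub>"
  "\<zero>\<^bsub>monoid_algebra M\<^esub> = (\<lambda>m. 0)"
  "x \<oplus>\<^bsub>monoid_algebra M\<^esub> y = (\<lambda>m. x m + y m)"
  "c \<odot>\<^bsub>monoid_algebra M\<^esub> x = (\<lambda>m. c * x m)"
  by (simp_all add: monoid_algebra_def)

lemma conv_on:
  assumes "finite A" "{m. x m \<noteq> 0} \<subseteq> A" "finite B" "{m. y m \<noteq> 0} \<subseteq> B"
  shows "(x \<otimes>\<^bsub>monoid_algebra M\<^esub> y) m = (\<Sum>a\<in>A. \<Sum>b\<in>B. if a \<otimes>\<^bsub>M\<^esub> b = m then x a * y b else 0)"
proof -
  have "(\<Sum>b | y b \<noteq> 0. if a \<otimes>\<^bsub>M\<^esub> b = m then x a * y b else 0) = (\<Sum>b\<in>B. if a \<otimes>\<^bsub>M\<^esub> b = m then x a * y b else 0)" for a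
    by (rule sum.mono_neutral_left) (use assms in auto)
  then show ?thesis unfolding monoid_algebra_simps
    by (simp only:) (rule sum.mono_neutral_left, use assms in \<open>auto split: if_splits intro!: sum.neutral\<close>)
qed

lemma conv_supp:
  assumes "(x \<otimes>\<^bsub>monoid_algebra M\<^esub> y) m \<noteq> 0"
  shows "m \<in> (\<lambda>(a, b). a \<otimes>\<^bsub>M\<^esub> b) ` ({m. x m \<noteq> 0} \<times> {m. y m \<noteq> 0})"
proof (rule ccontr)
  assume "m \<notin> (\<lambda>(a, b). a \<otimes>\<^bsub>M\<^esub> b) ` ({m. x m \<noteq> 0} \<times> {m. y m \<noteq> 0})"
  then have "(x \<otimes>\<^bsub>monoid_algebra M\<^esub> y) m = 0"
    unfolding monoid_algebra_simps by (intro sum.neutral ballI) force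
  then show False using assms by simp
qed

lemma conv_closed:
  assumes "monoid M" "x \<in> carrier (monoid_algebra M)" "y \<in> carrier (monoid_algebra M)"
  shows "x \<otimes>\<^bsub>monoid_algebra M\<^esub> y \<in> carrier (monoid_algebra M)"
proof -
  interpret monoid M by fact
  let ?S = "(\<lambda>(a, b). a \<otimes>\<^bsub>M\<^esub> b) ` ({m. x m \<noteq> 0} \<times> {m. y m \<noteq> 0})"
  have 1: "{m. (x \<otimes>\<^bsub>monoid_algebra M\<^esub> y) m \<noteq> 0} \<subseteq> ?S"
    by (intro subsetI conv_supp) simp
  have x: "finite {m. x m \<noteq> 0}" "{m. x m \<noteq> 0} \<subseteq> carrier M" and y: "finite {m. y m \<noteq> 0}" "{m. y m \<noteq> 0} \<subseteq> carrier M"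
    using assms(2,3) by (simp_all only: monoid_algebra_simps(1))
  have 2: "finite ?S" using x(1) y(1) by simp
  have 3: "?S \<subseteq> carrier M" using x(2) y(2) by auto
  show ?thesis unfolding monoid_algebra_simps(1)
    using finite_subset[OF 1 2] subset_trans[OF 1 3] by (rule conjI)
qed

text \<open>The convolution product is the one that makes linear extensions of multiplicative functions
  multiplicative.\<close>

lemma conv_functional:
  assumes "x \<in> carrier (monoid_algebra M)" "y \<in> carrier (monoid_algebra M)"
  shows "(\<Sum>m | (x \<otimes>\<^bsub>monoid_algebra M\<^esub> y) m \<noteq> 0. (x \<otimes>\<^bsub>monoid_algebra M\<^esub> y) m * F m)
     = (\<Sum>a | x a \<noteq> 0. \<Sum>b | y b \<noteq> 0. x a * y b * F (a \<otimes>\<^bsub>M\<^esub> b))"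
proof -
  let ?S = "(\<lambda>(a, b). a \<otimes>\<^bsub>M\<^esub> b) ` ({m. x m \<noteq> 0} \<times> {m. y m \<noteq> 0})"
  have fin: "finite {m. x m \<noteq> 0}" "finite {m. y m \<noteq> 0}" using assms by (auto simp: monoid_algebra_simps)
  have "(\<Sum>m | (x \<otimes>\<^bsub>monoid_algebra M\<^esub> y) m \<noteq> 0. (x \<otimes>\<^bsub>monoid_algebra M\<^esub> y) m * F m)
      = (\<Sum>m\<in>?S. (x \<otimes>\<^bsub>monoid_algebra M\<^esub> y) m * F m)"
  proof (rule sum.mono_neutral_left)
    show "finite ?S" using fin by simp
    show "{m. (x \<otimes>\<^bsub>monoid_algebra M\<^esub> y) m \<noteq> 0} \<subseteq> ?S" by (intro subsetI conv_supp) simp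
  qed simp
  also have "\<dots> = (\<Sum>m\<in>?S. \<Sum>a | x a \<noteq> 0. \<Sum>b | y b \<noteq> 0. if a \<otimes>\<^bsub>M\<^esub> b = m then x a * y b * F m else 0)"
    unfolding monoid_algebra_simps sum_distrib_right by (intro sum.cong refl) auto
  also have "\<dots> = (\<Sum>a | x a \<noteq> 0. \<Sum>b | y b \<noteq> 0. \<Sum>m\<in>?S. if a \<otimes>\<^bsub>M\<^esub> b = m then x a * y b * F m else 0)"
    by (rule trans[OF sum.swap]) (rule sum.cong[OF refl], rule sum.swap)
  also have "\<dots> = (\<Sum>a | x a \<noteq> 0. \<Sum>b | y b \<noteq> 0. x a * y b * F (a \<otimes>\<^bsub>M\<^esub> b))"
  proof (intro sum.cong refl)
    fix a b assume "a \<in> {m. x m \<noteq> 0}" "b \<in> {m. y m \<noteq> 0}"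
    then have "a \<otimes>\<^bsub>M\<^esub> b \<in> ?S" by auto
    then show "(\<Sum>m\<in>?S. if a \<otimes>\<^bsub>M\<^esub> b = m then x a * y b * F m else 0) = x a * y b * F (a \<otimes>\<^bsub>M\<^esub> b)"
      using fin by (simp add: sum.delta)
  qed
  finally show ?thesis .
qed

lemma basis_vec_carrier: "m \<in> carrier M \<Longrightarrow> basis_vec m \<in> carrier (monoid_algebra M)"
  by (auto simp: monoid_algebra_simps basis_vec_def)

lemma supp_basis_vec: "{x. basis_vec m x \<noteq> (0::'k::field)} = {m}"
  by (auto simp: basis_vec_def)

lemma monoid_algebra_ring:
  fixes M :: "('m, 'z) monoid_scheme"
  assumes "monoid M" shows "ring (monoid_algebra M :: ('k::field, 'm \<Rightarrow> 'k) module)"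
proof -
  interpret monoid M by fact
  let ?F = "monoid_algebra M :: ('k, 'm \<Rightarrow> 'k) module"
  show ?thesis
  proof (rule ringI)
    show "abelian_group ?F"
    proof (rule abelian_groupI)
      fix x y assume "x \<in> carrier ?F" "y \<in> carrier ?F"
      then have "finite ({m. x m \<noteq> 0} \<union> {m. y m \<noteq> 0})" "{m. x m \<noteq> 0} \<union> {m. y m \<noteq> 0} \<subseteq> carrier M"
        by (auto simp: monoid_algebra_simps)
      moreover have "{m. x m + y m \<noteq> 0} \<subseteq> {m. x m \<noteq> 0} \<union> {m. y m \<noteq> 0}" by auto
      ultimately show "x \<oplus>\<^bsub>?F\<^esub> y \<in> carrier ?F"
        unfolding monoid_algebra_simps by (meson finite_subset subset_trans)
    next
      fix x assume "x \<in> carrier ?F"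
      then have "(\<lambda>m. - x m) \<in> carrier ?F" "(\<lambda>m. - x m) \<oplus>\<^bsub>?F\<^esub> x = \<zero>\<^bsub>?F\<^esub>" by (auto simp: monoid_algebra_simps)
      then show "\<exists>y\<in>carrier ?F. y \<oplus>\<^bsub>?F\<^esub> x = \<zero>\<^bsub>?F\<^esub>" by blast
    qed (auto simp: monoid_algebra_simps algebra_simps)
    show "Group.monoid ?F"
    proof (rule monoidI)
      show "x \<otimes>\<^bsub>?F\<^esub> y \<in> carrier ?F" if "x \<in> carrier ?F" "y \<in> carrier ?F" for x y
        using conv_closed[OF assms that] .
      show "\<one>\<^bsub>?F\<^esub> \<in> carrier ?F" unfolding monoid_algebra_simps(3) by (rule basis_vec_carrier) simp
      fix x assume x: "x \<in> carrier ?F"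
      have xc: "a \<in> carrier M" if "x a \<noteq> 0" for a using x that by (auto simp: monoid_algebra_simps)
      have fin: "finite {m. x m \<noteq> 0}" using x by (auto simp: monoid_algebra_simps)
      show "\<one>\<^bsub>?F\<^esub> \<otimes>\<^bsub>?F\<^esub> x = x"
      proof
        fix m
        have "(\<one>\<^bsub>?F\<^esub> \<otimes>\<^bsub>?F\<^esub> x) m = (\<Sum>b | x b \<noteq> 0. if b = m then x b else 0)"
          unfolding monoid_algebra_simps supp_basis_vec by (auto simp: xc basis_vec_def intro!: sum.cong)
        then show "(\<one>\<^bsub>?F\<^esub> \<otimes>\<^bsub>?F\<^esub> x) m = x m" using fin by (simp add: sum.delta)
      qed
      show "x \<otimes>\<^bsub>?F\<^esub> \<one>\<^bsub>?F\<^esub> = x"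
      proof
        fix m
        have "(x \<otimes>\<^bsub>?F\<^esub> \<one>\<^bsub>?F\<^esub>) m = (\<Sum>b | x b \<noteq> 0. if b = m then x b else 0)"
          unfolding monoid_algebra_simps supp_basis_vec by (auto simp: xc basis_vec_def intro!: sum.cong)
        then show "(x \<otimes>\<^bsub>?F\<^esub> \<one>\<^bsub>?F\<^esub>) m = x m" using fin by (simp add: sum.delta)
      qed
      fix y z assume y: "y \<in> carrier ?F" and z: "z \<in> carrier ?F"
      have yc: "a \<in> carrier M" if "y a \<noteq> 0" for a using y that by (auto simp: monoid_algebra_simps)
      have zc: "a \<in> carrier M" if "z a \<noteq> 0" for a using z that by (auto simp: monoid_algebra_simps)
      show "x \<otimes>\<^bsub>?F\<^esub> y \<otimes>\<^bsub>?F\<^esub> z = x \<otimes>\<^bsub>?F\<^esub> (y \<otimes>\<^bsub>?F\<^esub> z)"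
      proof
        fix m
        let ?xy = "x \<otimes>\<^bsub>?F\<^esub> y" and ?yz = "y \<otimes>\<^bsub>?F\<^esub> z"
        have "(?xy \<otimes>\<^bsub>?F\<^esub> z) m = (\<Sum>n | ?xy n \<noteq> 0. ?xy n * (\<Sum>c | z c \<noteq> 0. if n \<otimes>\<^bsub>M\<^esub> c = m then z c else 0))"
          unfolding monoid_algebra_simps(2)[where x = ?xy] sum_distrib_left by (intro sum.cong refl) auto
        also have "\<dots> = (\<Sum>a | x a \<noteq> 0. \<Sum>b | y b \<noteq> 0. x a * y b * (\<Sum>c | z c \<noteq> 0. if a \<otimes>\<^bsub>M\<^esub> b \<otimes>\<^bsub>M\<^esub> c = m then z c else 0))"
          by (rule conv_functional[OF x y])
        also have "\<dots> = (\<Sum>a | x a \<noteq> 0. \<Sum>b | y b \<noteq> 0. \<Sum>c | z c \<noteq> 0. y b * z c * (if a \<otimes>\<^bsub>M\<^esub> (b \<otimes>\<^bsub>M\<^esub> c) = m then x a else 0))"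
          unfolding sum_distrib_left by (intro sum.cong refl) (auto simp: m_assoc xc yc zc)
        also have "\<dots> = (\<Sum>a | x a \<noteq> 0. \<Sum>n | ?yz n \<noteq> 0. ?yz n * (if a \<otimes>\<^bsub>M\<^esub> n = m then x a else 0))"
          by (intro sum.cong refl conv_functional[OF y z, symmetric])
        also have "\<dots> = (x \<otimes>\<^bsub>?F\<^esub> ?yz) m"
          unfolding monoid_algebra_simps(2)[where x = x] by (intro sum.cong refl) auto
        finally show "(?xy \<otimes>\<^bsub>?F\<^esub> z) m = (x \<otimes>\<^bsub>?F\<^esub> ?yz) m" .
      qed
    qed
    fix x y z assume "x \<in> carrier ?F" "y \<in> carrier ?F" "z \<in> carrier ?F"
    then have fin: "finite ({m. x m \<noteq> 0} \<union> {m. y m \<noteq> 0})" "finite {m. z m \<noteq> 0}" by (auto simp: monoid_algebra_simps)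
    let ?U = "{m. x m \<noteq> 0} \<union> {m. y m \<noteq> 0}"
    have s: "{m. (x \<oplus>\<^bsub>?F\<^esub> y) m \<noteq> 0} \<subseteq> ?U" by (auto simp: monoid_algebra_simps)
    show "(x \<oplus>\<^bsub>?F\<^esub> y) \<otimes>\<^bsub>?F\<^esub> z = x \<otimes>\<^bsub>?F\<^esub> z \<oplus>\<^bsub>?F\<^esub> y \<otimes>\<^bsub>?F\<^esub> z"
    proof
      fix m
      have "((x \<oplus>\<^bsub>?F\<^esub> y) \<otimes>\<^bsub>?F\<^esub> z) m = (x \<otimes>\<^bsub>?F\<^esub> z) m + (y \<otimes>\<^bsub>?F\<^esub> z) m"
        unfolding conv_on[OF fin(1) s fin(2) order.refl] conv_on[OF fin(1) Un_upper1 fin(2) order.refl]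
          conv_on[OF fin(1) Un_upper2 fin(2) order.refl] sum.distrib[symmetric]
        by (intro sum.cong refl) (auto simp: monoid_algebra_simps algebra_simps)
      then show "((x \<oplus>\<^bsub>?F\<^esub> y) \<otimes>\<^bsub>?F\<^esub> z) m = (x \<otimes>\<^bsub>?F\<^esub> z \<oplus>\<^bsub>?F\<^esub> y \<otimes>\<^bsub>?F\<^esub> z) m"
        by (simp add: monoid_algebra_simps(5))
    qed
    show "z \<otimes>\<^bsub>?F\<^esub> (x \<oplus>\<^bsub>?F\<^esub> y) = z \<otimes>\<^bsub>?F\<^esub> x \<oplus>\<^bsub>?F\<^esub> z \<otimes>\<^bsub>?F\<^esub> y"
    proof
      fix m
      have "(z \<otimes>\<^bsub>?F\<^esub> (x \<oplus>\<^bsub>?F\<^esub> y)) m = (z \<otimes>\<^bsub>?F\<^esub> x) m + (z \<otimes>\<^bsub>?F\<^esub> y) m"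
        unfolding conv_on[OF fin(2) order.refl fin(1) s] conv_on[OF fin(2) order.refl fin(1) Un_upper1]
          conv_on[OF fin(2) order.refl fin(1) Un_upper2] sum.distrib[symmetric]
        by (intro sum.cong refl) (auto simp: monoid_algebra_simps algebra_simps)
      then show "(z \<otimes>\<^bsub>?F\<^esub> (x \<oplus>\<^bsub>?F\<^esub> y)) m = (z \<otimes>\<^bsub>?F\<^esub> x \<oplus>\<^bsub>?F\<^esub> z \<otimes>\<^bsub>?F\<^esub> y) m"
        by (simp add: monoid_algebra_simps(5))
    qed
  qed
qed

lemma monoid_algebra_uminus:
  assumes "monoid M" "x \<in> carrier (monoid_algebra M)"
  shows "\<ominus>\<^bsub>monoid_algebra M\<^esub> x = (\<lambda>m. - x m)"
proof -
  interpret ring "monoid_algebra M" by (rule monoid_algebra_ring[OF assms(1)])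
  have "(\<lambda>m. - x m) \<in> carrier (monoid_algebra M)" "(\<lambda>m. - x m) \<oplus>\<^bsub>monoid_algebra M\<^esub> x = \<zero>\<^bsub>monoid_algebra M\<^esub>"
    using assms(2) by (auto simp: monoid_algebra_simps)
  then show ?thesis using assms(2) minus_equality by blast
qed

lemma monoid_algebra_minus:
  assumes "monoid M" "x \<in> carrier (monoid_algebra M)" "y \<in> carrier (monoid_algebra M)"
  shows "x \<ominus>\<^bsub>monoid_algebra M\<^esub> y = (\<lambda>m. x m - y m)"
  unfolding a_minus_def monoid_algebra_uminus[OF assms(1,3)] by (simp add: monoid_algebra_simps(5))

lemma monoid_algebra_smult_closed:
  "x \<in> carrier (monoid_algebra M) \<Longrightarrow> c \<odot>\<^bsub>monoid_algebra M\<^esub> x \<in> carrier (monoid_algebra M)"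
  unfolding monoid_algebra_simps using finite_subset[of "{m. c * x m \<noteq> 0}" "{m. x m \<noteq> 0}"] by auto

section \<open>Quotients\<close>

text \<open>The homomorphism theorem in the direction in which it is used here. The inverse sends \<open>c\<close> to its fibre,
  which is a coset.\<close>

lemma quotient_iso:
  fixes A :: "('k::field, 'a) module" and C :: "('k, 'c) module"
  assumes A: "ring A" and I: "ideal I A"
    and sm: "\<And>c x. x \<in> carrier A \<Longrightarrow> c \<odot>\<^bsub>A\<^esub> x \<in> carrier A"
    and cl: "\<And>x. x \<in> carrier A \<Longrightarrow> \<psi> x \<in> carrier C"
    and surj: "\<And>c. c \<in> carrier C \<Longrightarrow> \<exists>x \<in> carrier A. \<psi> x = c"
    and mult: "\<And>x y. x \<in> carrier A \<Longrightarrow> y \<in> carrier A \<Longrightarrow> \<psi> (x \<otimes>\<^bsub>A\<^esub> y) = \<psi> x \<otimes>\<^bsub>C\<^esub> \<psi> y"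
    and add: "\<And>x y. x \<in> carrier A \<Longrightarrow> y \<in> carrier A \<Longrightarrow> \<psi> (x \<oplus>\<^bsub>A\<^esub> y) = \<psi> x \<oplus>\<^bsub>C\<^esub> \<psi> y"
    and one: "\<psi> \<one>\<^bsub>A\<^esub> = \<one>\<^bsub>C\<^esub>"
    and smult: "\<And>c x. x \<in> carrier A \<Longrightarrow> \<psi> (c \<odot>\<^bsub>A\<^esub> x) = c \<odot>\<^bsub>C\<^esub> \<psi> x"
    and ker: "\<And>x y. x \<in> carrier A \<Longrightarrow> y \<in> carrier A \<Longrightarrow> \<psi> x = \<psi> y \<longleftrightarrow> x \<ominus>\<^bsub>A\<^esub> y \<in> I"
  shows "(\<lambda>c. {x \<in> carrier A. \<psi> x = c}) \<in> kalg_iso C (quotient_algebra A I)"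
proof -
  interpret ring A by fact
  interpret ideal I A by fact
  let ?Q = "quotient_algebra A I" and ?t = "\<lambda>c. {x \<in> carrier A. \<psi> x = c}"
  have coset: "I +>\<^bsub>A\<^esub> x = ?t (\<psi> x)" if x: "x \<in> carrier A" for x
  proof (intro Set.set_eqI iffI)
    fix y assume "y \<in> I +>\<^bsub>A\<^esub> x"
    then obtain i where i: "i \<in> I" "y = i \<oplus>\<^bsub>A\<^esub> x" by (auto simp: a_r_coset_def r_coset_def)
    have iA: "i \<in> carrier A" using i(1) Icarr by auto
    have "y \<ominus>\<^bsub>A\<^esub> x = i" using iA x i(2) by (simp add: a_minus_def a_assoc r_neg)
    then show "y \<in> ?t (\<psi> x)" using ker[of y x] i iA x by auto
  next
    fix y assume "y \<in> ?t (\<psi> x)"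
    then have y: "y \<in> carrier A" "y \<ominus>\<^bsub>A\<^esub> x \<in> I" using ker[of y x] x by auto
    have "y = (y \<ominus>\<^bsub>A\<^esub> x) \<oplus>\<^bsub>A\<^esub> x" using y x by (simp add: a_minus_def a_assoc l_neg)
    then show "y \<in> I +>\<^bsub>A\<^esub> x" using y(2) by (auto simp: a_r_coset_def r_coset_def)
  qed
  have ops: "carrier ?Q = a_rcosets\<^bsub>A\<^esub> I" "\<one>\<^bsub>?Q\<^esub> = I +>\<^bsub>A\<^esub> \<one>\<^bsub>A\<^esub>"
    "X \<otimes>\<^bsub>?Q\<^esub> Y = rcoset_mult A I X Y" "X \<oplus>\<^bsub>?Q\<^esub> Y = X <+>\<^bsub>A\<^esub> Y"
    "c \<odot>\<^bsub>?Q\<^esub> X = (\<Union>x\<in>X. I +>\<^bsub>A\<^esub> (c \<odot>\<^bsub>A\<^esub> x))" for X Y c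
    by (simp_all add: quotient_algebra_def FactRing_def ring.defs module.defs)
  have carr: "carrier ?Q = ?t ` carrier C"
  proof -
    have "carrier ?Q = (\<lambda>x. I +>\<^bsub>A\<^esub> x) ` carrier A"
      unfolding ops A_RCOSETS_def' by auto
    also have "\<dots> = (\<lambda>x. ?t (\<psi> x)) ` carrier A" using coset by auto
    also have "\<dots> = ?t ` (\<psi> ` carrier A)" by (simp only: image_image)
    also have "\<psi> ` carrier A = carrier C" using surj cl by blast
    finally show ?thesis .
  qed
  have inj: "inj_on ?t (carrier C)"
  proof (rule inj_onI)
    fix c c' assume "c \<in> carrier C" "c' \<in> carrier C" "?t c = ?t c'"
    then show "c = c'" using surj[of c] by blast
  qed
  have 1: "?t (c \<otimes>\<^bsub>C\<^esub> c') = ?t c \<otimes>\<^bsub>?Q\<^esub> ?t c' \<and> ?t (c \<oplus>\<^bsub>C\<^esub> c') = ?t c \<oplus>\<^bsub>?Q\<^esub> ?t c'"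
    if cc: "c \<in> carrier C" "c' \<in> carrier C" for c c'
  proof -
    obtain x y where xy: "x \<in> carrier A" "\<psi> x = c" "y \<in> carrier A" "\<psi> y = c'" using surj cc by metis
    have e: "?t c = I +>\<^bsub>A\<^esub> x" "?t c' = I +>\<^bsub>A\<^esub> y"
      using coset[OF xy(1)] coset[OF xy(3)] xy(2,4) by simp_all
    have "?t (\<psi> (x \<otimes>\<^bsub>A\<^esub> y)) = ?t c \<otimes>\<^bsub>?Q\<^esub> ?t c'"
      unfolding e ops rcoset_mult_add[OF xy(1,3)] by (rule coset[symmetric]) (use xy in simp)
    moreover have "?t (\<psi> (x \<oplus>\<^bsub>A\<^esub> y)) = ?t c \<oplus>\<^bsub>?Q\<^esub> ?t c'"
      unfolding e ops a_rcos_sum[OF xy(1,3)] by (rule coset[symmetric]) (use xy in simp)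
    ultimately show ?thesis using xy mult add by simp
  qed
  have 2: "?t \<one>\<^bsub>C\<^esub> = \<one>\<^bsub>?Q\<^esub>" unfolding ops using coset[of "\<one>\<^bsub>A\<^esub>"] one by simp
  have 3: "?t (k \<odot>\<^bsub>C\<^esub> c) = k \<odot>\<^bsub>?Q\<^esub> ?t c" if c: "c \<in> carrier C" for k c
  proof -
    have ne: "\<exists>x. x \<in> ?t c" using surj[OF c] by auto
    have "I +>\<^bsub>A\<^esub> (k \<odot>\<^bsub>A\<^esub> x) = ?t (k \<odot>\<^bsub>C\<^esub> c)" if "x \<in> ?t c" for x
      using that coset[OF sm] smult by auto
    then show ?thesis unfolding ops using ne by auto
  qed
  show ?thesis unfolding kalg_iso_def ring_iso_def ring_hom_def bij_betw_def
    using carr inj 1 2 3 by auto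
qed

section \<open>Linear maps\<close>

definition lin :: "('b \<Rightarrow> 'k::field) set \<Rightarrow> (('b \<Rightarrow> 'k) \<Rightarrow> 'b \<Rightarrow> 'k) \<Rightarrow> bool" where
  "lin W f \<longleftrightarrow> (\<forall>v\<in>W. f v \<in> W) \<and>
     (\<forall>v\<in>W. \<forall>w\<in>W. f (\<lambda>\<mu>. v \<mu> + w \<mu>) = (\<lambda>\<mu>. f v \<mu> + f w \<mu>)) \<and>
     (\<forall>c. \<forall>v\<in>W. f (\<lambda>\<mu>. c * v \<mu>) = (\<lambda>\<mu>. c * f v \<mu>))"

lemma lin_mem: "lin W f \<Longrightarrow> v \<in> W \<Longrightarrow> f v \<in> W" by (simp add: lin_def)

lemma lin_add: "lin W f \<Longrightarrow> v \<in> W \<Longrightarrow> w \<in> W \<Longrightarrow> f (\<lambda>\<mu>. v \<mu> + w \<mu>) = (\<lambda>\<mu>. f v \<mu> + f w \<mu>)"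
  by (simp add: lin_def)

lemma lin_scale: "lin W f \<Longrightarrow> v \<in> W \<Longrightarrow> f (\<lambda>\<mu>. c * v \<mu>) = (\<lambda>\<mu>. c * f v \<mu>)"
  by (simp add: lin_def)

lemma lin_zero: "lin (space S) f \<Longrightarrow> f (\<lambda>\<mu>. 0) = (\<lambda>\<mu>. 0)"
  using lin_scale[OF _ space_zero, of S f 0] by simp

lemma lin_on_iff: "lin_on W f \<longleftrightarrow> f \<in> extensional W \<and> lin W f"
  unfolding lin_on_def lin_def PiE_def by auto

lemma lin_restrict: "lin (space S) f \<Longrightarrow> lin_on (space S) (restrict f (space S))"
  unfolding lin_on_iff by (auto simp: lin_def space_add space_scale)

lemma lin_comp: "lin W f \<Longrightarrow> lin W g \<Longrightarrow> lin W (\<lambda>v. f (g v))"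
  by (simp add: lin_def)

lemma lin_sum:
  assumes "lin (space S) f" "finite A" "\<And>t. t \<in> A \<Longrightarrow> F t \<in> space S"
  shows "f (\<lambda>w. \<Sum>t\<in>A. k t * F t w) = (\<lambda>w. \<Sum>t\<in>A. k t * f (F t) w)"
proof -
  have "(\<lambda>w. \<Sum>t\<in>A. k t * F t w) \<in> space S \<and> f (\<lambda>w. \<Sum>t\<in>A. k t * F t w) = (\<lambda>w. \<Sum>t\<in>A. k t * f (F t) w)"
    using assms(2,3)
  proof (induction A rule: finite_induct)
    case empty then show ?case by (simp add: space_zero lin_zero[OF assms(1)])
  next
    case (insert a A)
    then show ?case using lin_add[OF assms(1) space_scale[of "F a" S "k a"]] lin_scale[OF assms(1), of "F a" "k a"]
      by (simp add: space_add space_scale)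
  qed
  then show ?thesis by simp
qed

lemma lin_sum_list:
  assumes "lin (space S) f" "\<And>t. t \<in> set ts \<Longrightarrow> F t \<in> space S"
  shows "(\<lambda>w. \<Sum>t\<leftarrow>ts. F t w) \<in> space S \<and> f (\<lambda>w. \<Sum>t\<leftarrow>ts. F t w) = (\<lambda>w. \<Sum>t\<leftarrow>ts. f (F t) w)"
  using assms(2)
  by (induction ts) (auto simp: lin_zero[OF assms(1)] lin_add[OF assms(1)] space_zero space_add)

lemma lin_basis_eq:
  assumes S: "finite S" and F: "lin (space S) F" and G: "lin (space S) G"
    and e: "\<And>x. x \<in> S \<Longrightarrow> F (basis_vec x) = G (basis_vec x)" and v: "v \<in> space S"
  shows "F v = G v"
proof -
  have "v \<in> space S \<and> F v = G v"
    using S v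
  proof (rule space_induct)
    show "(\<lambda>w. 0) \<in> space S \<and> F (\<lambda>w. 0) = G (\<lambda>w. 0)"
      by (simp add: space_zero lin_zero[OF F] lin_zero[OF G])
  next
    fix u v assume "u \<in> space S \<and> F u = G u" "v \<in> space S \<and> F v = G v"
    then show "(\<lambda>w. u w + v w) \<in> space S \<and> F (\<lambda>w. u w + v w) = G (\<lambda>w. u w + v w)"
      by (simp add: space_add lin_add[OF F] lin_add[OF G])
  next
    fix c v assume "v \<in> space S \<and> F v = G v"
    then show "(\<lambda>w. c * v w) \<in> space S \<and> F (\<lambda>w. c * v w) = G (\<lambda>w. c * v w)"
      by (simp add: space_scale lin_scale[OF F] lin_scale[OF G])
  next
    fix x assume "x \<in> S"
    then show "basis_vec x \<in> space S \<and> F (basis_vec x) = G (basis_vec x)" using e basis_vec_space by auto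
  qed
  then show ?thesis by simp
qed

lemma end_closed:
  assumes act: "\<And>i. i \<in> J \<Longrightarrow> lin (space S) (\<lambda>u. act u i)"
  shows "f \<in> carrier (end_algebra (space S) J act) \<Longrightarrow> g \<in> carrier (end_algebra (space S) J act) \<Longrightarrow>
      compose (space S) f g \<in> carrier (end_algebra (space S) J act)" (is "?a \<Longrightarrow> ?b \<Longrightarrow> ?c")
    and "restrict (\<lambda>v. v) (space S) \<in> carrier (end_algebra (space S) J act)"
    and "f \<in> carrier (end_algebra (space S) J act) \<Longrightarrow> g \<in> carrier (end_algebra (space S) J act) \<Longrightarrow>
      (\<lambda>v\<in>space S. \<lambda>\<mu>. f v \<mu> + g v \<mu>) \<in> carrier (end_algebra (space S) J act)"
    and "f \<in> carrier (end_algebra (space S) J act) \<Longrightarrow> (\<lambda>v\<in>space S. \<lambda>\<mu>. c * f v \<mu>) \<in> carrier (end_algebra (space S) J act)"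
    and "(\<lambda>v\<in>space S. \<lambda>\<mu>. 0) \<in> carrier (end_algebra (space S) J act)"
proof -
  let ?E = "end_algebra (space S) J act"
  have I: "restrict f (space S) \<in> carrier ?E"
    if "lin (space S) f" "\<And>i v. i \<in> J \<Longrightarrow> v \<in> space S \<Longrightarrow> f (act v i) = act (f v) i" for f
    unfolding end_algebra_carrier using lin_restrict[OF that(1)] that(2) lin_mem[OF act] lin_mem[OF that(1)] by simp
  have l: "lin (space S) f" "\<And>i v. i \<in> J \<Longrightarrow> v \<in> space S \<Longrightarrow> f (act v i) = act (f v) i" if "f \<in> carrier ?E" for f
    using that by (auto simp: end_algebra_carrier lin_on_iff)
  show "restrict (\<lambda>v. v) (space S) \<in> carrier ?E" by (rule I) (auto simp: lin_def)
  show "(\<lambda>v\<in>space S. \<lambda>\<mu>. 0) \<in> carrier ?E"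
    by (rule I) (auto simp: lin_def space_zero lin_zero[OF act])
  { fix f assume f: "f \<in> carrier ?E"
    show "(\<lambda>v\<in>space S. \<lambda>\<mu>. c * f v \<mu>) \<in> carrier ?E"
    proof (rule I)
      show "lin (space S) (\<lambda>v \<mu>. c * f v \<mu>)"
        unfolding lin_def using l(1)[OF f] by (auto simp: lin_mem lin_add lin_scale space_scale algebra_simps)
      show "(\<lambda>\<mu>. c * f (act v i) \<mu>) = act (\<lambda>\<mu>. c * f v \<mu>) i" if "i \<in> J" "v \<in> space S" for i v
        using lin_scale[OF act[OF that(1)] lin_mem[OF l(1)[OF f] that(2)]] l(2)[OF f that] by simp
    qed
    { fix g assume g: "g \<in> carrier ?E"
      show "compose (space S) f g \<in> carrier ?E" unfolding compose_def
        by (rule I) (use l(1)[OF f] l(1)[OF g] l(2)[OF f] l(2)[OF g] in \<open>auto simp: lin_comp lin_mem\<close>)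
      show "(\<lambda>v\<in>space S. \<lambda>\<mu>. f v \<mu> + g v \<mu>) \<in> carrier ?E"
      proof (rule I)
        show "lin (space S) (\<lambda>v \<mu>. f v \<mu> + g v \<mu>)"
          unfolding lin_def using l(1)[OF f] l(1)[OF g]
          by (auto simp: lin_mem lin_add lin_scale space_add algebra_simps)
        show "(\<lambda>\<mu>. f (act v i) \<mu> + g (act v i) \<mu>) = act (\<lambda>\<mu>. f v \<mu> + g v \<mu>) i" if "i \<in> J" "v \<in> space S" for i v
          using lin_add[OF act[OF that(1)] lin_mem[OF l(1)[OF f] that(2)] lin_mem[OF l(1)[OF g] that(2)]]
            l(2)[OF f that] l(2)[OF g that] by simp
      qed } }
qed

lemma end_monoid:
  assumes act: "\<And>i. i \<in> J \<Longrightarrow> lin (space S) (\<lambda>u. act u i)"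
  shows "Group.monoid (end_algebra (space S) J act)"
proof (rule monoidI)
  let ?E = "end_algebra (space S) J act"
  have m: "f v \<in> space S" "f \<in> extensional (space S)" if "f \<in> carrier ?E" "v \<in> space S" for f v
    using that by (auto simp: end_algebra_carrier lin_on_iff lin_mem)
  fix f assume f: "f \<in> carrier ?E"
  show "\<one>\<^bsub>?E\<^esub> \<otimes>\<^bsub>?E\<^esub> f = f" "f \<otimes>\<^bsub>?E\<^esub> \<one>\<^bsub>?E\<^esub> = f"
    using m[OF f] m(2)[OF f space_zero] by (auto simp: end_algebra_ops compose_def extensional_def fun_eq_iff)
  fix g assume g: "g \<in> carrier ?E"
  show "f \<otimes>\<^bsub>?E\<^esub> g \<in> carrier ?E" using end_closed(1)[OF act f g] by (simp add: end_algebra_ops)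
  fix h assume h: "h \<in> carrier ?E"
  show "f \<otimes>\<^bsub>?E\<^esub> g \<otimes>\<^bsub>?E\<^esub> h = f \<otimes>\<^bsub>?E\<^esub> (g \<otimes>\<^bsub>?E\<^esub> h)"
    using m[OF h] by (auto simp: end_algebra_ops compose_def fun_eq_iff)
next
  show "\<one>\<^bsub>end_algebra (space S) J act\<^esub> \<in> carrier (end_algebra (space S) J act)"
    using end_closed(2)[OF act] by (simp add: end_algebra_ops)
qed

section \<open>Operators on one tensor factor\<close>

text \<open>Functions on \<open>S\<close> are the tensor product of functions on \<open>S1\<close> and on \<open>S2\<close>, when \<open>S\<close> is in bijection with the
  product of the two sets.\<close>

locale prod_idx =
  fixes S1 :: "'b set" and S2 :: "'c set" and pr :: "'b \<Rightarrow> 'c \<Rightarrow> 'w" and S :: "'w set"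
  assumes fin1: "finite S1" and fin2: "finite S2"
    and inj: "x \<in> S1 \<Longrightarrow> x' \<in> S1 \<Longrightarrow> y \<in> S2 \<Longrightarrow> y' \<in> S2 \<Longrightarrow> pr x y = pr x' y' \<longleftrightarrow> x = x' \<and> y = y'"
    and S_eq: "S = {pr x y | x y. x \<in> S1 \<and> y \<in> S2}"
begin

lemma swapped: "prod_idx S2 S1 (\<lambda>y x. pr x y) S"
  by unfold_locales (use fin1 fin2 inj S_eq in auto)

lemma fin: "finite S"
proof -
  have "S = (\<lambda>(x, y). pr x y) ` (S1 \<times> S2)" unfolding S_eq by auto
  then show ?thesis using fin1 fin2 by simp
qed

definition "co w = (SOME p. fst p \<in> S1 \<and> snd p \<in> S2 \<and> w = pr (fst p) (snd p))"

lemma co: "x \<in> S1 \<Longrightarrow> y \<in> S2 \<Longrightarrow> co (pr x y) = (x, y)"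
  unfolding co_def by (rule some_equality) (auto simp: inj)

definition sl :: "('w \<Rightarrow> 'k::field) \<Rightarrow> 'c \<Rightarrow> 'b \<Rightarrow> 'k" where
  "sl v y = (\<lambda>x. if x \<in> S1 then v (pr x y) else 0)"

text \<open>The operator that applies \<open>f\<close> to every slice, that is, \<open>f\<close> tensored with the identity.\<close>

definition L :: "(('b \<Rightarrow> 'k::field) \<Rightarrow> 'b \<Rightarrow> 'k) \<Rightarrow> ('w \<Rightarrow> 'k) \<Rightarrow> 'w \<Rightarrow> 'k" where
  "L f v = (\<lambda>w. if w \<in> S then f (sl v (snd (co w))) (fst (co w)) else 0)"

lemma pr_S: "x \<in> S1 \<Longrightarrow> y \<in> S2 \<Longrightarrow> pr x y \<in> S" unfolding S_eq by auto

lemma L_at: "x \<in> S1 \<Longrightarrow> y \<in> S2 \<Longrightarrow> L f v (pr x y) = f (sl v y) x"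
  by (simp add: L_def pr_S co)

lemma L_space: "L f v \<in> space S" by (simp add: L_def space_def)

lemma sl_space: "sl v y \<in> space S1" by (simp add: sl_def space_def)

lemma space_eqI:
  assumes "u \<in> space S" "v \<in> space S" "\<And>x y. x \<in> S1 \<Longrightarrow> y \<in> S2 \<Longrightarrow> u (pr x y) = v (pr x y)"
  shows "u = v"
proof
  fix w show "u w = v w"
    using assms unfolding space_def S_eq by (cases "w \<in> S") (auto simp: S_eq)
qed

lemma sl_add: "sl (\<lambda>w. u w + v w) y = (\<lambda>x. sl u y x + sl v y x)" by (auto simp: sl_def)

lemma sl_scale: "sl (\<lambda>w. c * v w) y = (\<lambda>x. c * sl v y x)" by (auto simp: sl_def)

lemma sl_L: "lin (space S1) f \<Longrightarrow> y \<in> S2 \<Longrightarrow> sl (L f v) y = f (sl v y)"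
  using lin_mem[OF _ sl_space, of f v y] by (auto simp: sl_def[of "L f v"] L_at space_def)

lemma lin_L: "lin (space S1) f \<Longrightarrow> lin (space S) (L f)"
  unfolding lin_def[of "space S"]
  by (auto intro!: space_eqI L_space space_add space_scale
      simp: L_at sl_add sl_scale lin_add[OF _ sl_space sl_space] lin_scale[OF _ sl_space])

lemma L_comp: "lin (space S1) g \<Longrightarrow> L f (L g v) = L (\<lambda>u. f (g u)) v"
  by (rule space_eqI) (auto simp: L_space L_at sl_L)

lemma sl_basis: "x \<in> S1 \<Longrightarrow> y \<in> S2 \<Longrightarrow> y' \<in> S2 \<Longrightarrow>
    sl (basis_vec (pr x y)) y' = (\<lambda>z. (if y' = y then 1 else 0) * basis_vec x z)"
  by (auto simp: sl_def basis_vec_def inj fun_eq_iff)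

lemma L_basis:
  assumes f: "lin (space S1) f" and "x \<in> S1" "y \<in> S2" "x' \<in> S1" "y' \<in> S2"
  shows "L f (basis_vec (pr x y)) (pr x' y') = (if y' = y then f (basis_vec x) x' else 0)"
  using assms by (simp only: L_at sl_basis lin_scale[OF f basis_vec_space]) simp

abbreviation "R \<equiv> prod_idx.L S2 S1 (\<lambda>y x. pr x y) S"

lemmas R_at = prod_idx.L_at[OF swapped]
lemmas R_space = prod_idx.L_space[OF swapped]
lemmas lin_R = prod_idx.lin_L[OF swapped]
lemmas R_comp = prod_idx.L_comp[OF swapped]
lemmas R_basis = prod_idx.L_basis[OF swapped]

lemma sl_R_basis:
  assumes g: "lin (space S2) g" and "x \<in> S1" "y \<in> S2" "y' \<in> S2"
  shows "sl (R g (basis_vec (pr x y))) y' = (\<lambda>z. g (basis_vec y) y' * basis_vec x z)"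
  using assms R_basis[OF g assms(3,2,4)] by (auto simp: sl_def basis_vec_def)

lemma L_R_basis:
  assumes f: "lin (space S1) f" and g: "lin (space S2) g" and "x \<in> S1" "y \<in> S2" "x' \<in> S1" "y' \<in> S2"
  shows "L f (R g (basis_vec (pr x y))) (pr x' y') = f (basis_vec x) x' * g (basis_vec y) y'"
  using assms by (simp only: L_at sl_R_basis lin_scale[OF f basis_vec_space]) (simp add: mult.commute)

lemma L_R_commute:
  assumes f: "lin (space S1) f" and g: "lin (space S2) g" and v: "v \<in> space S"
  shows "L f (R g v) = R g (L f v)"
proof (rule lin_basis_eq[OF fin lin_comp[OF lin_L[OF f] lin_R[OF g]] lin_comp[OF lin_R[OF g] lin_L[OF f]] _ v])
  fix w assume "w \<in> S"
  then obtain x y where w: "w = pr x y" "x \<in> S1" "y \<in> S2" unfolding S_eq by auto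
  show "L f (R g (basis_vec w)) = R g (L f (basis_vec w))"
  proof (rule space_eqI[OF L_space R_space])
    fix x' y' assume x': "x' \<in> S1" "y' \<in> S2"
    show "L f (R g (basis_vec w)) (pr x' y') = R g (L f (basis_vec w)) (pr x' y')"
      using L_R_basis[OF f g w(2,3) x'] prod_idx.L_R_basis[OF swapped g f w(3,2) x'(2,1)] w(1)
      by (simp add: mult.commute)
  qed
qed

end

section \<open>Linear representations of a monoid algebra\<close>

text \<open>The linear extension to the monoid algebra of a family of operators indexed by the monoid.\<close>

definition rep :: "('m \<Rightarrow> ('b \<Rightarrow> 'k::field) \<Rightarrow> 'b \<Rightarrow> 'k) \<Rightarrow> ('m \<Rightarrow> 'k) \<Rightarrow> ('b \<Rightarrow> 'k) \<Rightarrow> 'b \<Rightarrow> 'k" where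
  "rep \<rho> x v = (\<lambda>w. \<Sum>m | x m \<noteq> 0. x m * \<rho> m v w)"

lemma rep_on:
  assumes "finite A" "{m. x m \<noteq> 0} \<subseteq> A"
  shows "rep \<rho> x v w = (\<Sum>m\<in>A. x m * \<rho> m v w)"
  unfolding rep_def by (rule sum.mono_neutral_left) (use assms in auto)

lemma rep_add:
  assumes "x \<in> carrier (monoid_algebra M)" "y \<in> carrier (monoid_algebra M)"
  shows "rep \<rho> (\<lambda>m. x m + y m) v w = rep \<rho> x v w + rep \<rho> y v w"
proof -
  have f: "finite ({m. x m \<noteq> 0} \<union> {m. y m \<noteq> 0})" using assms by (simp add: monoid_algebra_simps)
  have s: "{m. x m + y m \<noteq> 0} \<subseteq> {m. x m \<noteq> 0} \<union> {m. y m \<noteq> 0}" by auto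
  show ?thesis unfolding rep_on[OF f s] rep_on[OF f Un_upper1] rep_on[OF f Un_upper2]
    by (simp add: sum.distrib algebra_simps)
qed

lemma rep_scale: "rep \<rho> (\<lambda>m. c * x m) v w = c * rep \<rho> x v w"
proof (cases "c = 0")
  case True then show ?thesis by (simp add: rep_def)
next
  case False then show ?thesis by (simp add: rep_def sum_distrib_left mult.assoc)
qed

lemma rep_zero: "rep \<rho> (\<lambda>m. 0) v w = 0" by (simp add: rep_def)

lemma rep_basis: "rep \<rho> (basis_vec m) v w = \<rho> m v w"
  unfolding rep_def supp_basis_vec by (simp add: basis_vec_def)

lemma rep_lin:
  assumes \<rho>: "\<And>m. m \<in> carrier M \<Longrightarrow> lin (space S) (\<rho> m)" and x: "x \<in> carrier (monoid_algebra M)"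
  shows "lin (space S) (rep \<rho> x)"
proof -
  have l: "lin (space S) (\<rho> m)" if "x m \<noteq> 0" for m using \<rho> x that by (auto simp: monoid_algebra_simps)
  show ?thesis unfolding lin_def
  proof (intro conjI ballI allI)
    show "rep \<rho> x v \<in> space S" if "v \<in> space S" for v
      unfolding rep_def space_def using lin_mem[OF l that] by (auto simp: space_def intro!: sum.neutral)
    show "rep \<rho> x (\<lambda>\<mu>. v \<mu> + w \<mu>) = (\<lambda>\<mu>. rep \<rho> x v \<mu> + rep \<rho> x w \<mu>)" if "v \<in> space S" "w \<in> space S" for v w
      unfolding rep_def sum.distrib[symmetric]
      by (rule ext, rule sum.cong) (use lin_add[OF l that] in \<open>auto simp: algebra_simps\<close>)
    show "rep \<rho> x (\<lambda>\<mu>. c * v \<mu>) = (\<lambda>\<mu>. c * rep \<rho> x v \<mu>)" if "v \<in> space S" for c v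
      unfolding rep_def sum_distrib_left
      by (rule ext, rule sum.cong) (use lin_scale[OF l that] in \<open>auto simp: algebra_simps\<close>)
  qed
qed

lemma rep_comp:
  assumes \<rho>: "\<And>m. m \<in> carrier M \<Longrightarrow> lin (space S) (\<rho> m)"
    and x: "x \<in> carrier (monoid_algebra M)" and y: "y \<in> carrier (monoid_algebra M)" and v: "v \<in> space S"
  shows "rep \<rho> x (rep \<rho> y v) w = (\<Sum>a | x a \<noteq> 0. \<Sum>b | y b \<noteq> 0. x a * y b * \<rho> a (\<rho> b v) w)"
  unfolding rep_def[of \<rho> x]
proof (rule sum.cong[OF refl])
  have s: "finite {b. y b \<noteq> 0}" "y b \<noteq> 0 \<Longrightarrow> b \<in> carrier M" "x b \<noteq> 0 \<Longrightarrow> b \<in> carrier M" for b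
    using x y by (auto simp: monoid_algebra_simps)
  fix a assume a: "a \<in> {a. x a \<noteq> 0}"
  have "\<rho> a (rep \<rho> y v) = (\<lambda>w. \<Sum>b | y b \<noteq> 0. y b * \<rho> a (\<rho> b v) w)"
    unfolding rep_def
    by (rule lin_sum[OF \<rho>[OF s(3)] s(1)]) (use a lin_mem[OF \<rho>[OF s(2)] v] in auto)
  then show "x a * \<rho> a (rep \<rho> y v) w = (\<Sum>b | y b \<noteq> 0. x a * y b * \<rho> a (\<rho> b v) w)"
    by (simp add: sum_distrib_left mult.assoc)
qed

lemma rep_mult_hom:
  assumes \<rho>: "\<And>m. m \<in> carrier M \<Longrightarrow> lin (space S) (\<rho> m)"
    and h: "\<And>a b v. a \<in> carrier M \<Longrightarrow> b \<in> carrier M \<Longrightarrow> v \<in> space S \<Longrightarrow> \<rho> (a \<otimes>\<^bsub>M\<^esub> b) v = \<rho> a (\<rho> b v)"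
    and x: "x \<in> carrier (monoid_algebra M)" and y: "y \<in> carrier (monoid_algebra M)" and v: "v \<in> space S"
  shows "rep \<rho> (x \<otimes>\<^bsub>monoid_algebra M\<^esub> y) v = rep \<rho> x (rep \<rho> y v)"
proof
  fix w
  have "\<rho> (a \<otimes>\<^bsub>M\<^esub> b) v w = \<rho> a (\<rho> b v) w" if "x a \<noteq> 0" "y b \<noteq> 0" for a b
  proof -
    have "a \<in> carrier M" "b \<in> carrier M" using x y that by (auto simp: monoid_algebra_simps)
    then show ?thesis by (simp add: h[OF _ _ v])
  qed
  then have "(\<Sum>a | x a \<noteq> 0. \<Sum>b | y b \<noteq> 0. x a * y b * \<rho> (a \<otimes>\<^bsub>M\<^esub> b) v w)
      = (\<Sum>a | x a \<noteq> 0. \<Sum>b | y b \<noteq> 0. x a * y b * \<rho> a (\<rho> b v) w)"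
    by (intro sum.cong refl) auto
  also have "\<dots> = rep \<rho> x (rep \<rho> y v) w" by (rule rep_comp[OF \<rho> x y v, symmetric])
  finally show "rep \<rho> (x \<otimes>\<^bsub>monoid_algebra M\<^esub> y) v w = rep \<rho> x (rep \<rho> y v) w"
    unfolding rep_def[of \<rho> "x \<otimes>\<^bsub>monoid_algebra M\<^esub> y"] conv_functional[OF x y] .
qed

lemma rep_mult_antihom:
  assumes \<rho>: "\<And>m. m \<in> carrier M \<Longrightarrow> lin (space S) (\<rho> m)"
    and h: "\<And>a b v. a \<in> carrier M \<Longrightarrow> b \<in> carrier M \<Longrightarrow> v \<in> space S \<Longrightarrow> \<rho> (a \<otimes>\<^bsub>M\<^esub> b) v = \<rho> b (\<rho> a v)"
    and x: "x \<in> carrier (monoid_algebra M)" and y: "y \<in> carrier (monoid_algebra M)" and v: "v \<in> space S"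
  shows "rep \<rho> (x \<otimes>\<^bsub>monoid_algebra M\<^esub> y) v = rep \<rho> y (rep \<rho> x v)"
proof
  fix w
  have "\<rho> (a \<otimes>\<^bsub>M\<^esub> b) v w = \<rho> b (\<rho> a v) w" if "x a \<noteq> 0" "y b \<noteq> 0" for a b
  proof -
    have "a \<in> carrier M" "b \<in> carrier M" using x y that by (auto simp: monoid_algebra_simps)
    then show ?thesis by (simp add: h[OF _ _ v])
  qed
  then have "(\<Sum>a | x a \<noteq> 0. \<Sum>b | y b \<noteq> 0. x a * y b * \<rho> (a \<otimes>\<^bsub>M\<^esub> b) v w)
      = (\<Sum>a | x a \<noteq> 0. \<Sum>b | y b \<noteq> 0. y b * x a * \<rho> b (\<rho> a v) w)"
    by (intro sum.cong refl) auto
  also have "\<dots> = (\<Sum>b | y b \<noteq> 0. \<Sum>a | x a \<noteq> 0. y b * x a * \<rho> b (\<rho> a v) w)" by (rule sum.swap)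
  also have "\<dots> = rep \<rho> y (rep \<rho> x v) w" by (rule rep_comp[OF \<rho> y x v, symmetric])
  finally show "rep \<rho> (x \<otimes>\<^bsub>monoid_algebra M\<^esub> y) v w = rep \<rho> y (rep \<rho> x v) w"
    unfolding rep_def[of \<rho> "x \<otimes>\<^bsub>monoid_algebra M\<^esub> y"] conv_functional[OF x y] .
qed

text \<open>The hypothesis covers left and right actions: the kernel of an antihomomorphism is a two-sided ideal
  too.\<close>

lemma rep_annihilator:
  fixes M :: "('m, 'z) monoid_scheme" and \<rho> :: "'m \<Rightarrow> ('b \<Rightarrow> 'k::field) \<Rightarrow> 'b \<Rightarrow> 'k"
  assumes M: "Group.monoid M" and \<rho>: "\<And>m. m \<in> carrier M \<Longrightarrow> lin (space S) (\<rho> m)"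
    and h: "\<And>x y v. x \<in> carrier (monoid_algebra M) \<Longrightarrow> y \<in> carrier (monoid_algebra M) \<Longrightarrow> v \<in> space S \<Longrightarrow>
      rep \<rho> (x \<otimes>\<^bsub>monoid_algebra M\<^esub> y) v = rep \<rho> x (rep \<rho> y v) \<or> rep \<rho> (x \<otimes>\<^bsub>monoid_algebra M\<^esub> y) v = rep \<rho> y (rep \<rho> x v)"
  shows "ideal {x \<in> carrier (monoid_algebra M). \<forall>v\<in>space S. \<forall>w. rep \<rho> x v w = 0} (monoid_algebra M)"
    (is "ideal ?K ?F")
proof -
  interpret ring "monoid_algebra M :: ('k, 'm \<Rightarrow> 'k) module" by (rule monoid_algebra_ring[OF M])
  show ?thesis
  proof (rule idealI)
    show "Ring.ring ?F" by (rule ring_axioms)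
    show "subgroup ?K (add_monoid ?F)"
    proof (rule group.subgroupI)
      show "Group.group (add_monoid ?F)" using a_group .
      show "?K \<noteq> {}" using zero_closed rep_zero[of \<rho>] by (auto simp: monoid_algebra_simps(4))
      fix x assume x: "x \<in> ?K"
      have "inv\<^bsub>add_monoid ?F\<^esub> x = \<ominus>\<^bsub>?F\<^esub> x" by (simp add: a_inv_def)
      moreover have "\<ominus>\<^bsub>?F\<^esub> x = (\<lambda>p. (- 1) * x p)" using monoid_algebra_uminus[OF M, of x] x by simp
      ultimately show "inv\<^bsub>add_monoid ?F\<^esub> x \<in> ?K"
        using x a_inv_closed[of x] rep_scale[of \<rho> "- 1" x] by auto
      fix y assume y: "y \<in> ?K"
      show "x \<otimes>\<^bsub>add_monoid ?F\<^esub> y \<in> ?K"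
        using x y rep_add[of x M y \<rho>] a_closed[of x y] by (simp add: monoid_algebra_simps(5))
    qed auto
    fix a x assume a: "a \<in> ?K" and x: "x \<in> carrier ?F"
    have aF: "a \<in> carrier ?F" using a by simp
    have a0: "rep \<rho> a v = (\<lambda>w. 0)" if "v \<in> space S" for v using a that by auto
    note lx = rep_lin[OF \<rho> x]
    have "rep \<rho> (x \<otimes>\<^bsub>?F\<^esub> a) v = (\<lambda>w. 0)" "rep \<rho> (a \<otimes>\<^bsub>?F\<^esub> x) v = (\<lambda>w. 0)" if v: "v \<in> space S" for v
      using h[OF x aF v] h[OF aF x v] a0[OF v] a0[OF lin_mem[OF lx v]] lin_zero[OF lx] by auto
    then show "x \<otimes>\<^bsub>?F\<^esub> a \<in> ?K" "a \<otimes>\<^bsub>?F\<^esub> x \<in> ?K" using x aF by auto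
  qed
qed

section \<open>Commutants of a tensor product\<close>

text \<open>The generators in \<open>J\<close> act on one of the two tensor factors each, through \<open>\<phi>1\<close> on the first and through
  \<open>\<phi>2\<close> on the second.\<close>

locale tensor_end = prod_idx S1 S2 pr S
  for S1 :: "'b set" and S2 :: "'c set" and pr :: "'b \<Rightarrow> 'c \<Rightarrow> 'w" and S :: "'w set" +
  fixes J1 :: "'i set" and act1 :: "('b \<Rightarrow> 'k::field) \<Rightarrow> 'i \<Rightarrow> 'b \<Rightarrow> 'k"
    and J2 :: "'j set" and act2 :: "('c \<Rightarrow> 'k) \<Rightarrow> 'j \<Rightarrow> 'c \<Rightarrow> 'k"
    and J :: "'l set" and act :: "('w \<Rightarrow> 'k) \<Rightarrow> 'l \<Rightarrow> 'w \<Rightarrow> 'k"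
    and \<phi>1 :: "'i \<Rightarrow> 'l" and \<phi>2 :: "'j \<Rightarrow> 'l"
  assumes act1: "i \<in> J1 \<Longrightarrow> lin (space S1) (\<lambda>u. act1 u i)"
    and act2: "j \<in> J2 \<Longrightarrow> lin (space S2) (\<lambda>u. act2 u j)"
    and J_eq: "J = \<phi>1 ` J1 \<union> \<phi>2 ` J2"
    and c1: "i \<in> J1 \<Longrightarrow> v \<in> space S \<Longrightarrow> act v (\<phi>1 i) = L (\<lambda>u. act1 u i) v"
    and c2: "j \<in> J2 \<Longrightarrow> v \<in> space S \<Longrightarrow> act v (\<phi>2 j) = R (\<lambda>u. act2 u j) v"
begin

abbreviation "AA \<equiv> end_algebra (space S1) J1 act1"
abbreviation "BB \<equiv> end_algebra (space S2) J2 act2"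
abbreviation "CC \<equiv> end_algebra (space S) J act"
abbreviation "FF \<equiv> (monoid_algebra (AA \<times>\<times> BB) :: ('k, _) module)"

definition "II = relation_ideal FF (bilinear_relations AA BB)"

lemma mAB: "Group.monoid (AA \<times>\<times> BB)"
  by (rule DirProd_monoid[OF end_monoid end_monoid]) (use act1 act2 in auto)

lemma AA_lin: "a \<in> carrier AA \<Longrightarrow> lin (space S1) a" by (simp add: end_algebra_carrier lin_on_iff)
lemma BB_lin: "a \<in> carrier BB \<Longrightarrow> lin (space S2) a" by (simp add: end_algebra_carrier lin_on_iff)
lemma CC_lin: "a \<in> carrier CC \<Longrightarrow> lin (space S) a" by (simp add: end_algebra_carrier lin_on_iff)

lemma L_cong: "(\<And>u. u \<in> space S1 \<Longrightarrow> f u = g u) \<Longrightarrow> L f v = L g v"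
  by (rule space_eqI[OF L_space L_space]) (simp add: L_at sl_space)

lemma R_cong: "(\<And>u. u \<in> space S2 \<Longrightarrow> f u = g u) \<Longrightarrow> R f v = R g v"
  by (rule space_eqI[OF R_space R_space]) (simp add: R_at prod_idx.sl_space[OF swapped])

definition T :: "(('b \<Rightarrow> 'k) \<Rightarrow> 'b \<Rightarrow> 'k) \<times> (('c \<Rightarrow> 'k) \<Rightarrow> 'c \<Rightarrow> 'k) \<Rightarrow> ('w \<Rightarrow> 'k) \<Rightarrow> 'w \<Rightarrow> 'k" where
  "T p v = L (fst p) (R (snd p) v)"

lemma T_lin: "p \<in> carrier AA \<times> carrier BB \<Longrightarrow> lin (space S) (T p)"
  unfolding T_def by (rule lin_comp[OF lin_L[OF AA_lin] lin_R[OF BB_lin]]) auto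

lemma T_mult:
  assumes "p \<in> carrier AA \<times> carrier BB" "p' \<in> carrier AA \<times> carrier BB" "v \<in> space S"
  shows "T (p \<otimes>\<^bsub>AA \<times>\<times> BB\<^esub> p') v = T p (T p' v)"
proof -
  obtain a b a' b' where p: "p = (a, b)" "p' = (a', b')" by (cases p, cases p') auto
  have l: "lin (space S1) a" "lin (space S1) a'" "lin (space S2) b" "lin (space S2) b'"
    using assms AA_lin BB_lin by (auto simp: p)
  have "T (p \<otimes>\<^bsub>AA \<times>\<times> BB\<^esub> p') v = L (\<lambda>u. a (a' u)) (R (\<lambda>u. b (b' u)) v)"
    unfolding T_def p by (simp add: end_algebra_ops)
      (intro trans[OF L_cong arg_cong[where f = "L _"]] R_cong; simp add: compose_def)
  also have "\<dots> = L a (L a' (R b (R b' v)))" by (simp add: L_comp[OF l(2)] R_comp[OF l(4)])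
  also have "\<dots> = T p (T p' v)"
    unfolding T_def p using L_R_commute[OF l(2,3) R_space[of b' v]] by simp
  finally show ?thesis .
qed

lemma T_act:
  assumes p: "p \<in> carrier AA \<times> carrier BB" and v: "v \<in> space S" and j: "j \<in> J"
  shows "T p (act v j) = act (T p v) j"
proof -
  obtain a b where p: "p = (a, b)" "a \<in> carrier AA" "b \<in> carrier BB" using p by auto
  note la = AA_lin[OF p(2)] and lb = BB_lin[OF p(3)]
  have Tv: "T p v \<in> space S" unfolding T_def by (rule L_space)
  consider i where "i \<in> J1" "j = \<phi>1 i" | i where "i \<in> J2" "j = \<phi>2 i" using j J_eq by auto
  then show ?thesis
  proof cases
    case 1
    have "T p (act v j) = L a (L (\<lambda>u. act1 u i) (R b v))"
      unfolding 1 c1[OF 1(1) v] T_def p using L_R_commute[OF act1[OF 1(1)] lb v] by simp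
    also have "\<dots> = L (\<lambda>u. a (act1 u i)) (R b v)" by (rule L_comp[OF act1[OF 1(1)]])
    also have "\<dots> = L (\<lambda>u. act1 (a u) i) (R b v)"
      by (rule L_cong) (use p(2) 1 in \<open>auto simp: end_algebra_carrier\<close>)
    also have "\<dots> = L (\<lambda>u. act1 u i) (L a (R b v))" by (rule L_comp[OF la, symmetric])
    finally show ?thesis unfolding 1 c1[OF 1(1) Tv] by (simp add: T_def p)
  next
    case 2
    have "T p (act v j) = L a (R (\<lambda>u. b (act2 u i)) v)"
      unfolding 2 c2[OF 2(1) v] T_def p by (simp add: R_comp[OF act2[OF 2(1)]])
    also have "\<dots> = L a (R (\<lambda>u. act2 (b u) i) v)"
      by (rule arg_cong[OF R_cong]) (use p(3) 2 in \<open>auto simp: end_algebra_carrier\<close>)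
    also have "\<dots> = L a (R (\<lambda>u. act2 u i) (R b v))" by (simp add: R_comp[OF lb])
    also have "\<dots> = R (\<lambda>u. act2 u i) (L a (R b v))" by (rule L_R_commute[OF la act2[OF 2(1)] R_space])
    finally show ?thesis unfolding 2 c2[OF 2(1) Tv] by (simp add: T_def p)
  qed
qed

abbreviation "PSI \<equiv> rep T"

lemma F_supp:
  assumes "x \<in> carrier FF" shows "finite {p. x p \<noteq> 0}" "x p \<noteq> 0 \<Longrightarrow> p \<in> carrier AA \<times> carrier BB"
  using assms by (auto simp: monoid_algebra_simps DirProd_def)

lemma T_lin': "p \<in> carrier (AA \<times>\<times> BB) \<Longrightarrow> lin (space S) (T p)"
  using T_lin by (simp add: DirProd_def)

lemmas PSI_add = rep_add[where M = "AA \<times>\<times> BB" and \<rho> = T]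
lemmas PSI_scale = rep_scale[where \<rho> = T]
lemmas PSI_basis = rep_basis[where \<rho> = T]
lemmas PSI_zero = rep_zero[where \<rho> = T]

lemma lin_PSI: "x \<in> carrier FF \<Longrightarrow> lin (space S) (PSI x)"
  by (rule rep_lin[OF T_lin'])

lemma PSI_mult:
  assumes "x \<in> carrier FF" "y \<in> carrier FF" "v \<in> space S"
  shows "PSI (x \<otimes>\<^bsub>FF\<^esub> y) v = PSI x (PSI y v)"
  by (rule rep_mult_hom[OF T_lin' _ assms]) (use T_mult in \<open>auto simp: DirProd_def\<close>)

lemma FF_basis: "a \<in> carrier AA \<Longrightarrow> b \<in> carrier BB \<Longrightarrow> basis_vec (a, b) \<in> carrier FF"
  by (rule basis_vec_carrier) (simp add: DirProd_def)

lemma FF_ops: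
  "x \<in> carrier FF \<Longrightarrow> y \<in> carrier FF \<Longrightarrow> (\<lambda>p. x p + y p) \<in> carrier FF"
  "x \<in> carrier FF \<Longrightarrow> (\<lambda>p. c * x p) \<in> carrier FF"
  "(\<lambda>p. 0) \<in> carrier FF"
proof -
  interpret ring FF by (rule monoid_algebra_ring[OF mAB])
  show "x \<in> carrier FF \<Longrightarrow> y \<in> carrier FF \<Longrightarrow> (\<lambda>p. x p + y p) \<in> carrier FF"
    using a_closed[of x y] by (simp add: monoid_algebra_simps(5))
  show "x \<in> carrier FF \<Longrightarrow> (\<lambda>p. c * x p) \<in> carrier FF"
    using monoid_algebra_smult_closed[of x "AA \<times>\<times> BB" c] by (simp add: monoid_algebra_simps(6))
  show "(\<lambda>p. 0) \<in> carrier FF" using zero_closed by (simp add: monoid_algebra_simps(4))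
qed

lemma AA_ops:
  "a \<in> carrier AA \<Longrightarrow> a' \<in> carrier AA \<Longrightarrow> a \<oplus>\<^bsub>AA\<^esub> a' \<in> carrier AA"
  "a \<in> carrier AA \<Longrightarrow> c \<odot>\<^bsub>AA\<^esub> a \<in> carrier AA" "\<zero>\<^bsub>AA\<^esub> \<in> carrier AA" "\<one>\<^bsub>AA\<^esub> \<in> carrier AA"
  using end_closed(2-5)[where J = J1 and S = S1 and act = act1, OF act1] unfolding end_algebra_ops by simp_all

lemma BB_ops:
  "a \<in> carrier BB \<Longrightarrow> a' \<in> carrier BB \<Longrightarrow> a \<oplus>\<^bsub>BB\<^esub> a' \<in> carrier BB"
  "a \<in> carrier BB \<Longrightarrow> c \<odot>\<^bsub>BB\<^esub> a \<in> carrier BB" "\<zero>\<^bsub>BB\<^esub> \<in> carrier BB" "\<one>\<^bsub>BB\<^esub> \<in> carrier BB"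
  using end_closed(2-5)[where J = J2 and S = S2 and act = act2, OF act2] unfolding end_algebra_ops by simp_all

text \<open>Congruence modulo the bilinearity ideal.\<close>

definition "cg x y \<longleftrightarrow> x \<in> carrier FF \<and> y \<in> carrier FF \<and> (\<lambda>p. x p - y p) \<in> II"

lemma rel_sub: "{l \<ominus>\<^bsub>FF\<^esub> r | l r. (l, r) \<in> bilinear_relations AA BB} \<subseteq> carrier FF"
  and rel_carrier: "(l, r) \<in> bilinear_relations AA BB \<Longrightarrow> l \<in> carrier FF \<and> r \<in> carrier FF"
proof -
  interpret ring FF by (rule monoid_algebra_ring[OF mAB])
  show *: "l \<in> carrier FF \<and> r \<in> carrier FF" if "(l, r) \<in> bilinear_relations AA BB" for l r
    using that unfolding bilinear_relations_def Let_def monoid_algebra_simps(5,6)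
    by (auto intro!: FF_ops FF_basis AA_ops BB_ops)
  show "{l \<ominus>\<^bsub>FF\<^esub> r | l r. (l, r) \<in> bilinear_relations AA BB} \<subseteq> carrier FF"
    using * by auto
qed

lemma II_ideal: "ideal II FF"
  unfolding II_def relation_ideal_def
  by (rule ring.genideal_ideal[OF monoid_algebra_ring[OF mAB] rel_sub])

lemma cg_rel: "(l, r) \<in> bilinear_relations AA BB \<Longrightarrow> cg l r"
proof -
  assume a: "(l, r) \<in> bilinear_relations AA BB"
  have "l \<ominus>\<^bsub>FF\<^esub> r \<in> II" unfolding II_def relation_ideal_def
    using ring.genideal_self[OF monoid_algebra_ring[OF mAB] rel_sub] a by blast
  then show ?thesis unfolding cg_def using rel_carrier[OF a] monoid_algebra_minus[OF mAB, of l r] by simp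
qed

lemma II_sub: "additive_subgroup II FF" by (rule ideal.axioms(1)[OF II_ideal])

lemma II_zero: "(\<lambda>p. 0) \<in> II"
  using additive_subgroup.zero_closed[OF II_sub] by (simp add: monoid_algebra_simps(4))

lemma cg_refl: "x \<in> carrier FF \<Longrightarrow> cg x x"
  unfolding cg_def using II_zero by simp

lemma II_add: "x \<in> II \<Longrightarrow> y \<in> II \<Longrightarrow> (\<lambda>p. x p + y p) \<in> II"
  using additive_subgroup.a_closed[OF II_sub, of x y] by (simp add: monoid_algebra_simps(5))

lemma II_carrier: "x \<in> II \<Longrightarrow> x \<in> carrier FF"
  by (rule additive_subgroup.a_Hcarr[OF II_sub])

lemma II_uminus: "x \<in> II \<Longrightarrow> (\<lambda>p. - x p) \<in> II"
  using additive_subgroup.a_inv_closed[OF II_sub, of x] monoid_algebra_uminus[OF mAB II_carrier] by simp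

lemma cg_add: "cg x y \<Longrightarrow> cg x' y' \<Longrightarrow> cg (\<lambda>p. x p + x' p) (\<lambda>p. y p + y' p)"
  unfolding cg_def using II_add[of "\<lambda>p. x p - y p" "\<lambda>p. x' p - y' p"] FF_ops(1)
  by (auto simp: algebra_simps)

lemma cg_sym: "cg x y \<Longrightarrow> cg y x"
  unfolding cg_def using II_uminus[of "\<lambda>p. x p - y p"] by auto

lemma cg_trans: "cg x y \<Longrightarrow> cg y z \<Longrightarrow> cg x z"
  unfolding cg_def using II_add[of "\<lambda>p. x p - y p" "\<lambda>p. y p - z p"] by auto

lemma cg_bilinear:
  "a \<in> carrier AA \<Longrightarrow> a' \<in> carrier AA \<Longrightarrow> b \<in> carrier BB \<Longrightarrow>
     cg (basis_vec (a \<oplus>\<^bsub>AA\<^esub> a', b)) (\<lambda>p. basis_vec (a, b) p + basis_vec (a', b) p)"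
  "a \<in> carrier AA \<Longrightarrow> b \<in> carrier BB \<Longrightarrow> b' \<in> carrier BB \<Longrightarrow>
     cg (basis_vec (a, b \<oplus>\<^bsub>BB\<^esub> b')) (\<lambda>p. basis_vec (a, b) p + basis_vec (a, b') p)"
  "a \<in> carrier AA \<Longrightarrow> b \<in> carrier BB \<Longrightarrow> cg (basis_vec (c \<odot>\<^bsub>AA\<^esub> a, b)) (\<lambda>p. c * basis_vec (a, b) p)"
  "a \<in> carrier AA \<Longrightarrow> b \<in> carrier BB \<Longrightarrow> cg (basis_vec (a, c \<odot>\<^bsub>BB\<^esub> b)) (\<lambda>p. c * basis_vec (a, b) p)"
  by (rule cg_rel, unfold bilinear_relations_def Let_def monoid_algebra_simps(5,6), blast)+

lemma II_PSI: assumes "x \<in> II" "v \<in> space S" shows "PSI x v w = 0"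
proof -
  interpret ring FF by (rule monoid_algebra_ring[OF mAB])
  define K where "K = {x \<in> carrier FF. \<forall>v\<in>space S. \<forall>w. PSI x v w = 0}"
  have "ideal K FF" unfolding K_def by (rule rep_annihilator[OF mAB T_lin']) (simp_all add: PSI_mult)
  moreover have "{l \<ominus>\<^bsub>FF\<^esub> r | l r. (l, r) \<in> bilinear_relations AA BB} \<subseteq> K"
  proof clarify
    fix l r assume lr: "(l, r) \<in> bilinear_relations AA BB"
    have lrF: "l \<in> carrier FF" "r \<in> carrier FF" using rel_carrier[OF lr] by auto
    have e: "PSI l v w = PSI r v w" if v: "v \<in> space S" for v w
    proof -
      have 1: "L (a \<oplus>\<^bsub>AA\<^esub> a') u w = L a u w + L a' u w" for a a' u by (simp add: L_def end_algebra_ops sl_space)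
      have 2: "L (c \<odot>\<^bsub>AA\<^esub> a) u w = c * L a u w" for a c u by (simp add: L_def end_algebra_ops sl_space)
      have 3: "R (b \<oplus>\<^bsub>BB\<^esub> b') v = (\<lambda>w. R b v w + R b' v w)" for b b'
        by (rule ext) (simp add: prod_idx.L_def[OF swapped] end_algebra_ops prod_idx.sl_space[OF swapped])
      have 4: "R (c \<odot>\<^bsub>BB\<^esub> b) v = (\<lambda>w. c * R b v w)" for b c
        by (rule ext) (simp add: prod_idx.L_def[OF swapped] end_algebra_ops prod_idx.sl_space[OF swapped])
      show ?thesis using lr
        unfolding bilinear_relations_def Let_def monoid_algebra_simps(5,6)
        by (auto simp: PSI_add FF_basis PSI_scale PSI_basis T_def 1 2 3 4
            lin_add[OF lin_L[OF AA_lin] R_space R_space] lin_scale[OF lin_L[OF AA_lin] R_space])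
    qed
    have "l \<ominus>\<^bsub>FF\<^esub> r = (\<lambda>p. l p + (- 1) * r p)" using monoid_algebra_minus[OF mAB lrF] by simp
    then show "l \<ominus>\<^bsub>FF\<^esub> r \<in> K"
      using PSI_add[OF lrF(1) FF_ops(2)[OF lrF(2), of "- 1"]] FF_ops(1)[OF lrF(1) FF_ops(2)[OF lrF(2), of "- 1"]]
      by (simp only: K_def mem_Collect_eq PSI_scale) (simp add: e)
  qed
  ultimately have "II \<subseteq> K" unfolding II_def relation_ideal_def by (rule genideal_minimal)
  then show ?thesis using assms by (auto simp: K_def)
qed

lemma T_basis:
  assumes "p \<in> {f. lin (space S1) f} \<times> {g. lin (space S2) g}" "x \<in> S1" "y \<in> S2" "x' \<in> S1" "y' \<in> S2"
  shows "T p (basis_vec (pr x y)) (pr x' y') = fst p (basis_vec x) x' * snd p (basis_vec y) y'"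
  unfolding T_def using assms by (intro L_R_basis) auto

text \<open>A list \<open>K\<close> of pure tensors stands for the element \<open>el K\<close> of the free space on pairs and for an operator,
  which has the matrix \<open>cf K\<close>.\<close>

definition "el K = (\<lambda>p. \<Sum>t\<leftarrow>K. basis_vec t p)"

definition "cf K x x' y y' = (\<Sum>t\<leftarrow>K. fst t (basis_vec x) x' * snd t (basis_vec y) y')"

lemma el_simps: "el [] = (\<lambda>p. 0)" "el (t # K) = (\<lambda>p. basis_vec t p + el K p)"
  by (auto simp: el_def)

lemma el_carrier: "set K \<subseteq> carrier AA \<times> carrier BB \<Longrightarrow> el K \<in> carrier FF"
  by (induction K) (auto simp: el_simps intro!: FF_ops FF_basis)

lemma AA_eqI:
  assumes a: "a \<in> carrier AA" "a' \<in> carrier AA"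
    and e: "\<And>x x'. x \<in> S1 \<Longrightarrow> x' \<in> S1 \<Longrightarrow> a (basis_vec x) x' = a' (basis_vec x) x'"
  shows "a = a'"
proof -
  have "a (basis_vec x) = a' (basis_vec x)" if "x \<in> S1" for x
  proof
    fix x' show "a (basis_vec x) x' = a' (basis_vec x) x'"
      using e[OF that] lin_mem[OF AA_lin[OF a(1)] basis_vec_space[OF that]]
        lin_mem[OF AA_lin[OF a(2)] basis_vec_space[OF that]]
      by (cases "x' \<in> S1") (auto simp: space_def)
  qed
  then have "a v = a' v" if "v \<in> space S1" for v
    by (rule lin_basis_eq[OF fin1 AA_lin[OF a(1)] AA_lin[OF a(2)] _ that])
  moreover have "a \<in> extensional (space S1)" "a' \<in> extensional (space S1)"
    using a by (auto simp: end_algebra_carrier lin_on_iff)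
  ultimately show ?thesis by (rule extensionalityI[rotated 2])
qed

lemma BB_zeroI:
  assumes b: "b \<in> carrier BB"
    and e: "\<And>y y'. y \<in> S2 \<Longrightarrow> y' \<in> S2 \<Longrightarrow> b (basis_vec y) y' = 0"
  shows "b = \<zero>\<^bsub>BB\<^esub>"
proof -
  have l0: "lin (space S2) (\<lambda>v \<mu>. 0)" by (simp add: lin_def space_zero)
  have "b (basis_vec y) = (\<lambda>\<mu>. 0)" if "y \<in> S2" for y
  proof
    fix y' show "b (basis_vec y) y' = 0"
      using e[OF that] lin_mem[OF BB_lin[OF b] basis_vec_space[OF that]]
      by (cases "y' \<in> S2") (auto simp: space_def)
  qed
  then have "b v = (\<lambda>\<mu>. 0)" if "v \<in> space S2" for v
    by (rule lin_basis_eq[OF fin2 BB_lin[OF b] l0 _ that])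
  moreover have "b \<in> extensional (space S2)" using b by (auto simp: end_algebra_carrier lin_on_iff)
  ultimately show ?thesis unfolding end_algebra_ops by (intro extensionalityI[of b "space S2"]) auto
qed

fun lc where
  "lc k [] = \<zero>\<^bsub>AA\<^esub>"
| "lc k (t # K) = (k t \<odot>\<^bsub>AA\<^esub> fst t) \<oplus>\<^bsub>AA\<^esub> lc k K"

lemma lc_carrier: "set K \<subseteq> carrier AA \<times> carrier BB \<Longrightarrow> lc k K \<in> carrier AA"
  by (induction K) (auto intro!: AA_ops)

lemma lc_at: "u \<in> space S1 \<Longrightarrow> lc k K u w = (\<Sum>t\<leftarrow>K. k t * fst t u w)"
  by (induction K) (auto simp: end_algebra_ops)

lemma cg_basis_zero:
  "b \<in> carrier BB \<Longrightarrow> cg (basis_vec (\<zero>\<^bsub>AA\<^esub>, b)) (\<lambda>p. 0)"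
  "a \<in> carrier AA \<Longrightarrow> cg (basis_vec (a, \<zero>\<^bsub>BB\<^esub>)) (\<lambda>p. 0)"
proof -
  have z: "0 \<odot>\<^bsub>AA\<^esub> \<zero>\<^bsub>AA\<^esub> = \<zero>\<^bsub>AA\<^esub>" "0 \<odot>\<^bsub>BB\<^esub> \<zero>\<^bsub>BB\<^esub> = \<zero>\<^bsub>BB\<^esub>"
    unfolding end_algebra_ops by auto
  show "b \<in> carrier BB \<Longrightarrow> cg (basis_vec (\<zero>\<^bsub>AA\<^esub>, b)) (\<lambda>p. 0)"
    using cg_bilinear(3)[OF AA_ops(3), of b 0] z(1) by simp
  show "a \<in> carrier AA \<Longrightarrow> cg (basis_vec (a, \<zero>\<^bsub>BB\<^esub>)) (\<lambda>p. 0)"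
    using cg_bilinear(4)[OF _ BB_ops(3), of a 0] z(2) by simp
qed

lemma cg_lc:
  assumes b: "b \<in> carrier BB" and "set K \<subseteq> carrier AA \<times> carrier BB"
  shows "cg (basis_vec (lc k K, b)) (\<lambda>p. \<Sum>t\<leftarrow>K. basis_vec (fst t, k t \<odot>\<^bsub>BB\<^esub> b) p)"
  using assms(2)
proof (induction K)
  case Nil then show ?case using cg_basis_zero(1)[OF b] by simp
next
  case (Cons t K)
  have t: "fst t \<in> carrier AA" and K: "set K \<subseteq> carrier AA \<times> carrier BB" using Cons.prems by auto
  have 1: "cg (basis_vec (k t \<odot>\<^bsub>AA\<^esub> fst t, b)) (basis_vec (fst t, k t \<odot>\<^bsub>BB\<^esub> b))"
    by (rule cg_trans[OF cg_bilinear(3)[OF t b] cg_sym[OF cg_bilinear(4)[OF t b]]])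
  have 2: "cg (basis_vec (lc k (t # K), b)) (\<lambda>p. basis_vec (k t \<odot>\<^bsub>AA\<^esub> fst t, b) p + basis_vec (lc k K, b) p)"
    unfolding lc.simps by (rule cg_bilinear(1)[OF AA_ops(2)[OF t] lc_carrier[OF K] b])
  show ?case using cg_trans[OF 2 cg_add[OF 1 Cons.IH[OF K]]] by simp
qed

lemma cg_merge:
  assumes b: "b \<in> carrier BB" and "set K \<subseteq> carrier AA \<times> carrier BB"
  shows "cg (\<lambda>p. el K p + (\<Sum>t\<leftarrow>K. basis_vec (fst t, k t \<odot>\<^bsub>BB\<^esub> b) p))
    (el (map (\<lambda>t. (fst t, snd t \<oplus>\<^bsub>BB\<^esub> (k t \<odot>\<^bsub>BB\<^esub> b))) K))"
  using assms(2)
proof (induction K)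
  case Nil then show ?case by (simp add: el_simps cg_refl FF_ops)
next
  case (Cons t K)
  have t: "fst t \<in> carrier AA" "snd t \<in> carrier BB" and K: "set K \<subseteq> carrier AA \<times> carrier BB"
    using Cons.prems by auto
  have "cg (\<lambda>p. basis_vec t p + basis_vec (fst t, k t \<odot>\<^bsub>BB\<^esub> b) p) (basis_vec (fst t, snd t \<oplus>\<^bsub>BB\<^esub> (k t \<odot>\<^bsub>BB\<^esub> b)))"
    using cg_sym[OF cg_bilinear(2)[OF t(1,2) BB_ops(2)[OF b]]] by simp
  from cg_add[OF this Cons.IH[OF K]] show ?case by (simp add: el_simps algebra_simps)
qed

text \<open>
  Injectivity of the map from the tensor product to operators, by induction on the number of pure tensors. If the
  second component \<open>b\<close> of the first tensor has a nonzero matrix entry, that entry of the relation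
  expresses its first component through the others; distributing it makes the list shorter.
\<close>

lemma el_kernel:
  assumes "set K \<subseteq> carrier AA \<times> carrier BB"
    and "\<And>x x' y y'. x \<in> S1 \<Longrightarrow> x' \<in> S1 \<Longrightarrow> y \<in> S2 \<Longrightarrow> y' \<in> S2 \<Longrightarrow> cf K x x' y y' = 0"
  shows "cg (el K) (\<lambda>p. 0)"
  using assms
proof (induction "length K" arbitrary: K)
  case 0 then show ?case by (simp add: el_simps cg_refl FF_ops)
next
  case (Suc n)
  then obtain a b K' where K: "K = (a, b) # K'" by (cases K) auto
  have ab: "a \<in> carrier AA" "b \<in> carrier BB" and K': "set K' \<subseteq> carrier AA \<times> carrier BB" and n: "n = length K'"
    using Suc.prems(1) Suc.hyps(2) by (auto simp: K)
  have z: "a (basis_vec x) x' * b (basis_vec y) y' + cf K' x x' y y' = 0"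
    if "x \<in> S1" "x' \<in> S1" "y \<in> S2" "y' \<in> S2" for x x' y y'
    using Suc.prems(2)[OF that] by (simp add: cf_def K)
  show ?case
  proof (cases "\<exists>y0 y0'. y0 \<in> S2 \<and> y0' \<in> S2 \<and> b (basis_vec y0) y0' \<noteq> 0")
    case False
    then have "b = \<zero>\<^bsub>BB\<^esub>" by (intro BB_zeroI[OF ab(2)]) blast
    then have 1: "cg (basis_vec (a, b)) (\<lambda>p. 0)" using cg_basis_zero(2)[OF ab(1)] by simp
    have 2: "cg (el K') (\<lambda>p. 0)"
    proof (rule Suc.hyps(1)[OF n K'])
      fix x x' y y' assume xy: "x \<in> S1" "x' \<in> S1" "y \<in> S2" "y' \<in> S2"
      have "b (basis_vec y) y' = 0" using False xy by blast
      then show "cf K' x x' y y' = 0" using z[OF xy] by simp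
    qed
    show ?thesis using cg_add[OF 1 2] by (simp add: K el_simps)
  next
    case True
    then obtain y0 y0' where y0: "y0 \<in> S2" "y0' \<in> S2" and \<beta>: "b (basis_vec y0) y0' \<noteq> 0" by blast
    (* coefficients that express a through the other first components *)
    define k where "k t = - snd t (basis_vec y0) y0' / b (basis_vec y0) y0'" for t :: "(('b \<Rightarrow> 'k) \<Rightarrow> 'b \<Rightarrow> 'k) \<times> (('c \<Rightarrow> 'k) \<Rightarrow> 'c \<Rightarrow> 'k)"
    have ka: "(\<Sum>t\<leftarrow>K'. k t * fst t (basis_vec x) x') = a (basis_vec x) x'" if "x \<in> S1" "x' \<in> S1" for x x'
    proof -
      have "(\<Sum>t\<leftarrow>Z. k t * fst t (basis_vec x) x') * b (basis_vec y0) y0' = - cf Z x x' y0 y0'" for Z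
        using \<beta> by (induction Z) (auto simp: k_def cf_def algebra_simps)
      then have "(\<Sum>t\<leftarrow>K'. k t * fst t (basis_vec x) x') * b (basis_vec y0) y0' = a (basis_vec x) x' * b (basis_vec y0) y0'"
        using z[OF that y0] by (simp add: add_eq_0_iff)
      then show ?thesis using \<beta> by simp
    qed
    have a: "a = lc k K'"
      by (rule AA_eqI[OF ab(1) lc_carrier[OF K']]) (simp add: lc_at basis_vec_space ka)
    let ?K = "map (\<lambda>t. (fst t, snd t \<oplus>\<^bsub>BB\<^esub> (k t \<odot>\<^bsub>BB\<^esub> b))) K'"
    have "cg (\<lambda>p. el K' p + basis_vec (a, b) p) (\<lambda>p. el K' p + (\<Sum>t\<leftarrow>K'. basis_vec (fst t, k t \<odot>\<^bsub>BB\<^esub> b) p))"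
      unfolding a by (rule cg_add[OF cg_refl[OF el_carrier[OF K']] cg_lc[OF ab(2) K']])
    from cg_trans[OF this cg_merge[OF ab(2) K']] have 1: "cg (el K) (el ?K)"
      by (simp add: K el_simps add.commute)
    have "cg (el ?K) (\<lambda>p. 0)"
    proof (rule Suc.hyps(1))
      show "n = length ?K" using n by simp
      show "set ?K \<subseteq> carrier AA \<times> carrier BB" using K' ab(2) by (auto intro!: BB_ops)
      fix x x' y y' assume xy: "x \<in> S1" "x' \<in> S1" "y \<in> S2" "y' \<in> S2"
      have "cf (map (\<lambda>t. (fst t, snd t \<oplus>\<^bsub>BB\<^esub> (k t \<odot>\<^bsub>BB\<^esub> b))) Z) x x' y y'
          = cf Z x x' y y' + (\<Sum>t\<leftarrow>Z. k t * fst t (basis_vec x) x') * b (basis_vec y) y'" for Z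
        using basis_vec_space[OF xy(3)] by (induction Z) (auto simp: cf_def end_algebra_ops algebra_simps)
      then show "cf ?K x x' y y' = 0" using z[OF xy] ka[OF xy(1,2)] by (simp add: add.commute)
    qed
    then show ?thesis by (rule cg_trans[OF 1])
  qed
qed

lemma cg_el:
  assumes "x \<in> carrier FF"
  shows "\<exists>K. set K \<subseteq> carrier AA \<times> carrier BB \<and> cg x (el K)"
proof -
  obtain ps where ps: "set ps = {p. x p \<noteq> 0}" "distinct ps"
    using finite_distinct_list[OF F_supp(1)[OF assms]] by blast
  have c: "cg (\<lambda>p. \<Sum>t\<leftarrow>Z. x t * basis_vec t p) (el (map (\<lambda>t. (x t \<odot>\<^bsub>AA\<^esub> fst t, snd t)) Z))"
    if "set Z \<subseteq> carrier AA \<times> carrier BB" for Z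
    using that
  proof (induction Z)
    case Nil then show ?case by (simp add: el_simps cg_refl FF_ops)
  next
    case (Cons t Z)
    have t: "fst t \<in> carrier AA" "snd t \<in> carrier BB" using Cons.prems by auto
    have "cg (\<lambda>p. x t * basis_vec t p) (basis_vec (x t \<odot>\<^bsub>AA\<^esub> fst t, snd t))"
      using cg_sym[OF cg_bilinear(3)[OF t, of "x t"]] by simp
    from cg_add[OF this Cons.IH] show ?case using Cons.prems by (simp add: el_simps)
  qed
  have "x = (\<lambda>p. \<Sum>t\<leftarrow>ps. x t * basis_vec t p)"
  proof
    fix p
    have "(\<Sum>t\<leftarrow>ps. x t * basis_vec t p) = (\<Sum>t\<in>set ps. x t * basis_vec t p)"
      by (rule sum_list_distinct_conv_sum_set[OF ps(2)])
    also have "\<dots> = (\<Sum>t\<in>set ps. if t = p then x t else 0)"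
      by (intro sum.cong) (auto simp: basis_vec_def)
    also have "\<dots> = x p" unfolding ps(1) using F_supp(1)[OF assms] by (simp add: sum.delta)
    finally show "x p = (\<Sum>t\<leftarrow>ps. x t * basis_vec t p)" by simp
  qed
  moreover have s: "set ps \<subseteq> carrier AA \<times> carrier BB" unfolding ps(1) using F_supp(2)[OF assms] by blast
  ultimately have "cg x (el (map (\<lambda>t. (x t \<odot>\<^bsub>AA\<^esub> fst t, snd t)) ps))" using c[OF s] by simp
  then show ?thesis using s by (intro exI conjI) (auto intro!: AA_ops)
qed

lemma PSI_el: "set K \<subseteq> carrier AA \<times> carrier BB \<Longrightarrow> PSI (el K) v w = (\<Sum>t\<leftarrow>K. T t v w)"
proof (induction K)
  case Nil then show ?case by (simp add: el_simps PSI_zero)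
next
  case (Cons t K)
  then have "basis_vec t \<in> carrier FF" "el K \<in> carrier FF"
    using FF_basis[of "fst t" "snd t"] el_carrier by auto
  then show ?case using Cons by (simp add: el_simps PSI_add PSI_basis)
qed

lemma cg_PSI: "cg x y \<Longrightarrow> v \<in> space S \<Longrightarrow> PSI x v w = PSI y v w"
proof -
  assume c: "cg x y" and v: "v \<in> space S"
  have F: "(\<lambda>p. x p - y p) \<in> carrier FF" "y \<in> carrier FF"
    using c II_carrier unfolding cg_def by auto
  have "PSI (\<lambda>p. (x p - y p) + y p) v w = PSI (\<lambda>p. x p - y p) v w + PSI y v w"
    by (rule PSI_add[OF F])
  then show ?thesis using II_PSI[of "\<lambda>p. x p - y p" v w] c v by (simp add: cg_def)
qed

lemma PSI_ker:
  assumes x: "x \<in> carrier FF" and z: "\<And>v w. v \<in> space S \<Longrightarrow> PSI x v w = 0"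
  shows "x \<in> II"
proof -
  obtain K where K: "set K \<subseteq> carrier AA \<times> carrier BB" "cg x (el K)" using cg_el[OF x] by blast
  have "cg (el K) (\<lambda>p. 0)"
  proof (rule el_kernel[OF K(1)])
    fix x0 x' y y' assume xy: "x0 \<in> S1" "x' \<in> S1" "y \<in> S2" "y' \<in> S2"
    have v: "basis_vec (pr x0 y) \<in> space S" using xy by (intro basis_vec_space pr_S)
    have "PSI (el K) (basis_vec (pr x0 y)) (pr x' y') = 0" using cg_PSI[OF K(2) v] z[OF v] by simp
    moreover have "(\<Sum>t\<leftarrow>Z. T t (basis_vec (pr x0 y)) (pr x' y')) = cf Z x0 x' y y'"
      if "set Z \<subseteq> carrier AA \<times> carrier BB" for Z
      using that xy by (induction Z) (auto simp: cf_def T_basis AA_lin BB_lin)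
    ultimately show "cf K x0 x' y y' = 0" using PSI_el[OF K(1)] K(1) by simp
  qed
  from cg_trans[OF K(2) this] show ?thesis by (simp add: cg_def)
qed

text \<open>The commutator of \<open>f\<close> with the action of \<open>i\<close>, as a matrix.\<close>

definition "df f i x x' = f (act1 (basis_vec x) i) x' - act1 (f (basis_vec x)) i x'"

lemma df_merge:
  assumes f: "lin (space S1) f" and g: "lin (space S1) g" and i: "i \<in> J1" and x: "x \<in> S1"
  shows "df (\<lambda>u w. f u w + c * g u w) i x x' = df f i x x' + c * df g i x x'"
proof -
  have fx: "f (basis_vec x) \<in> space S1" "g (basis_vec x) \<in> space S1"
    using lin_mem[OF f basis_vec_space[OF x]] lin_mem[OF g basis_vec_space[OF x]] .
  have "act1 (\<lambda>w. f (basis_vec x) w + c * g (basis_vec x) w) i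
      = (\<lambda>w. act1 (f (basis_vec x)) i w + c * act1 (g (basis_vec x)) i w)"
    using lin_add[OF act1[OF i] fx(1) space_scale[OF fx(2)]] lin_scale[OF act1[OF i] fx(2)] by simp
  then show ?thesis by (simp add: df_def algebra_simps)
qed

lemma lin_merge: "lin W f \<Longrightarrow> lin W g \<Longrightarrow> (\<And>u v. u \<in> W \<Longrightarrow> v \<in> W \<Longrightarrow> (\<lambda>w. u w + c * v w) \<in> W) \<Longrightarrow>
  lin W (\<lambda>u w. f u w + c * g u w)"
  unfolding lin_def by (simp add: algebra_simps)

lemma df_zero_restrict:
  assumes f: "lin (space S1) f" and z: "\<And>i x x'. i \<in> J1 \<Longrightarrow> x \<in> S1 \<Longrightarrow> x' \<in> S1 \<Longrightarrow> df f i x x' = 0"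
  shows "restrict f (space S1) \<in> carrier AA"
  unfolding end_algebra_carrier
proof (intro conjI ballI lin_restrict[OF f])
  fix i and v :: "'b \<Rightarrow> 'k" assume i: "i \<in> J1" and v: "v \<in> space S1"
  have "f (act1 v i) = act1 (f v) i"
  proof (rule lin_basis_eq[OF fin1 lin_comp[OF f act1[OF i]] lin_comp[OF act1[OF i] f] _ v])
    fix x assume x: "x \<in> S1"
    have "f (act1 (basis_vec x) i) \<in> space S1" "act1 (f (basis_vec x)) i \<in> space S1"
      using lin_mem[OF lin_comp[OF f act1[OF i]] basis_vec_space[OF x]]
        lin_mem[OF lin_comp[OF act1[OF i] f] basis_vec_space[OF x]] .
    moreover have "f (act1 (basis_vec x) i) x' = act1 (f (basis_vec x)) i x'" if "x' \<in> S1" for x'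
      using z[OF i x that] by (simp add: df_def)
    ultimately show "f (act1 (basis_vec x) i) = act1 (f (basis_vec x)) i"
      unfolding space_def by (auto simp: fun_eq_iff) metis
  qed
  then show "restrict f (space S1) (act1 v i) = act1 (restrict f (space S1) v) i"
    using v lin_mem[OF act1[OF i] v] by simp
qed

text \<open>
  If the operator of a list commutes with the first action and all second components lie in \<open>BB\<close>, then
  the first components can be chosen in \<open>AA\<close>. A component that does not commute has a nonzero commutator entry,
  and that entry expresses the second component of its tensor through the others.
\<close>

lemma commuting_list:
  assumes "set K \<subseteq> {f. lin (space S1) f} \<times> carrier BB"
    and "\<And>i x x' y y'. i \<in> J1 \<Longrightarrow> x \<in> S1 \<Longrightarrow> x' \<in> S1 \<Longrightarrow> y \<in> S2 \<Longrightarrow> y' \<in> S2 \<Longrightarrow>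
      (\<Sum>t\<leftarrow>K. df (fst t) i x x' * snd t (basis_vec y) y') = 0"
  shows "\<exists>K'. set K' \<subseteq> carrier AA \<times> carrier BB \<and>
    (\<forall>x\<in>S1. \<forall>x'\<in>S1. \<forall>y\<in>S2. \<forall>y'\<in>S2. cf K' x x' y y' = cf K x x' y y')"
  using assms
proof (induction "length K" arbitrary: K)
  case 0 then show ?case by (intro exI[of _ "[]"]) simp
next
  case (Suc n)
  then obtain f b K0 where K: "K = (f, b) # K0" by (cases K) auto
  have f: "lin (space S1) f" and b: "b \<in> carrier BB" and K0: "set K0 \<subseteq> {f. lin (space S1) f} \<times> carrier BB"
    and n: "n = length K0"
    using Suc.prems(1) Suc.hyps(2) by (auto simp: K)
  have z: "df f i x x' * b (basis_vec y) y' + (\<Sum>t\<leftarrow>K0. df (fst t) i x x' * snd t (basis_vec y) y') = 0"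
    if "i \<in> J1" "x \<in> S1" "x' \<in> S1" "y \<in> S2" "y' \<in> S2" for i x x' y y'
    using Suc.prems(2)[OF that] by (simp add: K)
  show ?case
  proof (cases "\<exists>i x x'. i \<in> J1 \<and> x \<in> S1 \<and> x' \<in> S1 \<and> df f i x x' \<noteq> 0")
    case False
    have r: "restrict f (space S1) \<in> carrier AA" by (rule df_zero_restrict[OF f]) (use False in blast)
    have "\<exists>K'. set K' \<subseteq> carrier AA \<times> carrier BB \<and>
      (\<forall>x\<in>S1. \<forall>x'\<in>S1. \<forall>y\<in>S2. \<forall>y'\<in>S2. cf K' x x' y y' = cf K0 x x' y y')"
    proof (rule Suc.hyps(1)[OF n K0])
      fix i x x' y y' assume a: "i \<in> J1" "x \<in> S1" "x' \<in> S1" "y \<in> S2" "y' \<in> S2"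
      have "df f i x x' = 0" using False a by blast
      then show "(\<Sum>t\<leftarrow>K0. df (fst t) i x x' * snd t (basis_vec y) y') = 0" using z[OF a] by simp
    qed
    then obtain K' where K': "set K' \<subseteq> carrier AA \<times> carrier BB"
      "\<forall>x\<in>S1. \<forall>x'\<in>S1. \<forall>y\<in>S2. \<forall>y'\<in>S2. cf K' x x' y y' = cf K0 x x' y y'" by blast
    show ?thesis
      by (rule exI[of _ "(restrict f (space S1), b) # K'"])
        (use K' r b in \<open>auto simp: K cf_def basis_vec_space\<close>)
  next
    case True
    then obtain i0 x0 x0' where i0: "i0 \<in> J1" "x0 \<in> S1" "x0' \<in> S1" and \<beta>: "df f i0 x0 x0' \<noteq> 0" by blast
    (* coefficients that express b through the other second components *)
    define k where "k t = - df (fst t) i0 x0 x0' / df f i0 x0 x0'" for t :: "(('b \<Rightarrow> 'k) \<Rightarrow> 'b \<Rightarrow> 'k) \<times> (('c \<Rightarrow> 'k) \<Rightarrow> 'c \<Rightarrow> 'k)"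
    have kb: "(\<Sum>t\<leftarrow>K0. k t * snd t (basis_vec y) y') = b (basis_vec y) y'" if "y \<in> S2" "y' \<in> S2" for y y'
    proof -
      have "df f i0 x0 x0' * (\<Sum>t\<leftarrow>Z. k t * snd t (basis_vec y) y') = - (\<Sum>t\<leftarrow>Z. df (fst t) i0 x0 x0' * snd t (basis_vec y) y')" for Z
        using \<beta> by (induction Z) (auto simp: k_def algebra_simps)
      then have "df f i0 x0 x0' * (\<Sum>t\<leftarrow>K0. k t * snd t (basis_vec y) y') = df f i0 x0 x0' * b (basis_vec y) y'"
        using z[OF i0 that] by (simp add: add_eq_0_iff2)
      then show ?thesis using \<beta> by simp
    qed
    let ?m = "map (\<lambda>t. (\<lambda>u w. fst t u w + k t * f u w, snd t))"
    have cfm: "cf (?m Z) x x' y y' = cf Z x x' y y' + f (basis_vec x) x' * (\<Sum>t\<leftarrow>Z. k t * snd t (basis_vec y) y')" for Z x x' y y'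
      by (induction Z) (auto simp: cf_def algebra_simps)
    have "\<exists>K'. set K' \<subseteq> carrier AA \<times> carrier BB \<and>
      (\<forall>x\<in>S1. \<forall>x'\<in>S1. \<forall>y\<in>S2. \<forall>y'\<in>S2. cf K' x x' y y' = cf (?m K0) x x' y y')"
    proof (rule Suc.hyps(1))
      show "n = length (?m K0)" using n by simp
      show "set (?m K0) \<subseteq> {f. lin (space S1) f} \<times> carrier BB"
        using K0 f by (auto intro!: lin_merge space_add space_scale)
      fix i x x' y y' assume a: "i \<in> J1" "x \<in> S1" "x' \<in> S1" "y \<in> S2" "y' \<in> S2"
      have "(\<Sum>t\<leftarrow>?m Z. df (fst t) i x x' * snd t (basis_vec y) y')
          = (\<Sum>t\<leftarrow>Z. df (fst t) i x x' * snd t (basis_vec y) y') + df f i x x' * (\<Sum>t\<leftarrow>Z. k t * snd t (basis_vec y) y')"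
        if "set Z \<subseteq> {f. lin (space S1) f} \<times> carrier BB" for Z
        using that
      proof (induction Z)
        case (Cons t Z)
        have "lin (space S1) (fst t)" using Cons.prems by auto
        then show ?case using Cons df_merge[OF _ f a(1,2), of "fst t" "k t" x'] by (simp add: algebra_simps)
      qed simp
      from this[OF K0] show "(\<Sum>t\<leftarrow>?m K0. df (fst t) i x x' * snd t (basis_vec y) y') = 0"
        using z[OF a] kb[OF a(4,5)] by (simp add: add.commute)
    qed
    then show ?thesis using kb cfm by (simp add: K cf_def add.commute)
  qed
qed

lemma block_sum:
  assumes "set K \<subseteq> {f. lin (space S1) f} \<times> {g. lin (space S2) g}" "x \<in> S1" "y \<in> S2" "x' \<in> S1" "y' \<in> S2"
  shows "(\<Sum>t\<leftarrow>K. T t (basis_vec (pr x y)) (pr x' y')) = cf K x x' y y'"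
  using assms by (induction K) (auto simp: cf_def T_basis)

lemma lin_T_sum:
  assumes "set K \<subseteq> {f. lin (space S1) f} \<times> {g. lin (space S2) g}"
  shows "lin (space S) (\<lambda>v w. \<Sum>t\<leftarrow>K. T t v w)"
  using assms
proof (induction K)
  case Nil then show ?case by (simp add: lin_def space_zero)
next
  case (Cons t K)
  have t: "lin (space S) (T t)" unfolding T_def
    by (rule lin_comp[OF lin_L lin_R]) (use Cons.prems in auto)
  show ?case
    using lin_merge[OF t Cons.IH, of 1] Cons.prems by (simp add: space_add)
qed

lemma T_sum_eqI:
  assumes K: "set K \<subseteq> {f. lin (space S1) f} \<times> {g. lin (space S2) g}" and c: "lin (space S) c"
    and e: "\<And>x x' y y'. x \<in> S1 \<Longrightarrow> x' \<in> S1 \<Longrightarrow> y \<in> S2 \<Longrightarrow> y' \<in> S2 \<Longrightarrow> cf K x x' y y' = c (basis_vec (pr x y)) (pr x' y')"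
    and v: "v \<in> space S"
  shows "(\<lambda>w. \<Sum>t\<leftarrow>K. T t v w) = c v"
proof (rule lin_basis_eq[OF fin lin_T_sum[OF K] c _ v])
  fix z assume "z \<in> S"
  then obtain x y where z: "z = pr x y" "x \<in> S1" "y \<in> S2" unfolding S_eq by auto
  show "(\<lambda>w. \<Sum>t\<leftarrow>K. T t (basis_vec z) w) = c (basis_vec z)"
  proof (rule space_eqI)
    show "(\<lambda>w. \<Sum>t\<leftarrow>K. T t (basis_vec z) w) \<in> space S" "c (basis_vec z) \<in> space S"
      using lin_mem[OF lin_T_sum[OF K]] lin_mem[OF c] basis_vec_space[OF \<open>z \<in> S\<close>] by auto
    show "(\<Sum>t\<leftarrow>K. T t (basis_vec z) (pr x' y')) = c (basis_vec z) (pr x' y')" if "x' \<in> S1" "y' \<in> S2" for x' y'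
      using block_sum[OF K z(2,3) that] e[OF z(2) that(1) z(3) that(2)] by (simp add: z(1))
  qed
qed

text \<open>
  An operator is a sum over matrix units \<open>E\<close> of the first factor tensored with blocks \<open>g\<close>. When it commutes
  with the second action, each block lies in \<open>BB\<close>; when it also commutes with the first action,
  \<open>commuting_list\<close> applies.
\<close>

lemma tensor_span:
  assumes c: "c \<in> carrier CC"
  shows "\<exists>K. set K \<subseteq> carrier AA \<times> carrier BB \<and> (\<forall>v\<in>space S. (\<lambda>w. \<Sum>t\<leftarrow>K. T t v w) = c v)"
proof -
  have lc: "lin (space S) c" by (rule CC_lin[OF c])
  have cact: "c (act v j) = act (c v) j" if "v \<in> space S" "j \<in> J" for v j
    using c that by (auto simp: end_algebra_carrier)
  define box where "box x u = (\<lambda>w. if w \<in> S \<and> fst (co w) = x then u (snd (co w)) else 0)" for x and u :: "'c \<Rightarrow> 'k"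
  have box_space: "box x u \<in> space S" for x u by (auto simp: box_def space_def)
  have box_at: "box x u (pr x' y') = (if x' = x then u y' else 0)" if "x' \<in> S1" "y' \<in> S2" for x u x' y'
    unfolding box_def co[OF that] using pr_S[OF that] by simp
  have box_basis: "box x (basis_vec y) = basis_vec (pr x y)" if "x \<in> S1" "y \<in> S2" for x y
    by (rule space_eqI[OF box_space basis_vec_space[OF pr_S[OF that]]]) (use that in \<open>auto simp: box_at basis_vec_def inj\<close>)
  let ?sl = "prod_idx.sl S2 (\<lambda>y x. pr x y)"
  define g where "g x x' u = ?sl (c (box x u)) x'" for x x' u
  define E where "E x x' u = (\<lambda>z. u x * basis_vec x' z)" for x x' :: 'b and u :: "'b \<Rightarrow> 'k"
  have lin_box: "box x (\<lambda>w. u w + v w) = (\<lambda>w. box x u w + box x v w)" "box x (\<lambda>w. k * u w) = (\<lambda>w. k * box x u w)" for x u v k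
    by (auto simp: box_def)
  have lin_g: "lin (space S2) (g x x')" for x x'
    unfolding lin_def g_def
    by (auto simp: lin_box lin_add[OF lc box_space box_space] lin_scale[OF lc box_space]
        prod_idx.sl_add[OF swapped] prod_idx.sl_scale[OF swapped] prod_idx.sl_space[OF swapped])
  have g_BB: "restrict (g x x') (space S2) \<in> carrier BB" if x: "x \<in> S1" "x' \<in> S1" for x x'
    unfolding end_algebra_carrier
  proof (intro conjI ballI lin_restrict[OF lin_g])
    fix j and u :: "'c \<Rightarrow> 'k" assume j: "j \<in> J2" and u: "u \<in> space S2"
    have jJ: "\<phi>2 j \<in> J" using j J_eq by auto
    have slb: "?sl (box x u) z = (\<lambda>y. (if z = x then 1 else 0) * u y)" if "z \<in> S1" for z
      using u that by (auto simp: prod_idx.sl_def[OF swapped] box_at space_def fun_eq_iff)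
    have "box x (act2 u j) = R (\<lambda>u. act2 u j) (box x u)"
    proof (rule space_eqI[OF box_space R_space])
      fix x1 y1 assume a: "x1 \<in> S1" "y1 \<in> S2"
      show "box x (act2 u j) (pr x1 y1) = R (\<lambda>u. act2 u j) (box x u) (pr x1 y1)"
        unfolding R_at[OF a(2,1)] slb[OF a(1)] lin_scale[OF act2[OF j] u] box_at[OF a] by simp
    qed
    then have "c (box x (act2 u j)) = R (\<lambda>u. act2 u j) (c (box x u))"
      using cact[OF box_space jJ, of x u] c2[OF j box_space, of x u] c2[OF j lin_mem[OF lc box_space], of x u] by simp
    then have "g x x' (act2 u j) = act2 (g x x' u) j"
      unfolding g_def using prod_idx.sl_L[OF swapped act2[OF j] x(2)] by simp
    then show "restrict (g x x') (space S2) (act2 u j) = act2 (restrict (g x x') (space S2) u) j"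
      using u lin_mem[OF act2[OF j] u] by simp
  qed
  have lin_E: "lin (space S1) (E x x')" if "x' \<in> S1" for x x'
    using that unfolding lin_def E_def by (auto simp: space_def basis_vec_def algebra_simps)
  obtain xs where xs: "set xs = S1 \<times> S1" "distinct xs"
    using finite_distinct_list[of "S1 \<times> S1"] fin1 by auto
  define K where "K = map (\<lambda>p. (E (fst p) (snd p), restrict (g (fst p) (snd p)) (space S2))) xs"
  have K: "set K \<subseteq> {f. lin (space S1) f} \<times> carrier BB"
    unfolding K_def using xs(1) lin_E g_BB by auto
  then have K': "set K \<subseteq> {f. lin (space S1) f} \<times> {g. lin (space S2) g}" using BB_lin by blast
  have cfK: "cf K x x' y y' = c (basis_vec (pr x y)) (pr x' y')"
    if a: "x \<in> S1" "x' \<in> S1" "y \<in> S2" "y' \<in> S2" for x x' y y'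
  proof -
    have by_sp: "(basis_vec y :: 'c \<Rightarrow> 'k) \<in> space S2" by (rule basis_vec_space[OF a(3)])
    have "cf K x x' y y' = (\<Sum>p\<leftarrow>xs. E (fst p) (snd p) (basis_vec x) x' * g (fst p) (snd p) (basis_vec y) y')"
      unfolding K_def cf_def using by_sp by (simp add: o_def)
    also have "\<dots> = (\<Sum>p\<in>S1 \<times> S1. E (fst p) (snd p) (basis_vec x) x' * g (fst p) (snd p) (basis_vec y) y')"
      using sum_list_distinct_conv_sum_set[OF xs(2)] xs(1) by simp
    also have "\<dots> = (\<Sum>p\<in>S1 \<times> S1. if p = (x, x') then g x x' (basis_vec y) y' else 0)"
      by (intro sum.cong) (auto simp: E_def basis_vec_def)
    also have "\<dots> = g x x' (basis_vec y) y'" using fin1 a by (simp add: sum.delta)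
    also have "\<dots> = c (basis_vec (pr x y)) (pr x' y')"
      using a by (simp add: g_def box_basis prod_idx.sl_def[OF swapped])
    finally show ?thesis .
  qed
  have cK: "(\<lambda>w. \<Sum>t\<leftarrow>K. T t v w) = c v" if "v \<in> space S" for v
    using T_sum_eqI[OF K' lc cfK that] .
  have "\<exists>K'. set K' \<subseteq> carrier AA \<times> carrier BB \<and>
    (\<forall>x\<in>S1. \<forall>x'\<in>S1. \<forall>y\<in>S2. \<forall>y'\<in>S2. cf K' x x' y y' = cf K x x' y y')"
  proof (rule commuting_list[OF K])
    fix i x x' y y' assume a: "i \<in> J1" "x \<in> S1" "x' \<in> S1" "y \<in> S2" "y' \<in> S2"
    let ?v = "basis_vec (pr x y) :: 'w \<Rightarrow> 'k" and ?A = "\<lambda>u. act1 u i"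
    have v: "?v \<in> space S" using a by (intro basis_vec_space pr_S)
    have iJ: "\<phi>1 i \<in> J" using a J_eq by auto
    have lA: "lin (space S1) ?A" by (rule act1[OF a(1)])
    have Lv: "L ?A ?v \<in> space S" by (rule L_space)
    have 1: "(\<Sum>t\<leftarrow>Z. T t (L ?A ?v) (pr x' y')) = (\<Sum>t\<leftarrow>Z. fst t (act1 (basis_vec x) i) x' * snd t (basis_vec y) y')"
      if "set Z \<subseteq> {f. lin (space S1) f} \<times> {g. lin (space S2) g}" for Z
      using that
    proof (induction Z)
      case (Cons t Z)
      have lt: "lin (space S1) (fst t)" "lin (space S2) (snd t)" using Cons.prems by auto
      have "T t (L ?A ?v) = L (\<lambda>u. fst t (act1 u i)) (R (snd t) ?v)"
        unfolding T_def L_R_commute[OF lA lt(2) v, symmetric] L_comp[OF lA] ..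
      then have "T t (L ?A ?v) (pr x' y') = fst t (act1 (basis_vec x) i) x' * snd t (basis_vec y) y'"
        using L_R_basis[OF lin_comp[OF lt(1) lA] lt(2) a(2,4,3,5)] by simp
      then show ?case using Cons by simp
    qed simp
    have T_space: "T t ?v \<in> space S" for t by (simp add: T_def L_space)
    have "L ?A (\<lambda>w. \<Sum>t\<leftarrow>K. T t ?v w) = (\<lambda>w. \<Sum>t\<leftarrow>K. L ?A (T t ?v) w)"
      using lin_sum_list[OF lin_L[OF lA], of K "\<lambda>t. T t ?v"] T_space by blast
    moreover have 2: "(\<Sum>t\<leftarrow>Z. L ?A (T t ?v) (pr x' y')) = (\<Sum>t\<leftarrow>Z. act1 (fst t (basis_vec x)) i x' * snd t (basis_vec y) y')"
      if "set Z \<subseteq> {f. lin (space S1) f} \<times> {g. lin (space S2) g}" for Z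
      using that
    proof (induction Z)
      case (Cons t Z)
      have lt: "lin (space S1) (fst t)" "lin (space S2) (snd t)" using Cons.prems by auto
      have "L ?A (T t ?v) = L (\<lambda>u. act1 (fst t u) i) (R (snd t) ?v)"
        unfolding T_def by (simp add: L_comp[OF lt(1)])
      then have "L ?A (T t ?v) (pr x' y') = act1 (fst t (basis_vec x)) i x' * snd t (basis_vec y) y'"
        using L_R_basis[OF lin_comp[OF lA lt(1)] lt(2) a(2,4,3,5)] by simp
      then show ?case using Cons by simp
    qed simp
    ultimately have "L ?A (c ?v) (pr x' y') = (\<Sum>t\<leftarrow>K. act1 (fst t (basis_vec x)) i x' * snd t (basis_vec y) y')"
      using cK[OF v] 2[OF K'] by simp
    moreover have "c (L ?A ?v) (pr x' y') = (\<Sum>t\<leftarrow>K. fst t (act1 (basis_vec x) i) x' * snd t (basis_vec y) y')"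
      using fun_cong[OF cK[OF Lv], of "pr x' y'"] 1[OF K'] by simp
    moreover have "c (L ?A ?v) = L ?A (c ?v)"
      using cact[OF v iJ] c1[OF a(1) v] c1[OF a(1) lin_mem[OF lc v]] by simp
    moreover have "(\<Sum>t\<leftarrow>Z. df (fst t) i x x' * snd t (basis_vec y) y')
        = (\<Sum>t\<leftarrow>Z. fst t (act1 (basis_vec x) i) x' * snd t (basis_vec y) y')
        - (\<Sum>t\<leftarrow>Z. act1 (fst t (basis_vec x)) i x' * snd t (basis_vec y) y')"
      for Z :: "((('b \<Rightarrow> 'k) \<Rightarrow> 'b \<Rightarrow> 'k) \<times> (('c \<Rightarrow> 'k) \<Rightarrow> 'c \<Rightarrow> 'k)) list"
      by (induction Z) (auto simp: df_def algebra_simps)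
    ultimately show "(\<Sum>t\<leftarrow>K. df (fst t) i x x' * snd t (basis_vec y) y') = 0" by simp
  qed
  then obtain K1 where K1: "set K1 \<subseteq> carrier AA \<times> carrier BB"
    "\<forall>x\<in>S1. \<forall>x'\<in>S1. \<forall>y\<in>S2. \<forall>y'\<in>S2. cf K1 x x' y y' = cf K x x' y y'" by blast
  have "(\<lambda>w. \<Sum>t\<leftarrow>K1. T t v w) = c v" if "v \<in> space S" for v
  proof (rule T_sum_eqI[OF _ lc _ that])
    show "set K1 \<subseteq> {f. lin (space S1) f} \<times> {g. lin (space S2) g}" using K1(1) AA_lin BB_lin by blast
  qed (use K1(2) cfK in simp)
  then show ?thesis using K1(1) by blast
qed

text \<open>The map from the free algebra on pairs to operators is onto the commutant by \<open>tensor_span\<close>, and its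
  kernel is the ideal of the bilinearity relations by \<open>el_kernel\<close>.\<close>

theorem tensor_iso: "\<exists>\<Theta>. \<Theta> \<in> kalg_iso CC (tensor_algebra AA BB)"
proof -
  interpret ring FF by (rule monoid_algebra_ring[OF mAB])
  define \<psi> where "\<psi> x = (\<lambda>v\<in>space S. PSI x v)" for x
  have "(\<lambda>c. {x \<in> carrier FF. \<psi> x = c}) \<in> kalg_iso CC (quotient_algebra FF II)"
  proof (rule quotient_iso[OF ring_axioms II_ideal])
    show "c \<odot>\<^bsub>FF\<^esub> x \<in> carrier FF" if "x \<in> carrier FF" for c x
      using monoid_algebra_smult_closed[OF that] .
    fix x assume x: "x \<in> carrier FF"
    note lx = lin_PSI[OF x]
    show "\<psi> x \<in> carrier CC" unfolding end_algebra_carrier \<psi>_def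
    proof (intro conjI ballI lin_restrict[OF lx])
      fix j and v :: "'w \<Rightarrow> 'k" assume j: "j \<in> J" and v: "v \<in> space S"
      have lj: "lin (space S) (\<lambda>u. act u j)"
      proof -
        consider i where "i \<in> J1" "j = \<phi>1 i" | i where "i \<in> J2" "j = \<phi>2 i" using j J_eq by auto
        then show ?thesis
        proof cases
          case 1
          have "lin (space S) (L (\<lambda>u. act1 u i))" by (rule lin_L[OF act1[OF 1(1)]])
          then show ?thesis unfolding lin_def 1 by (simp add: c1[OF 1(1)] space_add space_scale)
        next
          case 2
          have "lin (space S) (R (\<lambda>u. act2 u i))" by (rule lin_R[OF act2[OF 2(1)]])
          then show ?thesis unfolding lin_def 2 by (simp add: c2[OF 2(1)] space_add space_scale)
        qed
      qed
      have "act (PSI x v) j = (\<lambda>w. \<Sum>p | x p \<noteq> 0. x p * act (T p v) j w)"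
        unfolding rep_def[abs_def]
        by (rule lin_sum[OF lj F_supp(1)[OF x]]) (use lin_mem[OF T_lin[OF F_supp(2)[OF x]] v] in auto)
      also have "\<dots> = PSI x (act v j)"
        unfolding rep_def[abs_def] using T_act[OF F_supp(2)[OF x] v j] by (intro ext sum.cong) auto
      finally show "restrict (PSI x) (space S) (act v j) = act (restrict (PSI x) (space S) v) j"
        using v lin_mem[OF lj v] by simp
    qed
    show "\<psi> (c \<odot>\<^bsub>FF\<^esub> x) = c \<odot>\<^bsub>CC\<^esub> \<psi> x" for c
      unfolding \<psi>_def end_algebra_ops monoid_algebra_simps(6) by (auto simp: PSI_scale fun_eq_iff)
    fix y assume y: "y \<in> carrier FF"
    show "\<psi> (x \<otimes>\<^bsub>FF\<^esub> y) = \<psi> x \<otimes>\<^bsub>CC\<^esub> \<psi> y"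
      unfolding \<psi>_def end_algebra_ops compose_def
      using PSI_mult[OF x y] lin_mem[OF lin_PSI[OF y]] by (auto simp: fun_eq_iff)
    show "\<psi> (x \<oplus>\<^bsub>FF\<^esub> y) = \<psi> x \<oplus>\<^bsub>CC\<^esub> \<psi> y"
      unfolding \<psi>_def end_algebra_ops monoid_algebra_simps(5) by (auto simp: PSI_add[OF x y] fun_eq_iff)
    have m: "(\<lambda>p. x p + (- 1) * y p) = x \<ominus>\<^bsub>FF\<^esub> y" using monoid_algebra_minus[OF mAB x y] by simp
    have xy: "x \<ominus>\<^bsub>FF\<^esub> y \<in> carrier FF" using x y by simp
    have P: "PSI (x \<ominus>\<^bsub>FF\<^esub> y) v w = PSI x v w - PSI y v w" for v w
      unfolding m[symmetric] using PSI_add[OF x FF_ops(2)[OF y, of "- 1"], of v w] PSI_scale[of "- 1" y v w] by simp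
    show "\<psi> x = \<psi> y \<longleftrightarrow> x \<ominus>\<^bsub>FF\<^esub> y \<in> II"
    proof
      assume e: "\<psi> x = \<psi> y"
      have "PSI x v w = PSI y v w" if "v \<in> space S" for v w
        using fun_cong[OF fun_cong[OF e, of v], of w] that by (simp add: \<psi>_def)
      then show "x \<ominus>\<^bsub>FF\<^esub> y \<in> II" by (intro PSI_ker[OF xy]) (simp add: P)
    next
      assume "x \<ominus>\<^bsub>FF\<^esub> y \<in> II"
      then have "PSI x v w = PSI y v w" if "v \<in> space S" for v w
        using II_PSI[OF _ that, of "x \<ominus>\<^bsub>FF\<^esub> y" w] P[of v w] by simp
      then show "\<psi> x = \<psi> y" unfolding \<psi>_def by (intro restrict_ext) auto
    qed
  next
    fix c assume c: "c \<in> carrier CC"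
    obtain K where K: "set K \<subseteq> carrier AA \<times> carrier BB" "\<forall>v\<in>space S. (\<lambda>w. \<Sum>t\<leftarrow>K. T t v w) = c v"
      using tensor_span[OF c] by blast
    have "\<psi> (el K) v = c v" if "v \<in> space S" for v
      using K(2) that PSI_el[OF K(1), of v] by (auto simp: \<psi>_def fun_eq_iff)
    moreover have "c \<in> extensional (space S)" "\<psi> (el K) \<in> extensional (space S)"
      using c by (auto simp: end_algebra_carrier lin_on_iff \<psi>_def)
    ultimately have "\<psi> (el K) = c" by (intro extensionalityI[of _ "space S"]) auto
    then show "\<exists>x\<in>carrier FF. \<psi> x = c" using el_carrier[OF K(1)] by blast
  next
    have "PSI \<one>\<^bsub>FF\<^esub> v = v" if v: "v \<in> space S" for v
    proof -
      have s2: "prod_idx.sl S2 (\<lambda>y x. pr x y) v x \<in> space S2" for x by (rule prod_idx.sl_space[OF swapped])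
      have "PSI \<one>\<^bsub>FF\<^esub> v = L \<one>\<^bsub>AA\<^esub> (R \<one>\<^bsub>BB\<^esub> v)"
        unfolding monoid_algebra_simps(3) by (rule ext) (simp add: PSI_basis T_def DirProd_def)
      also have "R \<one>\<^bsub>BB\<^esub> v = v"
        by (rule space_eqI[OF R_space v]) (simp add: R_at end_algebra_ops s2, simp add: prod_idx.sl_def[OF swapped])
      also have "L \<one>\<^bsub>AA\<^esub> v = v"
        by (rule space_eqI[OF L_space v]) (simp add: L_at end_algebra_ops sl_space, simp add: sl_def)
      finally show ?thesis .
    qed
    then show "\<psi> \<one>\<^bsub>FF\<^esub> = \<one>\<^bsub>CC\<^esub>" unfolding \<psi>_def end_algebra_ops by (intro restrict_ext) auto
  qed
  then show ?thesis unfolding tensor_algebra_def Let_def II_def by blast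
qed

end

section \<open>The action on lists\<close>

lemma tensor_space_eq: "tensor_space n d = space (multi_index n d)"
  by (simp add: tensor_space_def space_def)

lemma finite_index_set: "finite (index_set n)" by (simp add: index_set_def Let_def)

lemma index_set_minus: "x \<in> index_set n \<Longrightarrow> - x \<in> index_set n"
  by (auto simp: index_set_def Let_def split: if_splits)

lemma finite_multi_index: "finite (multi_index n d)"
proof -
  have "multi_index n d = {xs. set xs \<subseteq> index_set n \<and> length xs = d}" by (auto simp: multi_index_def)
  then show ?thesis using finite_lists_length_eq[OF finite_index_set] by simp
qed

lemma multi_index_iff: "\<mu> \<in> multi_index n d \<longleftrightarrow> length \<mu> = d \<and> (\<forall>i<d. \<mu> ! i \<in> index_set n)"
  by (auto simp: multi_index_def in_set_conv_nth subset_iff)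

lemma index_act_length: "length (index_act \<mu> t) = length \<mu>" by (simp add: index_act_def)

lemma index_act_nth: "t < length \<mu> \<Longrightarrow> i < length \<mu> \<Longrightarrow> index_act \<mu> t ! i =
   (if t = 0 then if i = 0 then - (\<mu> ! 0) else \<mu> ! i
    else if i = t then \<mu> ! (t - 1) else if i = t - 1 then \<mu> ! t else \<mu> ! i)"
  by (auto simp: index_act_def nth_list_update)

lemma index_act_index_act: "t < length \<mu> \<Longrightarrow> index_act (index_act \<mu> t) t = \<mu>"
  by (rule nth_equalityI) (auto simp: index_act_nth index_act_length)

lemma index_act_multi_index: "\<mu> \<in> multi_index n d \<Longrightarrow> t < d \<Longrightarrow> index_act \<mu> t \<in> multi_index n d"
  by (auto simp: multi_index_iff index_act_length index_act_nth index_set_minus)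

text \<open>The generator action by coefficients, where \<open>index_act\<close> is inverted by itself.\<close>

lemma gen_act_at:
  assumes \<nu>: "\<nu> \<in> multi_index n d" and t: "t < d"
  shows "gen_act Q q n d v t \<nu> =
    (if t = 0 then if \<nu> ! 0 = 0 then inverse Q * v \<nu>
       else v (index_act \<nu> 0) + (if \<nu> ! 0 < 0 then (inverse Q - Q) * v \<nu> else 0)
     else if \<nu> ! (t - 1) = \<nu> ! t then inverse q * v \<nu>
       else v (index_act \<nu> t) + (if \<nu> ! (t - 1) > \<nu> ! t then (inverse q - q) * v \<nu> else 0))"
proof -
  define k1 where "k1 \<mu> = (if t = 0 then if \<mu> ! 0 = 0 then inverse Q else 1
     else if \<mu> ! (t - 1) = \<mu> ! t then inverse q else 1)" for \<mu> :: "int list"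
  define k2 where "k2 \<mu> = (if t = 0 then if \<mu> ! 0 < 0 then inverse Q - Q else 0
     else if \<mu> ! (t - 1) > \<mu> ! t then inverse q - q else 0)" for \<mu> :: "int list"
  have len: "length \<nu> = d" using \<nu> by (simp add: multi_index_iff)
  have b: "basis_act Q q \<mu> t \<nu> = (if index_act \<mu> t = \<nu> then k1 \<mu> else 0) + (if \<mu> = \<nu> then k2 \<mu> else 0)" for \<mu>
    by (auto simp: basis_act_def k1_def k2_def basis_vec_def)
  have e: "index_act \<mu> t = \<nu> \<longleftrightarrow> \<mu> = index_act \<nu> t" if "\<mu> \<in> multi_index n d" for \<mu>
    using that t len index_act_index_act[of t \<mu>] index_act_index_act[of t \<nu>] by (auto simp: multi_index_iff)
  have "gen_act Q q n d v t \<nu> = (\<Sum>\<mu>\<in>multi_index n d. (if \<mu> = index_act \<nu> t then v \<mu> * k1 \<mu> else 0)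
      + (if \<mu> = \<nu> then v \<mu> * k2 \<mu> else 0))"
    unfolding gen_act_def b by (intro sum.cong refl) (auto simp: e distrib_left)
  also have "\<dots> = v (index_act \<nu> t) * k1 (index_act \<nu> t) + v \<nu> * k2 \<nu>"
    unfolding sum.distrib using finite_multi_index[of n d] index_act_multi_index[OF \<nu> t] \<nu> by (simp add: sum.delta)
  also have "\<dots> = (if t = 0 then if \<nu> ! 0 = 0 then inverse Q * v \<nu>
       else v (index_act \<nu> 0) + (if \<nu> ! 0 < 0 then (inverse Q - Q) * v \<nu> else 0)
     else if \<nu> ! (t - 1) = \<nu> ! t then inverse q * v \<nu>
       else v (index_act \<nu> t) + (if \<nu> ! (t - 1) > \<nu> ! t then (inverse q - q) * v \<nu> else 0))"
  proof (cases "t = 0")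
    case True
    have n0: "index_act \<nu> 0 ! 0 = - (\<nu> ! 0)" using t len by (simp add: index_act_nth)
    have "index_act \<nu> 0 = \<nu>" if "\<nu> ! 0 = 0"
      using that t len by (intro nth_equalityI) (auto simp: index_act_nth index_act_length)
    then show ?thesis using True n0 by (simp add: k1_def k2_def)
  next
    case False
    have n0: "index_act \<nu> t ! t = \<nu> ! (t - 1)" "index_act \<nu> t ! (t - 1) = \<nu> ! t"
      using t len False by (auto simp: index_act_nth)
    have "index_act \<nu> t = \<nu>" if "\<nu> ! (t - 1) = \<nu> ! t"
      using that t len False by (intro nth_equalityI) (auto simp: index_act_nth index_act_length)
    then show ?thesis using False n0 by (simp add: k1_def k2_def)
  qed
  finally show ?thesis .
qed

lemma gen_act_space: assumes t: "t < d" shows "gen_act Q q n d v t \<in> space (multi_index n d)"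
proof -
  have "basis_act Q q \<mu> t \<nu> = 0" if "\<mu> \<in> multi_index n d" "\<nu> \<notin> multi_index n d" for \<mu> \<nu>
  proof -
    have "\<nu> \<noteq> index_act \<mu> t" "\<nu> \<noteq> \<mu>" using that index_act_multi_index[OF that(1) t] by blast+
    then show ?thesis by (cases "t = 0") (simp_all add: basis_act_def basis_vec_def)
  qed
  then show ?thesis unfolding space_def gen_act_def by (simp add: sum.neutral)
qed

lemma lin_gen_act: assumes t: "t < d" shows "lin (space (multi_index n d)) (\<lambda>v. gen_act Q q n d v t)"
  unfolding lin_def
proof (intro conjI ballI allI)
  fix v :: "int list \<Rightarrow> 'a" show "gen_act Q q n d v t \<in> space (multi_index n d)" by (rule gen_act_space[OF t])
qed (simp_all add: gen_act_def sum.distrib sum_distrib_left distrib_right mult.assoc)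

text \<open>Passing between multi-indices and words of length \<open>d\<close>; on functions this is \<open>on_words\<close>, which
  is zero at words that have nonzero letters after place \<open>d\<close>.\<close>

definition list_of_word :: "nat \<Rightarrow> (nat \<Rightarrow> int) \<Rightarrow> int list" where "list_of_word d w = map w [0..<d]"

definition word_of_list :: "int list \<Rightarrow> nat \<Rightarrow> int" where "word_of_list \<mu> = (\<lambda>i. if i < length \<mu> then \<mu> ! i else 0)"

definition on_words :: "nat \<Rightarrow> (int list \<Rightarrow> 'k::field) \<Rightarrow> (nat \<Rightarrow> int) \<Rightarrow> 'k" where
  "on_words d v = (\<lambda>w. if \<forall>i\<ge>d. w i = 0 then v (list_of_word d w) else 0)"

lemma list_of_word_of_list: "length \<mu> = d \<Longrightarrow> list_of_word d (word_of_list \<mu>) = \<mu>"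
  by (rule nth_equalityI) (auto simp: list_of_word_def word_of_list_def)

lemma word_of_list_of_word: "\<forall>i\<ge>d. w i = 0 \<Longrightarrow> word_of_list (list_of_word d w) = w"
  by (rule ext) (auto simp: list_of_word_def word_of_list_def)

lemma list_of_word_swap: "t < d \<Longrightarrow> list_of_word d (swap t w) = index_act (list_of_word d w) t"
  by (rule nth_equalityI) (auto simp: list_of_word_def index_act_length index_act_nth swap_def)

lemma swap_beyond: "t < d \<Longrightarrow> (\<forall>i\<ge>d. swap t w i = 0) \<longleftrightarrow> (\<forall>i\<ge>d. w i = 0)"
proof -
  assume t: "t < d"
  have "swap t w i = w i" if "d \<le> i" for i using that t by (cases t) (simp_all add: swap_at)
  then show ?thesis by simp
qed

lemma on_words_at: "length \<mu> = d \<Longrightarrow> on_words d v (word_of_list \<mu>) = v \<mu>"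
  by (simp add: on_words_def list_of_word_of_list) (auto simp: word_of_list_def)

lemma on_words_linear: "on_words d (\<lambda>\<mu>. c * u \<mu> + v \<mu>) = (\<lambda>w. c * on_words d u w + on_words d v w)"
proof
  fix w show "on_words d (\<lambda>\<mu>. c * u \<mu> + v \<mu>) w = c * on_words d u w + on_words d v w"
  proof (cases "\<forall>i\<ge>d. w i = 0")
    case True show ?thesis unfolding on_words_def if_P[OF True] ..
  next
    case False show ?thesis unfolding on_words_def if_not_P[OF False] by simp
  qed
qed

lemma on_words_gen_act:
  assumes v: "v \<in> space (multi_index n d)" and t: "t < d"
  shows "on_words d (gen_act Q q n d v t) = on_words d v \<lhd>\<^sub>L TT Q q t"
proof
  fix w :: "nat \<Rightarrow> int"
  have nth: "list_of_word d w ! i = w i" if "i < d" for i using that by (simp add: list_of_word_def)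
  show "on_words d (gen_act Q q n d v t) w = (on_words d v \<lhd>\<^sub>L TT Q q t) w"
  proof (cases "\<forall>i\<ge>d. w i = 0")
    case False
    then have "on_words d u w = 0" "on_words d u (swap t w) = 0" for u :: "int list \<Rightarrow> 'a"
      unfolding on_words_def using swap_beyond[OF t, of w] by (simp_all only: if_False)
    then show ?thesis unfolding app_TT tf_def by (cases "t = 0") simp_all
  next
    case True
    show ?thesis
    proof (cases "list_of_word d w \<in> multi_index n d")
      case m: True
      have "t = 0 \<or> t - 1 < d" using t by auto
      then show ?thesis
        using True gen_act_at[OF m t, of Q q v] nth[OF t] nth[of "t - 1"] swap_beyond[OF t, of w] list_of_word_swap[OF t, of w]
        by (cases "t = 0") (simp_all add: app_TT on_words_def tf_def)
    next
      case m: False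
      have "list_of_word d (swap t w) \<notin> multi_index n d"
        using m index_act_multi_index[of "list_of_word d (swap t w)" n d t] t list_of_word_swap[OF t, of "swap t w"] by auto
      then have "v (list_of_word d w) = 0" "v (list_of_word d (swap t w)) = 0" using v m by (auto simp: space_def)
      moreover have "gen_act Q q n d v t (list_of_word d w) = 0" using gen_act_space[OF t, of Q q n v] m by (auto simp: space_def)
      ultimately show ?thesis using True by (cases "t = 0") (simp_all add: app_TT on_words_def tf_def)
    qed
  qed
qed

lemma on_words_inj:
  assumes "u \<in> space (multi_index n d)" "v \<in> space (multi_index n d)" "on_words d u = on_words d v" shows "u = v"
proof
  fix \<mu> show "u \<mu> = v \<mu>"
  proof (cases "length \<mu> = d")
    case True then show ?thesis using fun_cong[OF assms(3), of "word_of_list \<mu>"] by (simp add: on_words_at)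
  next
    case False then show ?thesis using assms by (auto simp: space_def multi_index_iff)
  qed
qed

section \<open>The action of the Hecke algebra\<close>

definition wmon :: "nat \<Rightarrow> nat list monoid" where
  "wmon d = \<lparr>carrier = lists {..<d}, monoid.mult = (@), one = []\<rparr>"

lemma free_algebra_eq: "free_algebra d = monoid_algebra (wmon d)"
  by (simp add: free_algebra_def wmon_def)

lemma wmon_monoid: "Group.monoid (wmon d)"
  by (rule monoidI) (auto simp: wmon_def)

lemma fold_lin: "w \<in> lists {..<d} \<Longrightarrow> lin (space (multi_index n d)) (\<lambda>v. foldl (gen_act Q q n d) v w)"
proof (induction w rule: rev_induct)
  case Nil then show ?case by (simp add: lin_def)
next
  case (snoc t w)
  then show ?case using lin_comp[OF lin_gen_act[of t d n Q q]] by auto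
qed

lemma free_act_eq: "free_act Q q n d v x = rep (\<lambda>w v. foldl (gen_act Q q n d) v w) x v"
  by (simp add: free_act_def rep_def)

lemma on_words_fold:
  assumes "w \<in> lists {..<d}" "v \<in> space (multi_index n d)"
  shows "foldl (gen_act Q q n d) v w \<in> space (multi_index n d) \<and>
    on_words d (foldl (gen_act Q q n d) v w) = foldl (\<lambda>u t. u \<lhd>\<^sub>L TT Q q t) (on_words d v) w"
  using assms(1)
proof (induction w rule: rev_induct)
  case Nil then show ?case using assms by simp
next
  case (snoc t w)
  then have t: "t < d" and w: "w \<in> lists {..<d}" by auto
  show ?case using on_words_gen_act[OF _ t, of "foldl (gen_act Q q n d) v w" n Q q] snoc.IH[OF w] gen_act_space[OF t] by simp
qed

context
  fixes Q q :: "'k::field"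
  assumes Q0: "Q \<noteq> 0" and q0: "q \<noteq> 0"
begin

interpretation H: hecke_ring scal "TT Q q" q "inverse Q" "- Q" by (rule TT_hecke[OF Q0 q0])

text \<open>The relations hold for the action because they hold for operators on functions of words.\<close>

lemma hecke_relation_act:
  assumes r: "(l, r) \<in> hecke_relations Q q d" and v: "v \<in> space (multi_index n d)"
  shows "l \<in> carrier (free_algebra d) \<and> r \<in> carrier (free_algebra d) \<and> free_act Q q n d v l = free_act Q q n d v r"
proof -
  let ?F = "free_algebra d" and ?f = "foldl (gen_act Q q n d) v"
  have bc: "basis_vec w \<in> carrier ?F" if "w \<in> lists {..<d}" for w
    unfolding free_algebra_eq by (rule basis_vec_carrier) (use that in \<open>simp add: wmon_def\<close>)
  have fb: "free_act Q q n d v (basis_vec w) = ?f w" for w unfolding free_act_eq by (rule ext) (simp add: rep_basis)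
  have eqI: "?f w = ?f w'" if "w \<in> lists {..<d}" "w' \<in> lists {..<d}"
    "foldl (\<lambda>u t. u \<lhd>\<^sub>L TT Q q t) (on_words d v) w = foldl (\<lambda>u t. u \<lhd>\<^sub>L TT Q q t) (on_words d v) w'" for w w'
    using on_words_inj on_words_fold[OF that(1) v, of Q q] on_words_fold[OF that(2) v, of Q q] that(3) by metis
  have quadI: "(\<lambda>p. c * basis_vec [i] p + basis_vec [] p) \<in> carrier ?F \<and>
      free_act Q q n d v (basis_vec [i, i]) = free_act Q q n d v (\<lambda>p. c * basis_vec [i] p + basis_vec [] p)"
    if i: "i < d" and e: "\<And>u. u \<lhd>\<^sub>L TT Q q i \<lhd>\<^sub>L TT Q q i = (\<lambda>w. c * (u \<lhd>\<^sub>L TT Q q i) w + u w)" for i c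
  proof
    have c1: "(\<lambda>p. c * basis_vec [i] p) \<in> carrier ?F" "basis_vec [] \<in> carrier ?F"
      using monoid_algebra_smult_closed[OF bc[of "[i]", unfolded free_algebra_eq], of c] bc[of "[]"] i
      by (simp_all add: free_algebra_eq monoid_algebra_simps(6))
    interpret ring ?F unfolding free_algebra_eq by (rule monoid_algebra_ring[OF wmon_monoid])
    show "(\<lambda>p. c * basis_vec [i] p + basis_vec [] p) \<in> carrier ?F"
      using a_closed[OF c1] by (simp add: free_algebra_eq monoid_algebra_simps(5))
    have g: "gen_act Q q n d v i \<in> space (multi_index n d)" by (rule gen_act_space[OF i])
    have "gen_act Q q n d (gen_act Q q n d v i) i = (\<lambda>w. c * gen_act Q q n d v i w + v w)"
    proof (rule on_words_inj[OF gen_act_space[OF i] space_add[OF space_scale[OF g] v]])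
      have "on_words d (gen_act Q q n d (gen_act Q q n d v i) i) = on_words d v \<lhd>\<^sub>L TT Q q i \<lhd>\<^sub>L TT Q q i"
        by (simp add: on_words_gen_act[OF g i] on_words_gen_act[OF v i])
      also have "\<dots> = (\<lambda>w. c * on_words d (gen_act Q q n d v i) w + on_words d v w)" by (simp add: e on_words_gen_act[OF v i])
      also have "\<dots> = on_words d (\<lambda>w. c * gen_act Q q n d v i w + v w)" by (simp only: on_words_linear)
      finally show "on_words d (gen_act Q q n d (gen_act Q q n d v i) i) = on_words d (\<lambda>w. c * gen_act Q q n d v i w + v w)" .
    qed
    then show "free_act Q q n d v (basis_vec [i, i]) = free_act Q q n d v (\<lambda>p. c * basis_vec [i] p + basis_vec [] p)"
      using rep_add[OF c1[unfolded free_algebra_eq], of "\<lambda>w v. foldl (gen_act Q q n d) v w" v]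
      unfolding fb unfolding free_act_eq by (auto simp: rep_scale rep_basis)
  qed
  have q: "u \<lhd>\<^sub>L TT Q q i \<lhd>\<^sub>L TT Q q i = (\<lambda>w. (inverse q - q) * (u \<lhd>\<^sub>L TT Q q i) w + u w)" if "1 \<le> i" for u i
  proof -
    have "u \<lhd>\<^sub>L (TT Q q i * TT Q q i) = u \<lhd>\<^sub>L (scal (inverse q - q) * TT Q q i + 1)" using H.quad[OF that] by simp
    then show ?thesis by (simp add: app_scale)
  qed
  have q0: "u \<lhd>\<^sub>L TT Q q 0 \<lhd>\<^sub>L TT Q q 0 = (\<lambda>w. (inverse Q - Q) * (u \<lhd>\<^sub>L TT Q q 0) w + u w)" for u
    by (rule ext) (simp add: app_TT tf_quad0[OF Q0])
  have b: "u \<lhd>\<^sub>L TT Q q i \<lhd>\<^sub>L TT Q q (Suc i) \<lhd>\<^sub>L TT Q q i = u \<lhd>\<^sub>L TT Q q (Suc i) \<lhd>\<^sub>L TT Q q i \<lhd>\<^sub>L TT Q q (Suc i)" if "1 \<le> i" for u i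
    using H.braid[OF that] by (metis app_simps(6))
  have b4: "u \<lhd>\<^sub>L TT Q q 0 \<lhd>\<^sub>L TT Q q 1 \<lhd>\<^sub>L TT Q q 0 \<lhd>\<^sub>L TT Q q 1 = u \<lhd>\<^sub>L TT Q q 1 \<lhd>\<^sub>L TT Q q 0 \<lhd>\<^sub>L TT Q q 1 \<lhd>\<^sub>L TT Q q 0" for u
    using arg_cong[OF H.braid4, of "\<lambda>x. u \<lhd>\<^sub>L x"] by (simp only: app_simps(6) mult.assoc)
  have f: "u \<lhd>\<^sub>L TT Q q i \<lhd>\<^sub>L TT Q q j = u \<lhd>\<^sub>L TT Q q j \<lhd>\<^sub>L TT Q q i" if "\<bar>int i - int j\<bar> > 1" for u i j
  proof -
    have "Suc i < j \<or> Suc j < i" using that by linarith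
    then have "TT Q q i * TT Q q j = TT Q q j * TT Q q i" using H.far[of i j] H.far[of j i] by auto
    from arg_cong[OF this, of "\<lambda>x. u \<lhd>\<^sub>L x"] show ?thesis by (simp only: app_simps(6))
  qed
  have ops: "(c \<odot>\<^bsub>?F\<^esub> basis_vec [i]) \<oplus>\<^bsub>?F\<^esub> \<one>\<^bsub>?F\<^esub> = (\<lambda>p. c * basis_vec [i] p + basis_vec [] p)" for c i
    by (simp add: free_algebra_eq monoid_algebra_simps(3,5,6)) (simp add: wmon_def)
  from r consider i where "l = basis_vec [i, i+1, i]" "r = basis_vec [i+1, i, i+1]" "1 \<le> i" "i + 2 \<le> d"
    | "l = basis_vec [0, 1, 0, 1]" "r = basis_vec [1, 0, 1, 0]" "2 \<le> d"
    | i j where "l = basis_vec [i, j]" "r = basis_vec [j, i]" "i < d" "j < d" "\<bar>int i - int j\<bar> > 1"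
    | "l = basis_vec [0, 0]" "r = (\<lambda>p. (inverse Q - Q) * basis_vec [0] p + basis_vec [] p)" "1 \<le> d"
    | i where "l = basis_vec [i, i]" "r = (\<lambda>p. (inverse q - q) * basis_vec [i] p + basis_vec [] p)" "1 \<le> i" "i < d"
    unfolding hecke_relations_def Let_def ops by (auto split: if_splits)
  then show ?thesis
  proof cases
    case (1 i)
    show ?thesis unfolding 1 fb by (intro conjI bc eqI) (use 1 b in auto)
  next
    case 2
    show ?thesis unfolding 2 fb by (intro conjI bc eqI) (use 2 b4 in auto)
  next
    case (3 i j)
    show ?thesis unfolding 3 fb by (intro conjI bc eqI) (use 3 f in auto)
  next
    case 4
    show ?thesis unfolding 4 using quadI[OF _ q0] 4(3) bc[of "[0, 0]"] by auto
  next
    case (5 i)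
    show ?thesis unfolding 5 using quadI[OF 5(4) q[OF 5(3)]] 5(4) bc[of "[i, i]"] by auto
  qed
qed

end

section \<open>Commuting with the Hecke algebra\<close>

lemma monoid_algebra_smult_conv:
  assumes "Group.monoid M" "y \<in> carrier (monoid_algebra M)"
  shows "c \<odot>\<^bsub>monoid_algebra M\<^esub> y = (c \<odot>\<^bsub>monoid_algebra M\<^esub> \<one>\<^bsub>monoid_algebra M\<^esub>) \<otimes>\<^bsub>monoid_algebra M\<^esub> y"
proof
  interpret Group.monoid M by fact
  fix m
  have y: "finite {m. y m \<noteq> 0}" "y b \<noteq> 0 \<Longrightarrow> b \<in> carrier M" for b using assms(2) by (auto simp: monoid_algebra_simps)
  have s: "{m. (c \<odot>\<^bsub>monoid_algebra M\<^esub> \<one>\<^bsub>monoid_algebra M\<^esub>) m \<noteq> 0} \<subseteq> {\<one>\<^bsub>M\<^esub>}"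
    by (auto simp: monoid_algebra_simps(3,6) basis_vec_def split: if_splits)
  have c1: "(c \<odot>\<^bsub>monoid_algebra M\<^esub> \<one>\<^bsub>monoid_algebra M\<^esub>) \<one>\<^bsub>M\<^esub> = c"
    by (simp add: monoid_algebra_simps(3,6) basis_vec_def)
  have "((c \<odot>\<^bsub>monoid_algebra M\<^esub> \<one>\<^bsub>monoid_algebra M\<^esub>) \<otimes>\<^bsub>monoid_algebra M\<^esub> y) m
      = (\<Sum>b | y b \<noteq> 0. if b = m then c * y b else 0)"
    unfolding conv_on[OF finite.insertI[OF finite.emptyI] s y(1) subset_refl]
    by simp (intro sum.cong, auto simp: y c1)
  also have "\<dots> = c * y m" using y(1) by (simp add: sum.delta)
  finally show "(c \<odot>\<^bsub>monoid_algebra M\<^esub> y) m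
      = ((c \<odot>\<^bsub>monoid_algebra M\<^esub> \<one>\<^bsub>monoid_algebra M\<^esub>) \<otimes>\<^bsub>monoid_algebra M\<^esub> y) m"
    by (simp add: monoid_algebra_simps(6))
qed

lemma free_algebra_ring: "ring (free_algebra d)"
  unfolding free_algebra_eq by (rule monoid_algebra_ring[OF wmon_monoid])

lemma free_act_mult:
  assumes "x \<in> carrier (free_algebra d)" "y \<in> carrier (free_algebra d)" "v \<in> space (multi_index n d)"
  shows "free_act Q q n d v (x \<otimes>\<^bsub>free_algebra d\<^esub> y) = free_act Q q n d (free_act Q q n d v x) y"
  unfolding free_act_eq free_algebra_eq
  by (rule rep_mult_antihom[of "wmon d" "multi_index n d"])
    (use assms fold_lin in \<open>simp_all add: free_algebra_eq wmon_def\<close>)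

lemma free_act_annihilator:
  "ideal {x \<in> carrier (free_algebra d). \<forall>v\<in>space (multi_index n d). \<forall>w. free_act Q q n d v x w = 0} (free_algebra d)"
proof -
  have "ideal {x \<in> carrier (monoid_algebra (wmon d)). \<forall>v\<in>space (multi_index n d). \<forall>w.
      rep (\<lambda>w v. foldl (gen_act Q q n d) v w) x v w = 0} (monoid_algebra (wmon d))"
  proof (rule rep_annihilator[OF wmon_monoid])
    show "lin (space (multi_index n d)) (\<lambda>v. foldl (gen_act Q q n d) v w)" if "w \<in> carrier (wmon d)" for w
      using that fold_lin by (simp add: wmon_def)
  qed (use free_act_mult[of _ d _ _ n Q q] in \<open>simp add: free_act_eq free_algebra_eq\<close>)
  then show ?thesis unfolding free_act_eq free_algebra_eq .
qed

lemma free_act_minus: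
  assumes "x \<in> carrier (free_algebra d)" "y \<in> carrier (free_algebra d)"
  shows "free_act Q q n d v (x \<ominus>\<^bsub>free_algebra d\<^esub> y) w = free_act Q q n d v x w - free_act Q q n d v y w"
proof -
  have y': "(\<lambda>m. (- 1) * y m) \<in> carrier (monoid_algebra (wmon d))"
    using monoid_algebra_smult_closed[of y "wmon d" "- 1"] assms(2) by (simp add: free_algebra_eq monoid_algebra_simps(6))
  have "x \<ominus>\<^bsub>free_algebra d\<^esub> y = (\<lambda>m. x m + (- 1) * y m)"
    using monoid_algebra_minus[OF wmon_monoid] assms by (simp add: free_algebra_eq)
  then show ?thesis
    unfolding free_act_eq by (simp only: rep_add[OF assms(1)[unfolded free_algebra_eq] y'] rep_scale) simp
qed

lemma free_act_add:
  assumes "x \<in> carrier (free_algebra d)" "y \<in> carrier (free_algebra d)"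
  shows "free_act Q q n d v (x \<oplus>\<^bsub>free_algebra d\<^esub> y) w = free_act Q q n d v x w + free_act Q q n d v y w"
  unfolding free_act_eq free_algebra_eq monoid_algebra_simps(5) by (rule rep_add[OF assms[unfolded free_algebra_eq]])

context
  fixes Q q :: "'k::field"
  assumes Q0: "Q \<noteq> 0" and q0: "q \<noteq> 0"
begin

lemma hecke_relators:
  "{l \<ominus>\<^bsub>free_algebra d\<^esub> r | l r. (l, r) \<in> hecke_relations Q q d}
    \<subseteq> {x \<in> carrier (free_algebra d). \<forall>v\<in>space (multi_index n d). \<forall>w. free_act Q q n d v x w = 0}"
proof -
  interpret ring "free_algebra d :: ('k, nat list \<Rightarrow> 'k) module" by (rule free_algebra_ring)
  have "l \<ominus>\<^bsub>free_algebra d\<^esub> r \<in> carrier (free_algebra d)" if r: "(l, r) \<in> hecke_relations Q q d" for l r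
    using hecke_relation_act[OF Q0 q0 r space_zero, of 0] by simp
  moreover have "free_act Q q n d u (l \<ominus>\<^bsub>free_algebra d\<^esub> r) w = 0"
    if r: "(l, r) \<in> hecke_relations Q q d" and u: "u \<in> space (multi_index n d)" for l r u w
    using hecke_relation_act[OF Q0 q0 r u] free_act_minus[of l d r Q q n u w] by simp
  ultimately show ?thesis by blast
qed

lemma hecke_ideal: "ideal (hecke_ideal Q q d) (free_algebra d)"
proof -
  interpret ring "free_algebra d :: ('k, nat list \<Rightarrow> 'k) module" by (rule free_algebra_ring)
  show ?thesis unfolding hecke_ideal_def relation_ideal_def
    by (rule genideal_ideal) (use hecke_relators in blast)
qed

lemma hecke_ideal_act:
  assumes "x \<in> hecke_ideal Q q d" "v \<in> space (multi_index n d)"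
  shows "free_act Q q n d v x w = 0"
proof -
  interpret ring "free_algebra d :: ('k, nat list \<Rightarrow> 'k) module" by (rule free_algebra_ring)
  show ?thesis
    using genideal_minimal[OF free_act_annihilator hecke_relators] assms
    unfolding hecke_ideal_def relation_ideal_def by blast
qed

lemma hecke_act_coset:
  assumes x: "x \<in> carrier (free_algebra d)" and v: "v \<in> space (multi_index n d)"
  shows "hecke_act Q q n d v (hecke_ideal Q q d +>\<^bsub>free_algebra d\<^esub> x) = free_act Q q n d v x"
proof -
  interpret ideal "hecke_ideal Q q d" "free_algebra d" by (rule hecke_ideal)
  let ?c = "hecke_ideal Q q d +>\<^bsub>free_algebra d\<^esub> x"
  have "free_act Q q n d v y = free_act Q q n d v x" if y: "y \<in> ?c" for y
  proof
    fix w
    obtain i where i: "i \<in> hecke_ideal Q q d" "y = i \<oplus>\<^bsub>free_algebra d\<^esub> x"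
      using y by (auto simp: a_r_coset_def r_coset_def)
    then show "free_act Q q n d v y w = free_act Q q n d v x w"
      using free_act_add[OF Icarr[OF i(1)] x] hecke_ideal_act[OF i(1) v] by simp
  qed
  moreover have "free_act Q q n d v x \<in> free_act Q q n d v ` ?c" by (rule imageI[OF a_rcos_self[OF x]])
  ultimately have "free_act Q q n d v ` ?c = {free_act Q q n d v x}" by blast
  then show ?thesis by (simp add: hecke_act_def)
qed

lemma hecke_B_ops:
  "carrier (hecke_B Q q d) = (\<lambda>x. hecke_ideal Q q d +>\<^bsub>free_algebra d\<^esub> x) ` carrier (free_algebra d)"
  "\<one>\<^bsub>hecke_B Q q d\<^esub> = hecke_ideal Q q d +>\<^bsub>free_algebra d\<^esub> \<one>\<^bsub>free_algebra d\<^esub>"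
  "X \<otimes>\<^bsub>hecke_B Q q d\<^esub> Y = rcoset_mult (free_algebra d) (hecke_ideal Q q d) X Y"
  "X \<oplus>\<^bsub>hecke_B Q q d\<^esub> Y = X <+>\<^bsub>free_algebra d\<^esub> Y"
  "c \<odot>\<^bsub>hecke_B Q q d\<^esub> X = (\<Union>x\<in>X. hecke_ideal Q q d +>\<^bsub>free_algebra d\<^esub> (c \<odot>\<^bsub>free_algebra d\<^esub> x))"
  by (auto simp: hecke_B_def quotient_algebra_def FactRing_def ring.defs module.defs A_RCOSETS_def')

text \<open>Elements of the Hecke algebra with a representative that involves only generators \<open>T\<^sub>i\<close> with \<open>i \<in> X\<close>.\<close>

definition cosets :: "nat \<Rightarrow> nat set \<Rightarrow> (nat list \<Rightarrow> 'k) set set" where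
  "cosets d X = {hecke_ideal Q q d +>\<^bsub>free_algebra d\<^esub> x | x.
     x \<in> carrier (free_algebra d) \<and> {w. x w \<noteq> 0} \<subseteq> lists X}"

lemma hecke_B_carrier: "carrier (hecke_B Q q d) = cosets d {..<d}"
  unfolding hecke_B_ops cosets_def by (auto simp: free_algebra_eq monoid_algebra_simps(1) wmon_def)

lemma gen_coset: assumes "t < d" "t \<in> X" shows "hecke_gen Q q d t \<in> cosets d X"
proof -
  have "basis_vec [t] \<in> carrier (free_algebra d)"
    unfolding free_algebra_eq by (rule basis_vec_carrier) (use assms in \<open>simp add: wmon_def\<close>)
  moreover have "{w. basis_vec [t] w \<noteq> (0::'k)} \<subseteq> lists X" unfolding supp_basis_vec using assms(2) by simp
  ultimately show ?thesis unfolding cosets_def hecke_gen_def by blast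
qed

lemma hecke_A_cosets: "hecke_A Q q d \<subseteq> cosets d {1..<d}"
proof
  let ?F = "free_algebra d :: ('k, nat list \<Rightarrow> 'k) module" and ?I = "hecke_ideal Q q d"
  interpret ideal ?I ?F by (rule hecke_ideal)
  fix h assume "h \<in> hecke_A Q q d"
  then show "h \<in> cosets d {1..<d}" unfolding hecke_A_def
  proof induction
    case (gen h) then show ?case using gen_coset by auto
  next
    case one
    have "\<one>\<^bsub>?F\<^esub> = basis_vec []" by (simp add: free_algebra_eq monoid_algebra_simps(3) wmon_def)
    then have "{w. \<one>\<^bsub>?F\<^esub> w \<noteq> 0} \<subseteq> lists {1..<d}" by (simp add: supp_basis_vec)
    then show ?case unfolding hecke_B_ops cosets_def using one_closed by blast
  next
    case (add h h')
    then obtain x y where x: "h = ?I +>\<^bsub>?F\<^esub> x" "x \<in> carrier ?F" "{w. x w \<noteq> 0} \<subseteq> lists {1..<d}"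
      and y: "h' = ?I +>\<^bsub>?F\<^esub> y" "y \<in> carrier ?F" "{w. y w \<noteq> 0} \<subseteq> lists {1..<d}"
      unfolding cosets_def by blast
    have "{w. (x \<oplus>\<^bsub>?F\<^esub> y) w \<noteq> 0} \<subseteq> {w. x w \<noteq> 0} \<union> {w. y w \<noteq> 0}"
      unfolding free_algebra_eq monoid_algebra_simps by auto
    then have "{w. (x \<oplus>\<^bsub>?F\<^esub> y) w \<noteq> 0} \<subseteq> lists {1..<d}" using x(3) y(3) by blast
    then show ?case unfolding hecke_B_ops x(1) y(1) a_rcos_sum[OF x(2) y(2)] cosets_def
      using a_closed[OF x(2) y(2)] by blast
  next
    case (mult h h')
    then obtain x y where x: "h = ?I +>\<^bsub>?F\<^esub> x" "x \<in> carrier ?F" "{w. x w \<noteq> 0} \<subseteq> lists {1..<d}"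
      and y: "h' = ?I +>\<^bsub>?F\<^esub> y" "y \<in> carrier ?F" "{w. y w \<noteq> 0} \<subseteq> lists {1..<d}"
      unfolding cosets_def by blast
    have "w \<in> lists {1..<d}" if w: "(x \<otimes>\<^bsub>?F\<^esub> y) w \<noteq> 0" for w
    proof -
      obtain a b where ab: "w = a @ b" "x a \<noteq> 0" "y b \<noteq> 0"
        using conv_supp[OF w[unfolded free_algebra_eq]] by (auto simp: wmon_def)
      then have "a \<in> lists {1..<d}" "b \<in> lists {1..<d}" using x(3) y(3) by blast+
      then show ?thesis by (simp add: ab(1))
    qed
    then have "{w. (x \<otimes>\<^bsub>?F\<^esub> y) w \<noteq> 0} \<subseteq> lists {1..<d}" by blast
    then show ?case unfolding hecke_B_ops x(1) y(1) rcoset_mult_add[OF x(2) y(2)] cosets_def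
      using m_closed[OF x(2) y(2)] by blast
  next
    case (smult h c)
    then obtain x where x: "h = ?I +>\<^bsub>?F\<^esub> x" "x \<in> carrier ?F" "{w. x w \<noteq> 0} \<subseteq> lists {1..<d}"
      unfolding cosets_def by blast
    have sc: "c \<odot>\<^bsub>?F\<^esub> y \<in> carrier ?F" if "y \<in> carrier ?F" for y
      using monoid_algebra_smult_closed that unfolding free_algebra_eq .
    have c1: "c \<odot>\<^bsub>?F\<^esub> y = (c \<odot>\<^bsub>?F\<^esub> \<one>\<^bsub>?F\<^esub>) \<otimes>\<^bsub>?F\<^esub> y" if "y \<in> carrier ?F" for y
      using monoid_algebra_smult_conv[OF wmon_monoid] that unfolding free_algebra_eq .
    (* scalars are multiplication by c 1, so the ideal absorbs the difference of two representatives *)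
    have e: "?I +>\<^bsub>?F\<^esub> (c \<odot>\<^bsub>?F\<^esub> y) = ?I +>\<^bsub>?F\<^esub> (c \<odot>\<^bsub>?F\<^esub> x)" if y: "y \<in> h" for y
    proof -
      obtain i where i: "i \<in> ?I" "y = i \<oplus>\<^bsub>?F\<^esub> x" using y by (auto simp: x(1) a_r_coset_def r_coset_def)
      have iF: "i \<in> carrier ?F" by (rule Icarr[OF i(1)])
      have "c \<odot>\<^bsub>?F\<^esub> y = (c \<odot>\<^bsub>?F\<^esub> \<one>\<^bsub>?F\<^esub>) \<otimes>\<^bsub>?F\<^esub> i \<oplus>\<^bsub>?F\<^esub> c \<odot>\<^bsub>?F\<^esub> x"
        unfolding i(2) c1[OF a_closed[OF iF x(2)]] c1[OF x(2)] by (rule r_distr[OF iF x(2) sc[OF one_closed]])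
      moreover have "(c \<odot>\<^bsub>?F\<^esub> \<one>\<^bsub>?F\<^esub>) \<otimes>\<^bsub>?F\<^esub> i \<in> ?I" by (rule I_l_closed[OF i(1) sc[OF one_closed]])
      ultimately have "c \<odot>\<^bsub>?F\<^esub> y \<in> ?I +>\<^bsub>?F\<^esub> (c \<odot>\<^bsub>?F\<^esub> x)" by (auto simp: a_r_coset_def r_coset_def)
      from a_repr_independence'[OF this sc[OF x(2)]] show ?thesis by simp
    qed
    have "x \<in> h" unfolding x(1) by (rule a_rcos_self[OF x(2)])
    then have "c \<odot>\<^bsub>hecke_B Q q d\<^esub> h = ?I +>\<^bsub>?F\<^esub> (c \<odot>\<^bsub>?F\<^esub> x)" unfolding hecke_B_ops using e by blast
    moreover have "{w. (c \<odot>\<^bsub>?F\<^esub> x) w \<noteq> 0} \<subseteq> lists {1..<d}"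
      using x(3) unfolding free_algebra_eq monoid_algebra_simps by auto
    ultimately show ?case unfolding cosets_def using sc[OF x(2)] by blast
  qed
qed

lemma commute_free_act:
  assumes f: "lin_on (space (multi_index n d)) f"
    and c: "\<And>t v. t \<in> X \<Longrightarrow> v \<in> space (multi_index n d) \<Longrightarrow> f (gen_act Q q n d v t) = gen_act Q q n d (f v) t"
    and x: "x \<in> carrier (free_algebra d)" "{w. x w \<noteq> 0} \<subseteq> lists X" and v: "v \<in> space (multi_index n d)"
  shows "f (free_act Q q n d v x) = free_act Q q n d (f v) x"
proof -
  let ?S = "space (multi_index n d) :: (int list \<Rightarrow> 'k) set" and ?g = "foldl (gen_act Q q n d)"
  have lf: "lin ?S f" using f by (simp add: lin_on_iff)
  have s: "finite {w. x w \<noteq> 0}" "x w \<noteq> 0 \<Longrightarrow> w \<in> lists {..<d}" for w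
    using x(1) by (auto simp: free_algebra_eq monoid_algebra_simps wmon_def)
  have fw: "?g v w \<in> ?S" if "w \<in> lists {..<d}" for w by (rule lin_mem[OF fold_lin[OF that] v])
  have g: "f (?g v w) = ?g (f v) w" if "w \<in> lists X" "w \<in> lists {..<d}" for w
    using that
  proof (induction w rule: rev_induct)
    case (snoc t w) then show ?case using c[of t "?g v w"] fw[of w] by auto
  qed simp
  have "f (free_act Q q n d v x) = (\<lambda>\<nu>. \<Sum>w | x w \<noteq> 0. x w * f (?g v w) \<nu>)"
    unfolding free_act_def by (rule lin_sum[OF lf s(1)]) (use s fw in auto)
  also have "\<dots> = free_act Q q n d (f v) x"
    unfolding free_act_def by (intro ext sum.cong refl) (use s(2) x(2) in \<open>simp add: g subset_iff\<close>)
  finally show ?thesis .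
qed

lemma end_algebra_cong:
  "(\<And>f. lin_on W f \<Longrightarrow> (\<forall>h\<in>H. \<forall>v\<in>W. f (act v h) = act (f v) h) \<longleftrightarrow> (\<forall>h\<in>H'. \<forall>v\<in>W. f (act' v h) = act' (f v) h)) \<Longrightarrow>
   end_algebra W H act = end_algebra W H' act'"
  unfolding end_algebra_def lin_on_def by (auto intro!: Collect_cong)

text \<open>Commuting with the generators suffices. This identifies both kinds of Schur algebra with
  commutants of finite families of operators.\<close>

lemma end_hecke:
  assumes H: "H \<subseteq> cosets d X" "hecke_gen Q q d ` X \<subseteq> H" and X: "X \<subseteq> {..<d}"
  shows "end_algebra (tensor_space n d) H (hecke_act Q q n d)
    = end_algebra (space (multi_index n d)) X (gen_act Q q n d)"
  unfolding tensor_space_eq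
proof (rule end_algebra_cong)
  let ?S = "space (multi_index n d) :: (int list \<Rightarrow> 'k) set"
  fix f :: "(int list \<Rightarrow> 'k) \<Rightarrow> int list \<Rightarrow> 'k" assume f: "lin_on ?S f"
  have m: "f v \<in> ?S" if "v \<in> ?S" for v using lin_on_mem[OF f that] .
  have 1: "hecke_act Q q n d v (hecke_gen Q q d t) = gen_act Q q n d v t" if "t \<in> X" "v \<in> ?S" for t v
  proof -
    have "basis_vec [t] \<in> carrier (free_algebra d)"
      unfolding free_algebra_eq by (rule basis_vec_carrier) (use that X in \<open>auto simp: wmon_def\<close>)
    from hecke_act_coset[OF this that(2)] show ?thesis
      unfolding hecke_gen_def free_act_eq by (auto simp: fun_eq_iff rep_basis)
  qed
  show "(\<forall>h\<in>H. \<forall>v\<in>?S. f (hecke_act Q q n d v h) = hecke_act Q q n d (f v) h) \<longleftrightarrow>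
      (\<forall>t\<in>X. \<forall>v\<in>?S. f (gen_act Q q n d v t) = gen_act Q q n d (f v) t)" (is "?l \<longleftrightarrow> ?r")
  proof
    assume l: ?l
    show ?r
    proof (intro ballI)
      fix t v assume t: "t \<in> X" and v: "v \<in> ?S"
      have "hecke_gen Q q d t \<in> H" using H(2) t by blast
      then have "f (hecke_act Q q n d v (hecke_gen Q q d t)) = hecke_act Q q n d (f v) (hecke_gen Q q d t)" using l v by blast
      then show "f (gen_act Q q n d v t) = gen_act Q q n d (f v) t" by (simp only: 1[OF t v] 1[OF t m[OF v]])
    qed
  next
    assume r: ?r
    show ?l
    proof (intro ballI)
      fix h v assume h: "h \<in> H" and v: "v \<in> ?S"
      obtain x where x: "h = hecke_ideal Q q d +>\<^bsub>free_algebra d\<^esub> x" "x \<in> carrier (free_algebra d)" "{w. x w \<noteq> 0} \<subseteq> lists X"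
        using h H(1) unfolding cosets_def by blast
      have "f (free_act Q q n d v x) = free_act Q q n d (f v) x"
        by (rule commute_free_act[OF f _ x(2,3) v]) (use r in blast)
      then show "f (hecke_act Q q n d v h) = hecke_act Q q n d (f v) h"
        unfolding x(1) hecke_act_coset[OF x(2) v] hecke_act_coset[OF x(2) m[OF v]] .
    qed
  qed
qed

lemma schur_B_eq: "schur_B Q q n d = end_algebra (space (multi_index n d)) {..<d} (gen_act Q q n d)"
  unfolding schur_B_def by (rule end_hecke) (auto simp: hecke_B_carrier intro: gen_coset)

lemma schur_A_eq: "schur_A Q q m i = end_algebra (space (multi_index m i)) {1..<i} (gen_act Q q m i)"
  unfolding schur_A_def
proof (rule end_hecke[OF hecke_A_cosets])
  show "hecke_gen Q q i ` {1..<i} \<subseteq> hecke_A Q q i"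
    unfolding hecke_A_def by (auto intro: subalgebra_generated.gen)
qed auto

end

section \<open>Isomorphisms of algebras\<close>

lemma kalg_iso_comp: "f \<in> kalg_iso A B \<Longrightarrow> g \<in> kalg_iso B C \<Longrightarrow> (\<lambda>x. g (f x)) \<in> kalg_iso A C"
  using ring_iso_set_trans[of f A B g C]
  unfolding kalg_iso_def by (auto simp: comp_def ring_iso_memE(1))

lemma direct_sum_iso:
  assumes \<Theta>: "\<And>i. i \<in> I \<Longrightarrow> \<Theta> i \<in> kalg_iso (A i) (B i)"
  shows "(\<lambda>x. \<lambda>i\<in>I. \<Theta> i (x i)) \<in> kalg_iso (direct_sum_algebra I A) (direct_sum_algebra I B)"
proof -
  let ?P = "\<lambda>x. \<lambda>i\<in>I. \<Theta> i (x i)"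
  have bij: "bij_betw (\<Theta> i) (carrier (A i)) (carrier (B i))" if "i \<in> I" for i
    using \<Theta>[OF that] by (simp add: kalg_iso_def ring_iso_def)
  have ops: "\<Theta> i (x \<otimes>\<^bsub>A i\<^esub> y) = \<Theta> i x \<otimes>\<^bsub>B i\<^esub> \<Theta> i y" "\<Theta> i (x \<oplus>\<^bsub>A i\<^esub> y) = \<Theta> i x \<oplus>\<^bsub>B i\<^esub> \<Theta> i y"
    if "i \<in> I" "x \<in> carrier (A i)" "y \<in> carrier (A i)" for i x y
    using \<Theta>[OF that(1)] that by (auto simp: kalg_iso_def ring_iso_def ring_hom_def)
  have smult: "\<Theta> i (c \<odot>\<^bsub>A i\<^esub> x) = c \<odot>\<^bsub>B i\<^esub> \<Theta> i x" if "i \<in> I" "x \<in> carrier (A i)" for i x c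
    using \<Theta>[OF that(1)] that by (simp add: kalg_iso_def)
  have one: "\<Theta> i \<one>\<^bsub>A i\<^esub> = \<one>\<^bsub>B i\<^esub>" if "i \<in> I" for i
    using \<Theta>[OF that] by (auto simp: kalg_iso_def ring_iso_def ring_hom_def)
  have "bij_betw ?P (\<Pi>\<^sub>E i\<in>I. carrier (A i)) (\<Pi>\<^sub>E i\<in>I. carrier (B i))"
  proof (rule bij_betw_byWitness[where f' = "\<lambda>y. \<lambda>i\<in>I. inv_into (carrier (A i)) (\<Theta> i) (y i)"])
    show "\<forall>x\<in>\<Pi>\<^sub>E i\<in>I. carrier (A i). (\<lambda>i\<in>I. inv_into (carrier (A i)) (\<Theta> i) (?P x i)) = x"
      using bij_betw_inv_into_left[OF bij] by (auto simp: fun_eq_iff PiE_iff extensional_def)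
    show "\<forall>y\<in>\<Pi>\<^sub>E i\<in>I. carrier (B i). ?P (\<lambda>i\<in>I. inv_into (carrier (A i)) (\<Theta> i) (y i)) = y"
      using bij_betw_inv_into_right[OF bij] by (auto simp: fun_eq_iff PiE_iff extensional_def)
    show "?P ` (\<Pi>\<^sub>E i\<in>I. carrier (A i)) \<subseteq> (\<Pi>\<^sub>E i\<in>I. carrier (B i))"
      using bij_betwE[OF bij] by (auto simp: PiE_iff)
    show "(\<lambda>y. \<lambda>i\<in>I. inv_into (carrier (A i)) (\<Theta> i) (y i)) ` (\<Pi>\<^sub>E i\<in>I. carrier (B i)) \<subseteq> (\<Pi>\<^sub>E i\<in>I. carrier (A i))"
      using bij_betwE[OF bij_betw_inv_into[OF bij]] by (auto simp: PiE_iff)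
  qed
  moreover have "?P x \<in> (\<Pi>\<^sub>E i\<in>I. carrier (B i))" if "x \<in> (\<Pi>\<^sub>E i\<in>I. carrier (A i))" for x
    using that bij_betwE[OF bij] by (auto simp: PiE_iff)
  ultimately show ?thesis
    unfolding kalg_iso_def ring_iso_def ring_hom_def direct_sum_algebra_def
    by (auto simp: PiE_iff fun_eq_iff ops one smult)
qed

lemma end_transfer_closed:
  assumes \<tau>: "\<And>v. v \<in> W \<Longrightarrow> \<tau> v \<in> W'" "\<And>v. v \<in> W \<Longrightarrow> \<sigma> (\<tau> v) = v"
    and \<sigma>: "\<And>v. v \<in> W' \<Longrightarrow> \<sigma> v \<in> W" "\<And>v. v \<in> W' \<Longrightarrow> \<tau> (\<sigma> v) = v"
    and add: "\<And>u v. u \<in> W \<Longrightarrow> v \<in> W \<Longrightarrow> \<tau> (\<lambda>w. u w + v w) = (\<lambda>w. \<tau> u w + \<tau> v w)"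
    and scale: "\<And>c v. v \<in> W \<Longrightarrow> \<tau> (\<lambda>w. c * v w) = (\<lambda>w. c * \<tau> v w)"
    and add': "\<And>u v. u \<in> W' \<Longrightarrow> v \<in> W' \<Longrightarrow> \<sigma> (\<lambda>w. u w + v w) = (\<lambda>w. \<sigma> u w + \<sigma> v w)"
    and scale': "\<And>c v. v \<in> W' \<Longrightarrow> \<sigma> (\<lambda>w. c * v w) = (\<lambda>w. c * \<sigma> v w)"
    and cl: "\<And>u v. u \<in> W' \<Longrightarrow> v \<in> W' \<Longrightarrow> (\<lambda>w. u w + v w) \<in> W'" "\<And>c v. v \<in> W' \<Longrightarrow> (\<lambda>w. c * v w) \<in> W'"
    and act: "\<And>t v. t \<in> X \<Longrightarrow> v \<in> W \<Longrightarrow> \<tau> (act v t) = act' (\<tau> v) t"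
    and act': "\<And>t v. t \<in> X \<Longrightarrow> v \<in> W' \<Longrightarrow> act' v t \<in> W' \<and> \<sigma> (act' v t) = act (\<sigma> v) t"
    and f: "f \<in> carrier (end_algebra W X act)"
  shows "(\<lambda>v\<in>W'. \<tau> (f (\<sigma> v))) \<in> carrier (end_algebra W' X act')"
proof -
  have lf: "lin W f" using f by (simp add: end_algebra_carrier lin_on_iff)
  have fc: "f (act v t) = act (f v) t" if "t \<in> X" "v \<in> W" for t v using f that by (simp add: end_algebra_carrier)
  show ?thesis unfolding end_algebra_carrier lin_on_iff lin_def
    by (auto simp: \<tau> \<sigma> add scale add' scale' cl act act' fc lin_mem[OF lf] lin_add[OF lf] lin_scale[OF lf])
qed

text \<open>Transport of a commutant along a linear bijection that intertwines the actions.\<close>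

lemma end_transfer:
  assumes \<tau>: "\<And>v. v \<in> W \<Longrightarrow> \<tau> v \<in> W'" "\<And>v. v \<in> W \<Longrightarrow> \<sigma> (\<tau> v) = v"
    and \<sigma>: "\<And>v. v \<in> W' \<Longrightarrow> \<sigma> v \<in> W" "\<And>v. v \<in> W' \<Longrightarrow> \<tau> (\<sigma> v) = v"
    and add: "\<And>u v. u \<in> W \<Longrightarrow> v \<in> W \<Longrightarrow> \<tau> (\<lambda>w. u w + v w) = (\<lambda>w. \<tau> u w + \<tau> v w)"
    and scale: "\<And>c v. v \<in> W \<Longrightarrow> \<tau> (\<lambda>w. c * v w) = (\<lambda>w. c * \<tau> v w)"
    and cl: "\<And>u v. u \<in> W \<Longrightarrow> v \<in> W \<Longrightarrow> (\<lambda>w. u w + v w) \<in> W" "\<And>c v. v \<in> W \<Longrightarrow> (\<lambda>w. c * v w) \<in> W"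
    and cl': "\<And>u v. u \<in> W' \<Longrightarrow> v \<in> W' \<Longrightarrow> (\<lambda>w. u w + v w) \<in> W'" "\<And>c v. v \<in> W' \<Longrightarrow> (\<lambda>w. c * v w) \<in> W'"
    and act: "\<And>t v. t \<in> X \<Longrightarrow> v \<in> W \<Longrightarrow> act v t \<in> W \<and> \<tau> (act v t) = act' (\<tau> v) t"
  shows "(\<lambda>f. \<lambda>v\<in>W'. \<tau> (f (\<sigma> v))) \<in> kalg_iso (end_algebra W X act) (end_algebra W' X act')"
proof -
  let ?E = "end_algebra W X act" and ?E' = "end_algebra W' X act'"
  let ?P = "\<lambda>f. \<lambda>v\<in>W'. \<tau> (f (\<sigma> v))" and ?P' = "\<lambda>g. \<lambda>v\<in>W. \<sigma> (g (\<tau> v))"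
  have add': "\<sigma> (\<lambda>w. u w + v w) = (\<lambda>w. \<sigma> u w + \<sigma> v w)" if "u \<in> W'" "v \<in> W'" for u v
    using \<tau>(2)[OF cl(1)[OF \<sigma>(1)[OF that(1)] \<sigma>(1)[OF that(2)]]] add[OF \<sigma>(1)[OF that(1)] \<sigma>(1)[OF that(2)]]
    by (simp add: \<sigma>(2) that)
  have scale': "\<sigma> (\<lambda>w. c * v w) = (\<lambda>w. c * \<sigma> v w)" if "v \<in> W'" for v c
    using \<tau>(2)[OF cl(2)[OF \<sigma>(1)[OF that]], of c] scale[OF \<sigma>(1)[OF that], of c] by (simp add: \<sigma>(2) that)
  have act': "act' v t \<in> W' \<and> \<sigma> (act' v t) = act (\<sigma> v) t" if "t \<in> X" "v \<in> W'" for t v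
  proof -
    have a: "act (\<sigma> v) t \<in> W" "\<tau> (act (\<sigma> v) t) = act' v t" using act[OF that(1) \<sigma>(1)[OF that(2)]] \<sigma>(2)[OF that(2)] by simp_all
    show ?thesis using \<tau>[OF a(1)] a(2) by simp
  qed
  have P: "?P f \<in> carrier ?E'" if "f \<in> carrier ?E" for f
    by (rule end_transfer_closed[OF \<tau> \<sigma> add scale add' scale' cl' _ act' that]) (use act in auto)
  have P': "?P' g \<in> carrier ?E" if "g \<in> carrier ?E'" for g
    by (rule end_transfer_closed[OF \<sigma> \<tau> add' scale' add scale cl _ act that]) (use act' in auto)
  have m: "f v \<in> W" "f \<in> extensional W" if "f \<in> carrier ?E" "v \<in> W" for f v
    using that by (auto simp: end_algebra_carrier lin_on_iff lin_mem)
  have ext: "f \<in> extensional W" if "f \<in> carrier ?E" for f using that by (simp add: end_algebra_carrier lin_on_iff)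
  have m': "f v \<in> W'" if "f \<in> carrier ?E'" "v \<in> W'" for f v
    using that by (auto simp: end_algebra_carrier lin_on_iff lin_mem)
  have ext': "f \<in> extensional W'" if "f \<in> carrier ?E'" for f using that by (simp add: end_algebra_carrier lin_on_iff)
  have "bij_betw ?P (carrier ?E) (carrier ?E')"
  proof (rule bij_betw_byWitness[where f' = ?P'])
    show "\<forall>f\<in>carrier ?E. ?P' (?P f) = f"
    proof
      fix f assume f: "f \<in> carrier ?E"
      show "?P' (?P f) = f" by (rule extensionalityI[OF _ ext[OF f]]) (use m[OF f] in \<open>simp_all add: \<tau>\<close>)
    qed
    show "\<forall>g\<in>carrier ?E'. ?P (?P' g) = g"
    proof
      fix g assume g: "g \<in> carrier ?E'"
      show "?P (?P' g) = g" by (rule extensionalityI[OF _ ext'[OF g]]) (use m'[OF g] in \<open>simp_all add: \<sigma>\<close>)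
    qed
  qed (use P P' in auto)
  moreover have "?P (compose W f g) = compose W' (?P f) (?P g)" if "g \<in> carrier ?E" for f g
    unfolding compose_def[of W'] by (rule restrict_ext) (simp add: compose_def \<sigma> \<tau> m[OF that])
  moreover have "?P (\<lambda>v\<in>W. \<lambda>\<mu>. f v \<mu> + g v \<mu>) = (\<lambda>v\<in>W'. \<lambda>\<mu>. ?P f v \<mu> + ?P g v \<mu>)"
    if "f \<in> carrier ?E" "g \<in> carrier ?E" for f g
    by (rule restrict_ext) (simp add: \<sigma> add m[OF that(1)] m[OF that(2)])
  moreover have "?P (\<lambda>v\<in>W. \<lambda>\<mu>. c * f v \<mu>) = (\<lambda>v\<in>W'. \<lambda>\<mu>. c * ?P f v \<mu>)" if "f \<in> carrier ?E" for f c
    by (rule restrict_ext) (simp add: \<sigma> scale m[OF that])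
  moreover have "?P (\<lambda>v\<in>W. v) = (\<lambda>v\<in>W'. v)" by (rule restrict_ext) (simp add: \<sigma>)
  ultimately show ?thesis
    using P unfolding kalg_iso_def ring_iso_def ring_hom_def by (simp add: end_algebra_ops)
qed

section \<open>From lists to words\<close>

lemma list_of_word_in:
  assumes "\<forall>i\<ge>d. w i = 0"
  shows "list_of_word d w \<in> multi_index n d \<longleftrightarrow> (\<forall>i<d. w i \<in> index_set n)"
  by (simp add: multi_index_iff list_of_word_def)

lemma (in words) schur_words_iso:
  assumes I: "I = index_set n"
  shows "\<exists>\<Psi>. \<Psi> \<in> kalg_iso (end_algebra (space (multi_index n d)) {..<d} (gen_act Q q n d)) (endW M {..<d} Q q)"
proof -
  let ?\<sigma> = "\<lambda>v \<mu>. if \<mu> \<in> multi_index n d then v (word_of_list \<mu>) else 0"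
  have words_with_iff: "w \<in> words_with (\<lambda>_. I) \<longleftrightarrow> (\<forall>i\<ge>d. w i = 0) \<and> list_of_word d w \<in> multi_index n d" for w
    using list_of_word_in[of d w n] unfolding words_with_def I by blast
  have "(\<lambda>f. \<lambda>v\<in>M. on_words d (f (?\<sigma> v))) \<in> kalg_iso (end_algebra (space (multi_index n d)) {..<d} (gen_act Q q n d)) (endW M {..<d} Q q)"
    unfolding endW_def M_def
  proof (rule end_transfer)
    fix v :: "int list \<Rightarrow> 'k" assume v: "v \<in> space (multi_index n d)"
    show "on_words d v \<in> space (words_with (\<lambda>_. I))"
      unfolding space_def mem_Collect_eq
    proof (intro allI impI)
      fix w assume w: "w \<notin> words_with (\<lambda>_. I)"
      show "on_words d v w = 0"
      proof (cases "\<forall>i\<ge>d. w i = 0")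
        case True
        then have "list_of_word d w \<notin> multi_index n d" using w words_with_iff by blast
        then show ?thesis unfolding on_words_def if_P[OF True] using v by (simp add: space_def)
      qed (simp only: on_words_def if_False)
    qed
    show "?\<sigma> (on_words d v) = v"
    proof
      fix \<mu> show "?\<sigma> (on_words d v) \<mu> = v \<mu>"
        using v by (cases "\<mu> \<in> multi_index n d") (simp_all add: on_words_at multi_index_iff space_def)
    qed
    show "on_words d (\<lambda>w. c * v w) = (\<lambda>w. c * on_words d v w)" for c by (auto simp: on_words_def fun_eq_iff)
    show "on_words d (\<lambda>w. v w + u w) = (\<lambda>w. on_words d v w + on_words d u w)" for u
      using on_words_linear[of d 1 v u] by simp
    show "gen_act Q q n d v t \<in> space (multi_index n d) \<and> on_words d (gen_act Q q n d v t) = on_words d v \<lhd>\<^sub>L TT Q q t"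
      if "t \<in> {..<d}" for t using gen_act_space on_words_gen_act[OF v] that by blast
  next
    fix v :: "(nat \<Rightarrow> int) \<Rightarrow> 'k" assume v: "v \<in> space (words_with (\<lambda>_. I))"
    show "?\<sigma> v \<in> space (multi_index n d)" by (simp add: space_def)
    show "on_words d (?\<sigma> v) = v"
    proof
      fix w
      show "on_words d (?\<sigma> v) w = v w"
      proof (cases "w \<in> words_with (\<lambda>_. I)")
        case True
        then have w: "\<forall>i\<ge>d. w i = 0" "list_of_word d w \<in> multi_index n d" using words_with_iff by blast+
        show ?thesis unfolding on_words_def if_P[OF w(1)] if_P[OF w(2)] word_of_list_of_word[OF w(1)] ..
      next
        case False
        then have "v w = 0" using v by (simp add: space_def)
        moreover have "on_words d (?\<sigma> v) w = 0" using False unfolding words_with_iff on_words_def by (simp only: if_False de_Morgan_conj split: if_split) blast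
        ultimately show ?thesis by simp
      qed
    qed
  qed (auto intro: space_add space_scale)
  then show ?thesis by blast
qed

section \<open>The two blocks of letters\<close>

lemma card_index_set:
  "card (index_set n) = n"
  "card (index_set n \<inter> {0..}) = (n + 1) div 2"
  "card (index_set n \<inter> {0<..}) = n div 2"
proof -
  define r where "r = n div 2"
  have n: "n = (if odd n then 2 * r + 1 else 2 * r)" unfolding r_def by auto
  have I: "index_set n = (if odd n then {- int r..int r} else {- int r..int r} - {0})"
    unfolding index_set_def Let_def r_def ..
  have c: "card {- int r..int r} = 2 * r + 1" by simp
  show "card (index_set n) = n" using n unfolding I by (auto simp: c)
  have "index_set n \<inter> {0..} = (if odd n then {0..int r} else {1..int r})" unfolding I by auto
  then show "card (index_set n \<inter> {0..}) = (n + 1) div 2" using n by (auto split: if_splits)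
  have "index_set n \<inter> {0<..} = {1..int r}" unfolding I by auto
  then show "card (index_set n \<inter> {0<..}) = n div 2" by (simp add: r_def)
qed

lemma increasing_relabelling:
  fixes A :: "int set"
  assumes "finite A" "card (index_set m) = card A"
  obtains \<theta> where "bij_betw \<theta> (index_set m) A"
    "\<And>i j. i \<in> index_set m \<Longrightarrow> j \<in> index_set m \<Longrightarrow> \<theta> i < \<theta> j \<longleftrightarrow> i < j"
    "\<And>i j. i \<in> index_set m \<Longrightarrow> j \<in> index_set m \<Longrightarrow> \<theta> i = \<theta> j \<longleftrightarrow> i = j"
proof -
  let ?xs = "sorted_list_of_set (index_set m)" and ?ys = "sorted_list_of_set A"
  have x: "bij_betw ((!) ?xs) {..<card A} (index_set m)" and y: "bij_betw ((!) ?ys) {..<card A} A"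
    using bij_betw_nth[of ?xs "{..<card A}" "index_set m"] bij_betw_nth[of ?ys "{..<card A}" A] assms finite_index_set
    by auto
  let ?p = "inv_into {..<card A} ((!) ?xs)"
  have p: "?p i < card A" "?xs ! ?p i = i" if "i \<in> index_set m" for i
    using bij_betwE[OF bij_betw_inv_into[OF x]] bij_betw_inv_into_right[OF x that] that by auto
  have less: "?xs ! k < ?xs ! l" "?ys ! k < ?ys ! l" if "k < l" "l < card A" for k l
    using that sorted_wrt_nth_less[OF strict_sorted_list_of_set[of "index_set m"] that(1)]
      sorted_wrt_nth_less[OF strict_sorted_list_of_set[of A] that(1)] assms by auto
  have mono: "?ys ! ?p i < ?ys ! ?p j" if i: "i \<in> index_set m" and j: "j \<in> index_set m" and "i < j" for i j
  proof -
    have "?p i < ?p j" using less(1)[of "?p j" "?p i"] p[OF i] p[OF j] \<open>i < j\<close>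
      by (metis linorder_neqE_nat order_less_asym order_less_irrefl)
    then show ?thesis using less(2) p(1)[OF j] by blast
  qed
  have b: "bij_betw ((!) ?ys \<circ> ?p) (index_set m) A"
    by (rule bij_betw_trans[OF bij_betw_inv_into[OF x] y])
  show ?thesis
    by (rule that[OF b]) (use mono in \<open>metis comp_apply linorder_less_linear order_less_asym order_less_irrefl\<close>)+
qed

text \<open>A word for \<open>B b\<close> is a pair of multi-indices, relabelled by \<open>\<theta>2\<close> and \<open>\<theta>1\<close>. Since the action compares
  letters only by order, increasing relabellings intertwine it.\<close>

lemma (in words) block_iso:
  assumes ab: "a + b = d"
    and \<theta>1: "bij_betw \<theta>1 (index_set m) (I \<inter> {0..})"
      "\<And>i j. i \<in> index_set m \<Longrightarrow> j \<in> index_set m \<Longrightarrow> \<theta>1 i < \<theta>1 j \<longleftrightarrow> i < j"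
      "\<And>i j. i \<in> index_set m \<Longrightarrow> j \<in> index_set m \<Longrightarrow> \<theta>1 i = \<theta>1 j \<longleftrightarrow> i = j"
    and \<theta>2: "bij_betw \<theta>2 (index_set m') (I \<inter> {0<..})"
      "\<And>i j. i \<in> index_set m' \<Longrightarrow> j \<in> index_set m' \<Longrightarrow> \<theta>2 i < \<theta>2 j \<longleftrightarrow> i < j"
      "\<And>i j. i \<in> index_set m' \<Longrightarrow> j \<in> index_set m' \<Longrightarrow> \<theta>2 i = \<theta>2 j \<longleftrightarrow> i = j"
  shows "\<exists>\<Theta>. \<Theta> \<in> kalg_iso (endW (B b) ({1..<d} - {b}) Q q)
    (tensor_algebra (end_algebra (space (multi_index m a)) {1..<a} (gen_act Q q m a))
      (end_algebra (space (multi_index m' b)) {1..<b} (gen_act Q q m' b)))"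
proof -
  let ?S1 = "multi_index m a" and ?S2 = "multi_index m' b" and ?S = "words_with (L b)"
  define pr where "pr x y = (\<lambda>i. if i < b then \<theta>2 (y ! i) else if i < d then \<theta>1 (x ! (i - b)) else 0)" for x y
  have pr1: "pr x y (b + i) = \<theta>1 (x ! i)" if "i < a" for x y i using that ab by (simp add: pr_def)
  have pr2: "pr x y i = \<theta>2 (y ! i)" if "i < b" for x y i using that by (simp add: pr_def)
  have pr_swap1: "swap (b + i) (pr x y) = pr (index_act x i) y" if i: "i \<in> {1..<a}" "x \<in> ?S1" for x y i
  proof -
    obtain k where k: "i = Suc k" using i by (cases i) auto
    have "swap (Suc (b + k)) (pr x y) j = pr (index_act x i) y j" for j
      using i ab unfolding k by (auto simp: swap_at pr_def index_act_nth multi_index_iff)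
    then show ?thesis unfolding k by (simp add: fun_eq_iff)
  qed
  have pr_swap2: "swap i (pr x y) = pr x (index_act y i)" if i: "i \<in> {1..<b}" "y \<in> ?S2" for x y i
  proof -
    obtain k where k: "i = Suc k" using i by (cases i) auto
    have "swap (Suc k) (pr x y) j = pr x (index_act y i) j" for j
      using i ab unfolding k by (auto simp: swap_at pr_def index_act_nth multi_index_iff)
    then show ?thesis unfolding k by (simp add: fun_eq_iff)
  qed
  have idx: "prod_idx ?S1 ?S2 pr ?S"
  proof
    show "finite ?S1" "finite ?S2" by (rule finite_multi_index)+
  next
    fix x x' y y' assume xy: "x \<in> ?S1" "x' \<in> ?S1" "y \<in> ?S2" "y' \<in> ?S2"
    show "pr x y = pr x' y' \<longleftrightarrow> x = x' \<and> y = y'"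
    proof
      assume e: "pr x y = pr x' y'"
      have "x ! i = x' ! i" if "i < a" for i
        using fun_cong[OF e, of "b + i"] \<theta>1(3) xy that by (simp add: pr1 multi_index_iff)
      moreover have "y ! i = y' ! i" if "i < b" for i
        using fun_cong[OF e, of i] \<theta>2(3) xy that by (simp add: pr2 multi_index_iff)
      ultimately show "x = x' \<and> y = y'" using xy by (auto simp: multi_index_iff intro!: nth_equalityI)
    qed simp
  next
    show "?S = {pr x y | x y. x \<in> ?S1 \<and> y \<in> ?S2}"
    proof (intro Set.set_eqI iffI)
      fix w assume "w \<in> {pr x y | x y. x \<in> ?S1 \<and> y \<in> ?S2}"
      then obtain x y where w: "w = pr x y" "x \<in> ?S1" "y \<in> ?S2" by blast
      have "\<theta>1 (x ! i) \<in> I \<inter> {0..}" if "i < a" for i using bij_betwE[OF \<theta>1(1)] w(2) that by (auto simp: multi_index_iff)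
      moreover have "\<theta>2 (y ! i) \<in> I \<inter> {0<..}" if "i < b" for i using bij_betwE[OF \<theta>2(1)] w(3) that by (auto simp: multi_index_iff)
      ultimately have "w i \<in> L b i" if "i < d" for i
        using that ab unfolding w(1) by (cases "i < b") (simp_all add: pr_def L_def)
      then show "w \<in> ?S" using ab by (simp add: words_with_def w(1) pr_def)
    next
      fix w assume w: "w \<in> ?S"
      let ?i1 = "inv_into (index_set m) \<theta>1" and ?i2 = "inv_into (index_set m') \<theta>2"
      let ?x = "map (\<lambda>i. ?i1 (w (b + i))) [0..<a]" and ?y = "map (\<lambda>i. ?i2 (w i)) [0..<b]"
      have w1: "w (b + i) \<in> I \<inter> {0..}" if i: "i < a" for i
      proof -
        have "w (b + i) \<in> L b (b + i)" using w i ab by (simp add: words_with_def)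
        then show ?thesis by (simp add: L_def)
      qed
      have w2: "w i \<in> I \<inter> {0<..}" if i: "i < b" for i
      proof -
        have "w i \<in> L b i" using w i ab by (simp add: words_with_def)
        then show ?thesis using i by (simp add: L_def)
      qed
      have "?x \<in> ?S1" using bij_betwE[OF bij_betw_inv_into[OF \<theta>1(1)]] w1 by (simp add: multi_index_iff)
      moreover have "?y \<in> ?S2" using bij_betwE[OF bij_betw_inv_into[OF \<theta>2(1)]] w2 by (simp add: multi_index_iff)
      moreover have "w = pr ?x ?y"
      proof
        fix j
        have "j < b \<or> (\<exists>i. j = b + i \<and> i < a) \<or> d \<le> j" using ab by presburger
        then consider "j < b" | i where "j = b + i" "i < a" | "d \<le> j" by blast
        then show "w j = pr ?x ?y j"
        proof cases
          case 1 then show ?thesis using bij_betw_inv_into_right[OF \<theta>2(1) w2[OF 1]] by (simp add: pr2)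
        next
          case (2 i) then show ?thesis using bij_betw_inv_into_right[OF \<theta>1(1) w1[OF 2(2)]] by (simp add: pr1)
        next
          case 3 then show ?thesis using w ab by (simp add: pr_def words_with_def)
        qed
      qed
      ultimately show "w \<in> {pr x y | x y. x \<in> ?S1 \<and> y \<in> ?S2}" by blast
    qed
  qed
  interpret P: prod_idx ?S1 ?S2 pr ?S by (rule idx)
  have act_S: "v \<lhd>\<^sub>L TT Q q t \<in> space ?S" if "t \<in> {1..<d} - {b}" "v \<in> space ?S" for t and v :: "(nat \<Rightarrow> int) \<Rightarrow> 'k"
    unfolding app_TT by (rule tf_space[OF that(2)]) (rule swap_WdL[OF _ that(1)])
  have 1: "v \<lhd>\<^sub>L TT Q q (b + i) = P.L (\<lambda>u. gen_act Q q m a u i) v" if i: "i \<in> {1..<a}" and v: "v \<in> space ?S" for i v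
  proof (rule P.space_eqI[OF act_S[OF _ v] P.L_space])
    show "b + i \<in> {1..<d} - {b}" using i ab by auto
    fix x y assume x: "x \<in> ?S1" and y: "y \<in> ?S2"
    have x': "index_act x i \<in> ?S1" using index_act_multi_index[OF x] i by simp
    have m: "x ! (i - 1) \<in> index_set m" "x ! i \<in> index_set m" using x i by (auto simp: multi_index_iff)
    have p: "pr x y (b + i - 1) = \<theta>1 (x ! (i - 1))" "pr x y (b + i) = \<theta>1 (x ! i)"
      using pr1[of "i - 1" x y] pr1[of i x y] i by auto
    have "i < a" using i by simp
    from gen_act_at[OF x this, of Q q "P.sl v y"] show "(v \<lhd>\<^sub>L TT Q q (b + i)) (pr x y) = P.L (\<lambda>u. gen_act Q q m a u i) v (pr x y)"
      using i by (simp add: P.L_at[OF x y] app_TT tf_def p pr_swap1[OF i x] \<theta>1(2,3) m P.sl_def x x' del: One_nat_def)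
  qed
  have 2: "v \<lhd>\<^sub>L TT Q q i = P.R (\<lambda>u. gen_act Q q m' b u i) v" if i: "i \<in> {1..<b}" and v: "v \<in> space ?S" for i v
  proof (rule P.space_eqI[OF act_S[OF _ v] P.R_space])
    show "i \<in> {1..<d} - {b}" using i ab by auto
    fix x y assume x: "x \<in> ?S1" and y: "y \<in> ?S2"
    have y': "index_act y i \<in> ?S2" using index_act_multi_index[OF y] i by simp
    have m: "y ! (i - 1) \<in> index_set m'" "y ! i \<in> index_set m'" using y i by (auto simp: multi_index_iff)
    have p: "pr x y (i - 1) = \<theta>2 (y ! (i - 1))" "pr x y i = \<theta>2 (y ! i)"
      using pr2[of "i - 1" x y] pr2[of i x y] i by auto
    have "i < b" using i by simp
    from gen_act_at[OF y this, of Q q "prod_idx.sl ?S2 (\<lambda>y x. pr x y) v x"]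
    show "(v \<lhd>\<^sub>L TT Q q i) (pr x y) = P.R (\<lambda>u. gen_act Q q m' b u i) v (pr x y)"
      using i by (simp add: P.R_at[OF y x] app_TT tf_def p pr_swap2[OF i y] \<theta>2(2,3) m prod_idx.sl_def[OF P.swapped] y y' del: One_nat_def)
  qed
  have "tensor_end ?S1 ?S2 pr ?S {1..<a} (gen_act Q q m a) {1..<b} (gen_act Q q m' b)
      ({1..<d} - {b}) (\<lambda>v t. v \<lhd>\<^sub>L TT Q q t) (\<lambda>i. b + i) (\<lambda>i. i)"
  proof (rule tensor_end.intro[OF idx], rule tensor_end_axioms.intro)
    show "{1..<d} - {b} = (\<lambda>i. b + i) ` {1..<a} \<union> (\<lambda>i. i) ` {1..<b}"
    proof (intro Set.set_eqI iffI)
      fix j assume j: "j \<in> {1..<d} - {b}"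
      show "j \<in> (\<lambda>i. b + i) ` {1..<a} \<union> (\<lambda>i. i) ` {1..<b}"
      proof (cases "j < b")
        case False
        then have "j = b + (j - b)" "j - b \<in> {1..<a}" using j ab by auto
        then show ?thesis by blast
      qed (use j in auto)
    qed (use ab in auto)
  qed (use 1 2 lin_gen_act in auto)
  from tensor_end.tensor_iso[OF this] show ?thesis unfolding endW_def B_def .
qed

section \<open>The type B Schur algebra\<close>

text \<open>An equality would give \<open>Q\<^sup>-\<^sup>2 + q\<^sup>2\<^sup>k = 0\<close> for \<open>k = i - j\<close>.\<close>

lemma f_B_separates:
  fixes Q q :: "'k::field"
  assumes Q: "Q \<noteq> 0" and q: "q \<noteq> 0" and f: "f_B d Q q dvd 1" and ij: "\<bar>i\<bar> + \<bar>j\<bar> < int d"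
  shows "- Q * q powi (2 * i) \<noteq> inverse Q * q powi (2 * j)"
proof
  assume e: "- Q * q powi (2 * i) = inverse Q * q powi (2 * j)"
  have "f_B d Q q \<noteq> 0" using f by auto
  then have "\<forall>k\<in>{1 - int d..int d - 1}. Q powi (- 2) + q powi (2 * k) \<noteq> 0"
    unfolding f_B_def by (subst (asm) prod_zero_iff) auto
  moreover have "i - j \<in> {1 - int d..int d - 1}" using ij by auto
  ultimately have "Q powi (- 2) + q powi (2 * (i - j)) \<noteq> 0" by blast
  moreover have "q powi (2 * (i - j)) = q powi (2 * i) / q powi (2 * j)"
    using q by (simp add: power_int_diff right_diff_distrib)
  moreover have "Q powi (- 2) = inverse Q * inverse Q"
    by (simp add: power_int_minus power2_eq_square)
  moreover have "q powi (2 * i) = - (inverse Q * inverse Q * q powi (2 * j))"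
  proof -
    have "q powi (2 * i) = - (inverse Q * (- Q * q powi (2 * i)))" using Q by (simp flip: mult.assoc)
    then show ?thesis unfolding e by (simp only: mult.assoc)
  qed
  ultimately show False using q by simp
qed

theorem theorem3p1p1:
  fixes q Q :: "'k::field" and n d :: nat
  assumes "q \<noteq> 0" and "Q \<noteq> 0" and "n \<ge> 1" and "d \<ge> 1"
    and "f_B d Q q dvd 1"
  shows "\<exists>\<Phi>. \<Phi> \<in> kalg_iso (schur_B Q q n d)
    (direct_sum_algebra {0..d}
      (\<lambda>i. tensor_algebra (schur_A Q q ((n + 1) div 2) i) (schur_A Q q (n div 2) (d - i))))"
proof -
  let ?m = "(n + 1) div 2" and ?m' = "n div 2" and ?I = "index_set n"
  interpret words Q q ?I d
    by (unfold_locales; (rule assms(1,2,4) finite_index_set | erule f_B_separates[OF assms(2,1,5)] | erule index_set_minus))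
  obtain \<Psi> where \<Psi>: "\<Psi> \<in> kalg_iso (schur_B Q q n d) (endW M {..<d} Q q)"
    using schur_words_iso[OF refl] unfolding schur_B_eq[OF assms(2,1)] by blast
  obtain \<theta>1 where \<theta>1: "bij_betw \<theta>1 (index_set ?m) (?I \<inter> {0..})"
      "\<And>i j. i \<in> index_set ?m \<Longrightarrow> j \<in> index_set ?m \<Longrightarrow> \<theta>1 i < \<theta>1 j \<longleftrightarrow> i < j"
      "\<And>i j. i \<in> index_set ?m \<Longrightarrow> j \<in> index_set ?m \<Longrightarrow> \<theta>1 i = \<theta>1 j \<longleftrightarrow> i = j"
    by (rule increasing_relabelling[of "?I \<inter> {0..}" ?m]) (auto simp: finite_index_set card_index_set)
  obtain \<theta>2 where \<theta>2: "bij_betw \<theta>2 (index_set ?m') (?I \<inter> {0<..})"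
      "\<And>i j. i \<in> index_set ?m' \<Longrightarrow> j \<in> index_set ?m' \<Longrightarrow> \<theta>2 i < \<theta>2 j \<longleftrightarrow> i < j"
      "\<And>i j. i \<in> index_set ?m' \<Longrightarrow> j \<in> index_set ?m' \<Longrightarrow> \<theta>2 i = \<theta>2 j \<longleftrightarrow> i = j"
    by (rule increasing_relabelling[of "?I \<inter> {0<..}" ?m']) (auto simp: finite_index_set card_index_set)
  have "\<exists>\<Theta>. \<Theta> \<in> kalg_iso (endW (B (d - a)) ({1..<d} - {d - a}) Q q)
      (tensor_algebra (schur_A Q q ?m a) (schur_A Q q ?m' (d - a)))" if "a \<in> {0..d}" for a
    using block_iso[OF _ \<theta>1 \<theta>2, of a "d - a"] that unfolding schur_A_eq[OF assms(2,1)] by simp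
  then obtain \<Theta> where \<Theta>: "\<And>a. a \<in> {0..d} \<Longrightarrow> \<Theta> a \<in> kalg_iso (endW (B (d - a)) ({1..<d} - {d - a}) Q q)
      (tensor_algebra (schur_A Q q ?m a) (schur_A Q q ?m' (d - a)))" by metis
  show ?thesis
    using kalg_iso_comp[OF kalg_iso_comp[OF \<Psi> Phi_iso] direct_sum_iso[OF \<Theta>]] by blast
qed

end
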